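(* For each $n$ let $W_n=(x_{ij,n})_{1\le i,j\le n}$ be an $n\times n$ real symmetric random matrix whose entries $\{x_{ij,n}: 1\le i\le j\le n\}$ are independent and satisfy Assumption A (stated in the context), with associated functions $g_{2k,n}$, $g_{2k}$ and truncation levels $t_n\in[0,\infty]$. Let $y_{ij}=x_{ij,n}\mathbf 1_{\{|x_{ij,n}|\le t_n\}}$ and $Z_n=(y_{ij})_{1\le i,j\le n}$. Then: (a) The empirical spectral distribution of $Z_n$ converges weakly almost surely to a probability measure $\mu'$ whose moment sequence is determined by the functions $g_{2k}$, $k\ge 1$. (b) The empirical spectral distribution of $W_n$ converges weakly to $\mu'$ almost surely (respectively in probability) if $$\frac1n\sum_{i,j} x_{ij,n}^2\,\mathbf 1_{\{|x_{ij,n}|>t_n\}}\longrightarrow 0\quad\text{almost surely (respectively in probability).}$$ Moreover, the law $\mu'$ is semi-circular if and only if $g_{2k}=0$ for all $k>1$ and $\int_0^1 g_2(x,y)\,dy$ is constant.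
   Context: The empirical spectral distribution of an $n\times n$ real symmetric random matrix with eigenvalues $\lambda_1,\dots,\lambda_n$ is the random probability measure $\frac1n\sum_{i=1}^n\delta_{\lambda_i}$. The standard semi-circular law has density $\frac{1}{2\pi}\sqrt{4-x^2}$ on $[-2,2]$; a semi-circular law of variance $s^2$ $(s>0)$ is the law of $s$ times a standard semi-circular variable. $\mathcal P(k)$ is the set of all partitions of $\{1,\dots,k\}$. For a sequence $(c_k)_{k\ge1}$ and $\sigma\in\mathcal P(k)$, $c_\sigma:=\prod_{V\text{ block of }\sigma}c_{|V|}$. $\|g\|$ denotes the sup norm. Assumption A. For each $k\ge 1$, $\{g_{2k,n}\}_{n\ge1}$ is a sequence of bounded Riemann integrable symmetric functions on $[0,1]^2$, and there is a sequence $t_n\in[0,\infty]$ such that: (i) For each $k\in\mathbb N$, $$n\,\mathbb E\big[x_{ij,n}^{2k}\mathbf 1_{\{|x_{ij,n}|\le t_n\}}\big]=g_{2k,n}\Big(\frac in,\frac jn\Big)\quad\text{for }1\le i\le j\le n,$$ $$\lim_{n\to\infty}n^{\alpha}\sup_{1\le i\le j\le n}\Big|\mathbb E\big[x_{ij,n}^{2k-1}\mathbf 1_{\{|x_{ij,n}|\le t_n\}}\big]\Big|=0\quad\text{for any }\alpha<1.$$ (ii) For each $k\ge1$, $g_{2k,n}$ converges uniformly to a function $g_{2k}$ as $n\to\infty$. (iii) Let $M_{2k}=\|g_{2k}\|$ and $M_{2k-1}=0$ for all $k\ge1$. Then $\alpha_{2k}=\sum_{\sigma\in\mathcal P(2k)}M_\sigma$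 satisfies Carleman's condition $\sum_{k=1}^\infty\alpha_{2k}^{-1/(2k)}=\infty$.
   Formalization: In the semi-circular criterion, "g_{2k}=0 for all k>1" and "∫g_2(x,y)dy is constant" are read almost everywhere and the constant must be positive; as written it fails for g_2=0 (μ'=δ_0) and when g_4 is nonzero only at one point off the grid. *)

theory Defs
  imports
    "HOL-Probability.Probability"
    "HOL-Computational_Algebra.Polynomial"
    "HOL-Library.Disjoint_Sets"
    "Jordan_Normal_Form.Char_Poly"
begin

abbreviation unit_square :: "(real \<times> real) set" where
  "unit_square \<equiv> cbox (0, 0) (1, 1)"

text \<open>
  Riemann integrability on a box. The gauge of the Henstock--Kurzweil integral is replaced by a
  uniform mesh: every cell of the tagged division lies in the ball of radius \<open>d\<close> around its tag.
\<close>

definition Riemann_integrable_cbox :: "('a::euclidean_space \<Rightarrow> real) \<Rightarrow> 'a \<Rightarrow> 'a \<Rightarrow> bool" where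
  "Riemann_integrable_cbox f a b \<longleftrightarrow>
     (\<exists>I. \<forall>e>0. \<exists>d>0. \<forall>D. D tagged_division_of (cbox a b) \<and> (\<lambda>u. ball u d) fine D \<longrightarrow>
        \<bar>(\<Sum>(u, K)\<in>D. measure lborel K * f u) - I\<bar> < e)"

text \<open>
  Entry arrays are indexed from 1 as on paper, whereas matrices of type \<open>mat\<close> are indexed from 0.
\<close>

definition matrix_of :: "nat \<Rightarrow> (nat \<Rightarrow> nat \<Rightarrow> real) \<Rightarrow> real mat" where
  "matrix_of n a = mat n n (\<lambda>(i, j). a (Suc i) (Suc j))"

text \<open>
  The uniform distribution on the multiset of real eigenvalues, counted with algebraic
  multiplicity. For a real symmetric matrix of size \<open>n > 0\<close> this multiset has exactly \<open>n\<close>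
  elements, so that this is the average of the Dirac measures at the eigenvalues. For the empty
  matrix the value is an unspecified probability measure.
\<close>

definition esd :: "real mat \<Rightarrow> real measure" where
  "esd A = distr (measure_pmf (pmf_of_multiset (proots (char_poly A)))) borel (\<lambda>l. l)"

definition std_semicircle :: "real measure" where
  "std_semicircle = density lborel
     (\<lambda>u. ennreal (indicator {-2..2} u * (sqrt (4 - u\<^sup>2) / (2 * pi))))"

definition semicircular :: "real measure \<Rightarrow> bool" where
  "semicircular \<mu> \<longleftrightarrow> (\<exists>s>0. \<mu> = distr std_semicircle borel (\<lambda>u. s * u))"

definition tendsto_in_prob :: "'a measure \<Rightarrow> (nat \<Rightarrow> 'a \<Rightarrow> real) \<Rightarrow> real \<Rightarrow> bool" where
  "tendsto_in_prob M X c \<longleftrightarrow>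
     (\<forall>e>0. (\<lambda>n. measure M {\<omega> \<in> space M. \<bar>X n \<omega> - c\<bar> > e}) \<longlonglongrightarrow> 0)"

definition weak_conv_as :: "'a measure \<Rightarrow> (nat \<Rightarrow> 'a \<Rightarrow> real measure) \<Rightarrow> real measure \<Rightarrow> bool" where
  "weak_conv_as M F \<mu> \<longleftrightarrow> (AE \<omega> in M. weak_conv_m (\<lambda>n. F n \<omega>) \<mu>)"

definition weak_conv_in_prob :: "'a measure \<Rightarrow> (nat \<Rightarrow> 'a \<Rightarrow> real measure) \<Rightarrow> real measure \<Rightarrow> bool" where
  "weak_conv_in_prob M F \<mu> \<longleftrightarrow>
     (\<forall>f :: real \<Rightarrow> real. continuous_on UNIV f \<and> bounded (range f) \<longrightarrow>
        tendsto_in_prob M (\<lambda>n \<omega>. \<integral>u. f u \<partial>(F n \<omega>)) (\<integral>u. f u \<partial>\<mu>))"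

text \<open>
  \<open>x n i j\<close> is the entry \<open>x\<^sub>i\<^sub>j\<^sub>,\<^sub>n\<close>; only \<open>1 \<le> i, j \<le> n\<close> matters. All matrices live on one probability
  space, and nothing is assumed about the joint law for different \<open>n\<close>.
\<close>

definition indep_symmetric_matrices ::
  "'a measure \<Rightarrow> (nat \<Rightarrow> nat \<Rightarrow> nat \<Rightarrow> 'a \<Rightarrow> real) \<Rightarrow> bool" where
  "indep_symmetric_matrices M x \<longleftrightarrow>
     prob_space M \<and>
     (\<forall>n\<ge>1. (\<forall>i\<in>{1..n}. \<forall>j\<in>{1..n}. \<forall>\<omega>\<in>space M. x n i j \<omega> = x n j i \<omega>) \<and>
       prob_space.indep_vars M (\<lambda>_. borel) (\<lambda>(i, j). x n i j) {(i, j). 1 \<le> i \<and> i \<le> j \<and> j \<le> n})"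

text \<open>\<open>below c u\<close> is the indicator of \<open>\<bar>u\<bar> \<le> c\<close>, where \<open>c\<close> may be infinite.\<close>

definition below :: "ennreal \<Rightarrow> real \<Rightarrow> real" where
  "below c u = indicator {v. ennreal \<bar>v\<bar> \<le> c} u"

text \<open>
  Here \<open>G k\<close> stands for the function \<open>g\<^sub>2\<^sub>k\<close>, with \<open>k \<ge> 1\<close>; the value at 0 is irrelevant, as are the
  values outside the unit square.
\<close>

definition M_seq :: "(nat \<Rightarrow> real \<times> real \<Rightarrow> real) \<Rightarrow> nat \<Rightarrow> real" where
  "M_seq G m = (if even m then SUP p\<in>unit_square. \<bar>G (m div 2) p\<bar> else 0)"

definition partition_weight :: "(nat \<Rightarrow> real) \<Rightarrow> nat set set \<Rightarrow> real" where
  "partition_weight c \<sigma> = (\<Prod>V\<in>\<sigma>. c (card V))"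

definition alpha :: "(nat \<Rightarrow> real \<times> real \<Rightarrow> real) \<Rightarrow> nat \<Rightarrow> real" where
  "alpha G k = (\<Sum>\<sigma> | partition_on {1..2 * k} \<sigma>. partition_weight (M_seq G) \<sigma>)"

text \<open>
  The series is taken in \<open>[0, \<infinity>]\<close>, so that a vanishing \<open>\<alpha>\<^sub>2\<^sub>k\<close> contributes the term \<open>\<infinity>\<close>.
\<close>

definition Carleman :: "(nat \<Rightarrow> real) \<Rightarrow> bool" where
  "Carleman a \<longleftrightarrow>
     (\<Sum>k. inverse (ennreal (a (Suc k) powr (1 / real (2 * Suc k))))) = (\<top> :: ennreal)"

text \<open>
  \<open>g k n\<close> stands for \<open>g\<^sub>2\<^sub>k\<^sub>,\<^sub>n\<close>. The integrability clause says that the expectations in the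
  assumption exist (it has content only when \<open>t n = \<infinity>\<close>); without it the Bochner integral of a
  non-integrable function would be 0.
\<close>

definition assumption_A ::
  "'a measure \<Rightarrow> (nat \<Rightarrow> nat \<Rightarrow> nat \<Rightarrow> 'a \<Rightarrow> real) \<Rightarrow> (nat \<Rightarrow> ennreal) \<Rightarrow>
   (nat \<Rightarrow> nat \<Rightarrow> real \<times> real \<Rightarrow> real) \<Rightarrow> (nat \<Rightarrow> real \<times> real \<Rightarrow> real) \<Rightarrow> bool" where
  "assumption_A M x t g G \<longleftrightarrow>
     (\<forall>k\<ge>1. \<forall>n\<ge>1. bounded (g k n ` unit_square) \<and> Riemann_integrable_cbox (g k n) (0, 0) (1, 1) \<and>
        (\<forall>u\<in>{0..1}. \<forall>v\<in>{0..1}. g k n (u, v) = g k n (v, u))) \<and>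
     (\<forall>k\<ge>1. \<forall>n i j. 1 \<le> i \<and> i \<le> j \<and> j \<le> n \<longrightarrow>
        integrable M (\<lambda>\<omega>. x n i j \<omega> ^ k * below (t n) (x n i j \<omega>))) \<and>
     (\<forall>k\<ge>1. \<forall>n i j. 1 \<le> i \<and> i \<le> j \<and> j \<le> n \<longrightarrow>
        real n * (\<integral>\<omega>. x n i j \<omega> ^ (2 * k) * below (t n) (x n i j \<omega>) \<partial>M)
          = g k n (real i / real n, real j / real n)) \<and>
     (\<forall>k\<ge>1. \<forall>a<1. (\<lambda>n. real n powr a *
        (SUP (i, j)\<in>{(i, j). 1 \<le> i \<and> i \<le> j \<and> j \<le> n}.
           \<bar>\<integral>\<omega>. x n i j \<omega> ^ (2 * k - 1) * below (t n) (x n i j \<omega>) \<partial>M\<bar>)) \<longlonglongrightarrow> 0) \<and>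
     (\<forall>k\<ge>1. uniform_limit unit_square (g k) (G k) sequentially) \<and>
     Carleman (alpha G)"

definition esd_W :: "(nat \<Rightarrow> nat \<Rightarrow> nat \<Rightarrow> 'a \<Rightarrow> real) \<Rightarrow> nat \<Rightarrow> 'a \<Rightarrow> real measure" where
  "esd_W x n \<omega> = esd (matrix_of n (\<lambda>i j. x n i j \<omega>))"

definition esd_Z ::
  "(nat \<Rightarrow> nat \<Rightarrow> nat \<Rightarrow> 'a \<Rightarrow> real) \<Rightarrow> (nat \<Rightarrow> ennreal) \<Rightarrow> nat \<Rightarrow> 'a \<Rightarrow> real measure" where
  "esd_Z x t n \<omega> = esd (matrix_of n (\<lambda>i j. x n i j \<omega> * below (t n) (x n i j \<omega>)))"

definition tail_sum ::
  "(nat \<Rightarrow> nat \<Rightarrow> nat \<Rightarrow> 'a \<Rightarrow> real) \<Rightarrow> (nat \<Rightarrow> ennreal) \<Rightarrow> nat \<Rightarrow> 'a \<Rightarrow> real" where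
  "tail_sum x t n \<omega> = 1 / real n *
     (\<Sum>i=1..n. \<Sum>j=1..n. (x n i j \<omega>)\<^sup>2 * indicator {v. ennreal \<bar>v\<bar> > t n} (x n i j \<omega>))"

text \<open>
  The functions \<open>G k\<close>, being limits of functions pinned down only on the grid points
  \<open>(i/n, j/n)\<close>, matter for the limit law only up to null sets, so the two conditions are read
  almost everywhere: changing \<open>G 2\<close> at one point of the square (grid point or not) is compatible
  with a semi-circular limit. For the same reason a section of \<open>G 1\<close> need be
  integrable only for almost every \<open>u\<close>. The constant is positive, since semi-circular laws have
  positive variance (\<open>G 1 = 0\<close> gives the Dirac measure at 0).
\<close>

definition semicircle_condition :: "(nat \<Rightarrow> real \<times> real \<Rightarrow> real) \<Rightarrow> bool" where
  "semicircle_condition G \<longleftrightarrow>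
     (\<forall>k>1. AE p in lborel. p \<in> unit_square \<longrightarrow> G k p = 0) \<and>
     (\<exists>c>0. AE u in lborel. u \<in> {0..1} \<longrightarrow> ((\<lambda>v. G 1 (u, v)) has_integral c) {0..1})"

end

theory Submission
  imports Defs "Jordan_Normal_Form.Schur_Decomposition" "HOL-Real_Asymp.Real_Asymp"
begin

text \<open>
  The moments of the spectral distribution of \<open>Z\<^sub>n\<close> are normalised traces of powers, that is, sums over
  closed walks. In the mean, only the walks survive whose edges form a tree with a vertex discovered by each edge;
  every edge is then crossed an even number of times, and such a walk contributes a Riemann sum of a product of
  functions \<open>G r\<close> over the edges of the tree. The edge blocks of these walks are distinct partitions, so the limits
  are at most \<open>\<alpha>\<^sub>2\<^sub>k\<close>, and Carleman's condition makes the moment problem determinate. The centred fourth moment of a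
  trace is \<open>O(n powr (5/2))\<close>, which gives almost sure convergence by summability. For \<open>W\<^sub>n\<close>, the characteristic
  functions of two symmetric matrices differ at \<open>s\<close> by at most \<open>\<bar>s\<bar>\<close> times the normalised Frobenius distance.
  Finally, the fourth moment is at least \<open>2 s\<^sup>4\<close> when the second is \<open>s\<^sup>2\<close>, with equality only if \<open>G 2\<close> vanishes
  and the row integrals of \<open>G 1\<close> are constant; the functions \<open>G r\<close> with \<open>r > 2\<close> are dominated through \<open>G 2\<close>.
\<close>

section \<open>The real spectral theorem\<close>

text \<open>The hypotheses are slightly too weak for exact counting: odd moments are only known to
  be smaller than \<open>n powr (- a)\<close> for every \<open>a < 1\<close>, not of order
  \<open>1 / n\<close>. If each edge is charged \<open>n powr (- a)\<close>, a power of
  \<open>n\<close> is lost that grows with the length of the walk; so \<open>a\<close> is chosen for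
  each length, close enough to 1 that the total loss is \<open>n powr (1 / 2)\<close>. A walk that
  is not a tree gains a full power of \<open>n\<close>, which outweighs this, and the same margin is
  the reason for the exponent 5/2 in the fourth moment. A second obstacle is that the functions
  \<open>G r\<close> are tied to moments only at rational points, so positivity is available only
  there. Limits are therefore handled as Riemann sums over grids, and turned into almost-everywhere
  statements through Borel functions that are close in mean to grid step functions. No law with
  prescribed moments has to be constructed: the spectral distributions supply it as a weak limit
  point. Carleman's condition makes the limit point unique, because the characteristic function lies
  in a quasi-analytic class.\<close>

lemma symmetric_real_eigenvalue:
  fixes A :: "real mat"
  assumes A: "A \<in> carrier_mat n n" and sym: "A\<^sup>T = A" and n: "n > 0"
  shows "\<exists>e. eigenvalue A e"
proof -
  let ?c = "complex_of_real"
  let ?A = "map_mat ?c A"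
  have cA: "?A \<in> carrier_mat n n" using A by auto
  have cp: "char_poly ?A = map_poly ?c (char_poly A)"
    using of_real_hom.char_poly_hom[OF A] by simp
  have "degree (char_poly ?A) = n" using degree_monic_char_poly[OF cA] by auto
  then have "\<not> constant (poly (char_poly ?A))" using n by (simp add: constant_degree)
  then obtain l where l: "poly (char_poly ?A) l = 0" using fundamental_theorem_of_algebra by blast
  then have "eigenvalue ?A l" using eigenvalue_root_char_poly[OF cA] by auto
  then obtain v where v: "v \<in> carrier_vec n" "v \<noteq> 0\<^sub>v n" "?A *\<^sub>v v = l \<cdot>\<^sub>v v"
    unfolding eigenvalue_def eigenvector_def using cA by auto
  have Asym: "A $$ (i,j) = A $$ (j,i)" if "i < n" "j < n" for i j
    using arg_cong[OF sym, of "\<lambda>B. B $$ (i,j)"] A that by auto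
  \<comment> \<open>The form of \<open>A\<close> at \<open>v\<close> is \<open>l\<close> times the
    squared norm of \<open>v\<close>, and symmetry makes it equal to its own conjugate; hence
    \<open>l\<close> is real.\<close>
  define S where "S = (\<Sum>i<n. \<Sum>j<n. cnj (v$i) * ?c (A$$(i,j)) * v$j)"
  define q where "q = (\<Sum>i<n. (cmod (v$i))^2)"
  have row: "(\<Sum>j<n. ?c (A$$(i,j)) * v$j) = l * v$i" if "i < n" for i
    using arg_cong[OF v(3), of "\<lambda>w. w$i"] v(1) A that
    by (auto simp: scalar_prod_def mult_mat_vec_def row_def lessThan_atLeast0)
  have "S = (\<Sum>i<n. cnj (v$i) * (l * v$i))"
    unfolding S_def by (intro sum.cong refl) (simp add: row[symmetric] sum_distrib_left mult.assoc)
  also have "\<dots> = l * ?c q"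
    by (simp add: q_def sum_distrib_left complex_norm_square mult_ac del: of_real_power)
  finally have S1: "S = l * ?c q" .
  have "cnj S = (\<Sum>i<n. \<Sum>j<n. v$i * ?c (A$$(i,j)) * cnj (v$j))" by (simp add: S_def)
  also have "\<dots> = (\<Sum>j<n. \<Sum>i<n. v$i * ?c (A$$(i,j)) * cnj (v$j))" by (rule sum.swap)
  also have "\<dots> = S" unfolding S_def by (intro sum.cong refl) (simp add: Asym mult_ac)
  finally have S2: "cnj S = S" .
  have "q \<noteq> 0"
  proof
    assume "q = 0"
    then have "\<forall>i\<in>{..<n}. (cmod (v$i))^2 = 0" unfolding q_def by (subst (asm) sum_nonneg_eq_0_iff) auto
    then have "v = 0\<^sub>v n" using v(1) by (intro eq_vecI) auto
    with v(2) show False by simp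
  qed
  then have "cnj l = l" using S1 S2 by simp
  then have "l = ?c (Re l)" by (simp add: complex_eq_iff)
  then have "poly (map_poly ?c (char_poly A)) (?c (Re l)) = 0" using l cp by simp
  then have "poly (char_poly A) (Re l) = 0" by simp
  then show ?thesis using eigenvalue_root_char_poly[OF A] by blast
qed

text \<open>Gram--Schmidt leaves the head of the list unchanged, so after normalisation the first
  column is still proportional to \<open>v\<close>. This is the change of basis that splits off an
  eigenvector.\<close>

lemma orthonormal_completion:
  fixes v :: "real vec"
  assumes v: "v \<in> carrier_vec n" "v \<noteq> 0\<^sub>v n"
  shows "\<exists>W\<in>carrier_mat n n. W\<^sup>T * W = 1\<^sub>m n \<and> (\<exists>c\<noteq>0. col W 0 = c \<cdot>\<^sub>v v)"
proof -
  interpret cof_vec_space n "TYPE(real)" .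
  have n: "n > 0" using v by (cases n) auto
  define b where "b = basis_completion v"
  define ws where "ws = gram_schmidt n b"
  from basis_completion[OF v, folded b_def]
  have span_b: "span (set b) = carrier_vec n" and dist_b: "distinct b" 
    and indep: "\<not> lin_dep (set b)" and b: "set b \<subseteq> carrier_vec n" and hdb: "hd b = v" 
    and len_b: "length b = n" by auto
  from hdb len_b n obtain vs where bv: "b = v # vs" by (cases b, auto)
  from gram_schmidt_result[OF b dist_b indep refl, folded ws_def]
  have ws: "set ws \<subseteq> carrier_vec n" "corthogonal ws" "length ws = n" 
    by (auto simp: len_b)
  from gram_schmidt_hd[OF v(1), of vs, folded bv] have hdws: "hd ws = v" unfolding ws_def .
  have ws_c: "ws ! i \<in> carrier_vec n" if "i < n" for i using ws that by auto
  \<comment> \<open>Over the reals the conjugation built into \<open>corthogonal\<close> is the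
    identity.\<close>
  have conj: "conjugate u = u" for u :: "real vec" by (intro eq_vecI) auto
  have o: "(ws ! i \<bullet> ws ! j = 0) = (i \<noteq> j)" if "i < n" "j < n" for i j
    using corthogonalD[OF ws(2), of i j] that ws(3) ws_c[of j] by (simp add: conj)
  have pos: "ws ! i \<bullet> ws ! i > 0" if "i < n" for i
  proof -
    have "ws ! i \<bullet> ws ! i \<ge> 0" using ws_c[OF that] by (auto simp: scalar_prod_def intro!: sum_nonneg)
    with o[OF that that] show ?thesis by simp
  qed
  define c where "c i = 1 / sqrt (ws ! i \<bullet> ws ! i)" for i
  define W where "W = mat_of_cols n (map (\<lambda>i. c i \<cdot>\<^sub>v ws ! i) [0..<n])"
  have W: "W \<in> carrier_mat n n" unfolding W_def by (simp add: mat_of_cols_def)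
  have colW: "col W i = c i \<cdot>\<^sub>v ws ! i" if "i < n" for i
    unfolding W_def using that ws_c by (subst col_mat_of_cols) auto
  have "W\<^sup>T * W = 1\<^sub>m n"
  proof (rule eq_matI)
    fix i j assume ij: "i < dim_row (1\<^sub>m n :: real mat)" "j < dim_col (1\<^sub>m n :: real mat)"
    then have "(W\<^sup>T * W) $$ (i,j) = col W i \<bullet> col W j" using W by auto
    also have "\<dots> = c i * c j * (ws ! i \<bullet> ws ! j)"
      using ij smult_scalar_prod_distrib[OF ws_c[of i], of "c j \<cdot>\<^sub>v ws ! j" "c i"]
        scalar_prod_smult_distrib[OF ws_c[of i] ws_c[of j], of "c j"] ws_c[of j] by (simp add: colW)
    also have "\<dots> = (1\<^sub>m n :: real mat) $$ (i,j)"
      using ij o[of i j] pos[of i] by (auto simp: c_def)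
    finally show "(W\<^sup>T * W) $$ (i,j) = (1\<^sub>m n :: real mat) $$ (i,j)" .
  qed (use W in auto)
  moreover have "col W 0 = c 0 \<cdot>\<^sub>v v" using colW[OF n] hdws ws(3) n by (cases ws) auto
  moreover have "c 0 \<noteq> 0" using pos[OF n] by (simp add: c_def)
  ultimately show ?thesis using W by blast
qed

text \<open>Deflation: in an orthonormal basis that starts with an eigenvector the first column is a
  multiple of the first unit vector, by symmetry so is the first row, and the induction hypothesis
  diagonalises the remaining block.\<close>

lemma real_spectral_theorem:
  fixes A :: "real mat"
  assumes A: "A \<in> carrier_mat n n" and sym: "A\<^sup>T = A"
  shows "\<exists>U\<in>carrier_mat n n. \<exists>d. U\<^sup>T * U = 1\<^sub>m n \<and> U\<^sup>T * A * U = mat n n (\<lambda>(i,j). if i = j then d i else 0)"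
  using assms
proof (induction n arbitrary: A)
  case 0
  show ?case by (rule bexI[of _ "1\<^sub>m 0"]) (use 0 in \<open>auto intro!: exI[of _ "\<lambda>_. 0"]\<close>)
next
  case (Suc n)
  let ?N = "Suc n"
  note A = Suc.prems(1) and sym = Suc.prems(2)
  obtain e where "eigenvalue A e" using symmetric_real_eigenvalue[OF A sym] by auto
  then obtain v where v: "v \<in> carrier_vec ?N" "v \<noteq> 0\<^sub>v ?N" "A *\<^sub>v v = e \<cdot>\<^sub>v v"
    unfolding eigenvalue_def eigenvector_def using A by auto
  obtain W c where W: "W \<in> carrier_mat ?N ?N" "W\<^sup>T * W = 1\<^sub>m ?N" and c: "col W 0 = c \<cdot>\<^sub>v v"
    using orthonormal_completion[OF v(1,2)] by auto
  define B where "B = W\<^sup>T * A * W"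
  have B: "B \<in> carrier_mat ?N ?N" using W A unfolding B_def by auto
  have Bsym: "B\<^sup>T = B"
    unfolding B_def using W A sym
    by (simp add: transpose_mult[of _ ?N ?N _ ?N] assoc_mult_mat[of _ ?N ?N _ ?N _ ?N])
  have Bs: "B $$ (i,j) = B $$ (j,i)" if "i < ?N" "j < ?N" for i j
    using arg_cong[OF Bsym, of "\<lambda>B. B $$ (i,j)"] B that by auto
  have cW: "col W 0 \<in> carrier_vec ?N" using col_dim[of W 0] W(1) by (metis carrier_matD(1))
  have "col B 0 = W\<^sup>T * A *\<^sub>v col W 0" unfolding B_def using W A by (subst col_mult2[of _ ?N ?N _ ?N]) auto
  also have "\<dots> = W\<^sup>T *\<^sub>v (A *\<^sub>v col W 0)" using W A cW by (subst assoc_mult_mat_vec[of _ ?N ?N _ ?N]) auto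
  also have "A *\<^sub>v col W 0 = e \<cdot>\<^sub>v col W 0"
    using A v by (simp add: c mult_mat_vec smult_smult_assoc mult.commute)
  also have "W\<^sup>T *\<^sub>v (e \<cdot>\<^sub>v col W 0) = e \<cdot>\<^sub>v (W\<^sup>T *\<^sub>v col W 0)" using W cW by (intro mult_mat_vec[of _ ?N ?N]) auto
  also have "W\<^sup>T *\<^sub>v col W 0 = col (W\<^sup>T * W) 0" using W by (subst col_mult2[of _ ?N ?N _ ?N]) auto
  finally have colB: "col B 0 = e \<cdot>\<^sub>v col (1\<^sub>m ?N) 0" by (simp add: W(2))
  have B0: "B $$ (i,0) = (if i = 0 then e else 0)" if "i < ?N" for i
    using arg_cong[OF colB, of "\<lambda>w. w $ i"] B that by auto
  define B3 where "B3 = mat n n (\<lambda>(i,j). B $$ (Suc i, Suc j))"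
  have "B3 \<in> carrier_mat n n" "B3\<^sup>T = B3" by (auto simp: B3_def Bs)
  from Suc.IH[OF this] obtain U3 d3 where U3: "U3 \<in> carrier_mat n n" "U3\<^sup>T * U3 = 1\<^sub>m n"
    "U3\<^sup>T * B3 * U3 = mat n n (\<lambda>(i,j). if i = j then d3 i else 0)" by blast
  define E where "E = mat 1 1 (\<lambda>_. e)"
  have E: "E \<in> carrier_mat 1 1" by (simp add: E_def)
  have B3: "B3 \<in> carrier_mat n n" by fact
  have Bblock: "B = four_block_mat E (0\<^sub>m 1 n) (0\<^sub>m n 1) B3"
  proof (rule eq_matI)
    fix i j assume "i < dim_row (four_block_mat E (0\<^sub>m 1 n) (0\<^sub>m n 1) B3)"
      "j < dim_col (four_block_mat E (0\<^sub>m 1 n) (0\<^sub>m n 1) B3)"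
    then have ij: "i < ?N" "j < ?N" by (auto simp: E_def B3_def)
    then show "B $$ (i,j) = four_block_mat E (0\<^sub>m 1 n) (0\<^sub>m n 1) B3 $$ (i,j)"
      using B0[of i] B0[of j] Bs[of 0 j] by (cases i; cases j) (auto simp: E_def B3_def)
  qed (use B in \<open>auto simp: E_def B3_def\<close>)
  define U' where "U' = four_block_mat (1\<^sub>m 1) (0\<^sub>m 1 n) (0\<^sub>m n 1) U3"
  have U': "U' \<in> carrier_mat ?N ?N" using U3 unfolding U'_def by auto
  have U'T: "U'\<^sup>T = four_block_mat (1\<^sub>m 1) (0\<^sub>m 1 n) (0\<^sub>m n 1) (U3\<^sup>T)"
    unfolding U'_def by (subst transpose_four_block_mat[of _ 1 1 _ n _ n]) (use U3 in auto)
  have U'U': "U'\<^sup>T * U' = 1\<^sub>m ?N"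
    by (subst U'T, subst U'_def, subst mult_four_block_mat[of _ 1 1 _ n _ n _ _ 1 _ n])
       (use U3 four_block_one_mat[of 1 n] in auto)
  have "U'\<^sup>T * B = four_block_mat E (0\<^sub>m 1 n) (0\<^sub>m n 1) (U3\<^sup>T * B3)"
    unfolding U'T Bblock
    by (subst mult_four_block_mat[of _ 1 1 _ n _ n _ _ 1 _ n]) (use U3 E B3 in auto)
  then have "U'\<^sup>T * B * U' = four_block_mat E (0\<^sub>m 1 n) (0\<^sub>m n 1) (U3\<^sup>T * B3 * U3)"
    unfolding U'_def
    by simp (subst mult_four_block_mat[of _ 1 1 _ n _ n _ _ 1 _ n], use U3 E B3 in auto)
  also have "\<dots> = mat ?N ?N (\<lambda>(i,j). if i = j then (case i of 0 \<Rightarrow> e | Suc k \<Rightarrow> d3 k) else 0)"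
    unfolding U3(3) by (rule eq_matI) (auto simp: E_def split: nat.splits)
  finally have D: "U'\<^sup>T * B * U' = mat ?N ?N (\<lambda>(i,j). if i = j then (case i of 0 \<Rightarrow> e | Suc k \<Rightarrow> d3 k) else 0)" .
  have "(W * U')\<^sup>T * (W * U') = U'\<^sup>T * (W\<^sup>T * W) * U'"
    using W(1) U' by (simp add: transpose_mult[of _ ?N ?N _ ?N] assoc_mult_mat[of _ ?N ?N _ ?N _ ?N])
  also have "\<dots> = 1\<^sub>m ?N" using W(2) U' U'U' by simp
  finally have 1: "(W * U')\<^sup>T * (W * U') = 1\<^sub>m ?N" .
  have "(W * U')\<^sup>T * A * (W * U') = U'\<^sup>T * B * U'"
    using W(1) U' A unfolding B_def by (simp add: transpose_mult[of _ ?N ?N _ ?N] assoc_mult_mat[of _ ?N ?N _ ?N _ ?N])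
  then show ?case using 1 D W U' by (intro bexI[of _ "W * U'"]) auto
qed

section \<open>Spectral distributions\<close>

text \<open>The squared Frobenius norm, without the root.\<close>

definition frob :: "real mat \<Rightarrow> real" where
  "frob A = (\<Sum>i<dim_row A. \<Sum>j<dim_col A. (A $$ (i,j))\<^sup>2)"

definition tr :: "real mat \<Rightarrow> real" where "tr A = (\<Sum>i<dim_row A. A $$ (i,i))"

abbreviation diag_of :: "nat \<Rightarrow> (nat \<Rightarrow> real) \<Rightarrow> real mat" where
  "diag_of n d \<equiv> mat n n (\<lambda>(i,j). if i = j then d i else 0)"

lemma tr_mult_commute:
  assumes "A \<in> carrier_mat n m" "B \<in> carrier_mat m n"
  shows "tr (A * B) = tr (B * A)"
proof -
  have "tr (A * B) = (\<Sum>i<n. \<Sum>j<m. A $$ (i,j) * B $$ (j,i))"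
    using assms unfolding tr_def by (auto simp: scalar_prod_def lessThan_atLeast0 intro!: sum.cong)
  also have "\<dots> = (\<Sum>j<m. \<Sum>i<n. B $$ (j,i) * A $$ (i,j))" by (subst sum.swap) (simp add: mult.commute)
  also have "\<dots> = tr (B * A)"
    using assms unfolding tr_def by (auto simp: scalar_prod_def lessThan_atLeast0 intro!: sum.cong)
  finally show ?thesis .
qed

lemma frob_tr:
  assumes "A \<in> carrier_mat n m" shows "frob A = tr (A\<^sup>T * A)"
proof -
  have "tr (A\<^sup>T * A) = (\<Sum>j<m. \<Sum>i<n. (A $$ (i,j))\<^sup>2)"
    using assms unfolding tr_def by (auto simp: scalar_prod_def lessThan_atLeast0 power2_eq_square intro!: sum.cong)
  also have "\<dots> = frob A" using assms unfolding frob_def by (subst sum.swap) auto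
  finally show ?thesis ..
qed

lemma frob_orthogonal:
  assumes U: "U \<in> carrier_mat n n" "U\<^sup>T * U = 1\<^sub>m n" and V: "V \<in> carrier_mat n n" "V\<^sup>T * V = 1\<^sub>m n"
    and A: "A \<in> carrier_mat n n"
  shows "frob (U\<^sup>T * A * V) = frob A"
proof -
  have UU: "U * U\<^sup>T = 1\<^sub>m n" using mat_mult_left_right_inverse[OF _ U(1) U(2)] U(1) by auto
  have VV: "V * V\<^sup>T = 1\<^sub>m n" using mat_mult_left_right_inverse[OF _ V(1) V(2)] V(1) by auto
  have "(U\<^sup>T * A * V)\<^sup>T * (U\<^sup>T * A * V) = V\<^sup>T * (A\<^sup>T * (U * U\<^sup>T) * A * V)"
    using U(1) V(1) A by (simp add: transpose_mult[of _ n n _ n] assoc_mult_mat[of _ n n _ n _ n])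
  also have "\<dots> = V\<^sup>T * (A\<^sup>T * A * V)" using A by (simp add: UU)
  finally have "frob (U\<^sup>T * A * V) = tr (V\<^sup>T * (A\<^sup>T * A * V))"
    using U V A by (subst frob_tr[of _ n n]) auto
  also have "\<dots> = tr ((A\<^sup>T * A * V) * V\<^sup>T)" using A V by (intro tr_mult_commute[of _ n n]) auto
  also have "(A\<^sup>T * A * V) * V\<^sup>T = A\<^sup>T * A"
    using A V(1) by (subst assoc_mult_mat[of _ n n _ n _ n]) (auto simp: VV)
  finally show ?thesis using frob_tr[OF A] by simp
qed

lemma orthogonal_rows:
  fixes Q :: "real mat"
  assumes Q: "Q \<in> carrier_mat n n" "Q\<^sup>T * Q = 1\<^sub>m n"
  shows "j < n \<Longrightarrow> (\<Sum>i<n. (Q $$ (i,j))\<^sup>2) = 1" "i < n \<Longrightarrow> (\<Sum>j<n. (Q $$ (i,j))\<^sup>2) = 1"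
proof -
  have QQ: "Q * Q\<^sup>T = 1\<^sub>m n" using mat_mult_left_right_inverse[of "Q\<^sup>T" n Q] Q by auto
  show "(\<Sum>i<n. (Q $$ (i,j))\<^sup>2) = 1" if "j < n"
    using arg_cong[OF Q(2), of "\<lambda>B. B $$ (j,j)"] that Q(1)
    by (auto simp: scalar_prod_def lessThan_atLeast0 power2_eq_square)
  show "(\<Sum>j<n. (Q $$ (i,j))\<^sup>2) = 1" if "i < n"
    using arg_cong[OF QQ, of "\<lambda>B. B $$ (i,i)"] that Q(1)
    by (auto simp: scalar_prod_def lessThan_atLeast0 power2_eq_square)
qed

text \<open>The squared entries of \<open>U\<^sup>T * V\<close> form a doubly stochastic matrix, that is, a coupling of the
  two spectra, whose quadratic cost is the squared Frobenius distance.\<close>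

lemma spectral_lipschitz:
  fixes f :: "real \<Rightarrow> 'b::real_normed_vector"
  assumes A: "A \<in> carrier_mat n n" and B: "B \<in> carrier_mat n n"
    and U: "U \<in> carrier_mat n n" "U\<^sup>T * U = 1\<^sub>m n" "U\<^sup>T * A * U = diag_of n d"
    and V: "V \<in> carrier_mat n n" "V\<^sup>T * V = 1\<^sub>m n" "V\<^sup>T * B * V = diag_of n e"
    and L: "\<And>x y. norm (f x - f y) \<le> L * \<bar>x - y\<bar>" and L0: "L \<ge> 0"
  shows "norm ((\<Sum>i<n. f (d i)) - (\<Sum>i<n. f (e i))) \<le> L * sqrt (real n * frob (A - B))"
proof -
  have UU: "U * U\<^sup>T = 1\<^sub>m n" using mat_mult_left_right_inverse[OF _ U(1) U(2)] U(1) by auto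
  have VV: "V * V\<^sup>T = 1\<^sub>m n" using mat_mult_left_right_inverse[OF _ V(1) V(2)] V(1) by auto
  define Q where "Q = U\<^sup>T * V"
  have Q: "Q \<in> carrier_mat n n" using U V by (auto simp: Q_def)
  have "Q\<^sup>T * Q = V\<^sup>T * (U * U\<^sup>T) * V"
    using U(1) V(1) by (simp add: Q_def transpose_mult[of _ n n _ n] assoc_mult_mat[of _ n n _ n _ n])
  also have "\<dots> = 1\<^sub>m n" using V UU by simp
  finally have QQ: "Q\<^sup>T * Q = 1\<^sub>m n" .
  note rows = orthogonal_rows[OF Q QQ]
  have "U\<^sup>T * A * V = U\<^sup>T * A * (U * U\<^sup>T) * V" unfolding UU using U(1) V(1) A by simp
  also have "\<dots> = (U\<^sup>T * A * U) * Q"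
    using U(1) V(1) A by (simp add: Q_def assoc_mult_mat[of _ n n _ n _ n])
  finally have 1: "U\<^sup>T * A * V = diag_of n d * Q" unfolding U(3) .
  have "U\<^sup>T * B * V = U\<^sup>T * (V * V\<^sup>T) * B * V" unfolding VV using U(1) V(1) B by simp
  also have "\<dots> = Q * (V\<^sup>T * B * V)"
    using U(1) V(1) B by (simp add: Q_def assoc_mult_mat[of _ n n _ n _ n])
  finally have 2: "U\<^sup>T * B * V = Q * diag_of n e" unfolding V(3) .
  have "U\<^sup>T * (A - B) * V = U\<^sup>T * A * V - U\<^sup>T * B * V"
    using U(1) V(1) A B by (simp add: mult_minus_distrib_mat[of _ n n _ n] minus_mult_distrib_mat[of _ n n _ _ n])
  also have "\<dots> = mat n n (\<lambda>(i,j). (d i - e j) * Q $$ (i,j))"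
    unfolding 1 2
  proof (rule eq_matI)
    fix i j assume "i < dim_row (mat n n (\<lambda>(i,j). (d i - e j) * Q $$ (i,j)))" "j < dim_col (mat n n (\<lambda>(i,j). (d i - e j) * Q $$ (i,j)))"
    then have ij: "i < n" "j < n" by auto
    have "(diag_of n d * Q) $$ (i,j) = (\<Sum>k<n. (if i = k then d i else 0) * Q $$ (k,j))"
      using ij Q by (auto simp: scalar_prod_def lessThan_atLeast0 intro!: sum.cong)
    also have "\<dots> = d i * Q $$ (i,j)"
      using ij by (subst sum.remove[of _ i]) (auto intro!: sum.neutral)
    finally have a: "(diag_of n d * Q) $$ (i,j) = d i * Q $$ (i,j)" .
    have "(Q * diag_of n e) $$ (i,j) = (\<Sum>k<n. Q $$ (i,k) * (if k = j then e k else 0))"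
      using ij Q by (auto simp: scalar_prod_def lessThan_atLeast0 intro!: sum.cong)
    also have "\<dots> = Q $$ (i,j) * e j"
      using ij by (subst sum.remove[of _ j]) (auto intro!: sum.neutral)
    finally have b: "(Q * diag_of n e) $$ (i,j) = Q $$ (i,j) * e j" .
    show "(diag_of n d * Q - Q * diag_of n e) $$ (i,j) = mat n n (\<lambda>(i,j). (d i - e j) * Q $$ (i,j)) $$ (i,j)"
      using ij Q a b by (simp add: algebra_simps)
  qed (use Q in auto)
  finally have D: "U\<^sup>T * (A - B) * V = mat n n (\<lambda>(i,j). (d i - e j) * Q $$ (i,j))" .
  let ?I = "{..<n} \<times> {..<n}"
  define q where "q p = \<bar>Q $$ p\<bar>" for p
  define r where "r p = \<bar>d (fst p) - e (snd p)\<bar> * \<bar>Q $$ p\<bar>" for p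
  \<comment> \<open>Between the two eigenbases the difference has the entries
    \<open>(d i - e j) * Q $$ (i,j)\<close>, so its squared norm is the quadratic cost of the
    coupling with the weights \<open>(Q $$ (i,j))\<^sup>2\<close>.\<close>
  have "frob (A - B) = frob (U\<^sup>T * (A - B) * V)"
    by (rule frob_orthogonal[OF U(1,2) V(1,2), symmetric]) (use A B in auto)
  also have "\<dots> = (\<Sum>p\<in>?I. (r p)\<^sup>2)"
    unfolding D frob_def by (simp add: sum.cartesian_product r_def case_prod_beta power_mult_distrib)
  finally have F: "frob (A - B) = (\<Sum>p\<in>?I. (r p)\<^sup>2)" .
  have q1: "(\<Sum>p\<in>?I. (q p)\<^sup>2) = n"
  proof -
    have "(\<Sum>p\<in>?I. (q p)\<^sup>2) = (\<Sum>i<n. \<Sum>j<n. (Q $$ (i,j))\<^sup>2)"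
      unfolding q_def by (simp add: sum.cartesian_product)
    also have "\<dots> = n" using rows(2) by simp
    finally show ?thesis .
  qed
  \<comment> \<open>Unit row sums spread \<open>f (d i)\<close> over row \<open>i\<close>, unit
    column sums spread \<open>f (e j)\<close> over column \<open>j\<close>; both sums then run over
    the same weighted pairs.\<close>
  have fd: "(\<Sum>i<n. f (d i)) = (\<Sum>i<n. \<Sum>j<n. (Q $$ (i,j))\<^sup>2 *\<^sub>R f (d i))"
    by (intro sum.cong refl) (simp add: scaleR_left.sum[symmetric] rows)
  have "(\<Sum>j<n. f (e j)) = (\<Sum>j<n. \<Sum>i<n. (Q $$ (i,j))\<^sup>2 *\<^sub>R f (e j))"
    by (intro sum.cong refl) (simp add: scaleR_left.sum[symmetric] rows)
  also have "\<dots> = (\<Sum>i<n. \<Sum>j<n. (Q $$ (i,j))\<^sup>2 *\<^sub>R f (e j))" by (rule sum.swap)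
  finally have fe: "(\<Sum>j<n. f (e j)) = (\<Sum>i<n. \<Sum>j<n. (Q $$ (i,j))\<^sup>2 *\<^sub>R f (e j))" .
  have "(\<Sum>i<n. f (d i)) - (\<Sum>i<n. f (e i)) = (\<Sum>p\<in>?I. (Q $$ p)\<^sup>2 *\<^sub>R (f (d (fst p)) - f (e (snd p))))"
    unfolding fd fe by (simp add: sum_subtractf[symmetric] scaleR_diff_right[symmetric] sum.cartesian_product case_prod_beta)
  also have "norm \<dots> \<le> (\<Sum>p\<in>?I. L * (\<bar>q p\<bar> * \<bar>r p\<bar>))"
  proof (rule sum_norm_le)
    fix p
    have "norm ((Q $$ p)\<^sup>2 *\<^sub>R (f (d (fst p)) - f (e (snd p)))) \<le> (Q $$ p)\<^sup>2 * (L * \<bar>d (fst p) - e (snd p)\<bar>)"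
      using mult_left_mono[OF L[of "d (fst p)" "e (snd p)"], of "(Q $$ p)\<^sup>2"] by simp
    also have "\<dots> = L * (\<bar>q p\<bar> * \<bar>r p\<bar>)"
      by (simp add: q_def r_def power2_eq_square abs_mult_self_eq[of "Q $$ p", symmetric] del: abs_mult_self_eq)
    finally show "norm ((Q $$ p)\<^sup>2 *\<^sub>R (f (d (fst p)) - f (e (snd p)))) \<le> L * (\<bar>q p\<bar> * \<bar>r p\<bar>)" .
  qed
  also have "\<dots> = L * (\<Sum>p\<in>?I. \<bar>q p\<bar> * \<bar>r p\<bar>)" by (simp add: sum_distrib_left)
  \<comment> \<open>Cauchy--Schwarz; the squares of the weights \<open>q\<close> add up to
    \<open>n\<close>.\<close>
  also have "\<dots> \<le> L * (L2_set q ?I * L2_set r ?I)"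
    by (intro mult_left_mono L2_set_mult_ineq L0)
  also have "\<dots> = L * sqrt (real n * frob (A - B))"
    by (simp add: L2_set_def q1 F[symmetric] real_sqrt_mult)
  finally show ?thesis .
qed

lemma proots_linear_factors: "proots (\<Prod>a\<leftarrow>xs. [:- a, 1:]) = mset (xs :: real list)"
proof (induction xs)
  case (Cons a xs)
  have "(\<Prod>a\<leftarrow>xs. [:- a, 1:]) \<noteq> 0" by (auto simp: prod_list_zero_iff)
  then have "proots ([:- a, 1:] * (\<Prod>a\<leftarrow>xs. [:- a, 1:])) = proots [:- a, 1:] + proots (\<Prod>a\<leftarrow>xs. [:- a, 1:])"
    by (intro proots_mult) auto
  then show ?case using Cons.IH by simp
qed simp

lemma proots_char_poly_orthogonal:
  assumes A: "A \<in> carrier_mat n n" and U: "U \<in> carrier_mat n n" "U\<^sup>T * U = 1\<^sub>m n" "U\<^sup>T * A * U = diag_of n d"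
  shows "similar_mat_wit A (diag_of n d) U (U\<^sup>T)" "proots (char_poly A) = mset (map d [0..<n])"
proof -
  have UU: "U * U\<^sup>T = 1\<^sub>m n" using mat_mult_left_right_inverse[OF _ U(1) U(2)] U(1) by auto
  have "A = (U * U\<^sup>T) * A * (U * U\<^sup>T)" unfolding UU using A by simp
  also have "\<dots> = U * (U\<^sup>T * A * U) * U\<^sup>T" using A U(1) by (simp add: assoc_mult_mat[of _ n n _ n _ n])
  finally have AU: "A = U * diag_of n d * U\<^sup>T" unfolding U(3) .
  show w: "similar_mat_wit A (diag_of n d) U (U\<^sup>T)"
    by (rule similar_mat_witI[of _ _ n]) (use A U UU AU in auto)
  have "char_poly A = char_poly (diag_of n d)" using w by (intro char_poly_similar) (auto simp: similar_mat_def)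
  also have "\<dots> = (\<Prod>a\<leftarrow>diag_mat (diag_of n d). [:- a, 1:])"
    by (rule char_poly_upper_triangular[of _ n]) (auto simp: upper_triangular_def)
  also have "diag_mat (diag_of n d) = map d [0..<n]" by (auto simp: diag_mat_def intro!: map_cong)
  finally show "proots (char_poly A) = mset (map d [0..<n])" by (simp only: proots_linear_factors)
qed

lemma integral_esd:
  fixes f :: "real \<Rightarrow> 'b::{banach, second_countable_topology}"
  assumes A: "A \<in> carrier_mat n n" and n: "n > 0" and p: "proots (char_poly A) = mset (map d [0..<n])"
    and f: "f \<in> borel_measurable borel"
  shows "integrable (esd A) f" "(\<integral>u. f u \<partial>esd A) = (1 / real n) *\<^sub>R (\<Sum>i<n. f (d i))"
proof -
  let ?P = "proots (char_poly A)"
  let ?p = "pmf_of_multiset ?P"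
  have ne: "?P \<noteq> {#}" using n p by (metis (no_types, lifting) length_0_conv length_map length_upt mset.simps(1) mset_eq_length neq0_conv minus_nat.diff_0)
  have sz: "size ?P = n" unfolding p by simp
  have st: "set_pmf ?p = d ` {..<n}" using ne by (simp, simp add: p lessThan_atLeast0)
  have fin: "finite (set_pmf ?p)" unfolding st by simp
  show "integrable (esd A) f" unfolding esd_def
    by (subst integrable_distr_eq) (use f fin in \<open>auto intro: integrable_measure_pmf_finite\<close>)
  have "(\<integral>u. f u \<partial>esd A) = (\<integral>u. f u \<partial>measure_pmf ?p)" unfolding esd_def
    by (subst integral_distr) (use f in auto)
  also have "\<dots> = (\<Sum>a\<in>d ` {..<n}. pmf ?p a *\<^sub>R f a)"
    by (rule integral_measure_pmf) (use fin st in auto)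
  also have "\<dots> = (\<Sum>a\<in>d ` {..<n}. (card {i\<in>{..<n}. d i = a} / real n) *\<^sub>R f a)"
  proof (intro sum.cong refl)
    fix a
    have "count (mset (map d [0..<m])) a = card {i\<in>{..<m}. d i = a}" for m
    proof (induction m)
      case (Suc m)
      have "{i\<in>{..<Suc m}. d i = a} = (if d m = a then insert m {i\<in>{..<m}. d i = a} else {i\<in>{..<m}. d i = a})"
        by (auto simp: less_Suc_eq)
      then show ?case using Suc by simp
    qed simp
    then have "count ?P a = card {i\<in>{..<n}. d i = a}" unfolding p .
    then show "pmf ?p a *\<^sub>R f a = (card {i\<in>{..<n}. d i = a} / real n) *\<^sub>R f a"
      using ne sz by simp
  qed
  also have "\<dots> = (\<Sum>a\<in>d ` {..<n}. \<Sum>i | i \<in> {..<n} \<and> d i = a. (1 / real n) *\<^sub>R f (d i))"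
    by (intro sum.cong refl) (simp add: sum_constant_scaleR)
  also have "\<dots> = (\<Sum>i<n. (1 / real n) *\<^sub>R f (d i))" by (rule sum.group) auto
  finally show "(\<integral>u. f u \<partial>esd A) = (1 / real n) *\<^sub>R (\<Sum>i<n. f (d i))" by (simp add: scaleR_sum_right)
qed

lemma real_distribution_esd: "real_distribution (esd A)"
  unfolding esd_def real_distribution_def real_distribution_axioms_def
  by (auto intro!: prob_space.prob_space_distr measure_pmf.prob_space_axioms)

lemma tr_pow_orthogonal:
  assumes A: "A \<in> carrier_mat n n" and U: "U \<in> carrier_mat n n" "U\<^sup>T * U = 1\<^sub>m n" "U\<^sup>T * A * U = diag_of n d"
  shows "tr (A ^\<^sub>m k) = (\<Sum>i<n. d i ^ k)"
proof -
  have D: "diag_of n d ^\<^sub>m k = diag_of n (\<lambda>i. d i ^ k)"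
  proof (induction k)
    case 0 show ?case by (auto intro!: eq_matI)
  next
    case (Suc k)
    have "diag_of n (\<lambda>i. d i ^ k) * diag_of n d = diag_of n (\<lambda>i. d i ^ Suc k)"
    proof (rule eq_matI)
      fix i j assume "i < dim_row (diag_of n (\<lambda>i. d i ^ Suc k))" "j < dim_col (diag_of n (\<lambda>i. d i ^ Suc k))"
      then have ij: "i < n" "j < n" by auto
      have "(diag_of n (\<lambda>i. d i ^ k) * diag_of n d) $$ (i,j) = (\<Sum>l<n. (if i = l then d i ^ k else 0) * (if l = j then d l else 0))"
        using ij by (auto simp: scalar_prod_def lessThan_atLeast0 intro!: sum.cong)
      also have "\<dots> = (if i = j then d i ^ k * d i else 0)"
        using ij by (subst sum.remove[of _ i]) (auto intro!: sum.neutral)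
      finally show "(diag_of n (\<lambda>i. d i ^ k) * diag_of n d) $$ (i,j) = diag_of n (\<lambda>i. d i ^ Suc k) $$ (i,j)"
        using ij by simp
    qed auto
    then show ?case using Suc by simp
  qed
  have "A ^\<^sub>m k = U * diag_of n d ^\<^sub>m k * U\<^sup>T"
    by (rule similar_mat_wit_pow_id[OF proots_char_poly_orthogonal(1)[OF assms]])
  then have "tr (A ^\<^sub>m k) = tr (U * diag_of n (\<lambda>i. d i ^ k) * U\<^sup>T)" unfolding D by simp
  also have "\<dots> = tr (U\<^sup>T * (U * diag_of n (\<lambda>i. d i ^ k)))"
    using U(1) by (intro tr_mult_commute[of _ n n]) auto
  also have "U\<^sup>T * (U * diag_of n (\<lambda>i. d i ^ k)) = diag_of n (\<lambda>i. d i ^ k)"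
    using U(1) by (subst assoc_mult_mat[symmetric, of _ n n _ n _ n]) (auto simp: U(2))
  finally show ?thesis by (simp add: tr_def)
qed

lemma sum_PiE_insert:
  assumes "k \<notin> S"
  shows "(\<Sum>w\<in>PiE (insert k S) T. F w) = (\<Sum>l\<in>T k. \<Sum>w\<in>PiE S T. F (w(k := l)))"
proof -
  have "(\<Sum>w\<in>PiE (insert k S) T. F w) = (\<Sum>(l,w)\<in>T k \<times> PiE S T. F (w(k := l)))"
    unfolding PiE_insert_eq
    by (subst sum.reindex) (auto simp: inj_combinator assms case_prod_beta intro!: sum.cong)
  then show ?thesis by (simp add: sum.cartesian_product)
qed

text \<open>A product of \<open>Suc k\<close> factors passes through \<open>k\<close> intermediate
  vertices, listed by \<open>w\<close>; the padded sequence \<open>v\<close> adds the two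
  ends.\<close>

lemma mat_pow_entry_walks:
  assumes A: "A \<in> carrier_mat n n" and "i < n" "j < n"
  shows "(A ^\<^sub>m Suc k) $$ (i,j) = (\<Sum>w\<in>PiE {..<k} (\<lambda>_. {..<n}).
     let v = (\<lambda>s. if s = 0 then i else if s = Suc k then j else w (s - 1)) in \<Prod>s<Suc k. A $$ (v s, v (Suc s)))"
  using assms(2,3)
proof (induction k arbitrary: j)
  case 0
  then show ?case using A by (simp add: left_mult_one_mat)
next
  case (Suc k)
  have P: "A ^\<^sub>m Suc k \<in> carrier_mat n n" using A by (rule pow_carrier_mat)
  have "(A ^\<^sub>m Suc (Suc k)) $$ (i,j) = (A ^\<^sub>m Suc k * A) $$ (i,j)" by simp
  also have "\<dots> = (\<Sum>l<n. (A ^\<^sub>m Suc k) $$ (i,l) * A $$ (l,j))"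
    using P A Suc.prems by (auto simp: scalar_prod_def lessThan_atLeast0 simp del: pow_mat.simps)
  also have "\<dots> = (\<Sum>l<n. \<Sum>w\<in>PiE {..<k} (\<lambda>_. {..<n}). 
     (let v = (\<lambda>s. if s = 0 then i else if s = Suc k then l else w (s - 1)) in \<Prod>s<Suc k. A $$ (v s, v (Suc s))) * A $$ (l,j))"
    using Suc by (simp add: sum_distrib_right del: pow_mat.simps prod.lessThan_Suc)
  also have "\<dots> = (\<Sum>l<n. \<Sum>w\<in>PiE {..<k} (\<lambda>_. {..<n}). 
     (let v = (\<lambda>s. if s = 0 then i else if s = Suc (Suc k) then j else (w(k := l)) (s - 1)) in \<Prod>s<Suc (Suc k). A $$ (v s, v (Suc s))))"
  proof (intro sum.cong refl)
    fix l w
    have "(\<Prod>s<Suc k. A $$ (if s = 0 then i else if s = Suc k then l else w (s - 1), if Suc s = 0 then i else if Suc s = Suc k then l else w (Suc s - 1)))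
       = (\<Prod>s<Suc k. A $$ (if s = 0 then i else if s = Suc (Suc k) then j else (w(k := l)) (s - 1), if Suc s = 0 then i else if Suc s = Suc (Suc k) then j else (w(k := l)) (Suc s - 1)))"
      by (intro prod.cong refl) auto
    then show "(let v = (\<lambda>s. if s = 0 then i else if s = Suc k then l else w (s - 1)) in \<Prod>s<Suc k. A $$ (v s, v (Suc s))) * A $$ (l,j)
      = (let v = (\<lambda>s. if s = 0 then i else if s = Suc (Suc k) then j else (w(k := l)) (s - 1)) in \<Prod>s<Suc (Suc k). A $$ (v s, v (Suc s)))"
      unfolding Let_def by (subst (2) prod.lessThan_Suc) simp
  qed
  also have "\<dots> = (\<Sum>w\<in>PiE {..<Suc k} (\<lambda>_. {..<n}). (let v = (\<lambda>s. if s = 0 then i else if s = Suc (Suc k) then j else w (s - 1)) in \<Prod>s<Suc (Suc k). A $$ (v s, v (Suc s))))"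
    by (subst lessThan_Suc, subst sum_PiE_insert) (auto simp del: prod.lessThan_Suc)
  finally show ?case .
qed

text \<open>The common first and last vertex is stored at position \<open>k - 1\<close>, behind the
  intermediate vertices. This is a rotation of the walk and leaves the cyclic product
  unchanged.\<close>

lemma tr_pow_closed_walks:
  assumes A: "A \<in> carrier_mat n n" and k: "k > 0"
  shows "tr (A ^\<^sub>m k) = (\<Sum>w\<in>PiE {..<k} (\<lambda>_. {..<n}). \<Prod>s<k. A $$ (w s, w (Suc s mod k)))"
proof -
  obtain m where m: "k = Suc m" using k by (cases k) auto
  have P: "A ^\<^sub>m k \<in> carrier_mat n n" using A by (rule pow_carrier_mat)
  then have "tr (A ^\<^sub>m k) = (\<Sum>i<n. (A ^\<^sub>m k) $$ (i,i))" by (auto simp: tr_def)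
  also have "\<dots> = (\<Sum>i<n. \<Sum>w\<in>PiE {..<m} (\<lambda>_. {..<n}). \<Prod>s<k. A $$ ((w(m := i)) s, (w(m := i)) (Suc s mod k)))"
  proof (intro sum.cong refl)
    fix i assume i: "i \<in> {..<n}"
    have "(A ^\<^sub>m k) $$ (i,i) = (\<Sum>w\<in>PiE {..<m} (\<lambda>_. {..<n}).
      let v = (\<lambda>s. if s = 0 then i else if s = Suc m then i else w (s - 1)) in \<Prod>s<Suc m. A $$ (v s, v (Suc s)))"
      unfolding m using i by (intro mat_pow_entry_walks[OF A]) auto
    also have "\<dots> = (\<Sum>w\<in>PiE {..<m} (\<lambda>_. {..<n}). \<Prod>s<k. A $$ ((w(m := i)) s, (w(m := i)) (Suc s mod k)))"
    proof (intro sum.cong refl)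
      fix w
      define W where "W = w(m := i)"
      have "(let v = (\<lambda>s. if s = 0 then i else if s = Suc m then i else w (s - 1)) in \<Prod>s<Suc m. A $$ (v s, v (Suc s)))
        = A $$ (W m, W 0) * (\<Prod>s<m. A $$ (W s, W (Suc s)))"
        unfolding Let_def by (subst prod.lessThan_Suc_shift) (auto simp: W_def intro!: arg_cong2[of _ _ _ _ "(*)"] prod.cong)
      also have "\<dots> = (\<Prod>s<k. A $$ (W s, W (Suc s mod k)))"
        unfolding m by (auto simp: mult.commute intro!: arg_cong2[of _ _ _ _ "(*)"] prod.cong)
      finally show "(let v = (\<lambda>s. if s = 0 then i else if s = Suc m then i else w (s - 1)) in \<Prod>s<Suc m. A $$ (v s, v (Suc s)))
        = (\<Prod>s<k. A $$ ((w(m := i)) s, (w(m := i)) (Suc s mod k)))" unfolding W_def .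
    qed
    finally show "(A ^\<^sub>m k) $$ (i,i) = (\<Sum>w\<in>PiE {..<m} (\<lambda>_. {..<n}). \<Prod>s<k. A $$ ((w(m := i)) s, (w(m := i)) (Suc s mod k)))" .
  qed
  also have "\<dots> = (\<Sum>w\<in>PiE {..<k} (\<lambda>_. {..<n}). \<Prod>s<k. A $$ (w s, w (Suc s mod k)))"
    unfolding m by (subst (2) lessThan_Suc, subst sum_PiE_insert) auto
  finally show ?thesis .
qed

section \<open>Carleman's condition\<close>

text \<open>Taylor expansion at \<open>x\<close> up to order \<open>N - n\<close>. Log-convexity
  bounds \<open>M (m + j)\<close> by \<open>M m\<close> times a power of the ratio
  \<open>M (Suc N) / M N\<close>, so the terms are dominated by those of the exponential series at
  some \<open>q \<le> 1\<close>, and their sum costs only one factor \<open>exp 1\<close>.\<close>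

lemma bang_step:
  fixes f :: "nat \<Rightarrow> real \<Rightarrow> complex" and M :: "nat \<Rightarrow> real"
  assumes Mpos: "\<And>n. M n > 0" and lc: "\<And>n. (M (Suc n))\<^sup>2 \<le> M n * M (Suc (Suc n))"
    and bd: "\<And>n x. cmod (f n x) \<le> M n"
    and taylor: "\<And>n m x h. cmod (f n (x + h) - (\<Sum>j\<le>m. f (n + j) x * of_real (h ^ j / fact j)))
        \<le> M (n + Suc m) * \<bar>h\<bar> ^ Suc m / fact (Suc m)"
    and x: "\<And>n. cmod (f n x) \<le> exp (real n) * M n * exp (- real (Suc N))"
    and h: "\<bar>h\<bar> * exp 1 * (M (Suc N) / M N) \<le> 1"
  shows "cmod (f n (x + h)) \<le> exp (real n) * M n * exp (- real N)"
proof -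
  let ?K = "Suc N"
  define r where "r n = M (Suc n) / M n" for n
  have rpos: "r n > 0" for n using Mpos by (simp add: r_def)
  have rmono1: "r n \<le> r (Suc n)" for n
    using lc[of n] Mpos[of n] Mpos[of "Suc n"] by (simp add: r_def field_simps power2_eq_square)
  have rmono: "r m \<le> r n" if "m \<le> n" for m n using that rmono1 by (simp add: lift_Suc_mono_le)
  have Mr: "M (m + j) \<le> M m * r N ^ j" if "m + j \<le> ?K" for m j
    using that
  proof (induction j)
    case (Suc j)
    have "M (m + Suc j) = M (m + j) * r (m + j)" using Mpos[of "m + j"] by (simp add: r_def)
    also have "\<dots> \<le> (M m * r N ^ j) * r N"
      using Suc rmono[of "m + j" N] rpos Mpos by (intro mult_mono) (auto intro: less_imp_le)
    finally show ?case by (simp add: mult_ac)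
  qed simp
  show ?thesis
  proof (cases "n \<le> N")
    case False
    \<comment> \<open>Above level \<open>N\<close> the trivial bound by \<open>M n\<close> is
      enough.\<close>
    have "M n = M n * exp 0" by simp
    also have "\<dots> \<le> M n * (exp (real n) * exp (- real N))"
      using False Mpos by (intro mult_left_mono) (auto simp: exp_add[symmetric] intro: less_imp_le)
    finally show ?thesis using bd[of n "x + h"] by (simp add: mult_ac)
  next
    case True
    then obtain m where m: "N = n + m" using le_Suc_ex by auto
    let ?c = "exp (real n) * M n * exp (- real ?K)"
    have c0: "?c > 0" using Mpos by simp
    define q where "q = \<bar>h\<bar> * exp 1 * r N"
    have q: "0 \<le> q" using rpos[of N] by (simp add: q_def)
    have q1: "q \<le> 1" using h by (simp add: q_def r_def)
    have t1: "cmod (f (n + j) x * of_real (h ^ j / fact j)) \<le> ?c * (q ^ j / fact j)" if "j \<le> m" for j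
    proof -
      have "cmod (f (n + j) x * of_real (h ^ j / fact j)) = cmod (f (n + j) x) * (\<bar>h\<bar> ^ j / fact j)"
        by (simp add: norm_mult norm_divide norm_power)
      also have "\<dots> \<le> (exp (real (n + j)) * M (n + j) * exp (- real ?K)) * (\<bar>h\<bar> ^ j / fact j)"
        by (intro mult_right_mono x) simp
      also have "\<dots> \<le> (exp (real (n + j)) * (M n * r N ^ j) * exp (- real ?K)) * (\<bar>h\<bar> ^ j / fact j)"
        using Mr[of n j] that m by (intro mult_right_mono mult_left_mono) auto
      also have "\<dots> = ?c * (q ^ j / fact j)"
        by (simp add: q_def power_mult_distrib exp_add exp_of_nat_mult[symmetric] mult_ac)
      finally show ?thesis .
    qed
    have t2: "M (n + Suc m) * \<bar>h\<bar> ^ Suc m / fact (Suc m) \<le> ?c * (q ^ Suc m / fact (Suc m))"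
    proof -
      \<comment> \<open>The exponents cancel exactly: the remainder, for which only the trivial
        bound is available, has the size of the next term of the series.\<close>
      have e: "exp (real n) * exp (- real ?K) * exp 1 ^ Suc m = 1"
        by (simp add: m exp_of_nat_mult[symmetric] exp_add[symmetric] del: power_Suc)
      have "M (n + Suc m) * \<bar>h\<bar> ^ Suc m \<le> (M n * r N ^ Suc m) * \<bar>h\<bar> ^ Suc m"
        using Mr[of n "Suc m"] m by (intro mult_right_mono) auto
      also have "\<dots> = (exp (real n) * exp (- real ?K) * exp 1 ^ Suc m) * ((M n * r N ^ Suc m) * \<bar>h\<bar> ^ Suc m)"
        unfolding e by simp
      also have "\<dots> = ?c * q ^ Suc m" by (simp add: q_def power_mult_distrib mult_ac)
      finally show ?thesis by (simp add: divide_right_mono del: power_Suc fact_Suc)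
    qed
    have "cmod (f n (x + h)) \<le> cmod (\<Sum>j\<le>m. f (n + j) x * of_real (h ^ j / fact j)) + M (n + Suc m) * \<bar>h\<bar> ^ Suc m / fact (Suc m)"
      using norm_triangle_sub[of "f n (x + h)" "\<Sum>j\<le>m. f (n + j) x * of_real (h ^ j / fact j)"] taylor[of n x h m] by linarith
    also have "\<dots> \<le> (\<Sum>j\<le>m. ?c * (q ^ j / fact j)) + ?c * (q ^ Suc m / fact (Suc m))"
      using t1 by (intro add_mono sum_norm_le t2) auto
    also have "\<dots> = ?c * (\<Sum>j\<le>Suc m. q ^ j / fact j)" by (simp add: sum_distrib_left distrib_left)
    also have "\<dots> \<le> ?c * exp q"
    proof (intro mult_left_mono)
      have "(\<Sum>j\<le>Suc m. q ^ j / fact j) \<le> (\<Sum>j. q ^ j / fact j)"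
        using summable_exp[of q] q by (intro sum_le_suminf) (auto simp: divide_inverse mult.commute)
      then show "(\<Sum>j\<le>Suc m. q ^ j / fact j) \<le> exp q" by (simp add: exp_def divide_inverse mult.commute scaleR_conv_of_real)
    qed (use c0 in simp)
    also have "\<dots> \<le> ?c * exp 1" using q1 c0 by (intro mult_left_mono) auto
    also have "\<dots> = exp (real n) * M n * exp (- real N)" by (simp add: exp_add[symmetric] mult.assoc)
    finally show ?thesis .
  qed
qed

text \<open>Bang's proof of the Denjoy--Carleman theorem: the quantity \<open>sup\<^sub>n exp (-n) \<bar>f\<^sub>n\<bar> / M\<^sub>n\<close>
  needs a step of length \<open>M\<^sub>N / (e M\<^sub>N\<^sub>+\<^sub>1)\<close> to grow from \<open>exp (-N-1)\<close> to \<open>exp (-N)\<close>, and these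
  lengths have an infinite sum.\<close>

lemma bang_quasianalytic:
  fixes f :: "nat \<Rightarrow> real \<Rightarrow> complex" and M :: "nat \<Rightarrow> real"
  assumes Mpos: "\<And>n. M n > 0" and lc: "\<And>n. (M (Suc n))\<^sup>2 \<le> M n * M (Suc (Suc n))"
    and bd: "\<And>n x. cmod (f n x) \<le> M n"
    and taylor: "\<And>n m x h. cmod (f n (x + h) - (\<Sum>j\<le>m. f (n + j) x * of_real (h ^ j / fact j)))
        \<le> M (n + Suc m) * \<bar>h\<bar> ^ Suc m / fact (Suc m)"
    and z: "\<And>n. f n 0 = 0" and div: "\<not> summable (\<lambda>n. M n / M (Suc n))"
  shows "f 0 t = 0"
proof -
  define l where "l N = M N / M (Suc N) / exp 1" for N
  have lpos: "l N > 0" for N using Mpos by (simp add: l_def)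
  \<comment> \<open>At 0 every \<open>f n\<close> vanishes, so the bound holds there at every level;
    moving outwards over the lengths \<open>l\<close> lowers the level by one per step.\<close>
  have reach: "cmod (f n x) \<le> exp (real n) * M n * exp (- real k)"
    if "\<bar>x\<bar> \<le> (\<Sum>N=k..<k+m. l N)" for x k m n
    using that
  proof (induction m arbitrary: x k n)
    case 0
    then show ?case using z Mpos[of n] by simp
  next
    case (Suc m)
    let ?s = "\<Sum>N=Suc k..<Suc k+m. l N"
    have s0: "?s \<ge> 0" using lpos by (intro sum_nonneg) (auto intro: less_imp_le)
    have S: "(\<Sum>N=k..<k+Suc m. l N) = l k + ?s" by (simp add: sum.atLeast_Suc_lessThan)
    \<comment> \<open>The point of the inner interval nearest to \<open>x\<close>; the rest of the
      way is a single admissible step.\<close>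
    define y where "y = max (- ?s) (min ?s x)"
    have y: "\<bar>y\<bar> \<le> ?s" "\<bar>x - y\<bar> \<le> l k" using Suc.prems s0 lpos[of k] unfolding S y_def by auto
    have "\<bar>x - y\<bar> * exp 1 * (M (Suc k) / M k) \<le> l k * exp 1 * (M (Suc k) / M k)"
      using y Mpos[of k] Mpos[of "Suc k"] by (intro mult_right_mono) auto
    also have "\<dots> = 1" using Mpos[of k] Mpos[of "Suc k"] by (simp add: l_def field_simps)
    finally have h: "\<bar>x - y\<bar> * exp 1 * (M (Suc k) / M k) \<le> 1" .
    have "cmod (f n (y + (x - y))) \<le> exp (real n) * M n * exp (- real k)"
      by (rule bang_step[OF Mpos lc bd taylor _ h]) (rule Suc.IH[OF y(1)])
    then show ?case by simp
  qed
  have nl: "\<not> summable l"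
  proof
    assume "summable l"
    then have "summable (\<lambda>N. l N * exp 1)" by (rule summable_mult2)
    then show False using div by (simp add: l_def)
  qed
  \<comment> \<open>The lengths still have an infinite sum after the first \<open>k\<close> are
    dropped, so \<open>t\<close> is reached from a high enough starting level while ending at level
    \<open>k\<close>.\<close>
  have small: "cmod (f 0 t) \<le> M 0 * exp (- real k)" for k
  proof -
    have "\<not> summable (\<lambda>N. l (N + k))" using nl by (subst summable_iff_shift)
    have "\<not> bdd_above (range (\<lambda>m. \<Sum>N<m. l (N + k)))"
    proof
      assume "bdd_above (range (\<lambda>m. \<Sum>N<m. l (N + k)))"
      then obtain C where "\<And>m. (\<Sum>N<m. l (N + k)) \<le> C" by (auto simp: bdd_above_def)
      then have "summable (\<lambda>N. l (N + k))"
        using lpos by (intro summableI_nonneg_bounded[of _ C]) (auto intro: less_imp_le)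
      then show False using \<open>\<not> summable (\<lambda>N. l (N + k))\<close> by simp
    qed
    then have "\<not> (\<forall>y\<in>range (\<lambda>m. \<Sum>N<m. l (N + k)). y \<le> \<bar>t\<bar>)" unfolding bdd_above_def by blast
    then obtain m where "\<bar>t\<bar> < (\<Sum>N<m. l (N + k))" by (auto simp: not_le)
    also have "(\<Sum>N<m. l (N + k)) = (\<Sum>N=k..<k+m. l N)"
      using sum.shift_bounds_nat_ivl[of l 0 k m] by (simp add: add.commute lessThan_atLeast0)
    finally show ?thesis using reach[of t k m 0] by simp
  qed
  have "(\<lambda>k. M 0 * exp (- real k)) \<longlonglongrightarrow> 0" by real_asymp
  then have "cmod (f 0 t) \<le> 0" by (rule LIMSEQ_le_const) (use small in auto)
  then show ?thesis by simp
qed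


section \<open>Carleman's inequality for geometric means\<close>

lemma summable_comp_inj:
  fixes f :: "nat \<Rightarrow> real"
  assumes "summable f" "\<And>n. f n \<ge> 0" "inj g"
  shows "summable (\<lambda>n. f (g n))"
proof (rule summableI_nonneg_bounded)
  fix n
  have "(\<Sum>i<n. f (g i)) = sum f (g ` {..<n})"
    using inj_on_subset[OF assms(3)] by (subst sum.reindex) auto
  also have "\<dots> \<le> suminf f" using assms by (intro sum_le_suminf) auto
  finally show "(\<Sum>i<n. f (g i)) \<le> suminf f" .
qed (use assms in auto)

text \<open>\<open>n ^ n / fact n\<close> is a single term of the exponential series at
  \<open>n\<close>.\<close>

lemma power_le_fact_exp: "real n ^ n \<le> fact n * exp (real n)"
proof -
  have "(\<Sum>k\<in>{n}. inverse (fact k) * real n ^ k) \<le> (\<Sum>k. inverse (fact k) * real n ^ k)"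
    by (intro sum_le_suminf summable_exp) auto
  then show ?thesis by (simp add: exp_def scaleR_conv_of_real divide_simps mult.commute)
qed

text \<open>The arithmetic-geometric mean inequality, applied to \<open>real (Suc i) * a i\<close>;
  the weights contribute the factorial of \<open>Suc n\<close>, whose root of that order is at least
  \<open>Suc n / exp 1\<close>.\<close>

lemma carleman_inequality_term:
  fixes a :: "nat \<Rightarrow> real"
  assumes a: "\<And>n. a n > 0"
  shows "(\<Prod>i<Suc n. a i) powr (1 / Suc n) \<le> exp 1 * ((\<Sum>i<Suc n. real (Suc i) * a i) / (real (Suc n))\<^sup>2)"
proof -
  let ?N = "Suc n"
  define P where "P = (\<Prod>i<?N. a i)"
  define S where "S = (\<Sum>i<?N. real (Suc i) * a i)"
  have P: "P > 0" unfolding P_def using a by (intro prod_pos) auto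
  have S: "S \<ge> 0" unfolding S_def using a by (intro sum_nonneg) (auto intro!: mult_nonneg_nonneg less_imp_le)
  have f: "(\<Prod>i<m. real (Suc i)) = fact m" for m by (induction m) (auto simp: algebra_simps)
  have gm: "(fact ?N * P) powr (1 / ?N) \<le> S / ?N"
  proof -
    have "fact ?N * P = (\<Prod>i<?N. real (Suc i) * a i)" unfolding P_def prod.distrib f ..
    moreover have "S / ?N = (\<Sum>i<?N. real (Suc i) * a i / real (card {..<?N}))"
      unfolding S_def by (simp only: sum_divide_distrib card_lessThan)
    moreover have "(\<Prod>i<?N. real (Suc i) * a i) powr (1 / real (card {..<?N})) \<le> (\<Sum>i<?N. real (Suc i) * a i / real (card {..<?N}))"
      by (rule arith_geom_mean) (use a in \<open>auto intro!: mult_nonneg_nonneg intro: less_imp_le\<close>)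
    ultimately show ?thesis by (simp only: card_lessThan)
  qed
  have "real ?N / exp 1 = ((real ?N / exp 1) ^ ?N) powr (1 / ?N)"
    by (subst powr_realpow[symmetric]) (simp_all add: powr_powr del: of_nat_Suc)
  also have "\<dots> \<le> (fact ?N) powr (1 / ?N)"
  proof (rule powr_mono2)
    have "(exp 1 :: real) ^ ?N = exp (real ?N)" using exp_of_nat_mult[of ?N "1::real"] by simp
    then show "(real ?N / exp 1) ^ ?N \<le> fact ?N"
      using power_le_fact_exp[of ?N] by (simp only: power_divide) (simp add: divide_le_eq del: power_Suc fact_Suc of_nat_Suc)
  qed auto
  finally have e: "real ?N / exp 1 \<le> (fact ?N) powr (1 / ?N)" .
  have "(real ?N / exp 1) * P powr (1 / ?N) \<le> (fact ?N) powr (1 / ?N) * P powr (1 / ?N)"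
    by (intro mult_right_mono e) simp
  also have "\<dots> = (fact ?N * P) powr (1 / ?N)" using P by (subst powr_mult) auto
  also note gm
  finally have "P powr (1 / ?N) \<le> (S / ?N) * (exp 1 / ?N)"
    by (simp add: field_simps del: of_nat_Suc)
  then show ?thesis by (simp only: P_def[symmetric] S_def[symmetric]) (simp add: power2_eq_square mult_ac del: of_nat_Suc)
qed

text \<open>When the termwise bounds are added, the total weight of \<open>a i\<close> is
  \<open>i + 1\<close> times the sum of the inverse squares from \<open>i + 1\<close> on, hence at
  most 2.\<close>

lemma carleman_inequality_summable:
  fixes a :: "nat \<Rightarrow> real"
  assumes a: "\<And>n. a n > 0" and s: "summable a"
  shows "summable (\<lambda>n. (\<Prod>i<Suc n. a i) powr (1 / Suc n))"
proof -
  define T where "T n = (\<Sum>i<n. real (Suc i) * a i)" for n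
  have T0: "T n \<ge> 0" for n
    unfolding T_def using a by (intro sum_nonneg) (auto intro!: mult_nonneg_nonneg less_imp_le)
  \<comment> \<open>The extra term \<open>T K / K\<close> anticipates the tail still to come; the
    induction closes because \<open>1 / (K + 1)\<^sup>2 + 1 / (K + 1) \<le> 1 / K\<close>.\<close>
  have inv: "(\<Sum>n<K. T (Suc n) / (real (Suc n))\<^sup>2) + T K / K \<le> 2 * (\<Sum>i<K. a i)" for K
  proof (induction K)
    case (Suc K)
    have TS: "T (Suc K) = T K + Suc K * a K" by (simp add: T_def)
    have "T (Suc K) / (real (Suc K))\<^sup>2 + T (Suc K) / Suc K = T K * (1 / (real (Suc K))\<^sup>2 + 1 / Suc K) + a K * (1 / Suc K + 1)"
    proof -
      have "(t + x * b) / x\<^sup>2 + (t + x * b) / x = t * (1 / x\<^sup>2 + 1 / x) + b * (1 / x + 1)" if "x > 0" for t x b :: real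
        using that by (simp add: field_simps power2_eq_square)
      then show ?thesis unfolding TS by (simp del: of_nat_Suc)
    qed
    also have "T K * (1 / (real (Suc K))\<^sup>2 + 1 / Suc K) \<le> T K / K"
    proof (cases "K = 0")
      case False
      then have "1 / (real (Suc K))\<^sup>2 + 1 / Suc K \<le> 1 / K" by (simp add: divide_simps power2_eq_square) (simp add: algebra_simps)
      from mult_left_mono[OF this T0[of K]] show ?thesis by simp
    qed (simp add: T_def)
    also have "a K * (1 / Suc K + 1) \<le> a K * 2"
      using a[of K] by (intro mult_left_mono) auto
    finally show ?case using Suc by (simp del: of_nat_Suc)
  qed (simp add: T_def)
  have "summable (\<lambda>n. T (Suc n) / (real (Suc n))\<^sup>2)"
  proof (rule summableI_nonneg_bounded)
    fix K
    have "(\<Sum>i<K. a i) \<le> suminf a" using s a by (intro sum_le_suminf) (auto intro: less_imp_le)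
    moreover have "T K / K \<ge> 0" using T0 by simp
    ultimately show "(\<Sum>n<K. T (Suc n) / (real (Suc n))\<^sup>2) \<le> 2 * suminf a" using inv[of K] by linarith
  qed (use T0 in auto)
  then have "summable (\<lambda>n. exp 1 * (T (Suc n) / (real (Suc n))\<^sup>2))" by (rule summable_mult)
  then show ?thesis
    by (rule summable_comparison_test') (use carleman_inequality_term[OF a] in \<open>auto simp: T_def simp del: of_nat_Suc prod.lessThan_Suc sum.lessThan_Suc\<close>)
qed

text \<open>The series lives in \<open>[0, \<infinity>]\<close>, as in \<open>Carleman\<close>: a
  vanishing even moment, which occurs for the point mass at 0, makes it infinite.\<close>

definition carleman_moments :: "(nat \<Rightarrow> real) \<Rightarrow> bool" where
  "carleman_moments m \<longleftrightarrow>
     (\<Sum>k. inverse (ennreal (m (2 * Suc k) powr (1 / real (2 * Suc k))))) = (\<top> :: ennreal)"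

section \<open>Derivatives of characteristic functions and determinacy\<close>

lemma (in real_distribution) integrable_abs_power:
  assumes "\<And>k. integrable M (\<lambda>u. u ^ k)"
  shows "integrable M (\<lambda>u. \<bar>u\<bar> ^ k)"
  using integrable_abs[OF assms[of k]] by (simp add: power_abs)

text \<open>The \<open>n\<close>-th derivative of the characteristic function, written as an
  integral so that Taylor's formula can be applied under the integral sign.\<close>

definition charderiv :: "real measure \<Rightarrow> nat \<Rightarrow> real \<Rightarrow> complex" where
  "charderiv M n t = (\<integral>u. (\<i> * of_real u) ^ n * iexp (t * u) \<partial>M)"

context real_distribution
begin

lemma integrable_charderiv:
  assumes I: "\<And>k. integrable M (\<lambda>u. u ^ k)"
  shows "integrable M (\<lambda>u. (\<i> * of_real u) ^ n * iexp (t * u))"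
  by (rule Bochner_Integration.integrable_bound[OF integrable_abs_power[OF I, of n]])
     (auto simp: norm_mult norm_power)

lemma charderiv_bound:
  assumes I: "\<And>k. integrable M (\<lambda>u. u ^ k)"
  shows "cmod (charderiv M n t) \<le> (\<integral>u. \<bar>u\<bar> ^ n \<partial>M)"
  unfolding charderiv_def
  by (rule order_trans[OF integral_norm_bound]) (simp add: norm_mult norm_power)

lemma charderiv_taylor:
  assumes I: "\<And>k. integrable M (\<lambda>u. u ^ k)"
  shows "cmod (charderiv M n (x + h) - (\<Sum>j\<le>m. charderiv M (n + j) x * of_real (h ^ j / fact j)))
        \<le> (\<integral>u. \<bar>u\<bar> ^ (n + Suc m) \<partial>M) * \<bar>h\<bar> ^ Suc m / fact (Suc m)"
proof -
  let ?R = "\<lambda>u. (\<i> * of_real u) ^ n * iexp (x * u) * (iexp (h * u) - (\<Sum>j\<le>m. (\<i> * of_real (h * u)) ^ j / fact j))"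
  have e: "(\<i> * of_real u) ^ n * iexp ((x + h) * u) - (\<Sum>j\<le>m. (\<i> * of_real u) ^ (n + j) * iexp (x * u) * of_real (h ^ j / fact j)) = ?R u" for u
  proof -
    have "iexp ((x + h) * u) = iexp (x * u) * iexp (h * u)" by (simp add: exp_add[symmetric] algebra_simps)
    moreover have "(\<Sum>j\<le>m. (\<i> * of_real u) ^ (n + j) * iexp (x * u) * of_real (h ^ j / fact j))
      = (\<i> * of_real u) ^ n * iexp (x * u) * (\<Sum>j\<le>m. (\<i> * of_real (h * u)) ^ j / fact j)"
      unfolding sum_distrib_left by (intro sum.cong refl) (simp add: power_add power_mult_distrib)
    ultimately show ?thesis by (simp add: algebra_simps)
  qed
  have i1: "integrable M (\<lambda>u. \<Sum>j\<le>m. (\<i> * of_real u) ^ (n + j) * iexp (x * u) * of_real (h ^ j / fact j))"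
    by (intro Bochner_Integration.integrable_sum integrable_mult_left integrable_charderiv I)
  have "charderiv M n (x + h) - (\<Sum>j\<le>m. charderiv M (n + j) x * of_real (h ^ j / fact j)) = (\<integral>u. ?R u \<partial>M)"
    unfolding e[symmetric] charderiv_def
    by (subst Bochner_Integration.integral_diff[OF integrable_charderiv[OF I] i1])
       (subst Bochner_Integration.integral_sum, intro integrable_mult_left integrable_charderiv I, subst integral_mult_left_zero, rule refl)
  also have "cmod \<dots> \<le> (\<integral>u. \<bar>u\<bar> ^ (n + Suc m) * (\<bar>h\<bar> ^ Suc m / fact (Suc m)) \<partial>M)"
  proof (rule Bochner_Integration.integral_norm_bound_integral)
    show "integrable M ?R" unfolding e[symmetric]
      by (intro Bochner_Integration.integrable_diff integrable_charderiv I i1)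
    show "integrable M (\<lambda>u. \<bar>u\<bar> ^ (n + Suc m) * (\<bar>h\<bar> ^ Suc m / fact (Suc m)))"
      by (intro integrable_mult_left integrable_abs_power I)
    fix u
    have "cmod (?R u) = \<bar>u\<bar> ^ n * cmod (iexp (h * u) - (\<Sum>j\<le>m. (\<i> * of_real (h * u)) ^ j / fact j))"
      by (simp add: norm_mult norm_power)
    also have "\<dots> \<le> \<bar>u\<bar> ^ n * (\<bar>h * u\<bar> ^ Suc m / fact (Suc m))"
      by (intro mult_left_mono iexp_approx1) auto
    also have "\<dots> = \<bar>u\<bar> ^ (n + Suc m) * (\<bar>h\<bar> ^ Suc m / fact (Suc m))"
      by (simp only: abs_mult power_mult_distrib power_add) (simp add: mult_ac)
    finally show "cmod (?R u) \<le> \<bar>u\<bar> ^ (n + Suc m) * (\<bar>h\<bar> ^ Suc m / fact (Suc m))" .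
  qed
  also have "\<dots> = (\<integral>u. \<bar>u\<bar> ^ (n + Suc m) \<partial>M) * \<bar>h\<bar> ^ Suc m / fact (Suc m)"
    by (subst integral_mult_left_zero) (simp only: times_divide_eq_right)
  finally show ?thesis .
qed

lemma charderiv_0: "charderiv M 0 t = char M t"
  by (simp add: charderiv_def char_def)

lemma charderiv_at_0: "charderiv M n 0 = \<i> ^ n * of_real (\<integral>u. u ^ n \<partial>M)"
  unfolding charderiv_def by (simp add: power_mult_distrib flip: of_real_power integral_complex_of_real)

lemma abs_moment_eq_0:
  assumes I: "\<And>k. integrable M (\<lambda>u. u ^ k)" and z: "(\<integral>u. \<bar>u\<bar> ^ n \<partial>M) = 0"
  shows "AE u in M. u = 0"
proof -
  have "AE u in M. \<bar>u\<bar> ^ n = 0"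
    using z integrable_abs_power[OF I, of n] by (subst (asm) integral_nonneg_eq_0_iff_AE) auto
  then show ?thesis by eventually_elim auto
qed

end

text \<open>The derivatives of the difference of the characteristic functions are bounded by
  \<open>M n\<close>, the sum of the absolute moments, and all vanish at 0. If the ratios
  \<open>M n / M (Suc n)\<close> were summable, Carleman's inequality would make Carleman's series
  finite; so their sum diverges and the difference vanishes by quasi-analyticity.\<close>

lemma real_distribution_moments_unique:
  assumes mu: "real_distribution \<mu>" and nu: "real_distribution \<nu>"
    and I: "\<And>k. integrable \<mu> (\<lambda>u. u ^ k)" "\<And>k. integrable \<nu> (\<lambda>u. u ^ k)"
    and m: "\<And>k. (\<integral>u. u ^ k \<partial>\<mu>) = m k" "\<And>k. (\<integral>u. u ^ k \<partial>\<nu>) = m k"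
    and C: "carleman_moments m"
  shows "\<mu> = \<nu>"
proof -
  interpret mu: real_distribution \<mu> by fact
  interpret nu: real_distribution \<nu> by fact
  define M where "M n = (\<integral>u. \<bar>u\<bar> ^ n \<partial>\<mu>) + (\<integral>u. \<bar>u\<bar> ^ n \<partial>\<nu>)" for n
  have nn: "(\<integral>u. \<bar>u\<bar> ^ n \<partial>\<mu>) \<ge> 0" "(\<integral>u. \<bar>u\<bar> ^ n \<partial>\<nu>) \<ge> 0" for n by auto
  have "char \<mu> t = char \<nu> t" for t
  proof (cases "\<exists>n. M n = 0")
    \<comment> \<open>Both laws are then the point mass at 0; outside this case all
      \<open>M n\<close> are positive.\<close>
    case True
    then obtain n where n: "(\<integral>u. \<bar>u\<bar> ^ n \<partial>\<mu>) = 0" "(\<integral>u. \<bar>u\<bar> ^ n \<partial>\<nu>) = 0"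
      using nn by (auto simp: M_def add_nonneg_eq_0_iff)
    have "char \<mu> t = (\<integral>u. 1 \<partial>\<mu>)" unfolding char_def
      by (rule integral_cong_AE) (use mu.abs_moment_eq_0[OF I(1) n(1)] in auto)
    moreover have "char \<nu> t = (\<integral>u. 1 \<partial>\<nu>)" unfolding char_def
      by (rule integral_cong_AE) (use nu.abs_moment_eq_0[OF I(2) n(2)] in auto)
    ultimately show ?thesis using mu.prob_space nu.prob_space by simp
  next
    case False
    have Mpos: "M n > 0" for n using False nn[of n] unfolding M_def
      by (metis add_nonneg_nonneg order_le_less)
    have lin3: "(\<integral>u. a * f u - b * g u + h u \<partial>N) = a * (\<integral>u. f u \<partial>N) - b * (\<integral>u. g u \<partial>N) + (\<integral>u. h u \<partial>N)"
      if "integrable N f" "integrable N g" "integrable N h" for N :: "real measure" and f g h :: "real \<Rightarrow> real" and a b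
      using that by simp
    have lc: "(M (Suc n))\<^sup>2 \<le> M n * M (Suc (Suc n))" for n
    proof -
      have quad: "0 \<le> M n * s\<^sup>2 - 2 * s * M (Suc n) + M (Suc (Suc n))" for s
      proof -
        have e: "\<bar>u\<bar> ^ n * (s - \<bar>u\<bar>)\<^sup>2 = s\<^sup>2 * \<bar>u\<bar> ^ n - 2 * s * \<bar>u\<bar> ^ Suc n + \<bar>u\<bar> ^ Suc (Suc n)" for u :: real
          by (simp add: power2_eq_square algebra_simps)
        have "0 \<le> (\<integral>u. \<bar>u\<bar> ^ n * (s - \<bar>u\<bar>)\<^sup>2 \<partial>\<mu>)" "0 \<le> (\<integral>u. \<bar>u\<bar> ^ n * (s - \<bar>u\<bar>)\<^sup>2 \<partial>\<nu>)" by auto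
        moreover have "(\<integral>u. s\<^sup>2 * \<bar>u\<bar> ^ n - 2 * s * \<bar>u\<bar> ^ Suc n + \<bar>u\<bar> ^ Suc (Suc n) \<partial>\<mu>)
          = s\<^sup>2 * (\<integral>u. \<bar>u\<bar> ^ n \<partial>\<mu>) - 2 * s * (\<integral>u. \<bar>u\<bar> ^ Suc n \<partial>\<mu>) + (\<integral>u. \<bar>u\<bar> ^ Suc (Suc n) \<partial>\<mu>)"
          by (intro lin3 mu.integrable_abs_power[OF I(1)])
        moreover have "(\<integral>u. s\<^sup>2 * \<bar>u\<bar> ^ n - 2 * s * \<bar>u\<bar> ^ Suc n + \<bar>u\<bar> ^ Suc (Suc n) \<partial>\<nu>)
          = s\<^sup>2 * (\<integral>u. \<bar>u\<bar> ^ n \<partial>\<nu>) - 2 * s * (\<integral>u. \<bar>u\<bar> ^ Suc n \<partial>\<nu>) + (\<integral>u. \<bar>u\<bar> ^ Suc (Suc n) \<partial>\<nu>)"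
          by (intro lin3 nu.integrable_abs_power[OF I(2)])
        ultimately show ?thesis unfolding e M_def by (simp add: algebra_simps del: power_Suc)
      qed
      \<comment> \<open>The value of \<open>s\<close> that minimises the quadratic
        polynomial.\<close>
      from quad[of "M (Suc n) / M n"] show ?thesis using Mpos[of n] by (simp add: field_simps power2_eq_square)
    qed
    define f where "f n t = charderiv \<mu> n t - charderiv \<nu> n t" for n t
    have "f 0 t = 0"
    proof (rule bang_quasianalytic[where f = f and M = M])
      show "M n > 0" for n by (rule Mpos)
      show "(M (Suc n))\<^sup>2 \<le> M n * M (Suc (Suc n))" for n by (rule lc)
      show "cmod (f n x) \<le> M n" for n x
        unfolding f_def M_def using norm_triangle_ineq4[of "charderiv \<mu> n x" "charderiv \<nu> n x"]
          mu.charderiv_bound[OF I(1), of n x] nu.charderiv_bound[OF I(2), of n x] by linarith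
      show "f n 0 = 0" for n by (simp add: f_def mu.charderiv_at_0 nu.charderiv_at_0 m)
      show "cmod (f n (x + h) - (\<Sum>j\<le>k. f (n + j) x * of_real (h ^ j / fact j)))
        \<le> M (n + Suc k) * \<bar>h\<bar> ^ Suc k / fact (Suc k)" for n k x h
      proof -
        have "f n (x + h) - (\<Sum>j\<le>k. f (n + j) x * of_real (h ^ j / fact j))
          = (charderiv \<mu> n (x + h) - (\<Sum>j\<le>k. charderiv \<mu> (n + j) x * of_real (h ^ j / fact j)))
          - (charderiv \<nu> n (x + h) - (\<Sum>j\<le>k. charderiv \<nu> (n + j) x * of_real (h ^ j / fact j)))"
          by (simp only: f_def left_diff_distrib sum_subtractf) simp
        also have "cmod \<dots> \<le> (\<integral>u. \<bar>u\<bar> ^ (n + Suc k) \<partial>\<mu>) * \<bar>h\<bar> ^ Suc k / fact (Suc k)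
            + (\<integral>u. \<bar>u\<bar> ^ (n + Suc k) \<partial>\<nu>) * \<bar>h\<bar> ^ Suc k / fact (Suc k)"
          by (rule order_trans[OF norm_triangle_ineq4 add_mono[OF mu.charderiv_taylor[OF I(1)] nu.charderiv_taylor[OF I(2)]]])
        also have "\<dots> = M (n + Suc k) * \<bar>h\<bar> ^ Suc k / fact (Suc k)"
          by (simp only: M_def distrib_right add_divide_distrib)
        finally show ?thesis .
      qed
      show "\<not> summable (\<lambda>n. M n / M (Suc n))"
      proof
        assume S: "summable (\<lambda>n. M n / M (Suc n))"
        \<comment> \<open>The ratios telescope, which turns their geometric means into roots of
          single moments.\<close>
        have tel: "(\<Prod>i<n. M i / M (Suc i)) = M 0 / M n" for n
          using Mpos by (induction n) (simp_all add: less_imp_neq[symmetric])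
        have "summable (\<lambda>n. (M 0 / M (Suc n)) powr (1 / Suc n))"
          using carleman_inequality_summable[OF _ S] Mpos unfolding tel by simp
        \<comment> \<open>The indices \<open>2 * k + 1\<close> select the even moments, where
          absolute values disappear.\<close>
        then have s1: "summable (\<lambda>k. (M 0 / M (Suc (2 * k + 1))) powr (1 / Suc (2 * k + 1)))"
          by (rule summable_comp_inj[of _ "\<lambda>k. 2 * k + 1"]) (auto simp: inj_def)
        have "(\<Sum>k. inverse (ennreal (m (2 * Suc k) powr (1 / real (2 * Suc k))))) < \<top>"
        proof -
          \<comment> \<open>The factor 2 from adding two equal moments cancels against
            \<open>M 0 = 2\<close>.\<close>
          have M0: "M 0 = 2" using mu.prob_space nu.prob_space by (simp add: M_def)
          have Me: "M (2 * Suc k) = 2 * m (2 * Suc k)" for k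
            unfolding M_def power_even_abs[OF dvd_triv_left] m by simp
          have "inverse (ennreal (m (2 * Suc k) powr (1 / real (2 * Suc k)))) = ennreal ((M 0 / M (Suc (2 * k + 1))) powr (1 / Suc (2 * k + 1)))" for k
          proof -
            have p: "m (2 * Suc k) > 0" using Mpos[of "2 * Suc k"] unfolding Me by simp
            then have "inverse (ennreal (m (2 * Suc k) powr (1 / real (2 * Suc k)))) = ennreal (inverse (m (2 * Suc k) powr (1 / real (2 * Suc k))))"
              by (intro inverse_ennreal) auto
            also have "inverse (m (2 * Suc k) powr (1 / real (2 * Suc k))) = inverse (m (2 * Suc k)) powr (1 / real (2 * Suc k))"
              using p by (simp add: powr_def ln_inverse exp_minus)
            also have "inverse (m (2 * Suc k)) = M 0 / M (Suc (2 * k + 1))"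
              using Me[of k] M0 p by (simp add: field_simps)
            finally show ?thesis by simp
          qed
          then show ?thesis using s1 by (simp add: suminf_ennreal2 del: of_nat_Suc)
        qed
        with C show False by (simp add: carleman_moments_def)
      qed
    qed
    then show ?thesis by (simp add: f_def mu.charderiv_0 nu.charderiv_0)
  qed
  then have "char \<mu> = char \<nu>" by auto
  then show ?thesis by (rule Levy_uniqueness[OF mu nu])
qed

section \<open>The method of moments\<close>

text \<open>Clamping changes \<open>u ^ k\<close> only where \<open>\<bar>u\<bar> > K\<close>, and
  there a factor \<open>\<bar>u\<bar> / K \<ge> 1\<close> can be spent. The exponent is raised to an
  even one so that an ordinary moment controls the error.\<close>

lemma clamp_power_error:
  fixes u K :: real
  assumes "K \<ge> 1"
  shows "\<bar>u ^ k - (max (-K) (min K u)) ^ k\<bar> \<le> u ^ (2 * (k + 1)) / K"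
proof (cases "\<bar>u\<bar> \<le> K")
  case True
  then have "max (-K) (min K u) = u" by auto
  moreover have "u ^ (2 * (k + 1)) \<ge> 0" by (rule zero_le_even_power) simp
  ultimately show ?thesis using assms by (simp only: diff_self abs_zero) (intro divide_nonneg_nonneg, auto)
next
  case False
  have "\<bar>u ^ k - (max (-K) (min K u)) ^ k\<bar> \<le> \<bar>u\<bar> ^ k"
  proof (cases "u > 0")
    case True
    then have "max (-K) (min K u) = K" using False assms by auto
    moreover have "K ^ k \<le> u ^ k" using True False assms by (intro power_mono) auto
    ultimately show ?thesis using True assms by (simp add: abs_le_iff)
  next
    case ng: False
    then have m: "max (-K) (min K u) = - K" using False assms by auto
    have "K ^ k \<le> (- u) ^ k" using ng False assms by (intro power_mono) auto
    moreover have "u ^ k - (-K) ^ k = (- 1) ^ k * ((- u) ^ k - K ^ k)"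
      by (simp add: right_diff_distrib power_mult_distrib[symmetric])
    ultimately show ?thesis unfolding m using ng assms by (simp add: abs_mult power_abs abs_le_iff)
  qed
  also have "\<dots> \<le> \<bar>u\<bar> ^ (2 * k + 1)" using False assms by (intro power_increasing) auto
  also have "\<dots> \<le> \<bar>u\<bar> ^ (2 * k + 1) * (\<bar>u\<bar> / K)"
    using False assms by (intro mult_right_mono[of 1 "\<bar>u\<bar> / K" "\<bar>u\<bar> ^ (2 * k + 1)", simplified mult_1 mult.commute[of "\<bar>u\<bar> / K"]]) auto
  also have "\<dots> = \<bar>u\<bar> ^ (2 * (k + 1)) / K" by simp
  also have "\<bar>u\<bar> ^ (2 * (k + 1)) = u ^ (2 * (k + 1))" by (intro power_even_abs) simp
  finally show ?thesis .
qed

lemma continuous_clamp_power: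
  "continuous_on UNIV (\<lambda>u::real. (max (-K) (min K u)) ^ k)"
  by (intro continuous_intros)

lemma clamp_power_bounded:
  fixes u K :: real assumes "K \<ge> 0"
  shows "\<bar>(max (-K) (min K u)) ^ k\<bar> \<le> K ^ k"
  unfolding power_abs using assms by (intro power_mono) auto

text \<open>Weak convergence only sees bounded continuous functions. Even powers are integrated
  through their truncations from above, which gives integrability; clamped powers then approximate
  \<open>u ^ k\<close> with an error of order \<open>1 / K\<close>, uniformly along the
  sequence.\<close>

lemma weak_limit_moments:
  fixes \<mu>s :: "nat \<Rightarrow> real measure"
  assumes d: "\<And>n. real_distribution (\<mu>s n)" and D: "real_distribution \<mu>"
    and I: "\<And>n k. integrable (\<mu>s n) (\<lambda>u. u ^ k)"
    and m: "\<And>k. (\<lambda>n. \<integral>u. u ^ k \<partial>\<mu>s n) \<longlonglongrightarrow> \<beta> k"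
    and W: "weak_conv_m \<mu>s \<mu>"
  shows "integrable \<mu> (\<lambda>u. u ^ k)" "(\<integral>u. u ^ k \<partial>\<mu>) = \<beta> k"
proof -
  interpret mu: real_distribution \<mu> by fact
  interpret mus: real_distribution "\<mu>s n" for n by (rule d)
  have conv: "(\<lambda>n. \<integral>u. f u \<partial>\<mu>s n) \<longlonglongrightarrow> (\<integral>u. f u \<partial>\<mu>)"
    if "continuous_on UNIV f" "\<And>u. \<bar>f u\<bar> \<le> B" for f :: "real \<Rightarrow> real" and B
    by (rule weak_conv_imp_integral_bdd_continuous_conv[OF d D W, where B = B])
       (use that in \<open>auto simp: continuous_on_eq_continuous_at\<close>)
  have ev: "integrable \<mu> (\<lambda>u. u ^ (2 * j))" and le: "(\<integral>u. u ^ (2 * j) \<partial>\<mu>) \<le> \<beta> (2 * j)" for j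
  proof -
    have b: "(\<integral>u. min (real N) (u ^ (2 * j)) \<partial>\<mu>) \<le> \<beta> (2 * j)" for N
    proof (rule LIMSEQ_le[OF _ m[of "2 * j"]])
      show "(\<lambda>n. \<integral>u. min (real N) (u ^ (2 * j)) \<partial>\<mu>s n) \<longlonglongrightarrow> (\<integral>u. min (real N) (u ^ (2 * j)) \<partial>\<mu>)"
        by (rule conv[of _ "real N"]) (auto intro!: continuous_intros)
      show "\<exists>N'. \<forall>n\<ge>N'. (\<integral>u. min (real N) (u ^ (2 * j)) \<partial>\<mu>s n) \<le> (\<integral>u. u ^ (2 * j) \<partial>\<mu>s n)"
        by (intro exI[of _ 0] allI impI integral_mono I mus.integrable_const_bound[where B = "real N"]) auto
    qed
    have i: "integrable \<mu> (\<lambda>u. min (real N) (u ^ (2 * j)))" for N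
      by (rule mu.integrable_const_bound[where B = "real N"]) auto
    have "(\<integral>\<^sup>+u. ennreal (u ^ (2 * j)) \<partial>\<mu>) = (\<integral>\<^sup>+u. (SUP N. ennreal (min (real N) (u ^ (2 * j)))) \<partial>\<mu>)"
    proof (intro nn_integral_cong)
      fix u :: real
      obtain N where N: "u ^ (2 * j) \<le> real N" using real_arch_simple by blast
      show "ennreal (u ^ (2 * j)) = (SUP N. ennreal (min (real N) (u ^ (2 * j))))"
        by (rule antisym)
           (use N in \<open>auto intro!: SUP_upper2[of N] SUP_least ennreal_leI simp: min_absorb2\<close>)
    qed
    also have "\<dots> = (SUP N. \<integral>\<^sup>+u. ennreal (min (real N) (u ^ (2 * j))) \<partial>\<mu>)"
      by (rule nn_integral_monotone_convergence_SUP)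
         (auto simp: incseq_def le_fun_def intro!: ennreal_leI min.mono)
    also have "\<dots> \<le> ennreal (\<beta> (2 * j))"
    proof (rule SUP_least)
      fix N
      have "(\<integral>\<^sup>+u. ennreal (min (real N) (u ^ (2 * j))) \<partial>\<mu>) = ennreal (\<integral>u. min (real N) (u ^ (2 * j)) \<partial>\<mu>)"
        by (rule nn_integral_eq_integral[OF i]) auto
      then show "(\<integral>\<^sup>+u. ennreal (min (real N) (u ^ (2 * j))) \<partial>\<mu>) \<le> ennreal (\<beta> (2 * j))"
        using b[of N] by (simp add: ennreal_leI)
    qed
    finally have nn: "(\<integral>\<^sup>+u. ennreal (u ^ (2 * j)) \<partial>\<mu>) \<le> ennreal (\<beta> (2 * j))" .
    show int: "integrable \<mu> (\<lambda>u. u ^ (2 * j))"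
      by (rule integrableI_nonneg) (use nn in \<open>auto simp: le_less_trans\<close>)
    have "\<beta> (2 * j) \<ge> 0" by (rule LIMSEQ_le_const[OF m[of "2 * j"]]) auto
    then show "(\<integral>u. u ^ (2 * j) \<partial>\<mu>) \<le> \<beta> (2 * j)"
      using nn nn_integral_eq_integral[OF int] by (simp add: ennreal_le_iff)
  qed
  show int: "integrable \<mu> (\<lambda>u. u ^ k)" for k
  proof (rule Bochner_Integration.integrable_bound)
    show "integrable \<mu> (\<lambda>u. 1 + u ^ (2 * k))" using ev[of k] by auto
    show "AE u in \<mu>. norm (u ^ k) \<le> norm (1 + u ^ (2 * k))"
    proof (rule AE_I2)
      fix u :: real
      have "0 \<le> (1 - \<bar>u ^ k\<bar>)\<^sup>2" by simp
      then have "\<bar>u ^ k\<bar> \<le> 1 + (u ^ k)\<^sup>2" using abs_ge_zero[of "u ^ k"] by (simp add: power2_eq_square algebra_simps)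
      then show "norm (u ^ k) \<le> norm (1 + u ^ (2 * k))" by (simp add: power_mult mult.commute[of 2])
    qed
  qed simp
  show "(\<integral>u. u ^ k \<partial>\<mu>) = \<beta> k"
  proof -
    obtain B where B: "\<And>n. \<bar>\<integral>u. u ^ (2 * (k + 1)) \<partial>\<mu>s n\<bar> \<le> B"
      using convergent_imp_Bseq[OF convergentI[OF m[of "2 * (k + 1)"]]] by (auto simp: Bseq_def)
    define B' where "B' = max B \<bar>\<integral>u. u ^ (2 * (k + 1)) \<partial>\<mu>\<bar>"
    have err: "\<bar>(\<integral>u. u ^ k \<partial>\<nu>) - (\<integral>u. (max (-K) (min K u)) ^ k \<partial>\<nu>)\<bar> \<le> B' / K"
      if nu: "real_distribution \<nu>" and int: "\<And>k. integrable \<nu> (\<lambda>u. u ^ k)" and le: "\<bar>\<integral>u. u ^ (2 * (k + 1)) \<partial>\<nu>\<bar> \<le> B'"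
        and K: "K \<ge> 1" for \<nu> K
    proof -
      interpret nu: real_distribution \<nu> by fact
      have ic: "integrable \<nu> (\<lambda>u. (max (-K) (min K u)) ^ k)"
        by (rule nu.integrable_const_bound[where B = "K ^ k"]) (use clamp_power_bounded[of K] K in auto)
      have "\<bar>\<integral>u. u ^ k - (max (-K) (min K u)) ^ k \<partial>\<nu>\<bar> \<le> (\<integral>u. u ^ (2 * (k + 1)) / K \<partial>\<nu>)"
        using Bochner_Integration.integral_norm_bound_integral[of \<nu> "\<lambda>u. u ^ k - (max (-K) (min K u)) ^ k" "\<lambda>u. u ^ (2 * (k + 1)) / K"]
          int ic clamp_power_error[OF K] by (simp del: power_Suc mult_Suc_right)
      also have "\<dots> = (\<integral>u. u ^ (2 * (k + 1)) \<partial>\<nu>) / K" by simp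
      also have "\<dots> \<le> B' / K" using le K by (intro divide_right_mono) auto
      finally show ?thesis using int ic by simp
    qed
    have key: "\<bar>\<beta> k - (\<integral>u. u ^ k \<partial>\<mu>)\<bar> \<le> 2 * B' / K" if K: "K \<ge> 1" for K
    proof -
      have "(\<lambda>n. \<integral>u. (max (-K) (min K u)) ^ k \<partial>\<mu>s n) \<longlonglongrightarrow> (\<integral>u. (max (-K) (min K u)) ^ k \<partial>\<mu>)"
        by (rule conv[OF continuous_clamp_power, of _ _ "K ^ k"]) (use clamp_power_bounded[of K] K in auto)
      then have "(\<lambda>n. \<bar>(\<integral>u. u ^ k \<partial>\<mu>s n) - (\<integral>u. (max (-K) (min K u)) ^ k \<partial>\<mu>s n)\<bar>) \<longlonglongrightarrow> \<bar>\<beta> k - (\<integral>u. (max (-K) (min K u)) ^ k \<partial>\<mu>)\<bar>"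
        by (intro tendsto_intros m)
      then have "\<bar>\<beta> k - (\<integral>u. (max (-K) (min K u)) ^ k \<partial>\<mu>)\<bar> \<le> B' / K"
        by (rule LIMSEQ_le_const2) (use err[OF d I _ K] B in \<open>auto simp: B'_def le_max_iff_disj\<close>)
      moreover have "\<bar>(\<integral>u. u ^ k \<partial>\<mu>) - (\<integral>u. (max (-K) (min K u)) ^ k \<partial>\<mu>)\<bar> \<le> B' / K"
        by (rule err[OF D int _ K]) (simp add: B'_def)
      ultimately show ?thesis by linarith
    qed
    have "(\<lambda>N. 2 * B' / real (Suc N)) \<longlonglongrightarrow> 0" by real_asymp
    then have "\<bar>\<beta> k - (\<integral>u. u ^ k \<partial>\<mu>)\<bar> \<le> 0"
      by (rule LIMSEQ_le_const) (use key[of "real (Suc _)"] in auto)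
    then show ?thesis by simp
  qed
qed

lemma tight_second_moment:
  fixes \<mu>s :: "nat \<Rightarrow> real measure"
  assumes d: "\<And>n. real_distribution (\<mu>s n)" and I: "\<And>n. integrable (\<mu>s n) (\<lambda>u. u\<^sup>2)"
    and B: "\<And>n. (\<integral>u. u\<^sup>2 \<partial>\<mu>s n) \<le> B"
  shows "tight \<mu>s"
  unfolding tight_def
proof (intro conjI allI impI d)
  fix e :: real assume e: "e > 0"
  \<comment> \<open>Markov's inequality for \<open>u\<^sup>2\<close> calls for
    \<open>\<bar>B\<bar> / K\<^sup>2 < e\<close>; the added 1 makes this strict and keeps
    \<open>K\<close> positive.\<close>
  define K where "K = sqrt (\<bar>B\<bar> / e) + 1"
  have K1: "K \<ge> 1" using e by (simp add: K_def)
  have "\<bar>B\<bar> / e < K\<^sup>2"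
  proof -
    have "sqrt (\<bar>B\<bar> / e) < K" by (simp add: K_def)
    then have "(sqrt (\<bar>B\<bar> / e))\<^sup>2 < K\<^sup>2" using e by (intro power_strict_mono) auto
    then show ?thesis using e by simp
  qed
  then have BK: "\<bar>B\<bar> / K\<^sup>2 < e" using e K1 by (simp add: field_simps)
  have "1 - e < measure (\<mu>s n) {-K-1<..K+1}" for n
  proof -
    interpret real_distribution "\<mu>s n" by (rule d)
    have "measure (\<mu>s n) {u \<in> space (\<mu>s n). K\<^sup>2 \<le> u\<^sup>2} \<le> (\<integral>u. u\<^sup>2 \<partial>\<mu>s n) / K\<^sup>2"
      by (rule integral_Markov_inequality_measure[where A = "{}"]) (use I K1 in auto)
    also have "\<dots> \<le> \<bar>B\<bar> / K\<^sup>2" using B[of n] by (intro divide_right_mono) auto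
    also have "\<dots> < e" by (rule BK)
    finally have 1: "measure (\<mu>s n) {u. K\<^sup>2 \<le> u\<^sup>2} < e" by simp
    have "1 = measure (\<mu>s n) UNIV" using prob_space by simp
    also have "\<dots> \<le> measure (\<mu>s n) ({-K-1<..K+1} \<union> {u. K\<^sup>2 \<le> u\<^sup>2})"
    proof (rule finite_measure_mono)
      show "UNIV \<subseteq> {-K-1<..K+1} \<union> {u. K\<^sup>2 \<le> u\<^sup>2}"
      proof
        fix u :: real
        have "\<bar>u\<bar> \<le> K \<or> K\<^sup>2 \<le> u\<^sup>2" using K1 by (metis abs_le_square_iff abs_of_nonneg le_cases order_trans zero_le_one)
        then show "u \<in> {-K-1<..K+1} \<union> {u. K\<^sup>2 \<le> u\<^sup>2}" by auto
      qed
    qed simp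
    also have "\<dots> \<le> measure (\<mu>s n) {-K-1<..K+1} + measure (\<mu>s n) {u. K\<^sup>2 \<le> u\<^sup>2}"
      by (rule measure_Un_le) auto
    finally show ?thesis using 1 by linarith
  qed
  then show "\<exists>a b. a < b \<and> (\<forall>n. 1 - e < measure (\<mu>s n) {a<..b})"
    using K1 by (intro exI[of _ "-K-1"] exI[of _ "K+1"]) auto
qed

text \<open>Tightness provides a weak limit of a subsequence. Every such limit has the moments
  \<open>\<beta>\<close>, so determinacy identifies them all and the whole sequence
  converges.\<close>

theorem method_of_moments:
  fixes \<mu>s :: "nat \<Rightarrow> real measure"
  assumes d: "\<And>n. real_distribution (\<mu>s n)"
    and I: "\<And>n k. integrable (\<mu>s n) (\<lambda>u. u ^ k)"
    and m: "\<And>k. (\<lambda>n. \<integral>u. u ^ k \<partial>\<mu>s n) \<longlonglongrightarrow> \<beta> k"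
    and C: "carleman_moments \<beta>"
  shows "\<exists>\<mu>. real_distribution \<mu> \<and> (\<forall>k. integrable \<mu> (\<lambda>u. u ^ k) \<and> (\<integral>u. u ^ k \<partial>\<mu>) = \<beta> k) \<and> weak_conv_m \<mu>s \<mu>"
proof -
  obtain B where B: "\<And>n. \<bar>\<integral>u. u\<^sup>2 \<partial>\<mu>s n\<bar> \<le> B"
    using convergent_imp_Bseq[OF convergentI[OF m[of 2]]] by (auto simp: Bseq_def)
  have t: "tight \<mu>s"
    by (rule tight_second_moment[OF d I, where B = B]) (use B in \<open>auto simp: abs_le_iff\<close>)
  have lim: "integrable \<nu> (\<lambda>u. u ^ k) \<and> (\<integral>u. u ^ k \<partial>\<nu>) = \<beta> k"
    if "strict_mono s" "real_distribution \<nu>" "weak_conv_m (\<mu>s \<circ> s) \<nu>" for s \<nu> k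
    using weak_limit_moments[of "\<mu>s \<circ> s" \<nu> \<beta> k] d I that LIMSEQ_subseq_LIMSEQ[OF m that(1)]
    by (auto simp: comp_def)
  obtain r \<mu> where r: "strict_mono r" "real_distribution \<mu>" "weak_conv_m (\<mu>s \<circ> id \<circ> r) \<mu>"
    using tight_imp_convergent_subsubsequence[OF t, of id] by (auto simp: strict_mono_def)
  have mu: "integrable \<mu> (\<lambda>u. u ^ k) \<and> (\<integral>u. u ^ k \<partial>\<mu>) = \<beta> k" for k
    using lim[of r \<mu> k] r by (simp add: comp_def)
  have "weak_conv_m \<mu>s \<mu>"
  proof (rule tight_subseq_weak_converge[OF d r(2) t])
    fix s \<nu> assume s: "strict_mono s" "real_distribution \<nu>" "weak_conv_m (\<mu>s \<circ> s) \<nu>"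
    then have "\<nu> = \<mu>"
      using lim[OF s] mu C r(2) by (intro real_distribution_moments_unique[of \<nu> \<mu> \<beta>]) auto
    with s show "weak_conv_m (\<mu>s \<circ> s) \<mu>" by simp
  qed
  then show ?thesis using mu r(2) by blast
qed

section \<open>Closed walks and their patterns\<close>

text \<open>An undirected edge with its smaller end first, so that it indexes an entry on or above
  the diagonal.\<close>

definition ed :: "nat \<Rightarrow> nat \<Rightarrow> nat \<times> nat" where "ed a b = (min a b, max a b)"

lemma ed_commute: "ed a b = ed b a" by (simp add: ed_def min.commute max.commute)

lemma ed_eq_iff: "ed a b = ed c d \<longleftrightarrow> (a = c \<and> b = d) \<or> (a = d \<and> b = c)"
  by (auto simp: ed_def min_def max_def split: if_splits)

lemma ed_inj_map: "inj_on f {a, b, c, d} \<Longrightarrow> ed (f a) (f b) = ed (f c) (f d) \<longleftrightarrow> ed a b = ed c d"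
  unfolding ed_eq_iff by (auto simp: inj_on_eq_iff)

definition step :: "nat \<Rightarrow> (nat \<Rightarrow> nat) \<Rightarrow> nat \<Rightarrow> nat \<times> nat" where
  "step k w s = ed (w s) (w (Suc s mod k))"

definition mult :: "nat \<Rightarrow> (nat \<Rightarrow> nat) \<Rightarrow> nat \<times> nat \<Rightarrow> nat" where
  "mult k w e = card {s. s < k \<and> step k w s = e}"

text \<open>A pattern lists, for every position of a closed walk, the first position with the same vertex. A
  vertex \<open>v \<noteq> 0\<close> of a pattern is thus discovered in step \<open>v - 1\<close>, along the edge from its parent.\<close>

definition patterns :: "nat \<Rightarrow> (nat \<Rightarrow> nat) set" where
  "patterns k = {p \<in> PiE {..<k} (\<lambda>_. {..<k}). \<forall>s<k. p s \<le> s \<and> p (p s) = p s}"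

definition pat :: "nat \<Rightarrow> (nat \<Rightarrow> nat) \<Rightarrow> nat \<Rightarrow> nat" where
  "pat k w = (\<lambda>s\<in>{..<k}. LEAST s'. w s' = w s)"

abbreviation verts :: "nat \<Rightarrow> (nat \<Rightarrow> nat) \<Rightarrow> nat set" where "verts k p \<equiv> p ` {..<k}"
abbreviation nonroots :: "nat \<Rightarrow> (nat \<Rightarrow> nat) \<Rightarrow> nat set" where "nonroots k p \<equiv> verts k p - {0}"
abbreviation parent :: "(nat \<Rightarrow> nat) \<Rightarrow> nat \<Rightarrow> nat" where "parent p v \<equiv> p (v - 1)"
abbreviation disc :: "(nat \<Rightarrow> nat) \<Rightarrow> nat \<Rightarrow> nat \<times> nat" where "disc p v \<equiv> ed (parent p v) v"

text \<open>The discovery edges always form a spanning tree of the visited vertices; the condition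
  says that the walk uses no other edge, and in particular no loop.\<close>

definition treelike :: "nat \<Rightarrow> (nat \<Rightarrow> nat) \<Rightarrow> bool" where
  "treelike k p \<longleftrightarrow> (\<forall>s<k. \<exists>v\<in>nonroots k p. step k p s = disc p v)"

definition injmaps :: "'v set \<Rightarrow> 'a set \<Rightarrow> ('v \<Rightarrow> 'a) set" where
  "injmaps V A = {\<phi> \<in> PiE V (\<lambda>_. A). inj_on \<phi> V}"

lemma finite_patterns [simp]: "finite (patterns k)"
  unfolding patterns_def by (auto intro!: finite_subset[OF _ finite_PiE[of "{..<k}" "\<lambda>_. {..<k}"]])

lemma patternsD:
  assumes "p \<in> patterns k"
  shows "s < k \<Longrightarrow> p s \<le> s" "s < k \<Longrightarrow> p (p s) = p s" "s < k \<Longrightarrow> p s < k"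
    "v \<in> verts k p \<Longrightarrow> p v = v" "v \<in> verts k p \<Longrightarrow> v < k"
    "v \<in> nonroots k p \<Longrightarrow> v > 0" "v \<in> nonroots k p \<Longrightarrow> v - 1 < k" "v \<in> nonroots k p \<Longrightarrow> parent p v < v"
    "v \<in> nonroots k p \<Longrightarrow> parent p v \<in> verts k p" "s < k \<Longrightarrow> p s \<in> verts k p"
proof -
  show le: "s < k \<Longrightarrow> p s \<le> s" and idem: "s < k \<Longrightarrow> p (p s) = p s" and "s < k \<Longrightarrow> p s < k" for s
    using assms by (auto simp: patterns_def)
  show v: "v \<in> verts k p \<Longrightarrow> p v = v" and vk: "v \<in> verts k p \<Longrightarrow> v < k" for v
    using assms by (auto simp: patterns_def)
  show v0: "v \<in> nonroots k p \<Longrightarrow> v > 0" and v1: "v \<in> nonroots k p \<Longrightarrow> v - 1 < k" for v using vk[of v] by auto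
  show "v \<in> nonroots k p \<Longrightarrow> parent p v < v" using le[of "v - 1"] v0[of v] v1[of v] by linarith
  show "v \<in> nonroots k p \<Longrightarrow> parent p v \<in> verts k p" using v1[of v] by auto
qed auto

lemma step_discovery:
  assumes "p \<in> patterns k" "v \<in> nonroots k p"
  shows "step k p (v - 1) = disc p v"
proof -
  have "v < k" "v > 0" "p v = v" using patternsD(4,5,6)[OF assms(1), of v] assms(2) by auto
  then show ?thesis by (simp add: step_def)
qed

text \<open>The child is the larger end of its discovery edge.\<close>

lemma inj_on_disc:
  assumes "p \<in> patterns k" shows "inj_on (disc p) (nonroots k p)"
proof (rule inj_onI)
  fix v w assume v: "v \<in> nonroots k p" and w: "w \<in> nonroots k p" and e: "disc p v = disc p w"
  show "v = w" using e patternsD(8)[OF assms v] patternsD(8)[OF assms w] by (auto simp: ed_eq_iff)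
qed

lemma disc_subset_steps:
  assumes "p \<in> patterns k" shows "disc p ` nonroots k p \<subseteq> step k p ` {..<k}"
  using step_discovery[OF assms] patternsD(7)[OF assms] by (metis (no_types, lifting) image_subsetI imageI lessThan_iff)

lemma treelike_iff:
  assumes "p \<in> patterns k"
  shows "treelike k p \<longleftrightarrow> step k p ` {..<k} = disc p ` nonroots k p"
proof -
  have "(\<forall>s<k. \<exists>v\<in>N. f s = g v) \<longleftrightarrow> f ` {..<k} \<subseteq> g ` N" for f :: "nat \<Rightarrow> nat \<times> nat" and g and N :: "nat set"
    by (simp only: image_subset_iff image_iff Ball_def lessThan_iff)
  then show ?thesis unfolding treelike_def using disc_subset_steps[OF assms] by blast
qed

lemma zero_in_verts:
  assumes "p \<in> patterns k" "k > 0" shows "0 \<in> verts k p" "p 0 = 0"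
  using patternsD(1)[OF assms(1), of 0] assms(2) by (auto simp: image_iff)

lemma card_nonroots:
  assumes "p \<in> patterns k" "k > 0" shows "card (verts k p) = Suc (card (nonroots k p))"
  using zero_in_verts[OF assms] by (metis card_Suc_Diff1 finite_imageI finite_lessThan)

text \<open>There is one discovery edge less than there are vertices, and a walk that is not
  treelike uses at least one further edge.\<close>

lemma card_verts_le:
  assumes "p \<in> patterns k" "k > 0" "\<not> treelike k p"
  shows "card (verts k p) \<le> card (step k p ` {..<k})"
proof -
  have "disc p ` nonroots k p \<subset> step k p ` {..<k}"
    using disc_subset_steps[OF assms(1)] assms(3) treelike_iff[OF assms(1)] by blast
  then have "card (disc p ` nonroots k p) < card (step k p ` {..<k})" by (intro psubset_card_mono) auto
  then show ?thesis using card_image[OF inj_on_disc[OF assms(1)]] card_nonroots[OF assms(1,2)] by simp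
qed

section \<open>Parity of the crossings of a tree edge\<close>

definition cross :: "nat \<Rightarrow> (nat \<Rightarrow> nat) \<Rightarrow> nat \<times> nat \<Rightarrow> nat \<Rightarrow> nat" where
  "cross k p e s = card {r. r < s \<and> step k p r = e}"

lemma cross_Suc: "cross k p e (Suc s) = cross k p e s + (if step k p s = e then 1 else 0)"
proof -
  have "{r. r < Suc s \<and> step k p r = e} = (if step k p s = e then insert s {r. r < s \<and> step k p r = e} else {r. r < s \<and> step k p r = e})"
    by (auto simp: less_Suc_eq)
  then show ?thesis by (simp add: cross_def)
qed

text \<open>Removing an edge of a tree separates its endpoints, so the parity of the number of crossings
  of that edge is determined by the current vertex.\<close>

lemma cross_parity:
  assumes p: "p \<in> patterns k" and t: "treelike k p" and "s \<le> k" "k > 0"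
  shows "even (cross k p e s) \<longleftrightarrow> even (cross k p e (if s = k then 0 else p s))"
  using assms(3)
proof (induction s rule: less_induct)
  case (less s)
  show ?case
  proof (cases s)
    case 0
    then show ?thesis using zero_in_verts[OF p \<open>k > 0\<close>] \<open>k > 0\<close> by simp
  next
    case (Suc r)
    have r: "r < k" using less.prems Suc by simp
    have IH: "even (cross k p e i) \<longleftrightarrow> even (cross k p e (p i))" if "i < s" "i < k" for i
      using less.IH[of i] that by simp
    \<comment> \<open>The vertex at time \<open>s\<close>; time \<open>k\<close> is the return to
      the root.\<close>
    define q where "q = p (s mod k)"
    have q: "q = (if s = k then 0 else p s)" using less.prems zero_in_verts[OF p \<open>k > 0\<close>] by (simp add: q_def)
    obtain v where v: "v \<in> nonroots k p" and sv: "step k p r = disc p v"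
      using t r unfolding treelike_def by blast
    note vd = patternsD(4-8)[OF p, of v]
    have st: "ed (p r) q = ed (parent p v) v" using sv by (simp add: step_def q_def Suc)
    \<comment> \<open>The step at time \<open>r\<close> and the discovery of \<open>v\<close> run
      along the same edge, so both counts change by the same amount; the induction hypothesis at
      \<open>r\<close> and at \<open>v - 1\<close> compares what remains.\<close>
    have v': "cross k p e v = cross k p e (v - 1) + (if disc p v = e then 1 else 0)"
      using cross_Suc[of k p e "v - 1"] vd v step_discovery[OF p v] by simp
    have s': "cross k p e s = cross k p e r + (if disc p v = e then 1 else 0)"
      unfolding Suc cross_Suc sv ..
    from st consider "p r = parent p v" "q = v" | "p r = v" "q = parent p v" by (auto simp: ed_eq_iff)
    then have "even (cross k p e s) \<longleftrightarrow> even (cross k p e q)"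
    proof cases
      case 1
      have "q \<le> s" using patternsD(1)[OF p, of s] less.prems q by (cases "s = k") auto
      then have "v - 1 < s" "v - 1 < k" using 1 vd v by auto
      then show ?thesis using IH[of "v - 1"] IH[of r] 1 r Suc v' s' by auto
    next
      case 2
      have "v \<le> r" using patternsD(1)[OF p r] 2 by simp
      then have "v - 1 < s" "v - 1 < k" using vd v Suc by auto
      then show ?thesis using IH[of "v - 1"] IH[of r] 2 r Suc v' s' by auto
    qed
    then show ?thesis by (simp add: q)
  qed
qed

lemma mult_cross: "mult k p e = cross k p e k"
  by (simp add: mult_def cross_def)

text \<open>At time \<open>k\<close> the walk is back at the root, where the count was 0.\<close>

lemma treelike_mult_even:
  assumes "p \<in> patterns k" "treelike k p" "k > 0" shows "even (mult k p e)"
  using cross_parity[OF assms(1,2) order.refl assms(3), of e] by (simp add: mult_cross) (simp add: cross_def)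

lemma mult_pos: "s < k \<Longrightarrow> mult k p (step k p s) > 0"
  unfolding mult_def by (subst card_gt_0_iff) auto

lemma sum_mult: "(\<Sum>e\<in>step k p ` {..<k}. mult k p e) = k"
proof -
  have "(\<Sum>e\<in>step k p ` {..<k}. mult k p e) = (\<Sum>e\<in>step k p ` {..<k}. \<Sum>s | s \<in> {..<k} \<and> step k p s = e. 1)"
    by (intro sum.cong refl) (auto simp: mult_def intro!: arg_cong[of _ _ card])
  also have "\<dots> = (\<Sum>s<k. 1)" by (rule sum.group) auto
  finally show ?thesis by simp
qed

section \<open>Walks as injectively labelled patterns\<close>

lemma pat_in_patterns: "pat k w \<in> patterns k"
proof -
  have le: "(LEAST s'. w s' = w s) \<le> s" for s by (rule Least_le) simp
  have eq: "w (LEAST s'. w s' = w s) = w s" for s by (rule LeastI[of _ s]) simp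
  show ?thesis unfolding patterns_def pat_def using le eq by (auto intro: le_less_trans)
qed

lemma pat_vertex: "s < k \<Longrightarrow> w (pat k w s) = w s"
  unfolding pat_def using LeastI[of "\<lambda>s'. w s' = w s" s] by simp

lemma pat_eq_iff:
  assumes "s < k" "r < k" shows "pat k w s = pat k w r \<longleftrightarrow> w s = w r"
proof
  assume "pat k w s = pat k w r"
  then show "w s = w r" using pat_vertex[OF assms(1), of w] pat_vertex[OF assms(2), of w] by simp
qed (use assms in \<open>simp add: pat_def\<close>)

lemma pat_compose:
  assumes p: "p \<in> patterns k" and i: "inj_on \<phi> (verts k p)"
  shows "pat k (\<lambda>s\<in>{..<k}. \<phi> (p s)) = p"
proof (rule ext)
  fix s
  let ?w = "\<lambda>s\<in>{..<k}. \<phi> (p s)"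
  show "pat k ?w s = p s"
  proof (cases "s < k")
    case False
    then show ?thesis using p by (simp add: pat_def patterns_def PiE_def extensional_def)
  next
    case True
    have "(LEAST s'. ?w s' = ?w s) = p s"
    proof (rule Least_equality)
      show "?w (p s) = ?w s" using patternsD(2,3)[OF p True] True by simp
      fix r assume r: "?w r = ?w s"
      show "p s \<le> r"
      proof (cases "r < k")
        case rk: True
        then have "\<phi> (p r) = \<phi> (p s)" using r True by simp
        then have "p r = p s" using i True rk by (auto dest: inj_onD)
        then show ?thesis using patternsD(1)[OF p rk] by simp
      qed (use patternsD(3)[OF p True] in auto)
    qed
    then show ?thesis using True by (simp add: pat_def)
  qed
qed

text \<open>A walk is its pattern together with an injective labelling of the vertices of the
  pattern; the labelling is the walk restricted to the positions of first visits.\<close>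

lemma sum_walks_by_pattern:
  fixes F :: "(nat \<Rightarrow> nat) \<Rightarrow> 'b::comm_monoid_add"
  assumes A: "finite A"
  shows "(\<Sum>w\<in>PiE {..<k} (\<lambda>_. A). F w) =
    (\<Sum>p\<in>patterns k. \<Sum>\<phi>\<in>injmaps (verts k p) A. F (\<lambda>s\<in>{..<k}. \<phi> (p s)))"
proof -
  have "(\<Sum>w\<in>PiE {..<k} (\<lambda>_. A). F w) = (\<Sum>p\<in>patterns k. \<Sum>w | w \<in> PiE {..<k} (\<lambda>_. A) \<and> pat k w = p. F w)"
    by (rule sum.group[symmetric]) (use A pat_in_patterns in \<open>auto intro!: finite_PiE\<close>)
  also have "\<dots> = (\<Sum>p\<in>patterns k. \<Sum>\<phi>\<in>injmaps (verts k p) A. F (\<lambda>s\<in>{..<k}. \<phi> (p s)))"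
  proof (rule sum.cong[OF refl])
    fix p assume p: "p \<in> patterns k"
    show "(\<Sum>w | w \<in> PiE {..<k} (\<lambda>_. A) \<and> pat k w = p. F w) = (\<Sum>\<phi>\<in>injmaps (verts k p) A. F (\<lambda>s\<in>{..<k}. \<phi> (p s)))"
    proof (rule sum.reindex_bij_witness[where i = "\<lambda>\<phi>. \<lambda>s\<in>{..<k}. \<phi> (p s)" and j = "\<lambda>w. restrict w (verts k p)"])
      fix w assume w: "w \<in> {w. w \<in> PiE {..<k} (\<lambda>_. A) \<and> pat k w = p}"
      have v: "w (p s) = w s" if "s < k" for s using w pat_vertex[OF that, of w] by auto
      show e: "(\<lambda>s\<in>{..<k}. restrict w (verts k p) (p s)) = w"
      proof (rule ext)
        fix s show "(\<lambda>s\<in>{..<k}. restrict w (verts k p) (p s)) s = w s"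
        proof (cases "s < k")
          case True then show ?thesis using v[OF True] by simp
        next
          case False
          moreover have "w \<in> extensional {..<k}" using w by (auto simp: PiE_def)
          ultimately show ?thesis by (simp add: extensional_def)
        qed
      qed
      have "inj_on (restrict w (verts k p)) (verts k p)"
      proof (rule inj_onI)
        fix x y assume x: "x \<in> verts k p" and y: "y \<in> verts k p" and "restrict w (verts k p) x = restrict w (verts k p) y"
        then have wxy: "w x = w y" by simp
        have "p x = p y" using w pat_eq_iff[of x k y w] patternsD(5)[OF p x] patternsD(5)[OF p y] wxy by auto
        then show "x = y" using patternsD(4)[OF p x] patternsD(4)[OF p y] by simp
      qed
      moreover have "restrict w (verts k p) \<in> PiE (verts k p) (\<lambda>_. A)"
        using w patternsD(5)[OF p] by (intro restrict_PiE_iff[THEN iffD2] ballI) (auto simp: PiE_def Pi_def)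
      ultimately show "restrict w (verts k p) \<in> injmaps (verts k p) A" by (simp add: injmaps_def)
      show "F (\<lambda>s\<in>{..<k}. restrict w (verts k p) (p s)) = F w" by (simp only: e)
    next
      fix \<phi> assume f: "\<phi> \<in> injmaps (verts k p) A"
      show "restrict (\<lambda>s\<in>{..<k}. \<phi> (p s)) (verts k p) = \<phi>"
      proof (rule ext)
        fix v show "restrict (\<lambda>s\<in>{..<k}. \<phi> (p s)) (verts k p) v = \<phi> v"
        proof (cases "v \<in> verts k p")
          case True
          then show ?thesis using patternsD(4)[OF p True] patternsD(5)[OF p True] by simp
        next
          case False
          then show ?thesis using f by (auto simp: injmaps_def PiE_def extensional_def)
        qed
      qed
      show "(\<lambda>s\<in>{..<k}. \<phi> (p s)) \<in> {w. w \<in> PiE {..<k} (\<lambda>_. A) \<and> pat k w = p}"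
        using pat_compose[OF p, of \<phi>] f by (auto simp: injmaps_def intro!: restrict_PiE_iff[THEN iffD2])
    qed
  qed
  finally show ?thesis .
qed

text \<open>With \<open>m e r\<close> the \<open>r\<close>-th moment of the entry at
  \<open>e\<close>, this is the mean of the product of the entries along the walk, by independence
  of distinct entries.\<close>

definition wprod :: "(nat \<times> nat \<Rightarrow> nat \<Rightarrow> real) \<Rightarrow> nat \<Rightarrow> (nat \<Rightarrow> nat) \<Rightarrow> real" where
  "wprod m k w = (\<Prod>e\<in>step k w ` {..<k}. m e (mult k w e))"

lemma step_compose:
  assumes "s < k" shows "step k (\<lambda>s\<in>{..<k}. \<phi> (p s)) s = ed (\<phi> (p s)) (\<phi> (p (Suc s mod k)))"
  using assms by (simp add: step_def)

lemma step_compose_eq_iff: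
  assumes p: "p \<in> patterns k" and i: "inj_on \<phi> (verts k p)" and "s < k" "r < k"
  shows "step k (\<lambda>s\<in>{..<k}. \<phi> (p s)) s = step k (\<lambda>s\<in>{..<k}. \<phi> (p s)) r \<longleftrightarrow> step k p s = step k p r"
  unfolding step_compose[OF assms(3)] step_compose[OF assms(4)] unfolding step_def
  by (rule ed_inj_map) (rule inj_on_subset[OF i], use assms(3,4) in auto)

lemma mult_compose:
  assumes p: "p \<in> patterns k" and i: "inj_on \<phi> (verts k p)" and s: "s < k"
  shows "mult k (\<lambda>s\<in>{..<k}. \<phi> (p s)) (step k (\<lambda>s\<in>{..<k}. \<phi> (p s)) s) = mult k p (step k p s)"
  unfolding mult_def using step_compose_eq_iff[OF p i _ s] by (auto intro!: arg_cong[of _ _ card])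

text \<open>An injective labelling acts injectively on edges; any step that crosses an edge may
  represent it.\<close>

lemma card_step_compose:
  assumes p: "p \<in> patterns k" and i: "inj_on \<phi> (verts k p)"
  shows "card (step k (\<lambda>s\<in>{..<k}. \<phi> (p s)) ` {..<k}) = card (step k p ` {..<k})"
proof -
  let ?w = "\<lambda>s\<in>{..<k}. \<phi> (p s)"
  have "bij_betw (\<lambda>e. step k ?w (SOME s. s < k \<and> step k p s = e)) (step k p ` {..<k}) (step k ?w ` {..<k})"
    unfolding bij_betw_def
  proof
    have sm: "(SOME r. r < k \<and> step k p r = step k p s) < k \<and> step k p (SOME r. r < k \<and> step k p r = step k p s) = step k p s" if "s < k" for s
      by (rule someI[of "\<lambda>r. r < k \<and> step k p r = step k p s" s]) (use that in auto)
    have val: "step k ?w (SOME r. r < k \<and> step k p r = step k p s) = step k ?w s" if "s < k" for s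
      using sm[OF that] step_compose_eq_iff[OF p i _ that] by blast
    show "inj_on (\<lambda>e. step k ?w (SOME s. s < k \<and> step k p s = e)) (step k p ` {..<k})"
    proof (rule inj_onI)
      fix e e' assume "e \<in> step k p ` {..<k}" "e' \<in> step k p ` {..<k}"
        and h: "step k ?w (SOME s. s < k \<and> step k p s = e) = step k ?w (SOME s. s < k \<and> step k p s = e')"
      then obtain s r where e: "e = step k p s" "s < k" and e': "e' = step k p r" "r < k" by blast
      have "step k ?w s = step k ?w r" using h val[OF e(2)] val[OF e'(2)] unfolding e(1) e'(1) by simp
      then show "e = e'" using step_compose_eq_iff[OF p i e(2) e'(2)] e e' by simp
    qed
    show "(\<lambda>e. step k ?w (SOME s. s < k \<and> step k p s = e)) ` step k p ` {..<k} = step k ?w ` {..<k}"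
      unfolding image_image by (rule image_cong) (auto simp: val)
  qed
  then show ?thesis by (rule bij_betw_same_card[THEN sym])
qed

text \<open>In a tree the edges correspond to the vertices other than the root, so the product can
  be indexed by children.\<close>

lemma wprod_treelike:
  assumes p: "p \<in> patterns k" and t: "treelike k p" and i: "inj_on \<phi> (verts k p)"
  shows "wprod m k (\<lambda>s\<in>{..<k}. \<phi> (p s)) =
    (\<Prod>v\<in>nonroots k p. m (ed (\<phi> (parent p v)) (\<phi> v)) (mult k p (disc p v)))"
proof -
  let ?w = "\<lambda>s\<in>{..<k}. \<phi> (p s)"
  have st: "step k ?w (v - 1) = ed (\<phi> (parent p v)) (\<phi> v)" if "v \<in> nonroots k p" for v
    using patternsD(4-7)[OF p, of v] that by (simp add: step_def)
  have im: "step k ?w ` {..<k} = (\<lambda>v. step k ?w (v - 1)) ` nonroots k p"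
  proof (intro equalityI subsetI)
    fix e assume "e \<in> step k ?w ` {..<k}"
    then obtain s where s: "s < k" "e = step k ?w s" by auto
    obtain v where v: "v \<in> nonroots k p" "step k p s = disc p v" using t s unfolding treelike_def by blast
    have "step k ?w s = step k ?w (v - 1)"
      using step_compose_eq_iff[OF p i s(1) patternsD(7)[OF p v(1)]] step_discovery[OF p v(1)] v(2) by simp
    then show "e \<in> (\<lambda>v. step k ?w (v - 1)) ` nonroots k p" using v(1) s by auto
  next
    fix e assume "e \<in> (\<lambda>v. step k ?w (v - 1)) ` nonroots k p"
    then obtain v where v: "v \<in> nonroots k p" "e = step k ?w (v - 1)" by blast
    then show "e \<in> step k ?w ` {..<k}" using patternsD(7)[OF p v(1)] by blast
  qed
  have inj: "inj_on (\<lambda>v. step k ?w (v - 1)) (nonroots k p)"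
  proof (rule inj_onI)
    fix u v assume u: "u \<in> nonroots k p" and v: "v \<in> nonroots k p" and e: "step k ?w (u - 1) = step k ?w (v - 1)"
    then have "disc p u = disc p v"
      using step_compose_eq_iff[OF p i patternsD(7)[OF p u] patternsD(7)[OF p v]] step_discovery[OF p u] step_discovery[OF p v] by simp
    then show "u = v" using inj_on_disc[OF p] u v by (auto dest: inj_onD)
  qed
  show ?thesis unfolding wprod_def im
  proof (subst prod.reindex[OF inj], rule prod.cong[OF refl])
    fix v assume v: "v \<in> nonroots k p"
    show "((\<lambda>e. m e (mult k ?w e)) \<circ> (\<lambda>v. step k ?w (v - 1))) v = m (ed (\<phi> (parent p v)) (\<phi> v)) (mult k p (disc p v))"
      using mult_compose[OF p i patternsD(7)[OF p v]] step_discovery[OF p v] st[OF v] by simp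
  qed
qed

text \<open>Step \<open>s\<close> runs along the discovery edge of some \<open>v\<close>, which is
  crossed at time \<open>v - 1\<close>. Novelty gives \<open>v - 1 \<ge> s\<close>, while
  \<open>v\<close> is an end of the step and so at most \<open>Suc s\<close>.\<close>

lemma new_edge_new_vertex:
  assumes p: "p \<in> patterns k" and t: "treelike k p" and s: "Suc s < k" and new: "\<And>r. r < s \<Longrightarrow> step k p r \<noteq> step k p s"
  shows "p (Suc s) = Suc s"
proof -
  have "s < k" using s by simp
  then obtain v where v: "v \<in> nonroots k p" "step k p s = disc p v" using t unfolding treelike_def by blast
  have "\<not> v - 1 < s" using new[of "v - 1"] step_discovery[OF p v(1)] v(2) by auto
  moreover have "v \<in> {p s, p (Suc s)}" using v(2) s by (auto simp: step_def ed_eq_iff)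
  moreover have "p s \<le> s" "p (Suc s) \<le> Suc s" using patternsD(1)[OF p] s by auto
  moreover have "v > 0" using patternsD(6)[OF p v(1)] .
  ultimately show ?thesis by auto
qed

text \<open>The walk is rebuilt position by position: along a repeated edge the next vertex is its
  other end, along a new edge it is a new vertex.\<close>

lemma treelike_determined_by_edges:
  assumes p: "p \<in> patterns k" "treelike k p" and q: "q \<in> patterns k" "treelike k q"
    and e: "\<And>r s. r < k \<Longrightarrow> s < k \<Longrightarrow> step k p r = step k p s \<longleftrightarrow> step k q r = step k q s"
  shows "p = q"
proof -
  have "p s = q s" if "s < k" for s
    using that
  proof (induction s rule: less_induct)
    case (less s)
    show ?case
    proof (cases s)
      case 0
      then show ?thesis using patternsD(1)[OF p(1) less.prems] patternsD(1)[OF q(1) less.prems] by simp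
    next
      case (Suc r)
      have r: "r < k" "Suc r < k" using less.prems Suc by auto
      have pr: "p r = q r" using less Suc by simp
      show ?thesis
      proof (cases "\<exists>i<r. step k p i = step k p r")
        case True
        then obtain i where i: "i < r" "step k p i = step k p r" by auto
        have "step k q r = step k q i" using e[of i r] i r by auto
        also have "\<dots> = step k p i" using less.IH[of i] less.IH[of "Suc i"] i r Suc by (simp add: step_def)
        also have "\<dots> = step k p r" by (rule i)
        finally show ?thesis using pr r Suc by (auto simp: step_def ed_eq_iff)
      next
        case False
        then have "p (Suc r) = Suc r" by (intro new_edge_new_vertex[OF p r(2)]) auto
        moreover have "q (Suc r) = Suc r"
          using False e r by (intro new_edge_new_vertex[OF q r(2)]) (metis less_trans)
        ultimately show ?thesis by (simp add: Suc)
      qed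
    qed
  qed
  moreover have "p \<in> extensional {..<k}" "q \<in> extensional {..<k}" using p(1) q(1) by (auto simp: patterns_def PiE_def)
  ultimately show ?thesis by (intro extensionalityI[of p "{..<k}" q]) auto
qed

text \<open>Shifted by one because the partitions in \<open>alpha\<close> are partitions of
  \<open>{1..2 * k}\<close>.\<close>

definition step_blocks :: "nat \<Rightarrow> (nat \<Rightarrow> nat) \<Rightarrow> nat set set" where
  "step_blocks k p = (\<lambda>e. Suc ` {s. s < k \<and> step k p s = e}) ` (step k p ` {..<k})"

lemma partition_step_blocks: "partition_on {1..k} (step_blocks k p)"
proof (rule partition_onI)
  show "\<Union> (step_blocks k p) = {1..k}"
  proof -
    have "\<Union> (step_blocks k p) = Suc ` {..<k}" by (auto simp: step_blocks_def)
    then show ?thesis by (simp add: image_Suc_lessThan)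
  qed
  show "disjnt A B" if "A \<in> step_blocks k p" "B \<in> step_blocks k p" "A \<noteq> B" for A B
    using that by (auto simp: step_blocks_def disjnt_def)
qed (auto simp: step_blocks_def)

lemma partition_weight_step_blocks:
  "partition_weight c (step_blocks k p) = (\<Prod>e\<in>step k p ` {..<k}. c (mult k p e))"
proof -
  have "inj_on (\<lambda>e. Suc ` {s. s < k \<and> step k p s = e}) (step k p ` {..<k})"
  proof (rule inj_onI)
    fix e e' assume "e \<in> step k p ` {..<k}" and h: "Suc ` {s. s < k \<and> step k p s = e} = Suc ` {s. s < k \<and> step k p s = e'}"
    then obtain s where s: "s < k" "e = step k p s" by blast
    then have "Suc s \<in> Suc ` {s. s < k \<and> step k p s = e'}" using h by blast
    then show "e = e'" using s by blast
  qed
  then show ?thesis unfolding partition_weight_def step_blocks_def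
    by (subst prod.reindex) (auto simp: mult_def card_image intro!: prod.cong)
qed

text \<open>Two steps run along the same edge exactly if they share a block, and these coincidences
  determine a treelike pattern.\<close>

lemma inj_on_step_blocks: "inj_on (step_blocks k) {p \<in> patterns k. treelike k p}"
proof (rule inj_onI)
  fix p q assume p: "p \<in> {p \<in> patterns k. treelike k p}" and q: "q \<in> {p \<in> patterns k. treelike k p}"
    and e: "step_blocks k p = step_blocks k q"
  have same: "step k p r = step k p s \<longleftrightarrow> (\<exists>B\<in>step_blocks k p. Suc r \<in> B \<and> Suc s \<in> B)" if "r < k" "s < k" for r s p
    using that by (auto simp: step_blocks_def)
  show "p = q"
    by (rule treelike_determined_by_edges[of p k q]) (use p q same e in auto)
qed

section \<open>The semi-circle law\<close>

text \<open>Walks on \<open>k\<close> positions whose last vertex is the current end of the walk: every step either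
  discovers a new vertex or goes back to the parent.\<close>

definition dyck :: "nat \<Rightarrow> (nat \<Rightarrow> nat) set" where
  "dyck m = {p \<in> extensional {..m}. p 0 = 0 \<and> (\<forall>s<m. p (Suc s) = Suc s \<or> (p s > 0 \<and> p (Suc s) = parent p (p s)))}"

text \<open>On \<open>dyck\<close> walks, the depth of the current vertex in the tree, read off from
  the steps. The truncated subtraction never meets height 0 there, since a return starts at a vertex
  other than the root.\<close>

fun height :: "(nat \<Rightarrow> nat) \<Rightarrow> nat \<Rightarrow> nat" where
  "height p 0 = 0" |
  "height p (Suc s) = (if p (Suc s) = Suc s then Suc (height p s) else height p s - 1)"

text \<open>A return from \<open>v\<close> leads to \<open>p (v - 1)\<close>, and the height becomes
  the one at time \<open>v - 1\<close>, just before \<open>v\<close> was discovered. The four facts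
  depend on each other and are carried through one strong induction.\<close>

lemma dyckD:
  assumes "p \<in> dyck m"
  shows "s \<le> m \<Longrightarrow> p s \<le> s" "s \<le> m \<Longrightarrow> p (p s) = p s"
    "s \<le> m \<Longrightarrow> height p (p s) = height p s" "s \<le> m \<Longrightarrow> height p s = 0 \<longleftrightarrow> p s = 0"
proof -
  have "p s \<le> s \<and> p (p s) = p s \<and> height p (p s) = height p s \<and> (height p s = 0 \<longleftrightarrow> p s = 0)" if "s \<le> m" for s
    using that
  proof (induction s rule: less_induct)
    case (less s)
    show ?case
    proof (cases s)
      case 0
      then show ?thesis using assms by (simp add: dyck_def)
    next
      case (Suc r)
      have IHr: "p r \<le> r" "p (p r) = p r" "height p (p r) = height p r" "height p r = 0 \<longleftrightarrow> p r = 0"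
        using less.IH[of r] less.prems Suc by auto
      show ?thesis
      proof (cases "p (Suc r) = Suc r")
        case True
        then show ?thesis unfolding Suc by simp
      next
        case False
        have "r < m" using less.prems Suc by simp
        then have "p (Suc r) = Suc r \<or> (p r > 0 \<and> p (Suc r) = parent p (p r))" using assms unfolding dyck_def by blast
        then have b: "p r > 0" "p (Suc r) = parent p (p r)" using False by auto
        define v where "v = p r"
        have v: "v > 0" "p v = v" "v \<le> r" using b IHr by (auto simp: v_def)
        have IHv: "p (v - 1) \<le> v - 1" "p (p (v - 1)) = p (v - 1)" "height p (p (v - 1)) = height p (v - 1)" "height p (v - 1) = 0 \<longleftrightarrow> p (v - 1) = 0"
          using less.IH[of "v - 1"] less.prems Suc v by auto
        have hv: "height p v = Suc (height p (v - 1))" using v by (cases v) auto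
        have "height p (Suc r) = height p (v - 1)" using False hv IHr(3) by (simp add: v_def)
        then show ?thesis unfolding Suc b(2) v_def[symmetric] using IHv v by auto
      qed
    qed
  qed
  then show "s \<le> m \<Longrightarrow> p s \<le> s" "s \<le> m \<Longrightarrow> p (p s) = p s"
    "s \<le> m \<Longrightarrow> height p (p s) = height p s" "s \<le> m \<Longrightarrow> height p s = 0 \<longleftrightarrow> p s = 0" by auto
qed

lemma height_Suc_down:
  assumes "p \<in> dyck m" "s < m" "p (Suc s) \<noteq> Suc s"
  shows "height p s = Suc (height p (Suc s))"
proof -
  have "p s > 0" using assms by (auto simp: dyck_def)
  then show ?thesis using dyckD(4)[OF assms(1), of s] assms by simp
qed

lemma height_cong: "(\<And>r. r \<le> s \<Longrightarrow> p r = q r) \<Longrightarrow> height p s = height q s"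
  by (induction s) auto

lemma finite_dyck: "finite (dyck m)"
proof (rule finite_subset)
  show "dyck m \<subseteq> PiE {..m} (\<lambda>_. {..m})" using dyckD(1)[of _ m] by (auto simp: PiE_def dyck_def intro: order_trans)
qed (auto intro: finite_PiE)

text \<open>The ballot numbers; at height 0 and even \<open>m\<close> they are the Catalan
  numbers.\<close>

definition dyck_count :: "nat \<Rightarrow> nat \<Rightarrow> nat" where
  "dyck_count m h = card {p \<in> dyck m. height p m = h}"

lemma dyck_count_0: "dyck_count 0 h = (if h = 0 then 1 else 0)"
proof -
  have "dyck 0 = {\<lambda>s\<in>{..0}. 0}"
    by (auto simp: dyck_def extensional_def restrict_def fun_eq_iff)
  then show ?thesis by (simp add: dyck_count_def)
qed

lemma dyck_extend_up:
  assumes "p \<in> dyck m" shows "p(Suc m := Suc m) \<in> dyck (Suc m)" "height (p(Suc m := Suc m)) (Suc m) = Suc (height p m)"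
proof -
  have *: "(p(Suc m := Suc m)) r = p r" if "r \<le> m" for r using that by simp
  show "p(Suc m := Suc m) \<in> dyck (Suc m)"
  proof -
    have "(p(Suc m := Suc m)) (Suc s) = Suc s \<or> ((p(Suc m := Suc m)) s > 0 \<and> (p(Suc m := Suc m)) (Suc s) = parent (p(Suc m := Suc m)) ((p(Suc m := Suc m)) s))" if "s < Suc m" for s
    proof (cases "s = m")
      case False
      then have s: "s < m" using that by simp
      have "p s - 1 \<le> m" using dyckD(1)[OF assms, of s] s by simp
      then show ?thesis using assms s by (auto simp: dyck_def)
    qed simp
    moreover have "p(Suc m := Suc m) \<in> extensional {..Suc m}" using assms by (auto simp: dyck_def extensional_def)
    ultimately show ?thesis using assms by (auto simp: dyck_def)
  qed
  show "height (p(Suc m := Suc m)) (Suc m) = Suc (height p m)" using height_cong[of m "p(Suc m := Suc m)" p] by simp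
qed

lemma dyck_extend_down:
  assumes "p \<in> dyck m" "height p m > 0"
  shows "p(Suc m := parent p (p m)) \<in> dyck (Suc m)" "height (p(Suc m := parent p (p m))) (Suc m) = height p m - 1"
    "parent p (p m) \<noteq> Suc m"
proof -
  let ?q = "p(Suc m := parent p (p m))"
  have pm: "p m > 0" "p m \<le> m" using dyckD(4)[OF assms(1), of m] dyckD(1)[OF assms(1), of m] assms(2) by auto
  have "p (p m - 1) \<le> p m - 1" using dyckD(1)[OF assms(1), of "p m - 1"] pm by simp
  then show ne: "parent p (p m) \<noteq> Suc m" using pm by simp
  show "?q \<in> dyck (Suc m)"
  proof -
    have "?q (Suc s) = Suc s \<or> (?q s > 0 \<and> ?q (Suc s) = parent ?q (?q s))" if "s < Suc m" for s
    proof (cases "s = m")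
      case False
      then have s: "s < m" using that by simp
      have "p s - 1 \<le> m" using dyckD(1)[OF assms(1), of s] s by simp
      then show ?thesis using assms s by (auto simp: dyck_def)
    qed (use pm in auto)
    moreover have "?q \<in> extensional {..Suc m}" using assms by (auto simp: dyck_def extensional_def)
    ultimately show ?thesis using assms by (auto simp: dyck_def)
  qed
  show "height ?q (Suc m) = height p m - 1" using height_cong[of m ?q p] ne by simp
qed

lemma dyck_restrict:
  assumes "p \<in> dyck (Suc m)" shows "restrict p {..m} \<in> dyck m" "height (restrict p {..m}) m = height p m"
proof -
  have "restrict p {..m} (Suc s) = Suc s \<or> (restrict p {..m} s > 0 \<and> restrict p {..m} (Suc s) = parent (restrict p {..m}) (restrict p {..m} s))" if "s < m" for s
  proof -
    have "p s - 1 \<le> m" using dyckD(1)[OF assms, of s] that by simp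
    then show ?thesis using assms that by (auto simp: dyck_def)
  qed
  then show "restrict p {..m} \<in> dyck m" using assms by (auto simp: dyck_def)
  show "height (restrict p {..m}) m = height p m" by (rule height_cong) auto
qed

lemma dyck_restrict_upd:
  assumes "p \<in> dyck (Suc m)" shows "(restrict p {..m})(Suc m := p (Suc m)) = p"
proof
  fix s show "((restrict p {..m})(Suc m := p (Suc m))) s = p s"
    using assms by (auto simp: dyck_def extensional_def restrict_def)
qed

text \<open>The last step is a discovery or a return according to whether the last vertex is new,
  and restriction to the earlier positions inverts both ways of extending a walk.\<close>

lemma dyck_count_Suc:
  "dyck_count (Suc m) h = (if h = 0 then 0 else dyck_count m (h - 1)) + dyck_count m (Suc h)"
proof -
  let ?U = "{p \<in> dyck (Suc m). height p (Suc m) = h \<and> p (Suc m) = Suc m}"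
  let ?D = "{p \<in> dyck (Suc m). height p (Suc m) = h \<and> p (Suc m) \<noteq> Suc m}"
  have "{p \<in> dyck (Suc m). height p (Suc m) = h} = ?U \<union> ?D" by auto
  moreover have "card (?U \<union> ?D) = card ?U + card ?D"
  proof (rule card_Un_disjoint)
    show "finite ?U" "finite ?D" by (rule finite_subset[OF _ finite_dyck[of "Suc m"]], blast)+
  qed blast
  ultimately have "dyck_count (Suc m) h = card ?U + card ?D" unfolding dyck_count_def by metis
  also have "card ?U = (if h = 0 then 0 else dyck_count m (h - 1))"
  proof (cases h)
    case 0
    then have "?U = {}" by auto
    then show ?thesis using 0 by (metis (no_types, lifting) card.empty)
  next
    case (Suc g)
    have "bij_betw (\<lambda>p. p(Suc m := Suc m)) {p \<in> dyck m. height p m = g} ?U"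
    proof (rule bij_betw_byWitness[where f' = "\<lambda>p. restrict p {..m}"])
      show "\<forall>p\<in>{p \<in> dyck m. height p m = g}. restrict (p(Suc m := Suc m)) {..m} = p"
        by (auto simp: dyck_def extensional_def restrict_def fun_eq_iff)
      show "\<forall>p\<in>?U. (restrict p {..m})(Suc m := Suc m) = p" using dyck_restrict_upd by (metis (mono_tags, lifting) mem_Collect_eq)
      show "(\<lambda>p. p(Suc m := Suc m)) ` {p \<in> dyck m. height p m = g} \<subseteq> ?U" using dyck_extend_up Suc by auto
      show "(\<lambda>p. restrict p {..m}) ` ?U \<subseteq> {p \<in> dyck m. height p m = g}" using dyck_restrict Suc by auto
    qed
    then show ?thesis using bij_betw_same_card Suc unfolding dyck_count_def by fastforce
  qed
  also have "card ?D = dyck_count m (Suc h)"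
  proof -
    have "bij_betw (\<lambda>p. p(Suc m := parent p (p m))) {p \<in> dyck m. height p m = Suc h} ?D"
    proof (rule bij_betw_byWitness[where f' = "\<lambda>p. restrict p {..m}"])
      show "\<forall>p\<in>{p \<in> dyck m. height p m = Suc h}. restrict (p(Suc m := parent p (p m))) {..m} = p"
        by (auto simp: dyck_def extensional_def restrict_def fun_eq_iff)
      show "\<forall>p\<in>?D. (restrict p {..m})(Suc m := parent (restrict p {..m}) (restrict p {..m} m)) = p"
      proof
        fix p assume p: "p \<in> ?D"
        then have b: "p m > 0" "p (Suc m) = parent p (p m)" by (auto simp: dyck_def)
        have "p m \<le> m" "p m - 1 \<le> m" using dyckD(1)[of p "Suc m" m] p by auto
        then have "parent (restrict p {..m}) (restrict p {..m} m) = p (Suc m)" using b by simp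
        then show "(restrict p {..m})(Suc m := parent (restrict p {..m}) (restrict p {..m} m)) = p"
          using dyck_restrict_upd p by simp
      qed
      show "(\<lambda>p. p(Suc m := parent p (p m))) ` {p \<in> dyck m. height p m = Suc h} \<subseteq> ?D"
        using dyck_extend_down by auto
      show "(\<lambda>p. restrict p {..m}) ` ?D \<subseteq> {p \<in> dyck m. height p m = Suc h}"
        using dyck_restrict height_Suc_down by fastforce
    qed
    then show ?thesis using bij_betw_same_card unfolding dyck_count_def by fastforce
  qed
  finally show ?thesis .
qed

lemma dyck_count_zero: "h > m \<Longrightarrow> dyck_count m h = 0"
  by (induction m arbitrary: h) (auto simp: dyck_count_0 dyck_count_Suc)

text \<open>Chebyshev polynomials of the second kind, rescaled to \<open>[-2, 2]\<close>.\<close>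

fun cheb :: "nat \<Rightarrow> real \<Rightarrow> real" where
  "cheb 0 x = 1" | "cheb (Suc 0) x = x" | "cheb (Suc (Suc h)) x = x * cheb (Suc h) x - cheb h x"

lemma cheb_sin: "cheb h (2 * cos t) * sin t = sin (real (Suc h) * t)"
proof (induction h rule: induct_nat_012)
  case 1 show ?case by (simp add: sin_double)
next
  case (ge2 h)
  have "sin (real (Suc (Suc (Suc h))) * t) = sin (real (Suc (Suc h)) * t + t)" by (simp add: algebra_simps)
  moreover have "sin (real (Suc h) * t) = sin (real (Suc (Suc h)) * t - t)" by (simp add: algebra_simps)
  ultimately have "sin (real (Suc (Suc (Suc h))) * t) + sin (real (Suc h) * t) = 2 * cos t * sin (real (Suc (Suc h)) * t)"
    by (simp add: sin_add sin_diff)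
  then show ?case using ge2 by (simp add: algebra_simps)
qed simp

text \<open>Multiplication by \<open>x\<close> sends \<open>cheb h\<close> to
  \<open>cheb (Suc h) + cheb (h - 1)\<close>, the second term being absent for \<open>h = 0\<close>:
  ballot paths change their height by the same rule.\<close>

lemma power_cheb: "x ^ m = (\<Sum>h\<le>m. real (dyck_count m h) * cheb h x)"
proof (induction m)
  case 0 show ?case by (simp add: dyck_count_0)
next
  case (Suc m)
  have "x ^ Suc m = (\<Sum>h\<le>m. real (dyck_count m h) * (x * cheb h x))"
    using Suc by (simp add: sum_distrib_left mult_ac)
  also have "\<dots> = (\<Sum>h\<le>m. real (dyck_count m h) * cheb (Suc h) x) + (\<Sum>h\<le>m. real (dyck_count m h) * (if h = 0 then 0 else cheb (h - 1) x))"
    unfolding sum.distrib[symmetric]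
  proof (intro sum.cong refl)
    fix h show "real (dyck_count m h) * (x * cheb h x) = real (dyck_count m h) * cheb (Suc h) x + real (dyck_count m h) * (if h = 0 then 0 else cheb (h - 1) x)"
      by (cases h) (auto simp: algebra_simps)
  qed
  also have "(\<Sum>h\<le>m. real (dyck_count m h) * cheb (Suc h) x) = (\<Sum>h\<le>Suc m. real (if h = 0 then 0 else dyck_count m (h - 1)) * cheb h x)"
    by (simp add: sum.atMost_Suc_shift del: sum.atMost_Suc)
  also have "(\<Sum>h\<le>m. real (dyck_count m h) * (if h = 0 then 0 else cheb (h - 1) x)) = (\<Sum>h\<le>Suc (Suc m). real (dyck_count m h) * (if h = 0 then 0 else cheb (h - 1) x))"
    by (simp add: dyck_count_zero)
  also have "\<dots> = (\<Sum>h\<le>Suc m. real (dyck_count m (Suc h)) * cheb h x)"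
    by (subst sum.atMost_Suc_shift) simp
  also have "(\<Sum>h\<le>Suc m. real (if h = 0 then 0 else dyck_count m (h - 1)) * cheb h x) + \<dots> = (\<Sum>h\<le>Suc m. real (dyck_count (Suc m) h) * cheb h x)"
    unfolding sum.distrib[symmetric] dyck_count_Suc by (intro sum.cong refl) (simp add: algebra_simps)
  finally show ?case .
qed

text \<open>Substituting \<open>u = 2 cos t\<close> turns \<open>cheb h u * sqrt (4 - u\<^sup>2)\<close> into \<open>2 sin ((h + 1) t)\<close>.\<close>

lemma has_integral_cheb:
  "((\<lambda>u. cheb h u * (sqrt (4 - u\<^sup>2) / (2 * pi))) has_integral (if h = 0 then 1 else 0)) {-2..2}"
proof -
  \<comment> \<open>A primitive of \<open>cos (h * t)\<close>, for which \<open>h = 0\<close> is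
    exceptional. It enters because \<open>2 * sin ((h + 1) * t) * sin t = cos (h * t) - cos ((h + 2)
    * t)\<close>.\<close>
  define S where "S t = (if h = 0 then t else sin (real h * t) / real h)" for t :: real
  define F where "F u = - (S (arccos (u / 2)) - sin (real (h + 2) * arccos (u / 2)) / real (h + 2)) / pi" for u
  have dS: "(S has_real_derivative cos (real h * t)) (at t)" for t
  proof (cases "h = 0")
    case True
    then have "S = (\<lambda>t. t)" by (simp add: S_def fun_eq_iff)
    then show ?thesis using True by (auto intro!: derivative_eq_intros)
  next
    case False
    then have "S = (\<lambda>t. sin (real h * t) / real h)" by (simp add: S_def fun_eq_iff)
    then show ?thesis using False by (auto intro!: derivative_eq_intros)
  qed
  have cS: "continuous_on A S" for A
    using dS by (auto intro!: continuous_at_imp_continuous_on DERIV_isCont)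
  have "((\<lambda>u. cheb h u * (sqrt (4 - u\<^sup>2) / (2 * pi))) has_integral (F 2 - F (-2))) {-2..2}"
  proof (rule fundamental_theorem_of_calculus_interior)
    have "continuous_on {-2..2} (\<lambda>u. S (arccos (u / 2)))"
      by (rule continuous_on_compose2[OF cS[of UNIV]]) (auto intro!: continuous_intros)
    moreover have "continuous_on {-2..2} (\<lambda>u. sin (real (h + 2) * arccos (u / 2)))"
      by (intro continuous_intros) auto
    ultimately show "continuous_on {-2..2} F" unfolding F_def by (intro continuous_intros) auto
    fix u :: real assume u: "u \<in> {-2<..<2}"
    define t where "t = arccos (u / 2)"
    have t: "cos t = u / 2" "0 < t" "t < pi" using u arccos_lt_bounded[of "u / 2"] by (auto simp: t_def)
    have st: "sin t > 0" using t by (intro sin_gt_zero) auto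
    have sq: "sqrt (4 - u\<^sup>2) = 2 * sin t"
    proof -
      have u': "u = 2 * cos t" using t(1) by simp
      have "4 - u\<^sup>2 = (2 * sin t)\<^sup>2" by (subst u') (simp add: power_mult_distrib sin_squared_eq algebra_simps)
      then show ?thesis using st by (simp only: real_sqrt_abs)
    qed
    have da: "((\<lambda>u. arccos (u / 2)) has_real_derivative (- 1 / (2 * sin t))) (at u)"
    proof -
      have "sqrt (1 - (u / 2)\<^sup>2) = sin t"
        using sin_arccos[of "u / 2"] u by (simp add: t_def)
      then show ?thesis using u by (auto intro!: derivative_eq_intros simp: field_simps)
    qed
    have "(F has_real_derivative - (cos (real h * t) * (- 1 / (2 * sin t)) - cos (real (h + 2) * t) * (real (h + 2) * (- 1 / (2 * sin t))) / real (h + 2)) / pi) (at u)"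
    proof -
      have d1: "((\<lambda>u. S (arccos (u / 2))) has_real_derivative cos (real h * t) * (- 1 / (2 * sin t))) (at u)"
        using DERIV_chain2[OF dS da] unfolding t_def[symmetric] by blast
      have d2: "((\<lambda>u. sin (real (h + 2) * arccos (u / 2))) has_real_derivative cos (real (h + 2) * t) * (real (h + 2) * (- 1 / (2 * sin t)))) (at u)"
        using DERIV_chain2[OF DERIV_sin DERIV_cmult[OF da, of "real (h + 2)"]] unfolding t_def[symmetric] by blast
      show ?thesis unfolding F_def by (intro DERIV_cdivide DERIV_minus DERIV_diff d1 d2)
    qed
    moreover have "- (cos (real h * t) * (- 1 / (2 * sin t)) - cos (real (h + 2) * t) * (real (h + 2) * (- 1 / (2 * sin t))) / real (h + 2)) / pi
      = cheb h u * (sqrt (4 - u\<^sup>2) / (2 * pi))"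
    proof -
      have "cos (real h * t) - cos (real (h + 2) * t) = 2 * sin (real (Suc h) * t) * sin t"
      proof -
        define a where "a = real (Suc h) * t"
        have e: "real h * t = a - t" "real (h + 2) * t = a + t" by (simp_all add: a_def algebra_simps)
        show ?thesis unfolding e a_def[symmetric] by (simp add: cos_add cos_diff)
      qed
      moreover have "cheb h u * sin t = sin (real (Suc h) * t)" using cheb_sin[of h t] t(1) by simp
      ultimately have "cos (real h * t) - cos (real (h + 2) * t) = 2 * cheb h u * (sin t)\<^sup>2"
        by (simp add: power2_eq_square)
      then have "(cos (real h * t) - cos (real (h + 2) * t)) / (2 * sin t * pi) = cheb h u * sin t / pi"
        using st by (simp add: field_simps power2_eq_square)
      moreover have "- (X * (- 1 / (2 * s)) - Y * (c * (- 1 / (2 * s))) / c) / pi = (X - Y) / (2 * s * pi)"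
        if "s > 0" "c > 0" for X Y c s :: real using that by (simp add: field_simps)
      from this[OF st, of "real (h + 2)"]
      have "- (cos (real h * t) * (- 1 / (2 * sin t)) - cos (real (h + 2) * t) * (real (h + 2) * (- 1 / (2 * sin t))) / real (h + 2)) / pi
        = (cos (real h * t) - cos (real (h + 2) * t)) / (2 * sin t * pi)" by simp
      ultimately show ?thesis unfolding sq by simp
    qed
    ultimately show "(F has_vector_derivative cheb h u * (sqrt (4 - u\<^sup>2) / (2 * pi))) (at u)"
      by (simp only: has_real_derivative_iff_has_vector_derivative)
  qed simp
  moreover have "F 2 - F (-2) = (if h = 0 then 1 else 0)"
  proof -
    \<comment> \<open>At the ends \<open>arccos\<close> takes the values 0 and \<open>pi\<close>,
      where all these sines vanish; only the linear primitive for \<open>h = 0\<close>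
      contributes.\<close>
    have "sin (real (h + 2) * pi) = 0" "sin (real h * pi) = 0" by (rule sin_npi)+
    then show ?thesis by (simp add: F_def S_def del: of_nat_add)
  qed
  ultimately show ?thesis by simp
qed

text \<open>The polynomials \<open>cheb h\<close> with \<open>h > 0\<close> integrate to 0, which
  leaves only the coefficient \<open>dyck_count k 0\<close> of \<open>power_cheb\<close>; the total
  mass is the integral for \<open>h = 0\<close>.\<close>

lemma real_distribution_std_semicircle: "real_distribution std_semicircle"
  and moments_std_semicircle: "integrable std_semicircle (\<lambda>u. u ^ k)"
    "(\<integral>u. u ^ k \<partial>std_semicircle) = dyck_count k 0"
proof -
  let ?d = "\<lambda>u::real. indicator {-2..2} u * (sqrt (4 - u\<^sup>2) / (2 * pi))"
  have dm: "?d \<in> borel_measurable borel" by simp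
  have d0: "?d u \<ge> 0" for u
  proof (cases "u \<in> {-2..2}")
    case True
    then have "u\<^sup>2 \<le> 2\<^sup>2" by (intro power2_le_iff_abs_le[THEN iffD2]) auto
    then show ?thesis using True by simp
  qed simp
  have cont: "continuous_on {-2..2} (\<lambda>u. f u * (sqrt (4 - u\<^sup>2) / (2 * pi)))" if "continuous_on UNIV f" for f :: "real \<Rightarrow> real"
    by (intro continuous_intros continuous_on_subset[OF that]) auto
  have I: "integrable lborel (\<lambda>u. ?d u * f u)" and
    E: "(\<integral>u. ?d u * f u \<partial>lborel) = integral {-2..2} (\<lambda>u. f u * (sqrt (4 - u\<^sup>2) / (2 * pi)))"
    if f: "continuous_on UNIV f" for f :: "real \<Rightarrow> real"
  proof -
    have si: "set_integrable lborel {-2..2} (\<lambda>u. f u * (sqrt (4 - u\<^sup>2) / (2 * pi)))"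
      by (intro borel_integrable_atLeastAtMost' cont f)
    have e: "?d u * f u = indicator {-2..2} u *\<^sub>R (f u * (sqrt (4 - u\<^sup>2) / (2 * pi)))" for u by simp
    show "integrable lborel (\<lambda>u. ?d u * f u)" using si unfolding e set_integrable_def .
    show "(\<integral>u. ?d u * f u \<partial>lborel) = integral {-2..2} (\<lambda>u. f u * (sqrt (4 - u\<^sup>2) / (2 * pi)))"
      using set_borel_integral_eq_integral(2)[OF si] unfolding e set_lebesgue_integral_def .
  qed
  have eq: "std_semicircle = density lborel ?d" by (simp add: std_semicircle_def)
  have mass: "emeasure std_semicircle UNIV = 1"
  proof -
    have "emeasure std_semicircle UNIV = (\<integral>\<^sup>+u. ennreal (?d u) \<partial>lborel)"
      unfolding eq by (subst emeasure_density) auto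
    also have "\<dots> = ennreal (\<integral>u. ?d u * 1 \<partial>lborel)"
      using nn_integral_eq_integral[OF I[of "\<lambda>_. 1"]] d0 by simp
    also have "(\<integral>u. ?d u * 1 \<partial>lborel) = 1"
    proof -
      have "integral {-2..2} (\<lambda>u. 1 * (sqrt (4 - u\<^sup>2) / (2 * pi))) = 1"
        using integral_unique[OF has_integral_cheb[of 0]] by (simp only: cheb.simps simp_thms if_True)
      then show ?thesis using E[of "\<lambda>_. 1"] by (simp only: continuous_on_const)
    qed
    finally show ?thesis by simp
  qed
  show "real_distribution std_semicircle"
    unfolding real_distribution_def real_distribution_axioms_def using mass
    by (auto simp: std_semicircle_def intro!: prob_spaceI)
  show "integrable std_semicircle (\<lambda>u. u ^ k)"
  proof -
    have "continuous_on UNIV (\<lambda>u::real. u ^ k)" by (intro continuous_intros)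
    from I[OF this] show ?thesis unfolding eq by (subst integrable_real_density) (use d0 in auto)
  qed
  have "(\<integral>u. u ^ k \<partial>std_semicircle) = (\<integral>u. ?d u * u ^ k \<partial>lborel)"
    unfolding eq by (subst integral_real_density) (use d0 in auto)
  also have "\<dots> = integral {-2..2} (\<lambda>u. u ^ k * (sqrt (4 - u\<^sup>2) / (2 * pi)))"
    by (rule E) (intro continuous_intros)
  also have "\<dots> = dyck_count k 0"
  proof (rule integral_unique)
    have "((\<lambda>u. \<Sum>h\<le>k. real (dyck_count k h) * (cheb h u * (sqrt (4 - u\<^sup>2) / (2 * pi)))) has_integral (\<Sum>h\<le>k. real (dyck_count k h) * (if h = 0 then 1 else 0))) {-2..2}"
      by (intro has_integral_sum has_integral_mult_right has_integral_cheb) auto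
    also have "(\<Sum>h\<le>k. real (dyck_count k h) * (if h = 0 then 1 else 0)) = dyck_count k 0"
      by (simp add: sum.If_cases if_distrib cong: if_cong)
    finally show "((\<lambda>u. u ^ k * (sqrt (4 - u\<^sup>2) / (2 * pi))) has_integral real (dyck_count k 0)) {-2..2}"
      by (simp only: power_cheb sum_distrib_right mult.assoc)
  qed
  finally show "(\<integral>u. u ^ k \<partial>std_semicircle) = dyck_count k 0" .
qed

section \<open>Trees traversed twice\<close>

lemma cross_mono: "r \<le> s \<Longrightarrow> cross k p e r \<le> cross k p e s"
  unfolding cross_def by (rule card_mono) auto

definition double_trees :: "nat \<Rightarrow> (nat \<Rightarrow> nat) set" where
  "double_trees k = {p \<in> patterns k. treelike k p \<and> (\<forall>v\<in>nonroots k p. mult k p (disc p v) = 2)}"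

text \<open>Appends the return to the root, turning a cyclic walk with \<open>k\<close> positions
  into a path with \<open>k\<close> steps.\<close>

definition close_walk :: "nat \<Rightarrow> (nat \<Rightarrow> nat) \<Rightarrow> nat \<Rightarrow> nat" where
  "close_walk k p = (\<lambda>s\<in>{..k}. if s = k then 0 else p s)"

text \<open>Suppose a step from a parent to its child is not the discovery of the child. With the
  walk again at the parent, the count of crossings has grown by an even positive number since before
  the discovery, so this step would be at least the third crossing.\<close>

lemma close_walk_dyck:
  assumes p: "p \<in> double_trees k" and k: "k > 0"
  shows "close_walk k p \<in> dyck k"
proof -
  let ?q = "close_walk k p"
  have pp: "p \<in> patterns k" and t: "treelike k p" and m: "\<And>v. v \<in> nonroots k p \<Longrightarrow> mult k p (disc p v) = 2"
    using p by (auto simp: double_trees_def)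
  note z = zero_in_verts[OF pp k]
  have "?q (Suc s) = Suc s \<or> (?q s > 0 \<and> ?q (Suc s) = parent ?q (?q s))" if s: "s < k" for s
  proof -
    have qs: "?q s = p s" using s by (simp add: close_walk_def)
    have qS: "?q (Suc s) = p (Suc s mod k)" using s z by (cases "Suc s = k") (auto simp: close_walk_def)
    obtain v where v: "v \<in> nonroots k p" and sv: "step k p s = disc p v" using t s unfolding treelike_def by blast
    note vd = patternsD(4-8)[OF pp, of v]
    from sv consider "p s = parent p v" "?q (Suc s) = v" | "p s = v" "?q (Suc s) = parent p v"
      by (auto simp: step_def ed_eq_iff qS)
    then show ?thesis
    proof cases
      case 1
      have "v = p (Suc s mod k)" using 1 qS by simp
      also have "\<dots> \<le> Suc s" using patternsD(1)[OF pp, of "Suc s mod k"] k by (meson le_trans mod_less_divisor mod_less_eq_dividend)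
      finally have le: "v \<le> Suc s" .
      have "v = Suc s"
      proof (rule ccontr)
        assume "v \<noteq> Suc s"
        then have vs: "v \<le> s" using le by simp
        let ?e = "disc p v"
        have c1: "cross k p ?e v = Suc (cross k p ?e (v - 1))"
          using cross_Suc[of k p ?e "v - 1"] vd v step_discovery[OF pp v] by simp
        have "even (cross k p ?e s) \<longleftrightarrow> even (cross k p ?e (p s))"
          using cross_parity[OF pp t, of s ?e] s k by simp
        moreover have "even (cross k p ?e (v - 1)) \<longleftrightarrow> even (cross k p ?e (p (v - 1)))"
          using cross_parity[OF pp t, of "v - 1" ?e] k vd v by simp
        moreover have "cross k p ?e v \<le> cross k p ?e s" by (rule cross_mono[OF vs])
        ultimately have "even (cross k p ?e s) \<longleftrightarrow> even (cross k p ?e (v - 1))" "Suc (cross k p ?e (v - 1)) \<le> cross k p ?e s"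
          using 1 c1 by simp_all
        moreover from this have "cross k p ?e s \<noteq> Suc (cross k p ?e (v - 1))" by auto
        ultimately have "cross k p ?e s \<ge> 2" by linarith
        then have "cross k p ?e (Suc s) \<ge> 3" using cross_Suc[of k p ?e s] sv by simp
        moreover have "cross k p ?e (Suc s) \<le> cross k p ?e k" by (rule cross_mono) (use s in simp)
        ultimately show False using m[OF v] by (simp add: mult_cross)
      qed
      then show ?thesis using 1 by simp
    next
      case 2
      have "v - 1 < k" "v > 0" using vd v by auto
      then have "parent ?q (?q s) = parent p v" using 2 qs by (simp add: close_walk_def)
      then show ?thesis using 2 qs \<open>v > 0\<close> by simp
    qed
  qed
  moreover have "?q 0 = 0" using z k by (simp add: close_walk_def)
  moreover have "?q \<in> extensional {..k}" by (simp add: close_walk_def)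
  ultimately show ?thesis by (auto simp: dyck_def)
qed

text \<open>The edge above \<open>v\<close> is crossed only by the discovery of \<open>v\<close> and
  by returns from \<open>v\<close>. A return happens while the walk is at \<open>v\<close>, where
  the count is odd, so the count never exceeds 2; being even and positive at the end, it is
  2.\<close>

lemma dyck_double_tree:
  assumes q: "q \<in> dyck k" and h: "height q k = 0" and k: "k > 0"
  shows "restrict q {..<k} \<in> double_trees k"
proof -
  define p where "p = restrict q {..<k}"
  have pe: "p s = q s" if "s < k" for s using that by (simp add: p_def)
  note dq = dyckD[OF q]
  have qk: "q k = 0" using dq(4)[of k] h by simp
  have q0: "q 0 = 0" using q by (simp add: dyck_def)
  have pp: "p \<in> patterns k"
  proof -
    have "q s \<le> s \<and> q (q s) = q s \<and> q s < k" if "s < k" for s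
      using dq(1,2)[of s] that by auto
    then have "\<forall>s<k. p s \<le> s \<and> p (p s) = p s \<and> p s < k" using pe by simp
    moreover from this have "p \<in> PiE {..<k} (\<lambda>_. {..<k})"
      by (intro PiE_I) (simp_all add: p_def)
    ultimately show ?thesis unfolding patterns_def by blast
  qed
  have nx: "p (Suc s mod k) = q (Suc s)" if "s < k" for s
    using that qk q0 k pe by (cases "Suc s = k") auto
  have q: "q (Suc s) = Suc s \<or> (q s > 0 \<and> q (Suc s) = parent q (q s))" if "s < k" for s
    using q that by (auto simp: dyck_def)
  have up: "Suc s \<in> nonroots k p \<and> step k p s = disc p (Suc s)" if "s < k" "q (Suc s) = Suc s" for s
  proof -
    have "Suc s < k" using that qk by (cases "Suc s = k") auto
    then have "Suc s \<in> verts k p" using that pe by (metis imageI lessThan_iff)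
    then show ?thesis using that nx[OF that(1)] pe[OF that(1)] by (simp add: step_def)
  qed
  have down: "q s \<in> nonroots k p \<and> step k p s = disc p (q s)" if "s < k" "q (Suc s) \<noteq> Suc s" for s
  proof -
    have "q s > 0" "q (Suc s) = parent q (q s)" using q[OF that(1)] that(2) by auto
    moreover have "q s \<le> s" using dq(1)[of s] that by simp
    moreover have "q s \<in> verts k p" using that pe by (metis imageI lessThan_iff)
    moreover have "p (q s - 1) = q (q s - 1)" using \<open>q s \<le> s\<close> that by (intro pe) simp
    ultimately show ?thesis using that nx[OF that(1)] pe[OF that(1)] by (simp add: step_def ed_commute)
  qed
  have t: "treelike k p" unfolding treelike_def using up down by blast
  have "mult k p (disc p v) = 2" if v: "v \<in> nonroots k p" for v
  proof -
    let ?e = "disc p v"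
    note vd = patternsD(4-8)[OF pp, of v]
    have inj: "u = v" if "u \<in> nonroots k p" "disc p u = ?e" for u
      using inj_on_disc[OF pp] that v by (auto dest: inj_onD)
    have which: "(q (Suc r) = Suc r \<and> r = v - 1) \<or> (q (Suc r) \<noteq> Suc r \<and> q r = v)" if "r < k" "step k p r = ?e" for r
    proof (cases "q (Suc r) = Suc r")
      case True
      then have "Suc r = v" using up[OF that(1)] inj[of "Suc r"] that(2) by metis
      then show ?thesis using True by simp
    next
      case False
      then show ?thesis using down[OF that(1)] inj[of "q r"] that(2) by metis
    qed
    have "{r. r < v - 1 \<and> step k p r = ?e} = {}"
    proof -
      have "step k p r \<noteq> ?e" if "r < v - 1" for r
        using which[of r] that vd v dq(1)[of r] by auto
      then show ?thesis by auto
    qed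
    then have c0: "cross k p ?e (v - 1) = 0" by (simp add: cross_def)
    have c1: "cross k p ?e v = 1"
      using cross_Suc[of k p ?e "v - 1"] vd v step_discovery[OF pp v] c0 by simp
    have vk: "v \<le> k" using vd v by auto
    have "1 \<le> cross k p ?e s \<and> cross k p ?e s \<le> 2" if "v \<le> s" "s \<le> k" for s
      using that
    proof (induction s rule: dec_induct)
      case base
      then show ?case using c1 by simp
    next
      case (step s)
      then have IH: "1 \<le> cross k p ?e s" "cross k p ?e s \<le> 2" and s: "s < k" by auto
      show ?case
      proof (cases "step k p s = ?e")
        case True
        have "s \<noteq> v - 1" using step vd v by auto
        then have "q s = v" using which[OF s True] by blast
        then have "even (cross k p ?e s) \<longleftrightarrow> even (cross k p ?e v)"
          using cross_parity[OF pp t, of s ?e] s k pe[OF s] by simp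
        then have "odd (cross k p ?e s)" using c1 by simp
        then have "cross k p ?e s = 1" using IH by (cases "cross k p ?e s = 2") auto
        then show ?thesis using cross_Suc[of k p ?e s] True by simp
      next
        case False
        then show ?thesis using cross_Suc[of k p ?e s] IH by simp
      qed
    qed
    from this[OF vk order.refl] have "1 \<le> mult k p ?e" "mult k p ?e \<le> 2" by (auto simp: mult_cross)
    moreover have "even (mult k p ?e)" by (rule treelike_mult_even[OF pp t k])
    ultimately show ?thesis by (cases "mult k p ?e = 1") auto
  qed
  then show ?thesis using pp t unfolding p_def[symmetric] by (simp add: double_trees_def)
qed

lemma card_double_trees:
  assumes k: "k > 0" shows "card (double_trees k) = dyck_count k 0"
proof -
  have "bij_betw (close_walk k) (double_trees k) {q \<in> dyck k. height q k = 0}"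
  proof (rule bij_betw_byWitness[where f' = "\<lambda>q. restrict q {..<k}"])
    show "\<forall>p\<in>double_trees k. restrict (close_walk k p) {..<k} = p"
      by (auto simp: double_trees_def patterns_def close_walk_def PiE_def extensional_def restrict_def fun_eq_iff)
    show "\<forall>q\<in>{q \<in> dyck k. height q k = 0}. close_walk k (restrict q {..<k}) = q"
    proof
      fix q assume q: "q \<in> {q \<in> dyck k. height q k = 0}"
      then have "q k = 0" using dyckD(4)[of q k k] by simp
      then show "close_walk k (restrict q {..<k}) = q"
        using q by (auto simp: close_walk_def dyck_def extensional_def restrict_def fun_eq_iff)
    qed
    show "close_walk k ` double_trees k \<subseteq> {q \<in> dyck k. height q k = 0}"
    proof
      fix q assume "q \<in> close_walk k ` double_trees k"
      then obtain p where p: "p \<in> double_trees k" "q = close_walk k p" by auto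
      have d: "q \<in> dyck k" using close_walk_dyck[OF p(1) k] p(2) by simp
      have "q k = 0" by (simp add: p(2) close_walk_def)
      then show "q \<in> {q \<in> dyck k. height q k = 0}" using d dyckD(4)[OF d, of k] by simp
    qed
    show "(\<lambda>q. restrict q {..<k}) ` {q \<in> dyck k. height q k = 0} \<subseteq> double_trees k"
      using dyck_double_tree k by auto
  qed
  then show ?thesis unfolding dyck_count_def by (rule bij_betw_same_card)
qed

lemma card_nonroots_double_tree:
  assumes p: "p \<in> double_trees k" shows "2 * card (nonroots k p) = k"
proof -
  have pp: "p \<in> patterns k" and t: "treelike k p" using p by (auto simp: double_trees_def)
  have "k = (\<Sum>e\<in>step k p ` {..<k}. mult k p e)" by (rule sum_mult[symmetric])
  also have "\<dots> = (\<Sum>v\<in>nonroots k p. mult k p (disc p v))"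
  proof -
    have im: "step k p ` {..<k} = disc p ` nonroots k p" using treelike_iff[OF pp] t by blast
    show ?thesis unfolding im by (subst sum.reindex[OF inj_on_disc[OF pp]]) simp
  qed
  also have "\<dots> = (\<Sum>v\<in>nonroots k p. 2)" using p by (intro sum.cong refl) (auto simp: double_trees_def)
  finally show ?thesis by simp
qed

section \<open>Riemann sums\<close>

definition cell :: "nat \<Rightarrow> nat \<Rightarrow> nat \<Rightarrow> (real \<times> real) set" where
  "cell N i j = cbox ((real i - 1) / N, (real j - 1) / N) (real i / N, real j / N)"

text \<open>The upper right corners of the cells: with indices from 1 these are the points
  \<open>(i/n, j/n)\<close> at which the moments are prescribed.\<close>

definition grid :: "nat \<Rightarrow> nat \<Rightarrow> nat \<Rightarrow> real \<times> real" where
  "grid N i j = (real i / N, real j / N)"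

definition cell_osc :: "(real \<times> real \<Rightarrow> real) \<Rightarrow> nat \<Rightarrow> nat \<Rightarrow> nat \<Rightarrow> real" where
  "cell_osc f N i j = (SUP p\<in>cell N i j. f p) - (INF p\<in>cell N i j. f p)"

text \<open>The gap between the upper and the lower Darboux sum on the uniform mesh.\<close>

definition osc :: "(real \<times> real \<Rightarrow> real) \<Rightarrow> nat \<Rightarrow> real" where
  "osc f N = (\<Sum>i=1..N. \<Sum>j=1..N. cell_osc f N i j) / (real N)\<^sup>2"

lemma mem_cell: "(u, v) \<in> cell N i j \<longleftrightarrow> (real i - 1) / N \<le> u \<and> u \<le> real i / N \<and> (real j - 1) / N \<le> v \<and> v \<le> real j / N"
  by (auto simp: cell_def cbox_Pair_eq)

lemma cell_subset: "N > 0 \<Longrightarrow> i \<in> {1..N} \<Longrightarrow> j \<in> {1..N} \<Longrightarrow> cell N i j \<subseteq> unit_square"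
proof
  fix p assume N: "N > 0" and i: "i \<in> {1..N}" and j: "j \<in> {1..N}" and p: "p \<in> cell N i j"
  obtain u v where uv: "p = (u, v)" by (cases p) auto
  have "0 \<le> (real i - 1) / N" "real i / N \<le> 1" "0 \<le> (real j - 1) / N" "real j / N \<le> 1" using N i j by auto
  then have "0 \<le> u" "u \<le> 1" "0 \<le> v" "v \<le> 1" using p unfolding uv mem_cell by linarith+
  then show "p \<in> unit_square" by (simp add: uv cbox_Pair_eq)
qed

lemma grid_in_cell: "N > 0 \<Longrightarrow> grid N i j \<in> cell N i j"
  by (auto simp: grid_def mem_cell divide_right_mono)

lemma cell_bounds:
  fixes f :: "real \<times> real \<Rightarrow> real"
  assumes b: "bounded (f ` unit_square)" and c: "N > 0" "i \<in> {1..N}" "j \<in> {1..N}"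
  shows "bdd_above (f ` cell N i j)" "bdd_below (f ` cell N i j)" "cell N i j \<noteq> {}"
  using bounded_imp_bdd_above[OF bounded_subset[OF b image_mono[OF cell_subset[OF c]]]]
    bounded_imp_bdd_below[OF bounded_subset[OF b image_mono[OF cell_subset[OF c]]]] grid_in_cell[OF c(1), of i j] by auto

lemma cell_osc_bound:
  fixes f :: "real \<times> real \<Rightarrow> real"
  assumes b: "bounded (f ` unit_square)" and c: "N > 0" "i \<in> {1..N}" "j \<in> {1..N}"
    and pq: "p \<in> cell N i j" "q \<in> cell N i j"
  shows "\<bar>f p - f q\<bar> \<le> cell_osc f N i j"
proof -
  note cb = cell_bounds[OF b c]
  have "f p \<le> (SUP p\<in>cell N i j. f p)" "f q \<le> (SUP p\<in>cell N i j. f p)" using cb(1) pq by (auto intro: cSUP_upper)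
  moreover have "(INF p\<in>cell N i j. f p) \<le> f p" "(INF p\<in>cell N i j. f p) \<le> f q" using cb(2) pq by (auto intro: cINF_lower)
  ultimately show ?thesis unfolding cell_osc_def by linarith
qed

lemma cell_osc_nonneg:
  fixes f :: "real \<times> real \<Rightarrow> real"
  assumes b: "bounded (f ` unit_square)" and c: "N > 0" "i \<in> {1..N}" "j \<in> {1..N}"
  shows "cell_osc f N i j \<ge> 0"
  using cell_osc_bound[OF assms grid_in_cell grid_in_cell] c by auto

lemma osc_nonneg: "bounded (f ` unit_square) \<Longrightarrow> osc f N \<ge> 0"
  unfolding osc_def by (cases "N = 0") (auto intro!: divide_nonneg_nonneg sum_nonneg cell_osc_nonneg)

lemma content_cell: "N > 0 \<Longrightarrow> measure lborel (cell N i j) = 1 / (real N)\<^sup>2"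
  unfolding cell_def by (simp add: content_Pair power2_eq_square divide_right_mono diff_divide_distrib)

lemma cell_inj:
  assumes "N > 0" "cell N i j = cell N i' j'" shows "i = i' \<and> j = j'"
proof -
  have "(real i / N, real j / N) \<in> cell N i' j'" "(real i' / N, real j' / N) \<in> cell N i j"
    using grid_in_cell[OF assms(1), of i j] grid_in_cell[OF assms(1), of i' j'] assms(2) by (auto simp: grid_def)
  then show ?thesis using assms(1) by (auto simp: mem_cell divide_right_mono divide_le_cancel)
qed

lemma exists_cell_index:
  assumes "N > 0" "0 \<le> u" "u \<le> 1"
  shows "\<exists>i\<in>{1..N}. (real i - 1) / N \<le> u \<and> u \<le> real i / N"
proof (cases "u = 0")
  case True
  then show ?thesis using assms by (intro bexI[of _ 1]) auto
next
  case False
  define i where "i = nat \<lceil>real N * u\<rceil>"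
  have p: "real N * u > 0" using assms False by simp
  have i: "real i - 1 < real N * u" "real N * u \<le> real i" using p unfolding i_def by linarith+
  have "\<lceil>real N * u\<rceil> \<le> int N" using assms by (intro ceiling_le) (simp add: mult_left_le)
  then have "i \<le> N" unfolding i_def by (simp only: nat_le_iff)
  moreover have "i \<ge> 1" using p i by (cases i) auto
  ultimately show ?thesis using i assms by (intro bexI[of _ i]) (auto simp: field_simps)
qed

lemma cells_division:
  assumes N: "N > 0" and p: "\<And>i j. i \<in> {1..N} \<Longrightarrow> j \<in> {1..N} \<Longrightarrow> p i j \<in> cell N i j"
  shows "(\<lambda>(i,j). (p i j, cell N i j)) ` ({1..N} \<times> {1..N}) tagged_division_of unit_square"
proof (rule tagged_division_ofI)
  fix x K assume xK: "(x, K) \<in> (\<lambda>(i,j). (p i j, cell N i j)) ` ({1..N} \<times> {1..N})"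
  then obtain i j where ij: "i \<in> {1..N}" "j \<in> {1..N}" "x = p i j" "K = cell N i j" by auto
  show "x \<in> K" using p ij by simp
  show "K \<subseteq> unit_square" using cell_subset[OF N] ij by simp
  show "\<exists>a b. K = cbox a b" using ij by (auto simp: cell_def)
  fix x' K' assume xK': "(x', K') \<in> (\<lambda>(i,j). (p i j, cell N i j)) ` ({1..N} \<times> {1..N})" and ne: "(x, K) \<noteq> (x', K')"
  from xK' obtain i' j' where ij': "i' \<in> {1..N}" "j' \<in> {1..N}" "x' = p i' j'" "K' = cell N i' j'" by auto
  show "interior K \<inter> interior K' = {}"
  proof (rule ccontr)
    assume "interior K \<inter> interior K' \<noteq> {}"
    then obtain u v where "(u, v) \<in> interior K" "(u, v) \<in> interior K'" by auto
    then have uv: "(real i - 1) / N < u" "u < real i / N" "(real j - 1) / N < v" "v < real j / N"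
        "(real i' - 1) / N < u" "u < real i' / N" "(real j' - 1) / N < v" "v < real j' / N"
      unfolding ij(4) ij'(4) cell_def cbox_Pair_eq interior_Times interior_cbox by auto
    have "(real i - 1) / N < real i' / N" "(real i' - 1) / N < real i / N" "(real j - 1) / N < real j' / N" "(real j' - 1) / N < real j / N"
      using uv by linarith+
    then have "i = i'" "j = j'" using N by (auto simp: divide_less_cancel)
    then show False using ne ij ij' by simp
  qed
next
  show "\<Union> {K. \<exists>x. (x, K) \<in> (\<lambda>(i,j). (p i j, cell N i j)) ` ({1..N} \<times> {1..N})} = unit_square"
  proof
    show "\<Union> {K. \<exists>x. (x, K) \<in> (\<lambda>(i,j). (p i j, cell N i j)) ` ({1..N} \<times> {1..N})} \<subseteq> unit_square"
      using cell_subset[OF N] by fastforce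
    show "unit_square \<subseteq> \<Union> {K. \<exists>x. (x, K) \<in> (\<lambda>(i,j). (p i j, cell N i j)) ` ({1..N} \<times> {1..N})}"
    proof
      fix z :: "real \<times> real" assume "z \<in> unit_square"
      then obtain u v where z: "z = (u, v)" "0 \<le> u" "u \<le> 1" "0 \<le> v" "v \<le> 1" by (cases z) (auto simp: cbox_Pair_eq)
      obtain i j where "i \<in> {1..N}" "j \<in> {1..N}" "z \<in> cell N i j"
        using exists_cell_index[OF N z(2,3)] exists_cell_index[OF N z(4,5)] z(1) by (auto simp: mem_cell)
      then show "z \<in> \<Union> {K. \<exists>x. (x, K) \<in> (\<lambda>(i,j). (p i j, cell N i j)) ` ({1..N} \<times> {1..N})}"
      proof (intro UnionI[of "cell N i j"] CollectI exI)
        show "(p i j, cell N i j) \<in> (\<lambda>(i,j). (p i j, cell N i j)) ` ({1..N} \<times> {1..N})"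
          by (rule image_eqI[of _ _ "(i, j)"]) (use \<open>i \<in> {1..N}\<close> \<open>j \<in> {1..N}\<close> in auto)
      qed
    qed
  qed
qed simp

lemma cell_subset_ball:
  assumes N: "N > 0" and d: "2 / real N < d" and p: "p \<in> cell N i j"
  shows "cell N i j \<subseteq> ball p d"
proof
  fix q assume q: "q \<in> cell N i j"
  obtain a b u v where pq: "p = (a, b)" "q = (u, v)" by (cases p, cases q) auto
  have "\<bar>a - u\<bar> \<le> 1 / N" "\<bar>b - v\<bar> \<le> 1 / N" using p q unfolding pq mem_cell by (auto simp: diff_divide_distrib)
  moreover have "dist p q \<le> \<bar>a - u\<bar> + \<bar>b - v\<bar>"
    unfolding pq dist_Pair_Pair dist_real_def by (rule order_trans[OF sqrt_sum_squares_le_sum_abs]) simp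
  ultimately have "dist p q \<le> 2 / N" by simp
  then show "q \<in> ball p d" using d by simp
qed

text \<open>Tags close to the supremum and tags close to the infimum of each cell both give sums
  close to the integral, so the Darboux gap is small.\<close>

lemma Riemann_integrable_osc:
  assumes b: "bounded (f ` unit_square)" and R: "Riemann_integrable_cbox f (0, 0) (1, 1)"
  shows "osc f \<longlonglongrightarrow> 0"
proof (rule LIMSEQ_I)
  fix r :: real assume r: "r > 0"
  \<comment> \<open>Two choices of tags and two Riemann sums cost less than \<open>4 * e\<close>
    together.\<close>
  define e where "e = r / 5"
  have e: "e > 0" using r by (simp add: e_def)
  obtain I where "\<forall>e>0. \<exists>d>0. \<forall>D. D tagged_division_of unit_square \<and> (\<lambda>u. ball u d) fine D \<longrightarrow>
        \<bar>(\<Sum>(u, K)\<in>D. measure lborel K * f u) - I\<bar> < e"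
    using R unfolding Riemann_integrable_cbox_def by blast
  then obtain d where d: "d > 0" and D: "\<And>D. D tagged_division_of unit_square \<Longrightarrow> (\<lambda>u. ball u d) fine D \<Longrightarrow>
        \<bar>(\<Sum>(u, K)\<in>D. measure lborel K * f u) - I\<bar> < e" by (metis e)
  obtain N0 where N0: "2 / d < real N0" using reals_Archimedean2 by blast
  have "norm (osc f N - 0) < r" if N: "N \<ge> N0" for N
  proof -
    have "2 / d < real N" using N N0 by linarith
    then have Npos: "N > 0" using d by (intro gr0I) (auto simp: field_simps)
    then have Nd: "2 / real N < d" using \<open>2 / d < real N\<close> d by (simp add: field_simps)
    have avg: "\<bar>(\<Sum>i=1..N. \<Sum>j=1..N. f (p i j)) / (real N)\<^sup>2 - I\<bar> < e"
      if p: "\<And>i j. i \<in> {1..N} \<Longrightarrow> j \<in> {1..N} \<Longrightarrow> p i j \<in> cell N i j" for p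
    proof -
      let ?F = "\<lambda>(i,j). (p i j, cell N i j)"
      have inj: "inj_on ?F ({1..N} \<times> {1..N})" using cell_inj[OF Npos] by (auto simp: inj_on_def)
      have "(\<Sum>(u, K)\<in>?F ` ({1..N} \<times> {1..N}). measure lborel K * f u) = (\<Sum>i=1..N. \<Sum>j=1..N. f (p i j)) / (real N)\<^sup>2"
        by (subst sum.reindex[OF inj])
           (simp add: case_prod_beta content_cell[OF Npos] sum.cartesian_product sum_divide_distrib)
      moreover have "(\<lambda>u. ball u d) fine ?F ` ({1..N} \<times> {1..N})"
        using cell_subset_ball[OF Npos Nd p] by (auto simp: fine_def)
      ultimately show ?thesis using D[OF cells_division[OF Npos p]] by simp
    qed
    have "\<exists>p\<in>cell N i j. (SUP p\<in>cell N i j. f p) - e < f p" if "i \<in> {1..N}" "j \<in> {1..N}" for i j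
      using less_cSUP_iff[OF cell_bounds(3)[OF b Npos that] cell_bounds(1)[OF b Npos that], of "(SUP p\<in>cell N i j. f p) - e"] e by auto
    then obtain p where p: "\<And>i j. i \<in> {1..N} \<Longrightarrow> j \<in> {1..N} \<Longrightarrow> p i j \<in> cell N i j \<and> (SUP p\<in>cell N i j. f p) - e < f (p i j)"
      by metis
    have "\<exists>p\<in>cell N i j. f p < (INF p\<in>cell N i j. f p) + e" if "i \<in> {1..N}" "j \<in> {1..N}" for i j
      using cINF_less_iff[OF cell_bounds(3)[OF b Npos that] cell_bounds(2)[OF b Npos that], of "(INF p\<in>cell N i j. f p) + e"] e by auto
    then obtain q where q: "\<And>i j. i \<in> {1..N} \<Longrightarrow> j \<in> {1..N} \<Longrightarrow> q i j \<in> cell N i j \<and> f (q i j) < (INF p\<in>cell N i j. f p) + e"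
      by metis
    have "(\<Sum>i=1..N. \<Sum>j=1..N. cell_osc f N i j) \<le> (\<Sum>i=1..N. \<Sum>j=1..N. (f (p i j) - f (q i j)) + 2 * e)"
      by (intro sum_mono) (use p q in \<open>force simp: cell_osc_def\<close>)
    also have "\<dots> = (\<Sum>i=1..N. \<Sum>j=1..N. f (p i j)) - (\<Sum>i=1..N. \<Sum>j=1..N. f (q i j)) + (real N)\<^sup>2 * (2 * e)"
      by (simp add: sum.distrib sum_subtractf power2_eq_square)
    finally have "osc f N \<le> ((\<Sum>i=1..N. \<Sum>j=1..N. f (p i j)) - (\<Sum>i=1..N. \<Sum>j=1..N. f (q i j)) + (real N)\<^sup>2 * (2 * e)) / (real N)\<^sup>2"
      unfolding osc_def by (rule divide_right_mono) simp
    also have "\<dots> = (\<Sum>i=1..N. \<Sum>j=1..N. f (p i j)) / (real N)\<^sup>2 - (\<Sum>i=1..N. \<Sum>j=1..N. f (q i j)) / (real N)\<^sup>2 + 2 * e"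
      using Npos by (simp add: add_divide_distrib diff_divide_distrib)
    also have "\<dots> < 4 * e" using avg[of p] avg[of q] p q by force
    also have "4 * e < r" using r by (simp add: e_def)
    finally show ?thesis using osc_nonneg[OF b, of N] by simp
  qed
  then show "\<exists>no. \<forall>n\<ge>no. norm (osc f n - 0) < r" by blast
qed

text \<open>A uniform error \<open>d\<close> changes each cell oscillation, and hence the Darboux
  gap, by at most \<open>2 * d\<close>. In this form Riemann integrability passes from the functions
  \<open>g r n\<close> to \<open>G r\<close>.\<close>

lemma osc_uniform_limit:
  assumes b: "\<And>n. n \<ge> 1 \<Longrightarrow> bounded (g n ` unit_square)" and R: "\<And>n. n \<ge> 1 \<Longrightarrow> osc (g n) \<longlonglongrightarrow> 0"
    and u: "uniform_limit unit_square g f sequentially"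
  shows "bounded (f ` unit_square)" "osc f \<longlonglongrightarrow> 0"
proof -
  have close: "\<exists>n\<ge>1. \<forall>p\<in>unit_square. \<bar>g n p - f p\<bar> < e" if "e > 0" for e
  proof -
    have "\<forall>\<^sub>F n in sequentially. n \<ge> 1 \<and> (\<forall>p\<in>unit_square. dist (g n p) (f p) < e)"
      using uniform_limitD[OF u that] eventually_ge_at_top[of 1] by eventually_elim auto
    then show ?thesis using eventually_happens[of _ sequentially] by (auto simp: dist_real_def)
  qed
  show bf: "bounded (f ` unit_square)"
  proof -
    obtain n where n: "n \<ge> 1" "\<forall>p\<in>unit_square. \<bar>g n p - f p\<bar> < 1" using close[of 1] by auto
    obtain B where B: "\<forall>p\<in>unit_square. \<bar>g n p\<bar> \<le> B" using b[OF n(1)] by (auto simp: bounded_iff)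
    have "\<bar>f p\<bar> \<le> B + 1" if "p \<in> unit_square" for p using n(2) B that by fastforce
    then show ?thesis by (auto intro!: boundedI[of _ "B + 1"])
  qed
  show "osc f \<longlonglongrightarrow> 0"
  proof (rule LIMSEQ_I)
    fix r :: real assume r: "r > 0"
    obtain n where n: "n \<ge> 1" "\<forall>p\<in>unit_square. \<bar>g n p - f p\<bar> < r / 4" using close[of "r / 4"] r by auto
    obtain N0 where N0: "\<And>N. N \<ge> N0 \<Longrightarrow> norm (osc (g n) N - 0) < r / 4"
      using LIMSEQ_D[OF R[OF n(1)], of "r / 4"] r by auto
    have "norm (osc f N - 0) < r" if N: "N \<ge> Suc N0" for N
    proof -
      have Np: "N > 0" using N by simp
      have "cell_osc f N i j \<le> cell_osc (g n) N i j + r / 2" if ij: "i \<in> {1..N}" "j \<in> {1..N}" for i j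
      proof -
        note cf = cell_bounds[OF bf Np ij] and cg = cell_bounds[OF b[OF n(1)] Np ij] and cs = cell_subset[OF Np ij]
        have "(SUP p\<in>cell N i j. f p) \<le> (SUP p\<in>cell N i j. g n p) + r / 4"
        proof (rule cSUP_least[OF cf(3)])
          fix p assume p: "p \<in> cell N i j"
          have "g n p \<le> (SUP p\<in>cell N i j. g n p)" by (rule cSUP_upper[OF p cg(1)])
          moreover have "\<bar>g n p - f p\<bar> < r / 4" using n(2) p cs by blast
          ultimately show "f p \<le> (SUP p\<in>cell N i j. g n p) + r / 4" by linarith
        qed
        moreover have "(INF p\<in>cell N i j. g n p) - r / 4 \<le> (INF p\<in>cell N i j. f p)"
        proof (rule cINF_greatest[OF cf(3)])
          fix p assume p: "p \<in> cell N i j"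
          have "(INF p\<in>cell N i j. g n p) \<le> g n p" by (rule cINF_lower[OF cg(2) p])
          moreover have "\<bar>g n p - f p\<bar> < r / 4" using n(2) p cs by blast
          ultimately show "(INF p\<in>cell N i j. g n p) - r / 4 \<le> f p" by linarith
        qed
        ultimately show ?thesis unfolding cell_osc_def by linarith
      qed
      then have "(\<Sum>i=1..N. \<Sum>j=1..N. cell_osc f N i j) \<le> (\<Sum>i=1..N. \<Sum>j=1..N. cell_osc (g n) N i j + r / 2)"
        by (intro sum_mono) auto
      also have "\<dots> = (\<Sum>i=1..N. \<Sum>j=1..N. cell_osc (g n) N i j) + (real N)\<^sup>2 * (r / 2)"
        by (simp add: sum.distrib power2_eq_square)
      finally have "osc f N \<le> ((\<Sum>i=1..N. \<Sum>j=1..N. cell_osc (g n) N i j) + (real N)\<^sup>2 * (r / 2)) / (real N)\<^sup>2"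
        unfolding osc_def by (rule divide_right_mono) simp
      also have "\<dots> = osc (g n) N + r / 2" using Np by (simp add: osc_def add_divide_distrib)
      also have "\<dots> < r" using N0[of N] N r by simp
      finally show ?thesis using osc_nonneg[OF bf, of N] by simp
    qed
    then show "\<exists>no. \<forall>n\<ge>no. norm (osc f n - 0) < r" by blast
  qed
qed

section \<open>Riemann sums along trees\<close>

text \<open>A Riemann sum in \<open>card V\<close> variables for a product along a graph, the edge
  \<open>e\<close> joining the variables \<open>a e\<close> and \<open>b e\<close>: a discretised
  homomorphism density.\<close>

definition gsum :: "nat set \<Rightarrow> nat set \<Rightarrow> (nat \<Rightarrow> nat) \<Rightarrow> (nat \<Rightarrow> nat) \<Rightarrow> (nat \<Rightarrow> real \<times> real \<Rightarrow> real) \<Rightarrow> nat \<Rightarrow> real" where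
  "gsum V E a b H n = (\<Sum>\<phi>\<in>PiE V (\<lambda>_. {1..n}). \<Prod>e\<in>E. H e (grid n (\<phi> (a e)) (\<phi> (b e)))) / real n ^ card V"

text \<open>\<open>q\<close> is \<open>n\<close>-to-one, so each coarse labelling has
  \<open>n ^ card V\<close> preimages.\<close>

lemma sum_PiE_comp:
  fixes F :: "(nat \<Rightarrow> nat) \<Rightarrow> real"
  assumes V: "finite V" and A: "finite A" and B: "finite B" and q: "q \<in> A \<rightarrow> B"
    and fib: "\<And>c. c \<in> B \<Longrightarrow> card {i \<in> A. q i = c} = n"
  shows "(\<Sum>\<phi>\<in>PiE V (\<lambda>_. A). F (\<lambda>v\<in>V. q (\<phi> v))) = real n ^ card V * (\<Sum>c\<in>PiE V (\<lambda>_. B). F c)"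
proof -
  have "(\<Sum>\<phi>\<in>PiE V (\<lambda>_. A). F (\<lambda>v\<in>V. q (\<phi> v)))
     = (\<Sum>c\<in>PiE V (\<lambda>_. B). \<Sum>\<phi> | \<phi> \<in> PiE V (\<lambda>_. A) \<and> (\<lambda>v\<in>V. q (\<phi> v)) = c. F (\<lambda>v\<in>V. q (\<phi> v)))"
    by (rule sum.group[symmetric]) (use assms in \<open>auto intro!: finite_PiE\<close>)
  also have "\<dots> = (\<Sum>c\<in>PiE V (\<lambda>_. B). real n ^ card V * F c)"
  proof (rule sum.cong[OF refl])
    fix c assume c: "c \<in> PiE V (\<lambda>_. B)"
    have "{\<phi>. \<phi> \<in> PiE V (\<lambda>_. A) \<and> (\<lambda>v\<in>V. q (\<phi> v)) = c} = PiE V (\<lambda>v. {i \<in> A. q i = c v})"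
    proof (intro equalityI subsetI)
      fix \<phi> assume "\<phi> \<in> {\<phi>. \<phi> \<in> PiE V (\<lambda>_. A) \<and> (\<lambda>v\<in>V. q (\<phi> v)) = c}"
      then show "\<phi> \<in> PiE V (\<lambda>v. {i \<in> A. q i = c v})" by (auto simp: PiE_def Pi_def)
    next
      fix \<phi> assume f: "\<phi> \<in> PiE V (\<lambda>v. {i \<in> A. q i = c v})"
      moreover have "(\<lambda>v\<in>V. q (\<phi> v)) = c"
      proof
        fix v show "(\<lambda>v\<in>V. q (\<phi> v)) v = c v" using f c by (cases "v \<in> V") (auto simp: PiE_def extensional_def)
      qed
      ultimately show "\<phi> \<in> {\<phi>. \<phi> \<in> PiE V (\<lambda>_. A) \<and> (\<lambda>v\<in>V. q (\<phi> v)) = c}" by (auto simp: PiE_def)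
    qed
    moreover have "card (PiE V (\<lambda>v. {i \<in> A. q i = c v})) = n ^ card V"
      using c fib by (subst card_PiE[OF V]) (simp add: PiE_def Pi_def)
    ultimately have "card {\<phi>. \<phi> \<in> PiE V (\<lambda>_. A) \<and> (\<lambda>v\<in>V. q (\<phi> v)) = c} = n ^ card V" by simp
    then show "(\<Sum>\<phi> | \<phi> \<in> PiE V (\<lambda>_. A) \<and> (\<lambda>v\<in>V. q (\<phi> v)) = c. F (\<lambda>v\<in>V. q (\<phi> v))) = real n ^ card V * F c"
      by (simp cong: conj_cong)
  qed
  finally show ?thesis by (simp add: sum_distrib_left)
qed

lemma sum_PiE_marginal:
  fixes h :: "nat \<Rightarrow> nat \<Rightarrow> real"
  assumes V: "finite V" "u \<in> V" "v \<in> V" "u \<noteq> v" and A: "finite A"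
  shows "(\<Sum>\<phi>\<in>PiE V (\<lambda>_. A). h (\<phi> u) (\<phi> v)) = real (card A) ^ (card V - 2) * (\<Sum>i\<in>A. \<Sum>j\<in>A. h i j)"
proof -
  note ins = sum_PiE_insert
  define S where "S = V - {u, v}"
  have VS: "V = insert u (insert v S)" "u \<notin> insert v S" "v \<notin> S" using V by (auto simp: S_def)
  have cS: "card S = card V - 2" using V by (simp add: S_def card_Diff_subset)
  have fS: "finite S" using V by (simp add: S_def)
  have "(\<Sum>\<phi>\<in>PiE V (\<lambda>_. A). h (\<phi> u) (\<phi> v)) = (\<Sum>i\<in>A. \<Sum>j\<in>A. \<Sum>\<phi>\<in>PiE S (\<lambda>_. A). h i j)"
    unfolding VS(1) ins[OF VS(2)] ins[OF VS(3)] using V(4) by simp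
  also have "\<dots> = real (card A) ^ (card V - 2) * (\<Sum>i\<in>A. \<Sum>j\<in>A. h i j)"
    using fS by (simp add: card_PiE cS sum_distrib_left)
  finally show ?thesis .
qed

lemma prod_bound:
  fixes f :: "'a \<Rightarrow> real"
  assumes "\<And>i. i \<in> A \<Longrightarrow> \<bar>f i\<bar> \<le> B"
  shows "\<bar>\<Prod>i\<in>A. f i\<bar> \<le> B ^ card A"
proof -
  have "\<bar>\<Prod>i\<in>A. f i\<bar> = (\<Prod>i\<in>A. \<bar>f i\<bar>)" by (rule abs_prod)
  also have "\<dots> \<le> (\<Prod>i\<in>A. B)" using assms by (intro prod_mono) auto
  finally show ?thesis by simp
qed

text \<open>Telescoping: the factors are exchanged one at a time.\<close>

lemma prod_diff_bound:
  fixes f g :: "'a \<Rightarrow> real"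
  assumes "finite A" and B: "B \<ge> 1" and f: "\<And>i. i \<in> A \<Longrightarrow> \<bar>f i\<bar> \<le> B" and g: "\<And>i. i \<in> A \<Longrightarrow> \<bar>g i\<bar> \<le> B"
  shows "\<bar>(\<Prod>i\<in>A. f i) - (\<Prod>i\<in>A. g i)\<bar> \<le> B ^ card A * (\<Sum>i\<in>A. \<bar>f i - g i\<bar>)"
  using assms
proof (induction A rule: finite_induct)
  case (insert x A)
  have "(\<Prod>i\<in>insert x A. f i) - (\<Prod>i\<in>insert x A. g i) = (f x - g x) * (\<Prod>i\<in>A. f i) + g x * ((\<Prod>i\<in>A. f i) - (\<Prod>i\<in>A. g i))"
    using insert by (simp add: algebra_simps)
  then have "\<bar>(\<Prod>i\<in>insert x A. f i) - (\<Prod>i\<in>insert x A. g i)\<bar> \<le> \<bar>f x - g x\<bar> * \<bar>\<Prod>i\<in>A. f i\<bar> + \<bar>g x\<bar> * \<bar>(\<Prod>i\<in>A. f i) - (\<Prod>i\<in>A. g i)\<bar>"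
    by (metis abs_triangle_ineq abs_mult)
  also have "\<dots> \<le> \<bar>f x - g x\<bar> * B ^ card A + B * (B ^ card A * (\<Sum>i\<in>A. \<bar>f i - g i\<bar>))"
    using insert by (intro add_mono mult_mono prod_bound) auto
  also have "\<dots> \<le> \<bar>f x - g x\<bar> * B ^ Suc (card A) + B * (B ^ card A * (\<Sum>i\<in>A. \<bar>f i - g i\<bar>))"
    using insert B by (intro add_mono mult_left_mono power_increasing) auto
  also have "\<dots> = B ^ card (insert x A) * (\<Sum>i\<in>insert x A. \<bar>f i - g i\<bar>)"
    using insert by (simp add: algebra_simps)
  finally show ?case .
qed simp

text \<open>The map collects the fine indices in consecutive blocks of length \<open>n\<close>, with
  indices and blocks both counted from 1.\<close>

lemma block_fibers:
  assumes n: "n > 0" and c: "c \<in> {1..N}"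
  shows "card {i \<in> {1..n * N}. (i - 1) div n + 1 = c} = n"
proof -
  have "{i \<in> {1..n * N}. (i - 1) div n + 1 = c} = {(c - 1) * n + 1..<(c - 1) * n + 1 + n}"
  proof (intro equalityI subsetI)
    fix i assume i: "i \<in> {i \<in> {1..n * N}. (i - 1) div n + 1 = c}"
    then have "(i - 1) div n = c - 1" "i \<ge> 1" by auto
    then show "i \<in> {(c - 1) * n + 1..<(c - 1) * n + 1 + n}"
      using div_mult_mod_eq[of "i - 1" n] mod_less_divisor[OF n, of "i - 1"] by auto
  next
    fix i assume i: "i \<in> {(c - 1) * n + 1..<(c - 1) * n + 1 + n}"
    then have "(c - 1) * n \<le> i - 1" "i - 1 < (c - 1) * n + n" by auto
    then have "(i - 1) div n = c - 1" using n by (intro div_nat_eqI) (auto simp: mult.commute)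
    moreover have "i \<le> (c - 1) * n + n" "(c - 1) * n + n = c * n" using i c by (auto simp: algebra_simps)
    moreover have "c * n \<le> n * N" using c by (simp add: mult.commute)
    ultimately have "(i - 1) div n = c - 1" "i \<le> n * N" by linarith+
    moreover have "i \<ge> 1" "c \<ge> 1" using i c by auto
    ultimately show "i \<in> {i \<in> {1..n * N}. (i - 1) div n + 1 = c}" by auto
  qed
  then show ?thesis by simp
qed

lemma block_range: "n > 0 \<Longrightarrow> i \<in> {1..n * N} \<Longrightarrow> (i - 1) div n + 1 \<in> {1..N}" for n i N :: nat
proof -
  assume n: "n > 0" and i: "i \<in> {1..n * N}"
  then have "i - 1 < N * n" by (auto simp: mult.commute)
  then have "(i - 1) div n < N" by (rule less_mult_imp_div_less)
  then show ?thesis by simp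
qed

lemma block_between:
  assumes n: "n > 0" and i: "i \<in> {1..n * N}"
  shows "(real ((i - 1) div n + 1) - 1) / N \<le> real i / real (n * N)" "real i / real (n * N) \<le> real ((i - 1) div n + 1) / N"
proof -
  have N: "N > 0" using i by (cases N) auto
  have "(i - 1) div n * n \<le> i - 1" by simp
  then have "(i - 1) div n * n \<le> i" using diff_le_self le_trans by blast
  then have 1: "real ((i - 1) div n) * n \<le> i" by (metis of_nat_le_iff of_nat_mult)
  have "i - 1 < (i - 1) div n * n + n" using div_mult_mod_eq[of "i - 1" n] mod_less_divisor[OF n, of "i - 1"] by linarith
  then have "i \<le> ((i - 1) div n + 1) * n" by (simp add: algebra_simps)
  then have 2: "real i \<le> real ((i - 1) div n + 1) * n" by (metis of_nat_le_iff of_nat_mult)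
  have e: "a / real N = a * real n / real (n * N)" for a using n N by (simp add: field_simps)
  show "(real ((i - 1) div n + 1) - 1) / N \<le> real i / real (n * N)" unfolding e using 1 by (intro divide_right_mono) auto
  show "real i / real (n * N) \<le> real ((i - 1) div n + 1) / N" unfolding e using 2 by (intro divide_right_mono) auto
qed

text \<open>Each fine label is replaced by the index of its block. Every edge function then moves by
  at most its oscillation on one coarse cell, and since it depends on two coordinates only,
  averaging over the others leaves \<open>osc (H e) N\<close>.\<close>

lemma gsum_refine:
  assumes V: "finite V" and E: "finite E" and ab: "\<And>e. e \<in> E \<Longrightarrow> a e \<in> V \<and> b e \<in> V \<and> a e \<noteq> b e"
    and bd: "\<And>e. e \<in> E \<Longrightarrow> bounded (H e ` unit_square)"
    and B: "B \<ge> 1" "\<And>e p. e \<in> E \<Longrightarrow> p \<in> unit_square \<Longrightarrow> \<bar>H e p\<bar> \<le> B"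
    and n: "n > 0" and N: "N > 0"
  shows "\<bar>gsum V E a b H (n * N) - gsum V E a b H N\<bar> \<le> B ^ card E * (\<Sum>e\<in>E. osc (H e) N)"
proof (cases "E = {}")
  case True
  then show ?thesis using n N V by (simp add: gsum_def card_PiE)
next
  case False
  define q where "q i = (i - 1) div n + 1" for i
  let ?A = "{1..n * N}"
  have gin: "grid K i j \<in> unit_square" if "K > 0" "i \<in> {1..K}" "j \<in> {1..K}" for K i j
    using that grid_in_cell cell_subset by blast
  have qr: "q i \<in> {1..N}" if "i \<in> ?A" for i using block_range[OF n that] by (simp only: q_def)
  have fib: "card {i \<in> ?A. q i = c} = n" if "c \<in> {1..N}" for c using block_fibers[OF n that] by (simp only: q_def)
  have V2: "card V \<ge> 2"
  proof -
    obtain e where "e \<in> E" using False by auto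
    then have "{a e, b e} \<subseteq> V" "card {a e, b e} = 2" using ab by auto
    then show ?thesis using card_mono[OF V, of "{a e, b e}"] by simp
  qed
  have coarse: "(\<Sum>\<phi>\<in>PiE V (\<lambda>_. ?A). \<Prod>e\<in>E. H e (grid N (q (\<phi> (a e))) (q (\<phi> (b e)))))
     = real n ^ card V * (\<Sum>c\<in>PiE V (\<lambda>_. {1..N}). \<Prod>e\<in>E. H e (grid N (c (a e)) (c (b e))))"
  proof -
    have "(\<Prod>e\<in>E. H e (grid N (q (\<phi> (a e))) (q (\<phi> (b e))))) = (\<lambda>c. \<Prod>e\<in>E. H e (grid N (c (a e)) (c (b e)))) (\<lambda>v\<in>V. q (\<phi> v))" for \<phi>
      using ab by (auto intro!: prod.cong)
    then show ?thesis
      using sum_PiE_comp[OF V, of ?A "{1..N}" q n "\<lambda>c. \<Prod>e\<in>E. H e (grid N (c (a e)) (c (b e)))"] qr fib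
      by auto
  qed
  have nN: "real (n * N) ^ card V = real n ^ card V * real N ^ card V" by (simp add: power_mult_distrib)
  have gN: "gsum V E a b H N = (\<Sum>\<phi>\<in>PiE V (\<lambda>_. ?A). \<Prod>e\<in>E. H e (grid N (q (\<phi> (a e))) (q (\<phi> (b e))))) / real (n * N) ^ card V"
    unfolding coarse nN gsum_def using n by simp
  have marg: "(\<Sum>\<phi>\<in>PiE V (\<lambda>_. ?A). \<bar>H e (grid (n * N) (\<phi> (a e)) (\<phi> (b e))) - H e (grid N (q (\<phi> (a e))) (q (\<phi> (b e))))\<bar>)
     \<le> real (n * N) ^ card V * osc (H e) N" if e: "e \<in> E" for e
  proof -
    have eq1: "(\<Sum>\<phi>\<in>PiE V (\<lambda>_. ?A). \<bar>H e (grid (n * N) (\<phi> (a e)) (\<phi> (b e))) - H e (grid N (q (\<phi> (a e))) (q (\<phi> (b e))))\<bar>)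
      = real (n * N) ^ (card V - 2) * (\<Sum>i\<in>?A. \<Sum>j\<in>?A. \<bar>H e (grid (n * N) i j) - H e (grid N (q i) (q j))\<bar>)"
      using sum_PiE_marginal[OF V, of "a e" "b e" ?A "\<lambda>i j. \<bar>H e (grid (n * N) i j) - H e (grid N (q i) (q j))\<bar>"] ab[OF e] by simp
    have "(\<Sum>i\<in>?A. \<Sum>j\<in>?A. \<bar>H e (grid (n * N) i j) - H e (grid N (q i) (q j))\<bar>)
      \<le> (\<Sum>i\<in>?A. \<Sum>j\<in>?A. cell_osc (H e) N (q i) (q j))"
    proof (intro sum_mono)
      fix i j assume i: "i \<in> ?A" and j: "j \<in> ?A"
      have "grid (n * N) i j \<in> cell N (q i) (q j)"
        unfolding grid_def mem_cell q_def using block_between[OF n i] block_between[OF n j] by (intro conjI)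
      then show "\<bar>H e (grid (n * N) i j) - H e (grid N (q i) (q j))\<bar> \<le> cell_osc (H e) N (q i) (q j)"
        by (rule cell_osc_bound[OF bd[OF e] N qr[OF i] qr[OF j]]) (rule grid_in_cell[OF N])
    qed
    also have "\<dots> = (\<Sum>c=1..N. \<Sum>d=1..N. real n * (real n * cell_osc (H e) N c d))"
    proof -
      have grp: "(\<Sum>i\<in>?A. F (q i)) = (\<Sum>c=1..N. real n * F c)" for F :: "nat \<Rightarrow> real"
      proof -
        have "(\<Sum>i\<in>?A. F (q i)) = (\<Sum>c=1..N. \<Sum>i | i \<in> ?A \<and> q i = c. F (q i))"
        proof (rule sum.group[symmetric])
          show "q ` ?A \<subseteq> {1..N}" using qr by blast
        qed simp_all
        also have "\<dots> = (\<Sum>c=1..N. real n * F c)"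
        proof (intro sum.cong refl)
          fix c assume c: "c \<in> {1..N}"
          have "(\<Sum>i | i \<in> ?A \<and> q i = c. F (q i)) = (\<Sum>i | i \<in> ?A \<and> q i = c. F c)"
            by (intro sum.cong refl) blast
          also have "\<dots> = real n * F c" using fib[OF c] by (simp only: sum_constant)
          finally show "(\<Sum>i | i \<in> ?A \<and> q i = c. F (q i)) = real n * F c" .
        qed
        finally show ?thesis .
      qed
      have "(\<Sum>i\<in>?A. \<Sum>j\<in>?A. cell_osc (H e) N (q i) (q j)) = (\<Sum>i\<in>?A. \<Sum>d=1..N. real n * cell_osc (H e) N (q i) d)"
        by (intro sum.cong refl grp)
      also have "\<dots> = (\<Sum>c=1..N. real n * (\<Sum>d=1..N. real n * cell_osc (H e) N c d))"
        by (rule grp[of "\<lambda>c. \<Sum>d=1..N. real n * cell_osc (H e) N c d"])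
      finally show ?thesis by (simp only: sum_distrib_left)
    qed
    also have "\<dots> = real (n * N) ^ 2 * osc (H e) N"
      using N by (simp add: osc_def sum_distrib_left[symmetric] power2_eq_square mult_ac)
    finally have "real (n * N) ^ (card V - 2) * (\<Sum>i\<in>?A. \<Sum>j\<in>?A. \<bar>H e (grid (n * N) i j) - H e (grid N (q i) (q j))\<bar>)
      \<le> real (n * N) ^ (card V - 2) * (real (n * N) ^ 2 * osc (H e) N)" by (rule mult_left_mono) simp
    also have "\<dots> = real (n * N) ^ card V * osc (H e) N"
    proof -
      have "card V - 2 + 2 = card V" using V2 by simp
      then have "real (n * N) ^ (card V - 2) * (real (n * N))\<^sup>2 = real (n * N) ^ card V" by (metis power_add)
      then show ?thesis by (metis mult.assoc)
    qed
    finally show ?thesis unfolding eq1 .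
  qed
  have "\<bar>gsum V E a b H (n * N) - gsum V E a b H N\<bar> = 
    \<bar>\<Sum>\<phi>\<in>PiE V (\<lambda>_. ?A). (\<Prod>e\<in>E. H e (grid (n * N) (\<phi> (a e)) (\<phi> (b e)))) - (\<Prod>e\<in>E. H e (grid N (q (\<phi> (a e))) (q (\<phi> (b e)))))\<bar> / real (n * N) ^ card V"
    unfolding gN unfolding gsum_def by (simp only: diff_divide_distrib[symmetric] sum_subtractf[symmetric] abs_divide) simp
  also have "\<dots> \<le> (\<Sum>\<phi>\<in>PiE V (\<lambda>_. ?A). B ^ card E * (\<Sum>e\<in>E. \<bar>H e (grid (n * N) (\<phi> (a e)) (\<phi> (b e))) - H e (grid N (q (\<phi> (a e))) (q (\<phi> (b e))))\<bar>)) / real (n * N) ^ card V"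
  proof (intro divide_right_mono order_trans[OF sum_abs] sum_mono prod_diff_bound E B)
    fix \<phi> e assume f: "\<phi> \<in> PiE V (\<lambda>_. ?A)" and e: "e \<in> E"
    have ij: "\<phi> (a e) \<in> ?A" "\<phi> (b e) \<in> ?A" using f ab[OF e] by (auto simp: PiE_def Pi_def)
    show "grid (n * N) (\<phi> (a e)) (\<phi> (b e)) \<in> unit_square" using gin[of "n * N"] ij n N by simp
    show "grid N (q (\<phi> (a e))) (q (\<phi> (b e))) \<in> unit_square" using gin[OF N qr[OF ij(1)] qr[OF ij(2)]] .
  qed auto
  also have "\<dots> = B ^ card E * (\<Sum>e\<in>E. \<Sum>\<phi>\<in>PiE V (\<lambda>_. ?A). \<bar>H e (grid (n * N) (\<phi> (a e)) (\<phi> (b e))) - H e (grid N (q (\<phi> (a e))) (q (\<phi> (b e))))\<bar>) / real (n * N) ^ card V"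
    by (subst sum.swap) (simp add: sum_distrib_left)
  also have "\<dots> \<le> B ^ card E * (\<Sum>e\<in>E. real (n * N) ^ card V * osc (H e) N) / real (n * N) ^ card V"
    using B by (intro divide_right_mono mult_left_mono sum_mono marg) auto
  also have "\<dots> = B ^ card E * (\<Sum>e\<in>E. osc (H e) N)" using n N by (simp add: sum_distrib_left[symmetric])
  finally show ?thesis .
qed

text \<open>The meshes \<open>m\<close> and \<open>n\<close> are compared through their common
  refinement \<open>m * n\<close>, which gives a Cauchy sequence without naming the limiting
  integral.\<close>

lemma convergent_gsum:
  assumes V: "finite V" and E: "finite E" and ab: "\<And>e. e \<in> E \<Longrightarrow> a e \<in> V \<and> b e \<in> V \<and> a e \<noteq> b e"
    and bd: "\<And>e. e \<in> E \<Longrightarrow> bounded (H e ` unit_square)"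
    and osc: "\<And>e. e \<in> E \<Longrightarrow> osc (H e) \<longlonglongrightarrow> 0"
  shows "convergent (gsum V E a b H)"
proof -
  have "\<exists>B. \<forall>p\<in>unit_square. \<bar>H e p\<bar> \<le> B" if "e \<in> E" for e using bd[OF that] by (auto simp: bounded_iff)
  then obtain Bf where Bf: "\<And>e p. e \<in> E \<Longrightarrow> p \<in> unit_square \<Longrightarrow> \<bar>H e p\<bar> \<le> Bf e" by metis
  define B where "B = 1 + (\<Sum>e\<in>E. \<bar>Bf e\<bar>)"
  have B1: "B \<ge> 1" by (simp add: B_def sum_nonneg)
  have B: "\<bar>H e p\<bar> \<le> B" if "e \<in> E" "p \<in> unit_square" for e p
  proof -
    have "\<bar>Bf e\<bar> \<le> (\<Sum>e\<in>E. \<bar>Bf e\<bar>)" using that E by (intro member_le_sum) auto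
    then show ?thesis using Bf[OF that] by (simp add: B_def)
  qed
  define w where "w N = B ^ card E * (\<Sum>e\<in>E. osc (H e) N)" for N
  have "w \<longlonglongrightarrow> B ^ card E * (\<Sum>e\<in>E. 0)" unfolding w_def by (intro tendsto_intros osc)
  then have w: "w \<longlonglongrightarrow> 0" by simp
  have "Cauchy (gsum V E a b H)"
  proof (rule metric_CauchyI)
    fix r :: real assume "r > 0"
    then obtain N0 where N0: "\<And>N. N \<ge> N0 \<Longrightarrow> norm (w N - 0) < r / 2" using LIMSEQ_D[OF w, of "r / 2"] by auto
    have "dist (gsum V E a b H m) (gsum V E a b H n) < r" if "m \<ge> Suc N0" "n \<ge> Suc N0" for m n
    proof -
      have mn: "m > 0" "n > 0" using that by auto
      have "\<bar>gsum V E a b H (m * n) - gsum V E a b H n\<bar> \<le> w n" "\<bar>gsum V E a b H (n * m) - gsum V E a b H m\<bar> \<le> w m"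
        unfolding w_def by (rule gsum_refine[OF V E ab bd B1 B], use mn in auto)+
      moreover have "w n < r / 2" "w m < r / 2" using N0[of n] N0[of m] that by auto
      ultimately show ?thesis unfolding dist_real_def mult.commute[of n m] by linarith
    qed
    then show "\<exists>M. \<forall>m\<ge>M. \<forall>n\<ge>M. dist (gsum V E a b H m) (gsum V E a b H n) < r" by blast
  qed
  then show ?thesis by (rule Cauchy_convergent)
qed

section \<open>Null sets and grid means\<close>

text \<open>\<open>idx N u\<close> is the index of the half-open interval \<open>((i - 1) / N, i / N]\<close> that contains \<open>u\<close>.\<close>

definition idx :: "nat \<Rightarrow> real \<Rightarrow> nat" where "idx N u = nat \<lceil>real N * u\<rceil>"

lemma measurable_idx [measurable]: "idx N \<in> borel \<rightarrow>\<^sub>M count_space UNIV"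
  unfolding idx_def by measurable

lemma idx_iff:
  assumes "N > 0" "i \<ge> 1" shows "idx N u = i \<longleftrightarrow> (real i - 1) / N < u \<and> u \<le> real i / N"
proof -
  have "idx N u = i \<longleftrightarrow> \<lceil>real N * u\<rceil> = int i" using assms(2) unfolding idx_def by linarith
  also have "\<dots> \<longleftrightarrow> real i - 1 < real N * u \<and> real N * u \<le> real i" by (simp add: ceiling_eq_iff)
  also have "\<dots> \<longleftrightarrow> (real i - 1) / N < u \<and> u \<le> real i / N" using assms(1) by (simp add: field_simps)
  finally show ?thesis .
qed

lemma idx_range:
  assumes "N > 0" "0 < u" "u \<le> 1" shows "idx N u \<in> {1..N}"
proof -
  have "0 < real N * u" using assms by simp
  then have "\<lceil>real N * u\<rceil> \<ge> 1" by linarith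
  moreover have "\<lceil>real N * u\<rceil> \<le> int N" using assms by (intro ceiling_le) (simp add: mult_left_le)
  ultimately have "1 \<le> idx N u \<and> idx N u \<le> N" unfolding idx_def by linarith
  then show ?thesis by simp
qed

lemma nn_integral_step:
  fixes F :: "nat \<Rightarrow> ennreal"
  assumes N: "N > 0"
  shows "(\<integral>\<^sup>+u. F (idx N u) * indicator {0<..1} u \<partial>lborel) = (\<Sum>i=1..N. F i * ennreal (1 / N))"
proof -
  have "F (idx N u) * indicator {0<..1} u = (\<Sum>i=1..N. F i * indicator {(real i - 1) / N<..real i / N} u)" for u :: real
  proof (cases "u \<in> {0<..1}")
    case True
    then have r: "idx N u \<in> {1..N}" using idx_range[OF N] by auto
    have "(\<Sum>i=1..N. F i * indicator {(real i - 1) / N<..real i / N} u) = (\<Sum>i=1..N. if i = idx N u then F i else 0)"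
      using idx_iff[OF N, of _ u] by (intro sum.cong refl) (auto simp: indicator_def)
    also have "\<dots> = F (idx N u)" using r by simp
    finally show ?thesis using True by simp
  next
    case False
    have "indicator {(real i - 1) / N<..real i / N} u = (0::ennreal)" if i: "i \<in> {1..N}" for i
    proof -
      have "0 \<le> (real i - 1) / N" "real i / N \<le> 1" using i N by auto
      then have "u \<notin> {(real i - 1) / N<..real i / N}" using False by (auto dest: le_less_trans order_trans)
      then show ?thesis by simp
    qed
    then show ?thesis using False by simp
  qed
  then have "(\<integral>\<^sup>+u. F (idx N u) * indicator {0<..1} u \<partial>lborel)
    = (\<integral>\<^sup>+u. (\<Sum>i=1..N. F i * indicator {(real i - 1) / N<..real i / N} u) \<partial>lborel)" by (simp only:)
  also have "\<dots> = (\<Sum>i=1..N. \<integral>\<^sup>+u. F i * indicator {(real i - 1) / N<..real i / N} u \<partial>lborel)"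
    by (rule nn_integral_sum) measurable
  also have "\<dots> = (\<Sum>i=1..N. F i * ennreal (1 / N))"
    using N by (intro sum.cong refl) (simp add: nn_integral_cmult divide_right_mono diff_divide_distrib)
  finally show ?thesis .
qed

lemma integral_step:
  fixes F :: "nat \<Rightarrow> real"
  assumes N: "N > 0"
  shows "set_integrable lborel {0<..1} (\<lambda>u. F (idx N u))" "(LINT u:{0<..1}|lborel. F (idx N u)) = (\<Sum>i=1..N. F i) / N"
proof -
  define B where "B = (\<Sum>i=1..N. \<bar>F i\<bar>)"
  have FB: "\<bar>F (idx N u)\<bar> \<le> B" if "u \<in> {0<..1}" for u
    unfolding B_def using that idx_range[OF N, of u] by (intro member_le_sum[of _ _ "\<lambda>i. \<bar>F i\<bar>"]) auto
  have int: "set_integrable lborel {0<..1} (\<lambda>u. F' (idx N u))" if "\<And>u. u \<in> {0<..1} \<Longrightarrow> \<bar>F' (idx N u)\<bar> \<le> C" for F' :: "nat \<Rightarrow> real" and C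
  proof (rule set_integrable_bound[where f = "\<lambda>_. C"])
    have "integrable lborel (indicat_real {0<..1::real})" by (rule integrable_real_indicator) auto
    then show "set_integrable lborel {0<..1::real} (\<lambda>_. C)" by (simp add: set_integrable_def)
    show "set_borel_measurable lborel {0<..1} (\<lambda>u. F' (idx N u))" unfolding set_borel_measurable_def by measurable
    show "AE u in lborel. u \<in> {0<..1} \<longrightarrow> norm (F' (idx N u)) \<le> norm C" using that by (intro AE_I2) force
  qed
  show I: "set_integrable lborel {0<..1} (\<lambda>u. F (idx N u))" by (rule int[of F B]) (rule FB)
  have pos: "(LINT u:{0<..1}|lborel. F' (idx N u)) = (\<Sum>i=1..N. F' i) / N" if nn: "\<And>i. F' i \<ge> 0" and b: "\<And>u. u \<in> {0<..1} \<Longrightarrow> \<bar>F' (idx N u)\<bar> \<le> C" for F' :: "nat \<Rightarrow> real" and C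
  proof -
    have "ennreal (LINT u:{0<..1}|lborel. F' (idx N u)) = (\<integral>\<^sup>+u. ennreal (indicator {0<..1} u *\<^sub>R F' (idx N u)) \<partial>lborel)"
      unfolding set_lebesgue_integral_def using int[of F' C, OF b] nn
      by (intro nn_integral_eq_integral[symmetric]) (auto simp: set_integrable_def)
    also have "\<dots> = (\<integral>\<^sup>+u. ennreal (F' (idx N u)) * indicator {0<..1} u \<partial>lborel)"
      by (intro nn_integral_cong) (simp add: indicator_def)
    also have "\<dots> = (\<Sum>i=1..N. ennreal (F' i) * ennreal (1 / N))" by (rule nn_integral_step[OF N])
    also have "\<dots> = ennreal ((\<Sum>i=1..N. F' i) / N)"
      using nn by (simp add: ennreal_mult[symmetric] sum_divide_distrib sum_ennreal)
    finally show ?thesis using nn by (subst (asm) ennreal_inj) (auto simp: set_lebesgue_integral_def intro!: integral_nonneg divide_nonneg_nonneg sum_nonneg)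
  qed
  \<comment> \<open>The formula is available for nonnegative functions; the general one follows from
    \<open>F = (F + \<bar>F\<bar>) - \<bar>F\<bar>\<close>.\<close>
  have b2: "\<bar>F (idx N u) + \<bar>F (idx N u)\<bar>\<bar> \<le> 2 * B" "\<bar>\<bar>F (idx N u)\<bar>\<bar> \<le> B" if "u \<in> {0<..1}" for u using FB[OF that] by auto
  have "(LINT u:{0<..1}|lborel. (F (idx N u) + \<bar>F (idx N u)\<bar>) - \<bar>F (idx N u)\<bar>)
     = (LINT u:{0<..1}|lborel. F (idx N u) + \<bar>F (idx N u)\<bar>) - (LINT u:{0<..1}|lborel. \<bar>F (idx N u)\<bar>)"
    by (rule set_integral_diff(2)[OF int[of "\<lambda>i. F i + \<bar>F i\<bar>" "2 * B", OF b2(1)] int[of "\<lambda>i. \<bar>F i\<bar>" B, OF b2(2)]])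
  also have "\<dots> = (\<Sum>i=1..N. F i + \<bar>F i\<bar>) / N - (\<Sum>i=1..N. \<bar>F i\<bar>) / N"
    using pos[of "\<lambda>i. F i + \<bar>F i\<bar>" "2 * B", OF _ b2(1)] pos[of "\<lambda>i. \<bar>F i\<bar>" B, OF _ b2(2)] by simp
  finally show "(LINT u:{0<..1}|lborel. F (idx N u)) = (\<Sum>i=1..N. F i) / N" by (simp add: sum.distrib add_divide_distrib)
qed

definition gstep :: "(real \<times> real \<Rightarrow> real) \<Rightarrow> nat \<Rightarrow> real \<Rightarrow> real \<Rightarrow> real" where
  "gstep f N u v = f (grid N (idx N u) (idx N v))"

text \<open>The half-open square, on which both values of \<open>idx N\<close> lie in
  \<open>{1..N}\<close>; it differs from \<open>unit_square\<close> by a null set.\<close>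

abbreviation "hbox \<equiv> {0<..1::real} \<times> {0<..1::real}"

lemma nn_integral_step2:
  fixes F :: "nat \<Rightarrow> nat \<Rightarrow> real"
  assumes N: "N > 0" and F: "\<And>i j. i \<in> {1..N} \<Longrightarrow> j \<in> {1..N} \<Longrightarrow> F i j \<ge> 0"
  shows "(\<integral>\<^sup>+p. ennreal (F (idx N (fst p)) (idx N (snd p))) * indicator hbox p \<partial>lborel) = ennreal ((\<Sum>i=1..N. \<Sum>j=1..N. F i j) / (real N)\<^sup>2)"
proof -
  have [measurable]: "(\<lambda>p. ennreal (F (idx N (fst p)) (idx N (snd p))) * indicator hbox p) \<in> borel_measurable (lborel \<Otimes>\<^sub>M lborel)"
    by measurable
  have "(\<integral>\<^sup>+p. ennreal (F (idx N (fst p)) (idx N (snd p))) * indicator hbox p \<partial>lborel)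
    = (\<integral>\<^sup>+u. \<integral>\<^sup>+v. ennreal (F (idx N u) (idx N v)) * indicator hbox (u, v) \<partial>lborel \<partial>lborel)"
    unfolding lborel_prod[symmetric] by (subst lborel.nn_integral_fst[symmetric]) auto
  also have "\<dots> = (\<integral>\<^sup>+u. (\<Sum>j=1..N. ennreal (F (idx N u) j) * ennreal (1 / N)) * indicator {0<..1} u \<partial>lborel)"
  proof (rule nn_integral_cong)
    fix u :: real
    have "(\<integral>\<^sup>+v. ennreal (F (idx N u) (idx N v)) * indicator hbox (u, v) \<partial>lborel)
       = (\<integral>\<^sup>+v. (ennreal (F (idx N u) (idx N v)) * indicator {0<..1} v) * indicator {0<..1} u \<partial>lborel)"
      by (intro nn_integral_cong) (auto simp: indicator_def)
    also have "\<dots> = (\<integral>\<^sup>+v. ennreal (F (idx N u) (idx N v)) * indicator {0<..1} v \<partial>lborel) * indicator {0<..1} u"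
      by (intro nn_integral_multc) measurable
    also have "\<dots> = (\<Sum>j=1..N. ennreal (F (idx N u) j) * ennreal (1 / N)) * indicator {0<..1} u"
      by (simp only: nn_integral_step[OF N, of "\<lambda>j. ennreal (F (idx N u) j)"])
    finally show "(\<integral>\<^sup>+v. ennreal (F (idx N u) (idx N v)) * indicator hbox (u, v) \<partial>lborel) = (\<Sum>j=1..N. ennreal (F (idx N u) j) * ennreal (1 / N)) * indicator {0<..1} u" .
  qed
  also have "\<dots> = (\<Sum>i=1..N. (\<Sum>j=1..N. ennreal (F i j) * ennreal (1 / N)) * ennreal (1 / N))"
    by (rule nn_integral_step[OF N, of "\<lambda>i. \<Sum>j=1..N. ennreal (F i j) * ennreal (1 / N)"])
  also have "\<dots> = (\<Sum>i=1..N. \<Sum>j=1..N. ennreal (F i j / (real N)\<^sup>2))"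
    unfolding sum_distrib_right
    by (intro sum.cong refl) (use F in \<open>auto simp: ennreal_mult[symmetric] power2_eq_square\<close>)
  also have "\<dots> = ennreal (\<Sum>i=1..N. \<Sum>j=1..N. F i j / (real N)\<^sup>2)"
  proof -
    have "(\<Sum>j=1..N. ennreal (F i j / (real N)\<^sup>2)) = ennreal (\<Sum>j=1..N. F i j / (real N)\<^sup>2)" if "i \<in> {1..N}" for i
      using F that by (intro sum_ennreal) auto
    then have "(\<Sum>i=1..N. \<Sum>j=1..N. ennreal (F i j / (real N)\<^sup>2)) = (\<Sum>i=1..N. ennreal (\<Sum>j=1..N. F i j / (real N)\<^sup>2))"
      by (intro sum.cong refl) auto
    also have "\<dots> = ennreal (\<Sum>i=1..N. \<Sum>j=1..N. F i j / (real N)\<^sup>2)"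
      using F by (intro sum_ennreal sum_nonneg) auto
    finally show ?thesis .
  qed
  finally show ?thesis by (simp add: sum_divide_distrib)
qed

text \<open>A Borel version, squeezed between the lower and the upper step functions of all meshes.\<close>

lemma Borel_version:
  fixes f :: "real \<times> real \<Rightarrow> real"
  assumes b: "bounded (f ` unit_square)" and o: "osc f \<longlonglongrightarrow> 0"
  shows "\<exists>h\<in>borel_measurable borel. (\<exists>B. \<forall>p. \<bar>h p\<bar> \<le> B) \<and> (AE p in lborel. p \<in> hbox \<longrightarrow> f p = h p) \<and>
     (\<forall>N>0. (\<integral>\<^sup>+p. ennreal \<bar>h p - gstep f N (fst p) (snd p)\<bar> * indicator hbox p \<partial>lborel) \<le> ennreal (osc f N))"
proof -
  obtain B where B: "\<And>p. p \<in> unit_square \<Longrightarrow> \<bar>f p\<bar> \<le> B" using b by (auto simp: bounded_iff)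
  have B0: "B \<ge> 0" using B[of "(0,0)"] by (simp add: cbox_Pair_eq)
  define up where "up N p = (SUP q\<in>cell N (idx N (fst p)) (idx N (snd p)). f q)" for N and p :: "real \<times> real"
  define lo where "lo N p = (INF q\<in>cell N (idx N (fst p)) (idx N (snd p)). f q)" for N and p :: "real \<times> real"
  have r: "idx N (fst p) \<in> {1..N}" "idx N (snd p) \<in> {1..N}" if "N > 0" "p \<in> hbox" for N p
    using that idx_range[OF that(1)] by (auto simp: mem_Times_iff)
  have pc: "p \<in> cell N (idx N (fst p)) (idx N (snd p))" if "N > 0" "p \<in> hbox" for N p
    using idx_iff[OF that(1), of "idx N (fst p)" "fst p"] idx_iff[OF that(1), of "idx N (snd p)" "snd p"] r[OF that]
    by (cases p) (auto simp: mem_cell)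
  have lu: "lo N p \<le> f q" "f q \<le> up N p" if "N > 0" "p \<in> hbox" "q \<in> cell N (idx N (fst p)) (idx N (snd p))" for N p q
    unfolding lo_def up_def using cell_bounds[OF b that(1) r[OF that(1,2)]] that(3) by (auto intro: cINF_lower cSUP_upper)
  have lB: "\<bar>lo N p\<bar> \<le> B" if "N > 0" "p \<in> hbox" for N p
  proof -
    note c = cell_bounds[OF b that(1) r[OF that]] cell_subset[OF that(1) r[OF that]]
    have "f p \<le> B" using B[of p] pc[OF that] c(4) by (auto simp: abs_le_iff)
    then have "lo N p \<le> B" using lu(1)[OF that pc[OF that]] by linarith
    moreover have "- B \<le> lo N p" unfolding lo_def
    proof (rule cINF_greatest[OF c(3)])
      fix x assume "x \<in> cell N (idx N (fst p)) (idx N (snd p))"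
      then show "- B \<le> f x" using B[of x] c(4) by (auto simp: abs_le_iff)
    qed
    ultimately show ?thesis by simp
  qed
  \<comment> \<open>The supremum of the lower step functions is Borel and lies below
    \<open>f\<close>, however irregular \<open>f\<close> is on null sets.\<close>
  define h where "h p = (if p \<in> hbox then (SUP N\<in>{0<..}. lo N p) else 0)" for p
  have bdd: "bdd_above ((\<lambda>N. lo N p) ` {0<..})" if "p \<in> hbox" for p
    using lB[OF _ that] by (auto simp: bdd_above_def abs_le_iff)
  have lom [measurable]: "lo N \<in> borel_measurable borel" "up N \<in> borel_measurable borel" for N
  proof -
    have "(\<lambda>p::real\<times>real. (\<lambda>(i,j). INF q\<in>cell N i j. f q) (idx N (fst p), idx N (snd p))) \<in> borel_measurable (borel \<Otimes>\<^sub>M borel)" by measurable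
    then show "lo N \<in> borel_measurable borel" unfolding lo_def borel_prod by simp
    have "(\<lambda>p::real\<times>real. (\<lambda>(i,j). SUP q\<in>cell N i j. f q) (idx N (fst p), idx N (snd p))) \<in> borel_measurable (borel \<Otimes>\<^sub>M borel)" by measurable
    then show "up N \<in> borel_measurable borel" unfolding up_def borel_prod by simp
  qed
  have hb: "hbox \<in> sets borel" unfolding borel_prod[symmetric] by measurable
  have hm: "h \<in> borel_measurable borel"
  proof -
    have "(\<lambda>p. SUP N\<in>{0<..}. if p \<in> hbox then lo N p else 0) \<in> borel_measurable borel"
    proof (rule borel_measurable_cSUP)
      show "bdd_above ((\<lambda>N. if p \<in> hbox then lo N p else 0) ` {0<..})" for p
        using bdd[of p] by (cases "p \<in> hbox") (auto simp: bdd_above_def)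
      show "(\<lambda>p. if p \<in> hbox then lo N p else 0) \<in> borel_measurable borel" for N using hb by measurable
    qed auto
    moreover have "h = (\<lambda>p. SUP N\<in>{0<..}. if p \<in> hbox then lo N p else 0)"
      by (rule ext) (auto simp: h_def)
    ultimately show ?thesis by simp
  qed
  have hl: "lo N p \<le> h p" if "N > 0" "p \<in> hbox" for N p
    unfolding h_def using that bdd[OF that(2)] by (auto intro!: cSUP_upper)
  have hf: "h p \<le> f p" if "p \<in> hbox" for p
    unfolding h_def using that lu(1)[OF _ that pc[OF _ that]] by (auto intro!: cSUP_least)
  have hbd: "\<bar>h p\<bar> \<le> B" for p
  proof (cases "p \<in> hbox")
    case True
    have "p \<in> unit_square" using pc[of 1 p] cell_subset[of 1 "idx 1 (fst p)" "idx 1 (snd p)"] r[of 1 p] True by auto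
    then show ?thesis using hf[OF True] hl[of 1 p] lB[of 1 p] B[of p] True by (auto simp: abs_le_iff)
  qed (simp add: h_def B0)
  have oint: "(\<integral>\<^sup>+p. ennreal (up N p - lo N p) * indicator hbox p \<partial>lborel) = ennreal (osc f N)" if N: "N > 0" for N
    using nn_integral_step2[OF N, of "cell_osc f N"] cell_osc_nonneg[OF b N]
    by (simp add: up_def lo_def cell_osc_def osc_def)
  have "AE p in lborel. p \<in> hbox \<longrightarrow> f p = h p"
  proof -
    \<comment> \<open>\<open>f - h\<close> is at most the gap of every mesh; the infimum of the gaps
      has integral 0 and so vanishes almost everywhere.\<close>
    define U where "U p = (INF N\<in>{0<..}. ennreal (up N p - lo N p) * indicator hbox p)" for p
    have Um: "U \<in> borel_measurable lborel" unfolding U_def using hb by measurable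
    have "(\<integral>\<^sup>+p. U p \<partial>lborel) \<le> ennreal (osc f (Suc N))" for N
    proof -
      have "(\<integral>\<^sup>+p. U p \<partial>lborel) \<le> (\<integral>\<^sup>+p. ennreal (up (Suc N) p - lo (Suc N) p) * indicator hbox p \<partial>lborel)"
        by (intro nn_integral_mono) (auto simp: U_def intro: INF_lower)
      then show ?thesis using oint[of "Suc N"] by simp
    qed
    moreover have "(\<lambda>N. ennreal (osc f (Suc N))) \<longlonglongrightarrow> ennreal 0"
      by (intro tendsto_ennrealI LIMSEQ_Suc o)
    ultimately have "(\<integral>\<^sup>+p. U p \<partial>lborel) \<le> ennreal 0" by (intro LIMSEQ_le_const[of _ "ennreal 0"]) auto
    then have "AE p in lborel. U p = 0" using nn_integral_0_iff_AE[OF Um] by simp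
    then show ?thesis
    proof eventually_elim
      case (elim p)
      show ?case
      proof
        assume p: "p \<in> hbox"
        show "f p = h p"
        proof (rule ccontr)
          assume "f p \<noteq> h p"
          then have "f p - h p > 0" using hf[OF p] by simp
          moreover have "ennreal (f p - h p) \<le> U p" unfolding U_def
          proof (rule INF_greatest)
            fix N :: nat assume "N \<in> {0<..}"
            then have "f p - h p \<le> up N p - lo N p" using lu(2)[OF _ p pc[OF _ p], of N] hl[OF _ p, of N] by auto
            then show "ennreal (f p - h p) \<le> ennreal (up N p - lo N p) * indicator hbox p" using p by (simp add: ennreal_leI)
          qed
          ultimately show False using elim by (simp add: ennreal_eq_0_iff)
        qed
      qed
    qed
  qed
  moreover have "(\<integral>\<^sup>+p. ennreal \<bar>h p - gstep f N (fst p) (snd p)\<bar> * indicator hbox p \<partial>lborel) \<le> ennreal (osc f N)" if N: "N > 0" for N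
  proof -
    have "(\<integral>\<^sup>+p. ennreal \<bar>h p - gstep f N (fst p) (snd p)\<bar> * indicator hbox p \<partial>lborel)
      \<le> (\<integral>\<^sup>+p. ennreal (up N p - lo N p) * indicator hbox p \<partial>lborel)"
    proof (intro nn_integral_mono)
      fix p :: "real \<times> real"
      show "ennreal \<bar>h p - gstep f N (fst p) (snd p)\<bar> * indicator hbox p \<le> ennreal (up N p - lo N p) * indicator hbox p"
      proof (cases "p \<in> hbox")
        case True
        have "lo N p \<le> h p" "h p \<le> up N p" using hl[OF N True] hf[OF True] lu(2)[OF N True pc[OF N True]] by auto
        moreover have "lo N p \<le> gstep f N (fst p) (snd p)" "gstep f N (fst p) (snd p) \<le> up N p"
          unfolding gstep_def using lu[OF N True grid_in_cell[OF N]] by auto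
        ultimately show ?thesis using True by (auto intro!: ennreal_leI simp: abs_le_iff)
      qed simp
    qed
    then show ?thesis using oint[OF N] by simp
  qed
  ultimately show ?thesis using hm hbd by blast
qed

lemma unit_square_AE_hbox:
  "(AE p in lborel. p \<in> unit_square \<longrightarrow> P p) \<longleftrightarrow> (AE p in lborel. p \<in> hbox \<longrightarrow> P p)"
proof -
  have ne: "AE p in lborel. fst p \<noteq> (0::real) \<and> snd p \<noteq> (0::real)"
  proof -
    have "negligible {p :: real \<times> real. p \<bullet> (1, 0) = 0}" "negligible {p :: real \<times> real. p \<bullet> (0, 1) = 0}"
      by (rule negligible_standard_hyperplane, simp add: Basis_prod_def)+
    then have "{p :: real \<times> real. p \<bullet> (1, 0) = 0} \<in> null_sets lebesgue" "{p :: real \<times> real. p \<bullet> (0, 1) = 0} \<in> null_sets lebesgue"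
      by (auto simp: negligible_iff_null_sets)
    then have n: "{p :: real \<times> real. p \<bullet> (1, 0) = 0} \<in> null_sets lborel" "{p :: real \<times> real. p \<bullet> (0, 1) = 0} \<in> null_sets lborel"
      by (auto simp: null_sets_completion_iff)
    from AE_not_in[OF n(1)] AE_not_in[OF n(2)] show ?thesis by eventually_elim (auto simp: inner_prod_def)
  qed
  from ne have a: "AE p in lborel. p \<in> unit_square \<longleftrightarrow> p \<in> hbox"
    by eventually_elim (auto simp: cbox_Pair_eq)
  show ?thesis
  proof
    assume "AE p in lborel. p \<in> unit_square \<longrightarrow> P p"
    with a show "AE p in lborel. p \<in> hbox \<longrightarrow> P p" by eventually_elim simp
  next
    assume "AE p in lborel. p \<in> hbox \<longrightarrow> P p"
    with a show "AE p in lborel. p \<in> unit_square \<longrightarrow> P p" by eventually_elim simp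
  qed
qed

text \<open>The mean of \<open>\<bar>h\<bar>\<close> over the square and the grid mean of
  \<open>\<bar>f\<bar>\<close> differ by at most \<open>osc f N\<close>, so the one is 0 exactly if
  the other tends to 0.\<close>

lemma AE_zero_iff_grid_mean:
  fixes f :: "real \<times> real \<Rightarrow> real"
  assumes b: "bounded (f ` unit_square)" and o: "osc f \<longlonglongrightarrow> 0"
  shows "(AE p in lborel. p \<in> unit_square \<longrightarrow> f p = 0) \<longleftrightarrow>
    (\<lambda>N. (\<Sum>i=1..N. \<Sum>j=1..N. \<bar>f (grid N i j)\<bar>) / (real N)\<^sup>2) \<longlonglongrightarrow> 0"
proof -
  obtain h B where h: "h \<in> borel_measurable borel" "\<And>p. \<bar>h p\<bar> \<le> B" "AE p in lborel. p \<in> hbox \<longrightarrow> f p = h p"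
    and L1: "\<And>N. N > 0 \<Longrightarrow> (\<integral>\<^sup>+p. ennreal \<bar>h p - gstep f N (fst p) (snd p)\<bar> * indicator hbox p \<partial>lborel) \<le> ennreal (osc f N)"
    using Borel_version[OF b o] by auto
  note [measurable] = h(1)
  have hb [measurable]: "hbox \<in> sets borel" unfolding borel_prod[symmetric] by measurable
  define m where "m N = (\<Sum>i=1..N. \<Sum>j=1..N. \<bar>f (grid N i j)\<bar>) / (real N)\<^sup>2" for N
  have m0: "m N \<ge> 0" for N unfolding m_def by (intro divide_nonneg_nonneg sum_nonneg) auto
  have gm [measurable]: "(\<lambda>p::real\<times>real. gstep f N (fst p) (snd p)) \<in> borel_measurable borel" for N
  proof -
    have "(\<lambda>p::real\<times>real. (\<lambda>(i,j). f (grid N i j)) (idx N (fst p), idx N (snd p))) \<in> borel_measurable (borel \<Otimes>\<^sub>M borel)" by measurable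
    then show ?thesis unfolding gstep_def borel_prod by simp
  qed
  have mi: "(\<integral>\<^sup>+p. ennreal \<bar>gstep f N (fst p) (snd p)\<bar> * indicator hbox p \<partial>lborel) = ennreal (m N)" if "N > 0" for N
    using nn_integral_step2[OF that, of "\<lambda>i j. \<bar>f (grid N i j)\<bar>"] by (simp add: gstep_def m_def)
  let ?I = "\<integral>\<^sup>+p. ennreal \<bar>h p\<bar> * indicator hbox p \<partial>lborel"
  have tri: "(\<integral>\<^sup>+p. ennreal \<bar>a p\<bar> * indicator hbox p \<partial>lborel) \<le>
      (\<integral>\<^sup>+p. ennreal \<bar>a p - c p\<bar> * indicator hbox p \<partial>lborel) + (\<integral>\<^sup>+p. ennreal \<bar>c p\<bar> * indicator hbox p \<partial>lborel)"
    if [measurable]: "a \<in> borel_measurable borel" "c \<in> borel_measurable borel" for a c :: "real \<times> real \<Rightarrow> real"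
  proof -
    have "(\<integral>\<^sup>+p. ennreal \<bar>a p\<bar> * indicator hbox p \<partial>lborel) \<le> (\<integral>\<^sup>+p. ennreal \<bar>a p - c p\<bar> * indicator hbox p + ennreal \<bar>c p\<bar> * indicator hbox p \<partial>lborel)"
      by (intro nn_integral_mono) (auto simp: indicator_def ennreal_plus[symmetric] simp del: ennreal_plus intro!: ennreal_leI)
    also have "\<dots> = (\<integral>\<^sup>+p. ennreal \<bar>a p - c p\<bar> * indicator hbox p \<partial>lborel) + (\<integral>\<^sup>+p. ennreal \<bar>c p\<bar> * indicator hbox p \<partial>lborel)"
      by (rule nn_integral_add) measurable
    finally show ?thesis .
  qed
  have swap: "(\<integral>\<^sup>+p. ennreal \<bar>gstep f N (fst p) (snd p) - h p\<bar> * indicator hbox p \<partial>lborel) \<le> ennreal (osc f N)" if "N > 0" for N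
    using L1[OF that] by (simp add: abs_minus_commute)
  have up: "?I \<le> ennreal (osc f N + m N)" if N: "N > 0" for N
    using tri[OF h(1) gm[of N]] L1[OF N] mi[OF N] osc_nonneg[OF b, of N] m0[of N]
    by (simp add: ennreal_plus) (meson add_right_mono order_trans)
  have lo: "ennreal (m N) \<le> ennreal (osc f N) + ?I" if N: "N > 0" for N
    using tri[OF gm[of N] h(1)] swap[OF N] mi[OF N] by (simp) (meson add_right_mono order_trans)
  have I0: "?I = 0 \<longleftrightarrow> (AE p in lborel. p \<in> hbox \<longrightarrow> h p = 0)"
    by (subst nn_integral_0_iff_AE) (auto simp: indicator_def ennreal_eq_0_iff intro!: AE_cong)
  have "m \<longlonglongrightarrow> 0 \<longleftrightarrow> ?I = 0"
  proof
    assume "m \<longlonglongrightarrow> 0"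
    from tendsto_add[OF o this] have "(\<lambda>N. ennreal (osc f (Suc N) + m (Suc N))) \<longlonglongrightarrow> ennreal 0"
      by (intro tendsto_ennrealI LIMSEQ_Suc) simp
    then have "?I \<le> ennreal 0" by (rule LIMSEQ_le_const) (use up in auto)
    then show "?I = 0" by simp
  next
    assume z: "?I = 0"
    have "m N \<le> osc f N" if "N > 0" for N
      using lo[OF that] osc_nonneg[OF b, of N] unfolding z by (simp add: ennreal_le_iff)
    then show "m \<longlonglongrightarrow> 0"
      by (intro tendsto_sandwich[OF _ _ tendsto_const o] eventually_sequentiallyI[of 1]) (use m0 in auto)
  qed
  moreover have "(AE p in lborel. p \<in> hbox \<longrightarrow> f p = 0) \<longleftrightarrow> (AE p in lborel. p \<in> hbox \<longrightarrow> h p = 0)"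
  proof
    assume "AE p in lborel. p \<in> hbox \<longrightarrow> f p = 0"
    with h(3) show "AE p in lborel. p \<in> hbox \<longrightarrow> h p = 0" by eventually_elim simp
  next
    assume "AE p in lborel. p \<in> hbox \<longrightarrow> h p = 0"
    with h(3) show "AE p in lborel. p \<in> hbox \<longrightarrow> f p = 0" by eventually_elim simp
  qed
  ultimately show ?thesis unfolding unit_square_AE_hbox m_def I0 by simp
qed

definition row_mean :: "(real \<times> real \<Rightarrow> real) \<Rightarrow> nat \<Rightarrow> nat \<Rightarrow> real" where
  "row_mean f N i = (\<Sum>j=1..N. f (grid N i j)) / N"

text \<open>By Fubini the section integrals of the Borel version differ from the row means by at
  most \<open>osc f N\<close> in mean, so the row means tend to \<open>c\<close> in mean exactly if
  almost all section integrals equal \<open>c\<close>.\<close>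

lemma has_integral_section_iff_row_mean:
  fixes f :: "real \<times> real \<Rightarrow> real"
  assumes b: "bounded (f ` unit_square)" and o: "osc f \<longlonglongrightarrow> 0"
  shows "(AE u in lborel. u \<in> {0..1} \<longrightarrow> ((\<lambda>v. f (u, v)) has_integral c) {0..1}) \<longleftrightarrow>
    (\<lambda>N. (\<Sum>i=1..N. \<bar>row_mean f N i - c\<bar>) / N) \<longlonglongrightarrow> 0"
proof -
  obtain h B where h: "h \<in> borel_measurable borel" "\<And>p. \<bar>h p\<bar> \<le> B" "AE p in lborel. p \<in> hbox \<longrightarrow> f p = h p"
    and L1: "\<And>N. N > 0 \<Longrightarrow> (\<integral>\<^sup>+p. ennreal \<bar>h p - gstep f N (fst p) (snd p)\<bar> * indicator hbox p \<partial>lborel) \<le> ennreal (osc f N)"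
    using Borel_version[OF b o] by auto
  note [measurable] = h(1)
  have hb [measurable]: "hbox \<in> sets borel" unfolding borel_prod[symmetric] by measurable
  have hm2 [measurable]: "(\<lambda>(u, v). h (u, v)) \<in> borel_measurable (borel \<Otimes>\<^sub>M borel)"
    unfolding borel_prod by simp
  have gm2 [measurable]: "(\<lambda>(u, v). gstep f N u v) \<in> borel_measurable (borel \<Otimes>\<^sub>M borel)" for N
  proof -
    have "(\<lambda>p::real\<times>real. (\<lambda>(i,j). f (grid N i j)) (idx N (fst p), idx N (snd p))) \<in> borel_measurable (borel \<Otimes>\<^sub>M borel)" by measurable
    then show ?thesis by (simp add: gstep_def case_prod_beta)
  qed
  have gm [measurable]: "(\<lambda>p::real\<times>real. gstep f N (fst p) (snd p)) \<in> borel_measurable borel" for N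
    using gm2[of N] unfolding borel_prod case_prod_beta .
  have hu [measurable]: "(\<lambda>v. h (u, v)) \<in> borel_measurable borel" for u by measurable
  have int: "set_integrable lborel {0<..1} (\<lambda>v. h (u, v))" for u
    by (rule set_integrable_bound[where f = "\<lambda>_. B"])
       (use h(2) in \<open>auto simp: set_integrable_def integrable_real_indicator set_borel_measurable_def intro!: AE_I2 order_trans[OF h(2)]\<close>)
  define k where "k u = (LINT v:{0<..1}|lborel. h (u, v))" for u
  have km [measurable]: "k \<in> borel_measurable borel"
    unfolding k_def set_lebesgue_integral_def by measurable
  have kg: "ennreal \<bar>k u - row_mean f N (idx N u)\<bar> \<le> (\<integral>\<^sup>+v. ennreal \<bar>h (u, v) - gstep f N u v\<bar> * indicator {0<..1} v \<partial>lborel)"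
    if N: "N > 0" for N u
  proof -
    note st = integral_step[OF N, of "\<lambda>j. f (grid N (idx N u) j)"]
    have "k u - row_mean f N (idx N u) = (LINT v:{0<..1}|lborel. h (u, v) - gstep f N u v)"
      unfolding k_def row_mean_def gstep_def st(2)[symmetric] by (rule set_integral_diff(2)[symmetric, OF int st(1)])
    also have "ennreal \<bar>\<dots>\<bar> \<le> (\<integral>\<^sup>+v. ennreal (norm (indicator {0<..1} v *\<^sub>R (h (u, v) - gstep f N u v))) \<partial>lborel)"
      unfolding set_lebesgue_integral_def
      using integral_norm_bound_ennreal[of lborel "\<lambda>v. indicator {0<..1} v *\<^sub>R (h (u, v) - gstep f N u v)"] set_integral_diff(1)[OF int st(1)]
      by (simp add: set_integrable_def gstep_def)
    also have "\<dots> = (\<integral>\<^sup>+v. ennreal \<bar>h (u, v) - gstep f N u v\<bar> * indicator {0<..1} v \<partial>lborel)"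
      by (intro nn_integral_cong) (simp add: indicator_def)
    finally show ?thesis .
  qed
  have L1k: "(\<integral>\<^sup>+u. ennreal \<bar>k u - row_mean f N (idx N u)\<bar> * indicator {0<..1} u \<partial>lborel) \<le> ennreal (osc f N)" if N: "N > 0" for N
  proof -
    have "(\<integral>\<^sup>+u. ennreal \<bar>k u - row_mean f N (idx N u)\<bar> * indicator {0<..1} u \<partial>lborel)
      \<le> (\<integral>\<^sup>+u. \<integral>\<^sup>+v. ennreal \<bar>h (u, v) - gstep f N u v\<bar> * indicator hbox (u, v) \<partial>lborel \<partial>lborel)"
    proof (intro nn_integral_mono)
      fix u :: real
      show "ennreal \<bar>k u - row_mean f N (idx N u)\<bar> * indicator {0<..1} u \<le> (\<integral>\<^sup>+v. ennreal \<bar>h (u, v) - gstep f N u v\<bar> * indicator hbox (u, v) \<partial>lborel)"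
        using kg[OF N, of u] by (cases "u \<in> {0<..1}") (auto simp: indicator_def cong: if_cong)
    qed
    also have "\<dots> = (\<integral>\<^sup>+p. ennreal \<bar>h p - gstep f N (fst p) (snd p)\<bar> * indicator hbox p \<partial>(lborel \<Otimes>\<^sub>M lborel))"
    proof -
      have "(\<lambda>p. ennreal \<bar>h p - gstep f N (fst p) (snd p)\<bar> * indicator hbox p) \<in> borel_measurable (lborel \<Otimes>\<^sub>M lborel)"
        unfolding lborel_prod by measurable
      then show ?thesis by (subst lborel.nn_integral_fst[symmetric]) auto
    qed
    also have "\<dots> \<le> ennreal (osc f N)" unfolding lborel_prod by (rule L1[OF N])
    finally show ?thesis .
  qed
  define m where "m N = (\<Sum>i=1..N. \<bar>row_mean f N i - c\<bar>) / N" for N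
  have m0: "m N \<ge> 0" for N unfolding m_def by (intro divide_nonneg_nonneg sum_nonneg) auto
  have mi: "(\<integral>\<^sup>+u. ennreal \<bar>row_mean f N (idx N u) - c\<bar> * indicator {0<..1} u \<partial>lborel) = ennreal (m N)" if "N > 0" for N
    using nn_integral_step[OF that, of "\<lambda>i. ennreal \<bar>row_mean f N i - c\<bar>"]
    by (simp add: m_def ennreal_mult[symmetric] sum_ennreal sum_divide_distrib)
  let ?I = "\<integral>\<^sup>+u. ennreal \<bar>k u - c\<bar> * indicator {0<..1} u \<partial>lborel"
  have tri: "(\<integral>\<^sup>+u. ennreal \<bar>a u - c\<bar> * indicator {0<..1} u \<partial>lborel) \<le>
      (\<integral>\<^sup>+u. ennreal \<bar>a u - d u\<bar> * indicator {0<..1} u \<partial>lborel) + (\<integral>\<^sup>+u. ennreal \<bar>d u - c\<bar> * indicator {0<..1} u \<partial>lborel)"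
    if [measurable]: "a \<in> borel_measurable borel" "d \<in> borel_measurable borel" for a d :: "real \<Rightarrow> real"
  proof -
    have "(\<integral>\<^sup>+u. ennreal \<bar>a u - c\<bar> * indicator {0<..1} u \<partial>lborel) \<le> (\<integral>\<^sup>+u. ennreal \<bar>a u - d u\<bar> * indicator {0<..1} u + ennreal \<bar>d u - c\<bar> * indicator {0<..1} u \<partial>lborel)"
      by (intro nn_integral_mono) (auto simp: indicator_def ennreal_plus[symmetric] simp del: ennreal_plus intro!: ennreal_leI)
    also have "\<dots> = (\<integral>\<^sup>+u. ennreal \<bar>a u - d u\<bar> * indicator {0<..1} u \<partial>lborel) + (\<integral>\<^sup>+u. ennreal \<bar>d u - c\<bar> * indicator {0<..1} u \<partial>lborel)"
      by (rule nn_integral_add) measurable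
    finally show ?thesis .
  qed
  have rm [measurable]: "(\<lambda>u. row_mean f N (idx N u)) \<in> borel_measurable borel" for N by measurable
  have swap: "(\<integral>\<^sup>+u. ennreal \<bar>row_mean f N (idx N u) - k u\<bar> * indicator {0<..1} u \<partial>lborel) \<le> ennreal (osc f N)" if "N > 0" for N
    using L1k[OF that] by (simp add: abs_minus_commute)
  have up: "?I \<le> ennreal (osc f N + m N)" if N: "N > 0" for N
    using tri[OF km rm[of N]] L1k[OF N] mi[OF N] osc_nonneg[OF b, of N] m0[of N]
    by (simp add: ennreal_plus) (meson add_right_mono order_trans)
  have lo: "ennreal (m N) \<le> ennreal (osc f N) + ?I" if N: "N > 0" for N
    using tri[OF rm[of N] km] swap[OF N] mi[OF N] by (simp) (meson add_right_mono order_trans)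
  have I0: "?I = 0 \<longleftrightarrow> (AE u in lborel. u \<in> {0<..1} \<longrightarrow> k u = c)"
    by (subst nn_integral_0_iff_AE) (auto simp: indicator_def ennreal_eq_0_iff intro!: AE_cong)
  have "m \<longlonglongrightarrow> 0 \<longleftrightarrow> ?I = 0"
  proof
    assume "m \<longlonglongrightarrow> 0"
    from tendsto_add[OF o this] have "(\<lambda>N. ennreal (osc f (Suc N) + m (Suc N))) \<longlonglongrightarrow> ennreal 0"
      by (intro tendsto_ennrealI LIMSEQ_Suc) simp
    then have "?I \<le> ennreal 0" by (rule LIMSEQ_le_const) (use up in auto)
    then show "?I = 0" by simp
  next
    assume z: "?I = 0"
    have "m N \<le> osc f N" if "N > 0" for N
      using lo[OF that] osc_nonneg[OF b, of N] unfolding z by (simp add: ennreal_le_iff)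
    then show "m \<longlonglongrightarrow> 0"
      by (intro tendsto_sandwich[OF _ _ tendsto_const o] eventually_sequentiallyI[of 1]) (use m0 in auto)
  qed
  moreover have "(AE u in lborel. u \<in> {0..1} \<longrightarrow> ((\<lambda>v. f (u, v)) has_integral c) {0..1}) \<longleftrightarrow> (AE u in lborel. u \<in> {0<..1} \<longrightarrow> k u = c)"
  proof -
    \<comment> \<open>For almost every \<open>u\<close> the section of \<open>f\<close> agrees
      almost everywhere with a Borel section, and is therefore integrable although \<open>f\<close>
      itself need not be Borel.\<close>
    have "AE u in lborel. AE v in lborel. (u, v) \<in> hbox \<longrightarrow> f (u, v) = h (u, v)"
      using h(3) unfolding lborel_prod[symmetric] by (rule lborel_pair.AE_pair)
    then have "AE u in lborel. u \<in> {0<..1} \<longrightarrow> ((\<lambda>v. f (u, v)) has_integral k u) {0..1}"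
    proof eventually_elim
      case (elim u)
      show ?case
      proof
        assume u: "u \<in> {0<..1}"
        have "((\<lambda>v. h (u, v)) has_integral k u) {0<..1}"
          using set_borel_integral_eq_integral[OF int[of u]] unfolding k_def by (simp add: integrable_integral)
        then have hi: "((\<lambda>v. if v \<in> {0<..1} then h (u, v) else 0) has_integral k u) UNIV"
          by (simp only: has_integral_restrict_UNIV)
        \<comment> \<open>The exceptional set need not be Borel, hence the completion; the point 0
          is added because \<open>hbox\<close> leaves it out.\<close>
        have "{v. \<not> ((u, v) \<in> hbox \<longrightarrow> f (u, v) = h (u, v))} \<union> {0} \<in> null_sets lebesgue"
        proof -
          have "{v. \<not> ((u, v) \<in> hbox \<longrightarrow> f (u, v) = h (u, v))} \<in> null_sets lebesgue"
            using AE_completion[OF elim]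
            by (simp only: completion.AE_iff_null_sets space_completion space_lborel space_borel UNIV_I simp_thms)
          then show ?thesis by auto
        qed
        then have ng: "negligible ({v. \<not> ((u, v) \<in> hbox \<longrightarrow> f (u, v) = h (u, v))} \<union> {0})"
          by (simp add: negligible_iff_null_sets)
        have "((\<lambda>v. if v \<in> {0..1} then f (u, v) else 0) has_integral k u) UNIV"
          by (rule has_integral_spike[OF ng _ hi]) (use u in auto)
        then show "((\<lambda>v. f (u, v)) has_integral k u) {0..1}" by (simp only: has_integral_restrict_UNIV)
      qed
    qed
    moreover have "AE u in lborel. u \<noteq> (0::real)" by (rule AE_lborel_singleton)
    ultimately have key: "AE u in lborel. (u \<in> {0..1} \<longrightarrow> ((\<lambda>v. f (u, v)) has_integral c) {0..1}) \<longleftrightarrow> (u \<in> {0<..1} \<longrightarrow> k u = c)"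
    proof eventually_elim
      case (elim u)
      then show ?case using has_integral_unique[of "\<lambda>v. f (u, v)"] by auto
    qed
    show ?thesis
    proof
      assume "AE u in lborel. u \<in> {0..1} \<longrightarrow> ((\<lambda>v. f (u, v)) has_integral c) {0..1}"
      with key show "AE u in lborel. u \<in> {0<..1} \<longrightarrow> k u = c" by eventually_elim blast
    next
      assume "AE u in lborel. u \<in> {0<..1} \<longrightarrow> k u = c"
      with key show "AE u in lborel. u \<in> {0..1} \<longrightarrow> ((\<lambda>v. f (u, v)) has_integral c) {0..1}" by eventually_elim blast
    qed
  qed
  ultimately show ?thesis unfolding I0 m_def by simp
qed

section \<open>The fourth moment of the trace\<close>

text \<open>Started at a vertex of \<open>V0\<close>, the walk can reach a new vertex only along a
  new edge, so it adds at least as many edges as vertices.\<close>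

lemma closed_walk_excess:
  assumes k: "k > 0" and V0: "finite V0" and F0: "finite F0" "\<And>e. e \<in> F0 \<Longrightarrow> fst e \<in> V0 \<and> snd e \<in> V0"
    and s0: "s0 < k" "w s0 \<in> V0"
  shows "card (V0 \<union> w ` {..<k}) + card F0 \<le> card V0 + card (F0 \<union> step k w ` {..<k})"
proof -
  \<comment> \<open>Rotates the closed walk so that it starts at the position \<open>s0\<close>,
    which lies in \<open>V0\<close>.\<close>
  define pos where "pos m = (s0 + m) mod k" for m
  define U where "U m = V0 \<union> (\<lambda>i. w (pos i)) ` {..m}" for m
  define H where "H m = F0 \<union> (\<lambda>i. step k w (pos i)) ` {..<m}" for m
  have fU: "finite (U m)" and fH: "finite (H m)" for m using V0 F0 by (auto simp: U_def H_def)
  have pS: "pos (Suc m) = Suc (pos m) mod k" for m by (simp add: pos_def mod_Suc_eq)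
  have US: "U (Suc m) = insert (w (pos (Suc m))) (U m)" for m by (auto simp: U_def atMost_Suc)
  have HS: "H (Suc m) = insert (ed (w (pos m)) (w (pos (Suc m)))) (H m)" for m
    by (auto simp: H_def lessThan_Suc step_def pS)
  have "card (U m) + card F0 \<le> card V0 + card (H m) \<and> (\<forall>e\<in>H m. fst e \<in> U m \<and> snd e \<in> U m)" for m
  proof (induction m)
    case 0
    have "U 0 = V0" "H 0 = F0" using s0 by (auto simp: U_def H_def pos_def)
    then show ?case using F0 by simp
  next
    case (Suc m)
    let ?x = "w (pos (Suc m))" and ?e = "ed (w (pos m)) (w (pos (Suc m)))"
    have m: "w (pos m) \<in> U m" by (auto simp: U_def)
    have "\<forall>e\<in>H (Suc m). fst e \<in> U (Suc m) \<and> snd e \<in> U (Suc m)"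
      using Suc m unfolding US HS by (auto simp: ed_def min_def max_def)
    moreover have "card (U (Suc m)) + card F0 \<le> card V0 + card (H (Suc m))"
    proof (cases "?x \<in> U m")
      case True
      then have "card (U (Suc m)) = card (U m)" unfolding US by (simp add: insert_absorb)
      moreover have "card (H m) \<le> card (H (Suc m))" by (rule card_mono[OF fH]) (auto simp: HS)
      ultimately show ?thesis using Suc by linarith
    next
      case False
      have "?e \<notin> H m"
      proof
        assume "?e \<in> H m"
        then have "fst ?e \<in> U m \<and> snd ?e \<in> U m" using Suc by blast
        then have "?x \<in> U m" by (auto simp: ed_def min_def max_def split: if_splits)
        then show False using False by simp
      qed
      then have "card (H (Suc m)) = Suc (card (H m))" unfolding HS using fH by simp
      moreover have "card (U (Suc m)) = Suc (card (U m))" unfolding US using fU False by simp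
      ultimately show ?thesis using Suc by linarith
    qed
    ultimately show ?case by blast
  qed
  from this[of k] have *: "card (U k) + card F0 \<le> card V0 + card (H k)" by simp
  have im: "pos ` {..<k} = {..<k}"
  proof
    show "pos ` {..<k} \<subseteq> {..<k}" using k by (auto simp: pos_def)
    show "{..<k} \<subseteq> pos ` {..<k}"
    proof
      fix r assume r: "r \<in> {..<k}"
      have "pos ((r + k - s0) mod k) = (s0 + (r + k - s0)) mod k" by (simp add: pos_def mod_add_right_eq)
      also have "\<dots> = r" using r s0 by simp
      finally show "r \<in> pos ` {..<k}" using k by (intro image_eqI[of _ _ "(r + k - s0) mod k"]) auto
    qed
  qed
  have "H k = F0 \<union> step k w ` (pos ` {..<k})" unfolding H_def image_image ..
  then have Hk: "H k = F0 \<union> step k w ` {..<k}" unfolding im .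
  have "V0 \<union> w ` (pos ` {..<k}) \<subseteq> U k" unfolding U_def image_image by auto
  then have "card (V0 \<union> w ` {..<k}) \<le> card (U k)" unfolding im by (rule card_mono[OF fU])
  then show ?thesis using * unfolding Hk by linarith
qed

section \<open>Joint central moments of four circuits\<close>

definition vset :: "nat \<Rightarrow> (nat \<Rightarrow> nat \<Rightarrow> nat) \<Rightarrow> nat set \<Rightarrow> nat set" where
  "vset k W J = (\<Union>a\<in>J. W a ` {..<k})"

definition eset :: "nat \<Rightarrow> (nat \<Rightarrow> nat \<Rightarrow> nat) \<Rightarrow> nat set \<Rightarrow> (nat \<times> nat) set" where
  "eset k W J = (\<Union>a\<in>J. step k (W a) ` {..<k})"

lemma finite_vset [simp]: "finite J \<Longrightarrow> finite (vset k W J)" and finite_eset [simp]: "finite J \<Longrightarrow> finite (eset k W J)"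
  by (auto simp: vset_def eset_def)

lemma vset_insert: "vset k W (insert a J) = vset k W J \<union> W a ` {..<k}"
  and eset_insert: "eset k W (insert a J) = eset k W J \<union> step k (W a) ` {..<k}"
  by (auto simp: vset_def eset_def)

lemma step_endpoints: "s < k \<Longrightarrow> fst (step k w s) \<in> w ` {..<k} \<and> snd (step k w s) \<in> w ` {..<k}"
  by (auto simp: step_def ed_def min_def max_def)

lemma eset_endpoints: "e \<in> eset k W J \<Longrightarrow> fst e \<in> vset k W J \<and> snd e \<in> vset k W J"
  unfolding eset_def vset_def using step_endpoints by fastforce

text \<open>A further circuit raises the excess of vertices over edges by at most one, for its
  starting vertex. If it shares an edge with the earlier circuits, it can be started at an old
  vertex and the excess does not grow.\<close>

lemma excess_insert:
  assumes k: "k > 0" and J: "finite J" and ex: "card (vset k W J) \<le> card (eset k W J) + c"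
  shows "card (vset k W (insert a J)) \<le> card (eset k W (insert a J)) + Suc c"
    and "step k (W a) ` {..<k} \<inter> eset k W J \<noteq> {} \<Longrightarrow> card (vset k W (insert a J)) \<le> card (eset k W (insert a J)) + c"
proof -
  have gen: "card (vset k W (insert a J)) + card (eset k W J) \<le> card V0 + card (eset k W (insert a J))"
    if "vset k W J \<subseteq> V0" "finite V0" "s < k" "W a s \<in> V0" for V0 s
  proof -
    have "card (V0 \<union> W a ` {..<k}) + card (eset k W J) \<le> card V0 + card (eset k W J \<union> step k (W a) ` {..<k})"
      using closed_walk_excess[of k V0 "eset k W J" s "W a"] k eset_endpoints[of _ k W J] J that by auto
    moreover have "card (vset k W (insert a J)) \<le> card (V0 \<union> W a ` {..<k})"
      by (rule card_mono) (use that in \<open>auto simp: vset_insert\<close>)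
    ultimately show ?thesis by (simp add: eset_insert)
  qed
  have "card (insert (W a 0) (vset k W J)) \<le> Suc (card (vset k W J))" by (rule card_insert_le_m1) auto
  then show "card (vset k W (insert a J)) \<le> card (eset k W (insert a J)) + Suc c"
    using gen[of "insert (W a 0) (vset k W J)" 0, OF subset_insertI] k J ex by simp
  assume "step k (W a) ` {..<k} \<inter> eset k W J \<noteq> {}"
  then obtain s where s: "s < k" "step k (W a) s \<in> eset k W J" by blast
  from eset_endpoints[OF s(2)] have "W a s \<in> vset k W J" by (auto simp: step_def ed_def min_def max_def split: if_splits)
  then show "card (vset k W (insert a J)) \<le> card (eset k W (insert a J)) + c"
    using gen[of "vset k W J" s] s J ex by auto
qed

text \<open>If every circuit shares an edge with another one, the circuits fall into at most two
  connected groups, and each group has at most one vertex more than edges.\<close>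

lemma four_circuits_excess:
  assumes k: "k > 0"
    and touch: "\<And>a. a < 4 \<Longrightarrow> \<exists>b<4. b \<noteq> a \<and> step k (W a) ` {..<k} \<inter> step k (W b) ` {..<k} \<noteq> {}"
  shows "card (vset k W {..<4}) \<le> card (eset k W {..<4}) + 2"
proof -
  let ?S = "\<lambda>a. step k (W a) ` {..<k}"
  obtain b where b: "b < 4" "b \<noteq> 0" "?S 0 \<inter> ?S b \<noteq> {}" using touch[of 0] by auto
  have e0: "card (vset k W {}) \<le> card (eset k W {}) + 0" by (simp add: vset_def)
  have e1: "card (vset k W {0}) \<le> card (eset k W {0}) + Suc 0" by (rule excess_insert(1)[OF k _ e0]) simp
  have e2: "card (vset k W {b, 0}) \<le> card (eset k W {b, 0}) + Suc 0"
    by (rule excess_insert(2)[OF k _ e1]) (use b in \<open>auto simp: eset_def\<close>)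
  have "card ({..<4} - {0, b}) = 2" using b by (subst card_Diff_subset) auto
  then obtain l m where lm: "{..<4} - {0, b} = {l, m}" "l \<noteq> m" by (auto simp: card_2_iff)
  have "{..<4} = ({..<4} - {0, b}) \<union> {0, b}" using b by auto
  then have "{..<4} = {l, m} \<union> {0, b}" unfolding lm(1) .
  then have all: "{..<4} = {m, l, b, 0}" "{..<4} = {l, m, b, 0}" by blast+
  have easy: ?thesis if "{..<4} = {y, x, b, 0}" "?S x \<inter> eset k W {b, 0} \<noteq> {}" for x y
  proof -
    have e3: "card (vset k W {x, b, 0}) \<le> card (eset k W {x, b, 0}) + Suc 0" by (rule excess_insert(2)[OF k _ e2 that(2)]) simp
    have "card (vset k W {y, x, b, 0}) \<le> card (eset k W {y, x, b, 0}) + Suc (Suc 0)" by (rule excess_insert(1)[OF k _ e3]) simp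
    then show ?thesis using that(1) by (simp add: numeral_2_eq_2)
  qed
  show ?thesis
  proof (cases "?S l \<inter> eset k W {b, 0} \<noteq> {} \<or> ?S m \<inter> eset k W {b, 0} \<noteq> {}")
    case True
    then show ?thesis using easy all by blast
  next
    case False
    \<comment> \<open>Neither of the two remaining circuits meets the first pair, so they meet each
      other and form the second group.\<close>
    have "l < 4" using all(1) by (metis insertCI lessThan_iff)
    then obtain c where c: "c < 4" "c \<noteq> l" "?S l \<inter> ?S c \<noteq> {}" using touch[of l] by auto
    have "c \<in> {m, l, b, 0}" using c all(1) by (metis lessThan_iff)
    then have cm: "c = m" using False c by (auto simp: eset_def)
    have e3: "card (vset k W {l, b, 0}) \<le> card (eset k W {l, b, 0}) + Suc (Suc 0)" by (rule excess_insert(1)[OF k _ e2]) simp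
    have "card (vset k W {m, l, b, 0}) \<le> card (eset k W {m, l, b, 0}) + Suc (Suc 0)"
      by (rule excess_insert(2)[OF k _ e3]) (use c cm in \<open>auto simp: eset_def\<close>)
    then show ?thesis using all(1) by (simp add: numeral_2_eq_2)
  qed
qed

text \<open>The mixed moment of the circuits in \<open>A\<close>: an edge counts once for every pair
  of a circuit and a position at which it is crossed.\<close>

definition mprod :: "(nat \<times> nat \<Rightarrow> nat \<Rightarrow> real) \<Rightarrow> nat \<Rightarrow> (nat \<Rightarrow> nat \<Rightarrow> nat) \<Rightarrow> nat set \<Rightarrow> real" where
  "mprod m k W A = (\<Prod>e\<in>eset k W A. m e (card {z \<in> A \<times> {..<k}. step k (W (fst z)) (snd z) = e}))"

lemma mprod_insert:
  assumes A: "finite A" "a \<notin> A" and d: "step k (W a) ` {..<k} \<inter> eset k W A = {}"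
  shows "mprod m k W (insert a A) = mprod m k W {a} * mprod m k W A"
proof -
  let ?c = "\<lambda>A e. card {z \<in> A \<times> {..<k}. step k (W (fst z)) (snd z) = e}"
  have 1: "?c (insert a A) e = ?c {a} e" if "e \<in> step k (W a) ` {..<k}" for e
  proof -
    have "e \<notin> eset k W A" using that d by auto
    then have "{z \<in> insert a A \<times> {..<k}. step k (W (fst z)) (snd z) = e} = {z \<in> {a} \<times> {..<k}. step k (W (fst z)) (snd z) = e}"
      by (force simp: eset_def)
    then show ?thesis by simp
  qed
  have 2: "?c (insert a A) e = ?c A e" if "e \<in> eset k W A" for e
  proof -
    have "e \<notin> step k (W a) ` {..<k}" using that d by auto
    then have "{z \<in> insert a A \<times> {..<k}. step k (W (fst z)) (snd z) = e} = {z \<in> A \<times> {..<k}. step k (W (fst z)) (snd z) = e}"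
      by force
    then show ?thesis by simp
  qed
  have ea: "eset k W {a} = step k (W a) ` {..<k}" by (simp add: eset_def)
  have "mprod m k W (insert a A) = (\<Prod>e\<in>step k (W a) ` {..<k} \<union> eset k W A. m e (?c (insert a A) e))"
    unfolding mprod_def eset_insert by (simp add: Un_commute)
  also have "\<dots> = (\<Prod>e\<in>step k (W a) ` {..<k}. m e (?c (insert a A) e)) * (\<Prod>e\<in>eset k W A. m e (?c (insert a A) e))"
    by (rule prod.union_disjoint) (use A d in auto)
  also have "\<dots> = mprod m k W {a} * mprod m k W A"
    unfolding mprod_def ea using 1 2 by (intro arg_cong2[of _ _ _ _ "(*)"] prod.cong) auto
  finally show ?thesis .
qed

text \<open>The joint central moment of the circuits, expanded into products of mixed moments.\<close>

definition cmoment :: "(nat \<times> nat \<Rightarrow> nat \<Rightarrow> real) \<Rightarrow> nat \<Rightarrow> (nat \<Rightarrow> nat \<Rightarrow> nat) \<Rightarrow> nat set \<Rightarrow> real" where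
  "cmoment m k W J = (\<Sum>A\<in>Pow J. mprod m k W A * (\<Prod>a\<in>J - A. - mprod m k W {a}))"

text \<open>A circuit without common edges factors out of the mixed moments, so the terms for
  \<open>A\<close> and \<open>insert a A\<close> cancel.\<close>

lemma cmoment_isolated:
  assumes J: "finite J" "a \<in> J" and d: "\<And>b. b \<in> J \<Longrightarrow> b \<noteq> a \<Longrightarrow> step k (W a) ` {..<k} \<inter> step k (W b) ` {..<k} = {}"
  shows "cmoment m k W J = 0"
proof -
  define K where "K = J - {a}"
  have JK: "J = insert a K" "a \<notin> K" "finite K" using J by (auto simp: K_def)
  have dA: "step k (W a) ` {..<k} \<inter> eset k W A = {}" if "A \<subseteq> K" for A
    using d that JK unfolding eset_def by blast
  have "cmoment m k W J = (\<Sum>A\<in>Pow K. mprod m k W A * (\<Prod>b\<in>J - A. - mprod m k W {b}))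
      + (\<Sum>A\<in>insert a ` Pow K. mprod m k W A * (\<Prod>b\<in>J - A. - mprod m k W {b}))"
    unfolding cmoment_def JK(1) Pow_insert using JK by (intro sum.union_disjoint) auto
  also have "(\<Sum>A\<in>insert a ` Pow K. mprod m k W A * (\<Prod>b\<in>J - A. - mprod m k W {b}))
    = (\<Sum>A\<in>Pow K. mprod m k W (insert a A) * (\<Prod>b\<in>J - insert a A. - mprod m k W {b}))"
  proof (subst sum.reindex)
    show "inj_on (insert a) (Pow K)" using JK(2) by (intro inj_onI) (metis PowD insert_ident subsetD)
  qed simp
  also have "(\<Sum>A\<in>Pow K. mprod m k W A * (\<Prod>b\<in>J - A. - mprod m k W {b})) = (\<Sum>A\<in>Pow K. - (mprod m k W (insert a A) * (\<Prod>b\<in>J - insert a A. - mprod m k W {b})))"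
  proof (rule sum.cong[OF refl])
    fix A assume A: "A \<in> Pow K"
    then have "J - A = insert a (K - A)" "J - insert a A = K - A" "a \<notin> A" "finite A" using JK by (auto intro: finite_subset)
    moreover have "mprod m k W (insert a A) = mprod m k W {a} * mprod m k W A"
      by (rule mprod_insert) (use A dA calculation in auto)
    ultimately show "mprod m k W A * (\<Prod>b\<in>J - A. - mprod m k W {b}) = - (mprod m k W (insert a A) * (\<Prod>b\<in>J - insert a A. - mprod m k W {b}))"
      using JK by simp
  qed
  finally show ?thesis by (simp add: sum_negf)
qed

lemma mult_le_mprod:
  assumes "finite A" "e \<in> eset k W A"
  shows "card {z \<in> A \<times> {..<k}. step k (W (fst z)) (snd z) = e} \<ge> 1"
    "card {z \<in> A \<times> {..<k}. step k (W (fst z)) (snd z) = e} \<le> card A * k"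
proof -
  have f: "finite {z \<in> A \<times> {..<k}. step k (W (fst z)) (snd z) = e}" using assms by auto
  obtain a s where "a \<in> A" "s < k" "step k (W a) s = e" using assms(2) by (auto simp: eset_def)
  then have "(a, s) \<in> {z \<in> A \<times> {..<k}. step k (W (fst z)) (snd z) = e}" by auto
  then show "card {z \<in> A \<times> {..<k}. step k (W (fst z)) (snd z) = e} \<ge> 1"
  proof -
    assume "(a, s) \<in> {z \<in> A \<times> {..<k}. step k (W (fst z)) (snd z) = e}"
    then have "{z \<in> A \<times> {..<k}. step k (W (fst z)) (snd z) = e} \<noteq> {}" by blast
    then have "card {z \<in> A \<times> {..<k}. step k (W (fst z)) (snd z) = e} > 0" using f by (intro card_gt_0_iff[THEN iffD2] conjI)
    then show ?thesis by linarith
  qed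
  have "card {z \<in> A \<times> {..<k}. step k (W (fst z)) (snd z) = e} \<le> card (A \<times> {..<k})" by (rule card_mono) (use assms in auto)
  then show "card {z \<in> A \<times> {..<k}. step k (W (fst z)) (snd z) = e} \<le> card A * k" by (simp only: card_cartesian_product card_lessThan)
qed

lemma mprod_bound:
  assumes A: "finite A" and B: "\<And>e r. e \<in> eset k W A \<Longrightarrow> 1 \<le> r \<Longrightarrow> r \<le> card A * k \<Longrightarrow> \<bar>m e r\<bar> \<le> B"
  shows "\<bar>mprod m k W A\<bar> \<le> B ^ card (eset k W A)"
proof -
  have "\<bar>mprod m k W A\<bar> = (\<Prod>e\<in>eset k W A. \<bar>m e (card {z \<in> A \<times> {..<k}. step k (W (fst z)) (snd z) = e})\<bar>)"
    unfolding mprod_def by (rule abs_prod)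
  also have "\<dots> \<le> (\<Prod>e\<in>eset k W A. B)"
    by (intro prod_mono conjI abs_ge_zero B) (use mult_le_mprod[OF A] in auto)
  finally show ?thesis by simp
qed

text \<open>There are \<open>2 ^ card J\<close> terms. Splitting circuits off into separate means
  can only increase the number of factors \<open>q\<close>, because a shared edge is then counted
  repeatedly; the number of factors \<open>C\<close> stays at most
  \<open>card J * k\<close>.\<close>

lemma cmoment_bound:
  assumes J: "finite J" and C: "C \<ge> 1" and q: "0 < q" "q \<le> 1"
    and B: "\<And>e r. e \<in> eset k W J \<Longrightarrow> 1 \<le> r \<Longrightarrow> r \<le> card J * k \<Longrightarrow> \<bar>m e r\<bar> \<le> C * q"
  shows "\<bar>cmoment m k W J\<bar> \<le> 2 ^ card J * (C ^ (card J * k) * q ^ card (eset k W J))"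
proof -
  have cE: "card (eset k W {a}) \<le> k" for a
    using card_image_le[of "{..<k}" "step k (W a)"] by (simp add: eset_def)
  have cEA: "card (eset k W A) \<le> (\<Sum>a\<in>A. card (eset k W {a}))" if "finite A" for A
    using card_UN_le[OF that, of "\<lambda>a. step k (W a) ` {..<k}"] by (simp add: eset_def)
  have tm: "\<bar>mprod m k W A * (\<Prod>a\<in>J - A. - mprod m k W {a})\<bar> \<le> C ^ (card J * k) * q ^ card (eset k W J)" if A: "A \<in> Pow J" for A
  proof -
    have fA: "finite A" "finite (J - A)" using A J by (auto intro: finite_subset)
    let ?N = "card (eset k W A) + (\<Sum>a\<in>J - A. card (eset k W {a}))"
    have sub: "eset k W A' \<subseteq> eset k W J" if "A' \<subseteq> J" for A' using that by (auto simp: eset_def)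
    have b1: "\<bar>mprod m k W A\<bar> \<le> (C * q) ^ card (eset k W A)"
    proof (rule mprod_bound[OF fA(1) B])
      fix e r assume "e \<in> eset k W A" "1 \<le> r" "r \<le> card A * k"
      moreover have "card A * k \<le> card J * k" using A J by (intro mult_right_mono card_mono) auto
      ultimately show "e \<in> eset k W J" "1 \<le> r" "r \<le> card J * k" using sub[of A] A by (blast, linarith, linarith)
    qed
    have b2: "\<bar>mprod m k W {a}\<bar> \<le> (C * q) ^ card (eset k W {a})" if a: "a \<in> J - A" for a
    proof (rule mprod_bound[OF _ B])
      fix e r assume "e \<in> eset k W {a}" "1 \<le> r" "r \<le> card {a} * k"
      moreover have "card {a} * k \<le> card J * k" using a J by (intro mult_right_mono card_mono) auto
      ultimately show "e \<in> eset k W J" "1 \<le> r" "r \<le> card J * k" using sub[of "{a}"] a by (blast, linarith, linarith)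
    qed simp
    have "\<bar>mprod m k W A * (\<Prod>a\<in>J - A. - mprod m k W {a})\<bar> = \<bar>mprod m k W A\<bar> * (\<Prod>a\<in>J - A. \<bar>mprod m k W {a}\<bar>)"
      by (simp add: abs_mult abs_prod)
    also have "\<dots> \<le> (C * q) ^ card (eset k W A) * (\<Prod>a\<in>J - A. (C * q) ^ card (eset k W {a}))"
      using b1 b2 C q by (intro mult_mono prod_mono) (auto intro!: prod_nonneg)
    also have "\<dots> = C ^ ?N * q ^ ?N" by (simp only: power_sum[symmetric] power_add[symmetric]) (simp only: power_mult_distrib)
    also have "\<dots> \<le> C ^ (card J * k) * q ^ card (eset k W J)"
    proof (intro mult_mono)
      have "?N \<le> (\<Sum>a\<in>A. card (eset k W {a})) + (\<Sum>a\<in>J - A. card (eset k W {a}))" using cEA[OF fA(1)] by simp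
      also have "\<dots> = (\<Sum>a\<in>J. card (eset k W {a}))" using A J by (metis PowD add.commute sum.subset_diff)
      also have "\<dots> \<le> (\<Sum>a\<in>J. k)" by (intro sum_mono cE)
      finally show "C ^ ?N \<le> C ^ (card J * k)" using C by (intro power_increasing) auto
      have "eset k W J = eset k W A \<union> eset k W (J - A)" using A by (auto simp: eset_def)
      then have "card (eset k W J) \<le> card (eset k W A) + card (eset k W (J - A))" by (metis card_Un_le)
      then have "card (eset k W J) \<le> ?N" using cEA[OF fA(2)] by simp
      then show "q ^ ?N \<le> q ^ card (eset k W J)" using q by (intro power_decreasing) auto
    qed (use C q in auto)
    finally show ?thesis .
  qed
  have "\<bar>cmoment m k W J\<bar> \<le> (\<Sum>A\<in>Pow J. C ^ (card J * k) * q ^ card (eset k W J))"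
    unfolding cmoment_def by (rule order_trans[OF sum_abs sum_mono[OF tm]])
  then show ?thesis using J by (simp add: card_Pow)
qed

text \<open>A family of walks with \<open>v\<close> vertices in all is a family of walks on
  \<open>{..<v}\<close> followed by a labelling.\<close>

lemma card_walks_with_vertices:
  assumes J: "finite J"
  shows "card {W \<in> PiE J (\<lambda>_. PiE {..<k} (\<lambda>_. {1..n})). card (vset k W J) = v} \<le> v ^ (k * card J) * n ^ v"
proof -
  let ?T = "PiE J (\<lambda>_. PiE {..<k} (\<lambda>_. {..<v})) \<times> PiE {..<v} (\<lambda>_. {1..n})"
  let ?f = "\<lambda>(P, \<phi>). (\<lambda>a\<in>J. \<lambda>s\<in>{..<k}. \<phi> (P a s))"
  have fT: "finite ?T" using J by (intro finite_cartesian_product finite_PiE) auto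
  have "{W \<in> PiE J (\<lambda>_. PiE {..<k} (\<lambda>_. {1..n})). card (vset k W J) = v} \<subseteq> ?f ` ?T"
  proof
    fix W :: "nat \<Rightarrow> nat \<Rightarrow> nat" assume "W \<in> {W \<in> PiE J (\<lambda>_. PiE {..<k} (\<lambda>_. {1..n})). card (vset k W J) = v}"
    then have W: "W \<in> PiE J (\<lambda>_. PiE {..<k} (\<lambda>_. {1..n}))" and c: "card (vset k W J) = v" by auto
    obtain h where h: "bij_betw h {..<v} (vset k W J)"
      using ex_bij_betw_nat_finite[OF finite_vset[OF J], of k W] c by (auto simp: atLeast0LessThan)
    have mem: "W a s \<in> vset k W J" if "a \<in> J" "s < k" for a s using that by (auto simp: vset_def)
    have hi: "h (inv_into {..<v} h x) = x" "inv_into {..<v} h x \<in> {..<v}" if "x \<in> vset k W J" for x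
    proof -
      have "x \<in> h ` {..<v}" using h that by (simp add: bij_betw_def)
      then show "h (inv_into {..<v} h x) = x" "inv_into {..<v} h x \<in> {..<v}" by (rule f_inv_into_f inv_into_into)+
    qed
    let ?P = "\<lambda>a\<in>J. \<lambda>s\<in>{..<k}. inv_into {..<v} h (W a s)"
    have sub: "vset k W J \<subseteq> {1..n}" using W by (auto simp: vset_def PiE_def Pi_def)
    have "restrict h {..<v} \<in> PiE {..<v} (\<lambda>_. {1..n})" using h sub by (auto simp: bij_betw_def)
    moreover have "?P \<in> PiE J (\<lambda>_. PiE {..<k} (\<lambda>_. {..<v}))"
      by (intro restrict_PiE_iff[THEN iffD2] ballI) (use hi(2) mem in auto)
    moreover have "?f (?P, restrict h {..<v}) = W"
    proof (rule ext)
      fix a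
      show "?f (?P, restrict h {..<v}) a = W a"
      proof (cases "a \<in> J")
        case True
        have "W a \<in> extensional {..<k}" using W True by (auto simp: PiE_def Pi_def)
        then show ?thesis using True hi[OF mem[OF True]] by (auto simp: extensional_def fun_eq_iff)
      next
        case False
        then show ?thesis using W by (auto simp: PiE_def extensional_def)
      qed
    qed
    ultimately show "W \<in> ?f ` ?T" by (intro image_eqI[of _ _ "(?P, restrict h {..<v})"]) auto
  qed
  then have "card {W \<in> PiE J (\<lambda>_. PiE {..<k} (\<lambda>_. {1..n})). card (vset k W J) = v} \<le> card ?T"
    by (rule surj_card_le[OF fT])
  also have "\<dots> = v ^ (k * card J) * n ^ v"
    using J by (simp add: card_cartesian_product card_PiE power_mult)
  finally show ?thesis .
qed

text \<open>Only families without an isolated circuit contribute, and with \<open>v\<close> vertices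
  these have at least \<open>v - 2\<close> edges. Counting gives \<open>n ^ v\<close> times
  \<open>n powr (- \<alpha> * (v - 2))\<close>, where \<open>v \<le> 4 * k\<close>.\<close>

lemma sum_cmoment_bound:
  fixes m :: "nat \<times> nat \<Rightarrow> nat \<Rightarrow> real"
  assumes k: "k > 0" and n: "n \<ge> 1" and C: "C \<ge> 1" and a: "0 < \<alpha>" "\<alpha> \<le> 1"
    and B: "\<And>e r. fst e \<in> {1..n} \<Longrightarrow> snd e \<in> {1..n} \<Longrightarrow> fst e \<le> snd e \<Longrightarrow> 1 \<le> r \<Longrightarrow> r \<le> 4 * k \<Longrightarrow> \<bar>m e r\<bar> \<le> C * real n powr (- \<alpha>)"
  shows "(\<Sum>W\<in>PiE {..<4} (\<lambda>_. PiE {..<k} (\<lambda>_. {1..n})). cmoment m k W {..<4})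
    \<le> (real (4 * k) + 1) * (2 ^ 4 * C ^ (4 * k) * real (4 * k) ^ (4 * k)) * real n powr (2 + (1 - \<alpha>) * real (4 * k))"
proof -
  let ?W = "PiE {..<4::nat} (\<lambda>_. PiE {..<k} (\<lambda>_. {1..n}))"
  let ?q = "real n powr (- \<alpha>)"
  have fW: "finite ?W" by (intro finite_PiE) auto
  have q: "0 < ?q" "?q \<le> 1" using n a by (auto simp: powr_minus inverse_le_1_iff ge_one_powr_ge_zero)
  have sub: "vset k W {..<4} \<subseteq> {1..n}" if "W \<in> ?W" for W using that by (auto simp: vset_def PiE_def Pi_def)
  have ord: "fst e \<le> snd e" if "e \<in> eset k W J" for e W J using that by (auto simp: eset_def step_def ed_def)
  have v4: "card (vset k W {..<4}) \<le> 4 * k" for W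
  proof -
    have "card (vset k W {..<4}) \<le> (\<Sum>a<4. card (W a ` {..<k}))" unfolding vset_def by (rule card_UN_le) simp
    also have "\<dots> \<le> (\<Sum>a<(4::nat). k)" by (intro sum_mono order_trans[OF card_image_le]) auto
    finally show ?thesis by simp
  qed
  let ?D = "2 ^ 4 * C ^ (4 * k)"
  have each: "cmoment m k W {..<4} \<le> ?D * real n powr (- \<alpha> * (real (card (vset k W {..<4})) - 2))" if W: "W \<in> ?W" for W
  proof (cases "\<forall>a<4. \<exists>b<4. b \<noteq> a \<and> step k (W a) ` {..<k} \<inter> step k (W b) ` {..<k} \<noteq> {}")
    case False
    then obtain a where "a < 4" "\<And>b. b < 4 \<Longrightarrow> b \<noteq> a \<Longrightarrow> step k (W a) ` {..<k} \<inter> step k (W b) ` {..<k} = {}" by blast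
    then have "cmoment m k W {..<4} = 0" by (intro cmoment_isolated[of _ a]) auto
    then show ?thesis using C by simp
  next
    case True
    then have ex: "card (vset k W {..<4}) \<le> card (eset k W {..<4}) + 2" by (intro four_circuits_excess[OF k]) blast
    have "\<bar>cmoment m k W {..<4}\<bar> \<le> 2 ^ card {..<4::nat} * (C ^ (card {..<4::nat} * k) * ?q ^ card (eset k W {..<4}))"
    proof (rule cmoment_bound[OF _ C q])
      fix e r assume e: "e \<in> eset k W {..<4}" and r: "1 \<le> r" "r \<le> card {..<4::nat} * k"
      show "\<bar>m e r\<bar> \<le> C * ?q"
        using eset_endpoints[OF e] sub[OF W] ord[OF e] r by (intro B) auto
    qed simp
    also have "\<dots> = ?D * ?q ^ card (eset k W {..<4})" by simp
    also have "?q ^ card (eset k W {..<4}) = real n powr (- \<alpha> * real (card (eset k W {..<4})))"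
      using n by (simp add: powr_realpow[symmetric] powr_powr)
    also have "\<dots> \<le> real n powr (- \<alpha> * (real (card (vset k W {..<4})) - 2))"
      using n ex a by (intro powr_mono) auto
    finally show ?thesis using C by simp
  qed
  have "(\<Sum>W\<in>?W. cmoment m k W {..<4}) \<le> (\<Sum>W\<in>?W. ?D * real n powr (- \<alpha> * (real (card (vset k W {..<4})) - 2)))"
    by (intro sum_mono each)
  also have "\<dots> = (\<Sum>v\<le>4 * k. \<Sum>W | W \<in> ?W \<and> card (vset k W {..<4}) = v. ?D * real n powr (- \<alpha> * (real (card (vset k W {..<4})) - 2)))"
    by (rule sum.group[symmetric]) (use fW v4 in auto)
  also have "\<dots> = (\<Sum>v\<le>4 * k. real (card {W \<in> ?W. card (vset k W {..<4}) = v}) * (?D * real n powr (- \<alpha> * (real v - 2))))"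
    by (intro sum.cong refl) simp
  also have "\<dots> \<le> (\<Sum>v\<le>4 * k. (real (4 * k) ^ (4 * k) * real n powr real v) * (?D * real n powr (- \<alpha> * (real v - 2))))"
  proof (intro sum_mono mult_right_mono)
    fix v assume v: "v \<in> {..4 * k}"
    have "real (card {W \<in> ?W. card (vset k W {..<4}) = v}) \<le> real (v ^ (k * card {..<4::nat}) * n ^ v)"
      using card_walks_with_vertices[of "{..<4}" k n v] by (simp only: of_nat_le_iff finite_lessThan)
    also have "\<dots> = real v ^ (4 * k) * real n powr real v" using n by (simp add: powr_realpow mult.commute)
    also have "\<dots> \<le> real (4 * k) ^ (4 * k) * real n powr real v"
      using v by (intro mult_right_mono power_mono) (simp_all only: atMost_iff of_nat_le_iff, auto)
    finally show "real (card {W \<in> ?W. card (vset k W {..<4}) = v}) \<le> real (4 * k) ^ (4 * k) * real n powr real v" .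
  qed (use C in auto)
  also have "\<dots> = (\<Sum>v\<le>4 * k. (?D * real (4 * k) ^ (4 * k)) * real n powr (real v + (- \<alpha> * (real v - 2))))"
    by (intro sum.cong refl) (simp only: powr_add mult_ac)
  also have "\<dots> \<le> (\<Sum>v\<le>4 * k. (?D * real (4 * k) ^ (4 * k)) * real n powr (2 + (1 - \<alpha>) * real (4 * k)))"
  proof (intro sum_mono mult_left_mono powr_mono)
    fix v assume "v \<in> {..4 * k}"
    then have "(1 - \<alpha>) * real v \<le> (1 - \<alpha>) * real (4 * k)" using a by (intro mult_left_mono) auto
    moreover have "real v + (- \<alpha> * (real v - 2)) = (1 - \<alpha>) * real v + 2 * \<alpha>" by (simp add: algebra_simps)
    ultimately show "real v + (- \<alpha> * (real v - 2)) \<le> 2 + (1 - \<alpha>) * real (4 * k)" using a by linarith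
  qed (use n C in auto)
  also have "\<dots> = (real (4 * k) + 1) * (?D * real (4 * k) ^ (4 * k)) * real n powr (2 + (1 - \<alpha>) * real (4 * k))"
    by simp
  finally show ?thesis .
qed

section \<open>The mean of the trace\<close>

text \<open>Since \<open>G r\<close> is \<open>g\<^sub>2\<^sub>r\<close>, an edge of multiplicity \<open>m\<close> carries \<open>g\<^sub>m\<close>.\<close>

definition tree_H :: "(nat \<Rightarrow> real \<times> real \<Rightarrow> real) \<Rightarrow> nat \<Rightarrow> (nat \<Rightarrow> nat) \<Rightarrow> nat \<Rightarrow> real \<times> real \<Rightarrow> real" where
  "tree_H G k p v = G (mult k p (disc p v) div 2)"

definition tree_sum :: "(nat \<Rightarrow> real \<times> real \<Rightarrow> real) \<Rightarrow> nat \<Rightarrow> (nat \<Rightarrow> nat) \<Rightarrow> nat \<Rightarrow> real" where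
  "tree_sum G k p = gsum (verts k p) (nonroots k p) (parent p) (\<lambda>v. v) (tree_H G k p)"

definition tree_patterns :: "nat \<Rightarrow> (nat \<Rightarrow> nat) set" where
  "tree_patterns k = {p \<in> patterns k. treelike k p}"

text \<open>The moments of the limit law. The total mass is set separately, since a walk without
  positions has no root; for odd \<open>k\<close> there are no tree patterns and the sum is
  empty.\<close>

definition beta :: "(nat \<Rightarrow> real \<times> real \<Rightarrow> real) \<Rightarrow> nat \<Rightarrow> real" where
  "beta G k = (if k = 0 then 1 else \<Sum>p\<in>tree_patterns k. lim (tree_sum G k p))"

lemma finite_tree_patterns [simp]: "finite (tree_patterns k)" by (simp add: tree_patterns_def)

lemma tree_patterns_half_mult:
  assumes p: "p \<in> tree_patterns k" and k: "k > 0" and v: "v \<in> nonroots k p"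
  shows "mult k p (disc p v) = 2 * (mult k p (disc p v) div 2)" "mult k p (disc p v) div 2 \<ge> 1"
proof -
  have pp: "p \<in> patterns k" "treelike k p" using p by (auto simp: tree_patterns_def)
  have e: "even (mult k p (disc p v))" by (rule treelike_mult_even[OF pp k])
  then show *: "mult k p (disc p v) = 2 * (mult k p (disc p v) div 2)" by simp
  have "mult k p (disc p v) > 0"
    using mult_pos[OF patternsD(7)[OF pp(1) v], of p] step_discovery[OF pp(1) v] by simp
  then show "mult k p (disc p v) div 2 \<ge> 1" using * by linarith
qed

lemma grid_in_unit: "n > 0 \<Longrightarrow> i \<in> {1..n} \<Longrightarrow> j \<in> {1..n} \<Longrightarrow> grid n i j \<in> unit_square"
  using grid_in_cell cell_subset by blast

text \<open>The tree sums evaluate \<open>G r\<close> at grid points only, and with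
  \<open>r \<ge> 1\<close>. This gives the claim that the functions \<open>G r\<close> determine the
  moments.\<close>

lemma beta_cong:
  assumes "\<And>r p. r \<ge> 1 \<Longrightarrow> p \<in> unit_square \<Longrightarrow> G' r p = G r p"
  shows "beta G' k = beta G k"
proof (cases "k = 0")
  case False
  have "tree_sum G' k p = tree_sum G k p" if p: "p \<in> tree_patterns k" for p
  proof
    fix n
    have pp: "p \<in> patterns k" using p by (simp add: tree_patterns_def)
    have "tree_H G' k p v (grid n (\<phi> (parent p v)) (\<phi> v)) = tree_H G k p v (grid n (\<phi> (parent p v)) (\<phi> v))"
      if f: "\<phi> \<in> PiE (verts k p) (\<lambda>_. {1..n})" and v: "v \<in> nonroots k p" for \<phi> v
    proof -
      have "\<phi> (parent p v) \<in> {1..n}" "\<phi> v \<in> {1..n}" using f patternsD(9)[OF pp v] v by auto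
      moreover from this have "n > 0" by auto
      ultimately show ?thesis unfolding tree_H_def
        using False tree_patterns_half_mult(2)[OF p _ v] grid_in_unit by (intro assms) auto
    qed
    then show "tree_sum G' k p n = tree_sum G k p n"
      unfolding tree_sum_def gsum_def by (intro arg_cong2[of _ _ _ _ "(/)"] sum.cong prod.cong refl) auto
  qed
  then show ?thesis using False by (simp add: beta_def)
qed (simp add: beta_def)

text \<open>Union bound: two given vertices receive the same label in a fraction
  \<open>1 / n\<close> of all maps.\<close>

lemma card_noninj_maps:
  assumes V: "finite V" and n: "n > 0"
  shows "real (card (PiE V (\<lambda>_. {1..n}) - injmaps V {1..n})) \<le> (real (card V))\<^sup>2 * real n ^ card V / real n"
proof -
  let ?P = "PiE V (\<lambda>_. {1..n::nat})"
  let ?D = "{(u, v). u \<in> V \<and> v \<in> V \<and> u \<noteq> v}"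
  have fP: "finite ?P" using V by (intro finite_PiE) auto
  have fD: "finite ?D" by (rule finite_subset[of _ "V \<times> V"]) (use V in auto)
  have "?P - injmaps V {1..n} \<subseteq> (\<Union>(u,v)\<in>?D. {\<phi> \<in> ?P. \<phi> u = \<phi> v})"
    by (auto simp: injmaps_def inj_on_def)
  then have "card (?P - injmaps V {1..n}) \<le> card (\<Union>(u,v)\<in>?D. {\<phi> \<in> ?P. \<phi> u = \<phi> v})"
    by (rule card_mono[rotated]) (use fP fD in auto)
  also have "\<dots> \<le> (\<Sum>d\<in>?D. card {\<phi> \<in> ?P. \<phi> (fst d) = \<phi> (snd d)})"
    using card_UN_le[OF fD, of "\<lambda>d. {\<phi> \<in> ?P. \<phi> (fst d) = \<phi> (snd d)}"] by (simp add: case_prod_beta)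
  finally have "real (card (?P - injmaps V {1..n})) \<le> (\<Sum>d\<in>?D. real (card {\<phi> \<in> ?P. \<phi> (fst d) = \<phi> (snd d)}))"
    by (simp only: of_nat_sum[symmetric] of_nat_le_iff)
  also have "\<dots> = (\<Sum>d\<in>?D. real n ^ card V / real n)"
  proof (intro sum.cong refl)
    fix d assume d: "d \<in> ?D"
    then obtain u v where uv: "d = (u, v)" "u \<in> V" "v \<in> V" "u \<noteq> v" by auto
    have "real (card {\<phi> \<in> ?P. \<phi> u = \<phi> v}) = (\<Sum>\<phi>\<in>?P. of_bool (\<phi> u = \<phi> v))"
      using fP by (simp add: Int_def)
    also have "\<dots> = real (card {1..n}) ^ (card V - 2) * (\<Sum>i\<in>{1..n}. \<Sum>j\<in>{1..n}. of_bool (i = j))"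
      by (rule sum_PiE_marginal[OF V uv(2-4)]) simp
    also have "(\<Sum>i\<in>{1..n}. \<Sum>j\<in>{1..n}. of_bool (i = j)) = real n" by simp
    also have "real (card {1..n}) ^ (card V - 2) * real n = real n ^ card V / real n"
    proof -
      have "card {u, v} \<le> card V" by (rule card_mono) (use V uv in auto)
      then have "card V = card V - 2 + 2" using uv by simp
      then have "real n ^ card V = real n ^ (card V - 2) * real n ^ 2" by (metis power_add)
      then show ?thesis using n by (simp add: power2_eq_square)
    qed
    finally show "real (card {\<phi> \<in> ?P. \<phi> (fst d) = \<phi> (snd d)}) = real n ^ card V / real n" using uv by simp
  qed
  also have "\<dots> \<le> (real (card V))\<^sup>2 * real n ^ card V / real n"
  proof -
    have "card ?D \<le> card (V \<times> V)" by (rule card_mono) (use V in auto)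
    then have "card ?D \<le> card V * card V" by (simp only: card_cartesian_product)
    then have "real (card ?D) \<le> (real (card V))\<^sup>2" by (simp only: power2_eq_square of_nat_mult[symmetric] of_nat_le_iff)
    from mult_right_mono[OF this, of "real n ^ card V / real n"] show ?thesis by simp
  qed
  finally show ?thesis .
qed

lemma card_injmaps_le:
  assumes "finite V" shows "card (injmaps V {1..n}) \<le> n ^ card V"
proof -
  have "card (injmaps V {1..n}) \<le> card (PiE V (\<lambda>_. {1..n}))"
    by (rule card_mono) (use assms in \<open>auto simp: injmaps_def intro!: finite_PiE\<close>)
  then show ?thesis using assms by (simp add: card_PiE)
qed

text \<open>Only moments appear here, no random variables: \<open>m n e r\<close> stands for the
  \<open>r\<close>-th moment of the entry at \<open>e\<close>. The condition \<open>small\<close> is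
  what even moments, of order \<open>1 / n\<close>, and odd moments have in common; the exponent
  \<open>a\<close> may come arbitrarily close to 1 without reaching it.\<close>

locale moment_array =
  fixes m :: "nat \<Rightarrow> nat \<times> nat \<Rightarrow> nat \<Rightarrow> real"
    and g :: "nat \<Rightarrow> nat \<Rightarrow> real \<times> real \<Rightarrow> real" and G :: "nat \<Rightarrow> real \<times> real \<Rightarrow> real"
  assumes small: "\<And>r a. r \<ge> 1 \<Longrightarrow> a < 1 \<Longrightarrow>
      \<exists>C. \<forall>\<^sub>F n in sequentially. \<forall>i j. 1 \<le> i \<and> i \<le> j \<and> j \<le> n \<longrightarrow> \<bar>m n (i, j) r\<bar> \<le> C * real n powr (- a)"
    and even_moment: "\<And>r n i j. r \<ge> 1 \<Longrightarrow> 1 \<le> i \<Longrightarrow> i \<le> j \<Longrightarrow> j \<le> n \<Longrightarrow> real n * m n (i, j) (2 * r) = g r n (grid n i j)"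
    and even_moment_nonneg: "\<And>r n i j. 1 \<le> i \<Longrightarrow> i \<le> j \<Longrightarrow> j \<le> n \<Longrightarrow> m n (i, j) (2 * r) \<ge> 0"
    and g_limit: "\<And>r. r \<ge> 1 \<Longrightarrow> uniform_limit unit_square (g r) (G r) sequentially"
    and g_sym: "\<And>r n u v. r \<ge> 1 \<Longrightarrow> n \<ge> 1 \<Longrightarrow> u \<in> {0..1} \<Longrightarrow> v \<in> {0..1} \<Longrightarrow> g r n (u, v) = g r n (v, u)"
    and g_bounded: "\<And>r n. r \<ge> 1 \<Longrightarrow> n \<ge> 1 \<Longrightarrow> bounded (g r n ` unit_square)"
    and g_osc: "\<And>r n. r \<ge> 1 \<Longrightarrow> n \<ge> 1 \<Longrightarrow> osc (g r n) \<longlonglongrightarrow> 0"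
begin

lemma G_bounded: "r \<ge> 1 \<Longrightarrow> bounded (G r ` unit_square)" and G_osc: "r \<ge> 1 \<Longrightarrow> osc (G r) \<longlonglongrightarrow> 0"
  using osc_uniform_limit[of "g r" "G r"] g_bounded g_osc g_limit by auto

lemma even_moment_ed:
  assumes r: "r \<ge> 1" and ij: "i \<in> {1..n}" "j \<in> {1..n}"
  shows "m n (ed i j) (2 * r) = g r n (grid n i j) / real n"
proof -
  have n: "n \<ge> 1" using ij by auto
  have "real n * m n (ed i j) (2 * r) = g r n (grid n i j)"
  proof (cases "i \<le> j")
    case True
    then show ?thesis using even_moment[OF r, of i j n] ij by (simp add: ed_def)
  next
    case False
    have "g r n (grid n j i) = g r n (grid n i j)"
      unfolding grid_def by (rule g_sym[OF r n]) (use ij n in auto)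
    then show ?thesis using False even_moment[OF r, of j i n] ij by (simp add: ed_def)
  qed
  then show ?thesis using n by (simp add: field_simps)
qed

text \<open>The point \<open>(i/n, j/n)\<close> lies on the grid of every multiple of
  \<open>n\<close>, where \<open>g r\<close> is a rescaled even moment; hence \<open>G r\<close> is
  a limit of moments there and inherits their positivity.\<close>

lemma G_grid_LIMSEQ:
  assumes r: "r \<ge> 1" and ij: "i \<in> {1..n}" "j \<in> {1..n}"
  shows "(\<lambda>l. real (n * Suc l) * m (n * Suc l) (ed (i * Suc l) (j * Suc l)) (2 * r)) \<longlonglongrightarrow> G r (grid n i j)"
proof -
  have n: "n \<ge> 1" using ij by auto
  have lim: "(\<lambda>N. g r N (grid n i j)) \<longlonglongrightarrow> G r (grid n i j)"
    by (rule tendsto_uniform_limitI[OF g_limit[OF r]]) (use grid_in_unit ij n in auto)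
  have "strict_mono (\<lambda>l. n * Suc l)" using n by (auto simp: strict_mono_def)
  from LIMSEQ_subseq_LIMSEQ[OF lim this] have lims: "(\<lambda>l. g r (n * Suc l) (grid n i j)) \<longlonglongrightarrow> G r (grid n i j)"
    by (simp add: comp_def)
  have "g r (n * Suc l) (grid n i j) = real (n * Suc l) * m (n * Suc l) (ed (i * Suc l) (j * Suc l)) (2 * r)" for l
  proof -
    let ?N = "n * Suc l"
    have *: "i * Suc l \<in> {1..?N}" "j * Suc l \<in> {1..?N}" using ij by (auto simp del: mult_Suc_right)
    have "grid ?N (i * Suc l) (j * Suc l) = grid n i j" by (simp add: grid_def del: of_nat_Suc mult_Suc_right)
    then have "m ?N (ed (i * Suc l) (j * Suc l)) (2 * r) = g r ?N (grid n i j) / real ?N" using even_moment_ed[OF r *] by simp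
    moreover have "real ?N \<noteq> 0" using n by (simp only: of_nat_eq_0_iff) simp
    ultimately show ?thesis by (simp only: nonzero_mult_div_cancel_left times_divide_eq_right not_False_eq_True)
  qed
  then show ?thesis using lims by (simp only:)
qed

lemma ed_moment_nonneg: "i \<in> {1..n} \<Longrightarrow> j \<in> {1..n} \<Longrightarrow> m n (ed i j) (2 * r) \<ge> 0"
  unfolding ed_def by (rule even_moment_nonneg) auto

lemma scaled_grid: "i \<in> {1..n} \<Longrightarrow> i * Suc l \<in> {1..n * Suc l}"
  by (auto simp del: mult_Suc_right)

lemma G_grid_nonneg:
  assumes r: "r \<ge> 1" and ij: "i \<in> {1..n}" "j \<in> {1..n}"
  shows "G r (grid n i j) \<ge> 0"
  by (rule LIMSEQ_le_const[OF G_grid_LIMSEQ[OF assms]]) (intro exI allI impI mult_nonneg_nonneg ed_moment_nonneg scaled_grid ij of_nat_0_le_iff)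

lemma G_grid_sym:
  assumes r: "r \<ge> 1" and ij: "i \<in> {1..n}" "j \<in> {1..n}"
  shows "G r (grid n i j) = G r (grid n j i)"
  using LIMSEQ_unique[OF G_grid_LIMSEQ[OF assms]] G_grid_LIMSEQ[OF r ij(2,1)] by (simp add: ed_commute)

context
  fixes k :: nat and p :: "nat \<Rightarrow> nat"
  assumes k: "k > 0" and p: "p \<in> tree_patterns k"
begin

lemma pp: "p \<in> patterns k" "treelike k p" using p by (auto simp: tree_patterns_def)

lemma convergent_tree_sum: "convergent (tree_sum G k p)"
  unfolding tree_sum_def
proof (rule convergent_gsum)
  fix v assume v: "v \<in> nonroots k p"
  show "parent p v \<in> verts k p \<and> v \<in> verts k p \<and> parent p v \<noteq> v" using patternsD(8,9)[OF pp(1) v] v by auto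
  show "bounded (tree_H G k p v ` unit_square)" "osc (tree_H G k p v) \<longlonglongrightarrow> 0"
    unfolding tree_H_def by (intro G_bounded G_osc tree_patterns_half_mult(2)[OF p k v])+
qed auto

lemma tree_sum_abs_le:
  assumes B: "\<And>v q. v \<in> nonroots k p \<Longrightarrow> q \<in> unit_square \<Longrightarrow> \<bar>tree_H G k p v q\<bar> \<le> B v"
  shows "\<bar>tree_sum G k p n\<bar> \<le> (\<Prod>v\<in>nonroots k p. B v)"
proof (cases "n = 0")
  case True
  have "verts k p \<noteq> {}" using k by auto
  then have "card (verts k p) > 0" by (simp add: card_gt_0_iff)
  moreover have "B v \<ge> 0" if "v \<in> nonroots k p" for v
    using B[OF that, of "(0,0)"] by (simp add: cbox_Pair_eq)
  ultimately show ?thesis using True by (simp add: tree_sum_def gsum_def power_0_left) (auto intro!: prod_nonneg)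
next
  case False
  let ?P = "PiE (verts k p) (\<lambda>_. {1..n})"
  have "\<bar>\<Sum>\<phi>\<in>?P. \<Prod>v\<in>nonroots k p. tree_H G k p v (grid n (\<phi> (parent p v)) (\<phi> v))\<bar> \<le> (\<Sum>\<phi>\<in>?P. \<Prod>v\<in>nonroots k p. B v)"
  proof (rule order_trans[OF sum_abs sum_mono])
    fix \<phi> assume f: "\<phi> \<in> ?P"
    have "grid n (\<phi> (parent p v)) (\<phi> v) \<in> unit_square" if v: "v \<in> nonroots k p" for v
      using f patternsD(9)[OF pp(1) v] v False by (intro grid_in_unit) auto
    then show "\<bar>\<Prod>v\<in>nonroots k p. tree_H G k p v (grid n (\<phi> (parent p v)) (\<phi> v))\<bar> \<le> (\<Prod>v\<in>nonroots k p. B v)"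
      unfolding abs_prod using B by (intro prod_mono) auto
  qed
  also have "\<dots> = real n ^ card (verts k p) * (\<Prod>v\<in>nonroots k p. B v)" by (simp add: card_PiE)
  finally show ?thesis using False by (simp add: tree_sum_def gsum_def abs_divide divide_le_eq mult.commute)
qed

lemma tree_sum_nonneg: "tree_sum G k p n \<ge> 0"
  unfolding tree_sum_def gsum_def
proof (intro divide_nonneg_nonneg sum_nonneg prod_nonneg)
  fix \<phi> v assume "\<phi> \<in> PiE (verts k p) (\<lambda>_. {1..n})" "v \<in> nonroots k p"
  then show "0 \<le> tree_H G k p v (grid n (\<phi> (parent p v)) (\<phi> v))"
    unfolding tree_H_def using patternsD(9)[OF pp(1)] tree_patterns_half_mult(2)[OF p k]
    by (intro G_grid_nonneg) auto
qed simp

text \<open>A tree has one vertex more than edges, so \<open>1 / n\<close> for each edge and the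
  final \<open>1 / n\<close> together normalise the sum over labellings. It remains to replace
  \<open>g\<close> by \<open>G\<close>, by uniform convergence, and injective labellings by all
  labellings, at a cost of order \<open>1 / n\<close>.\<close>

lemma tree_contribution:
  "(\<lambda>n. (\<Sum>\<phi>\<in>injmaps (verts k p) {1..n}. wprod (m n) k (\<lambda>s\<in>{..<k}. \<phi> (p s))) / real n) \<longlonglongrightarrow> lim (tree_sum G k p)"
proof -
  let ?V = "verts k p" and ?E = "nonroots k p"
  let ?r = "\<lambda>v. mult k p (disc p v) div 2"
  let ?P = "\<lambda>n. PiE ?V (\<lambda>_. {1..n::nat})" and ?I = "\<lambda>n. injmaps ?V {1..n::nat}"
  let ?gr = "\<lambda>n \<phi> v. grid n (\<phi> (parent p v)) (\<phi> v)"
  define A where "A n = (\<Sum>\<phi>\<in>?I n. wprod (m n) k (\<lambda>s\<in>{..<k}. \<phi> (p s))) / real n" for n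
  have r1: "?r v \<ge> 1" if "v \<in> ?E" for v using tree_patterns_half_mult(2)[OF p k that] .
  have IP: "?I n \<subseteq> ?P n" for n by (auto simp: injmaps_def)
  have fP: "finite (?P n)" for n by (intro finite_PiE) auto
  have mem: "\<phi> (parent p v) \<in> {1..n}" "\<phi> v \<in> {1..n}" if "\<phi> \<in> ?P n" "v \<in> ?E" for \<phi> v n
    using that patternsD(9)[OF pp(1) that(2)] by auto
  have cV: "card ?V = Suc (card ?E)" by (rule card_nonroots[OF pp(1) k])
  have A: "A n = (\<Sum>\<phi>\<in>?I n. \<Prod>v\<in>?E. g (?r v) n (?gr n \<phi> v)) / real n ^ card ?V" if n: "n \<ge> 1" for n
  proof -
    have "wprod (m n) k (\<lambda>s\<in>{..<k}. \<phi> (p s)) = (\<Prod>v\<in>?E. g (?r v) n (?gr n \<phi> v)) / real n ^ card ?E" if f: "\<phi> \<in> ?I n" for \<phi>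
    proof -
      have "wprod (m n) k (\<lambda>s\<in>{..<k}. \<phi> (p s)) = (\<Prod>v\<in>?E. m n (ed (\<phi> (parent p v)) (\<phi> v)) (mult k p (disc p v)))"
        by (rule wprod_treelike[OF pp]) (use f in \<open>auto simp: injmaps_def\<close>)
      also have "\<dots> = (\<Prod>v\<in>?E. g (?r v) n (?gr n \<phi> v) / real n)"
      proof (intro prod.cong refl)
        fix v assume v: "v \<in> ?E"
        have "m n (ed (\<phi> (parent p v)) (\<phi> v)) (2 * ?r v) = g (?r v) n (?gr n \<phi> v) / real n"
        proof -
          have "\<phi> \<in> ?P n" using f IP by blast
          from mem[OF this v] show ?thesis by (rule even_moment_ed[OF r1[OF v]])
        qed
        then show "m n (ed (\<phi> (parent p v)) (\<phi> v)) (mult k p (disc p v)) = g (?r v) n (?gr n \<phi> v) / real n"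
          using tree_patterns_half_mult(1)[OF p k v] by simp
      qed
      finally show ?thesis by (simp add: prod_dividef)
    qed
    then have "(\<Sum>\<phi>\<in>?I n. wprod (m n) k (\<lambda>s\<in>{..<k}. \<phi> (p s))) = (\<Sum>\<phi>\<in>?I n. (\<Prod>v\<in>?E. g (?r v) n (?gr n \<phi> v)) / real n ^ card ?E)"
      by (rule sum.cong[OF refl])
    then have "A n = (\<Sum>\<phi>\<in>?I n. (\<Prod>v\<in>?E. g (?r v) n (?gr n \<phi> v)) / real n ^ card ?E) / real n"
      unfolding A_def by simp
    then show ?thesis by (simp add: sum_divide_distrib[symmetric] cV mult.commute)
  qed
  have "\<exists>B. \<forall>v\<in>?E. \<forall>q\<in>unit_square. \<bar>G (?r v) q\<bar> \<le> B"
  proof -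
    have "\<forall>v\<in>?E. \<exists>B. \<forall>q\<in>unit_square. \<bar>G (?r v) q\<bar> \<le> B" using G_bounded[OF r1] by (auto simp: bounded_iff)
    then obtain Bf where Bf: "\<And>v q. v \<in> ?E \<Longrightarrow> q \<in> unit_square \<Longrightarrow> \<bar>G (?r v) q\<bar> \<le> Bf v" by metis
    have "\<bar>G (?r v) q\<bar> \<le> (\<Sum>v\<in>?E. \<bar>Bf v\<bar>)" if "v \<in> ?E" "q \<in> unit_square" for v q
    proof -
      have "\<bar>Bf v\<bar> \<le> (\<Sum>v\<in>?E. \<bar>Bf v\<bar>)" by (rule member_le_sum[OF that(1)]) auto
      then show ?thesis using Bf[OF that] by linarith
    qed
    then show ?thesis by blast
  qed
  then obtain B0 where B0: "\<And>v q. v \<in> ?E \<Longrightarrow> q \<in> unit_square \<Longrightarrow> \<bar>G (?r v) q\<bar> \<le> B0" by blast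
  \<comment> \<open>The added 1 leaves room for \<open>g\<close>, which eventually differs from
    \<open>G\<close> by at most \<open>d \<le> 1\<close>.\<close>
  define B where "B = max 1 B0 + 1"
  have B1: "B \<ge> 1" by (simp add: B_def)
  have GB: "\<bar>G (?r v) q\<bar> \<le> B" if "v \<in> ?E" "q \<in> unit_square" for v q using B0[OF that] by (simp add: B_def)
  have "(\<lambda>n. A n - tree_sum G k p n) \<longlonglongrightarrow> 0"
  proof (rule LIMSEQ_I)
    fix e :: real assume e: "e > 0"
    \<comment> \<open>Small enough that replacing \<open>g\<close> by \<open>G\<close> in all edge
      factors costs at most \<open>e / 2\<close>.\<close>
    define d where "d = min 1 (e / (2 * B ^ card ?E * (real (card ?E) + 1)))"
    have d: "d > 0" "d \<le> 1" using e B1 by (auto simp: d_def intro!: divide_pos_pos mult_pos_pos)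
    have de: "B ^ card ?E * (real (card ?E) * d) \<le> e / 2"
    proof -
      have "(real (card ?E) + 1) * d \<le> (real (card ?E) + 1) * (e / (2 * B ^ card ?E * (real (card ?E) + 1)))"
        by (intro mult_left_mono) (auto simp: d_def)
      also have "\<dots> = e / (2 * B ^ card ?E)" by (simp add: divide_simps)
      finally have "real (card ?E) * d \<le> e / (2 * B ^ card ?E)" using d by (simp add: distrib_right)
      then show ?thesis using B1 by (simp add: field_simps)
    qed
    have ev1: "\<forall>\<^sub>F n in sequentially. \<forall>v\<in>?E. \<forall>q\<in>unit_square. dist (g (?r v) n q) (G (?r v) q) < d"
      by (subst eventually_ball_finite_distrib) (use uniform_limitD[OF g_limit[OF r1] d(1)] in auto)
    define c where "c = B ^ card ?E * (real (card ?V))\<^sup>2"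
    have "(\<lambda>n. c / real n) \<longlonglongrightarrow> 0" by real_asymp
    then have ev2: "\<forall>\<^sub>F n in sequentially. c / real n < e / 2" using e by (intro order_tendstoD(2)) auto
    have "\<forall>\<^sub>F n in sequentially. norm (A n - tree_sum G k p n - 0) < e"
      using ev1 ev2 eventually_ge_at_top[of 1]
    proof eventually_elim
      case (elim n)
      have n: "n \<ge> 1" by fact
      let ?x = "\<lambda>\<phi>. \<Prod>v\<in>?E. g (?r v) n (?gr n \<phi> v)" and ?y = "\<lambda>\<phi>. \<Prod>v\<in>?E. G (?r v) (?gr n \<phi> v)"
      have gu: "?gr n \<phi> v \<in> unit_square" if "\<phi> \<in> ?P n" "v \<in> ?E" for \<phi> v using mem[OF that] n by (intro grid_in_unit) auto
      have xy: "\<bar>?x \<phi> - ?y \<phi>\<bar> \<le> B ^ card ?E * (real (card ?E) * d)" if f: "\<phi> \<in> ?P n" for \<phi>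
      proof -
        have close: "\<bar>g (?r v) n (?gr n \<phi> v) - G (?r v) (?gr n \<phi> v)\<bar> \<le> d" if "v \<in> ?E" for v
          using elim(1) that gu[OF f that] by (auto simp: dist_real_def intro: less_imp_le)
        have "\<bar>?x \<phi> - ?y \<phi>\<bar> \<le> B ^ card ?E * (\<Sum>v\<in>?E. \<bar>g (?r v) n (?gr n \<phi> v) - G (?r v) (?gr n \<phi> v)\<bar>)"
        proof (rule prod_diff_bound[OF _ B1])
          fix v assume v: "v \<in> ?E"
          show "\<bar>G (?r v) (?gr n \<phi> v)\<bar> \<le> B" by (rule GB[OF v gu[OF f v]])
          show "\<bar>g (?r v) n (?gr n \<phi> v)\<bar> \<le> B"
            using close[OF v] B0[OF v gu[OF f v]] d unfolding B_def by linarith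
        qed simp
        also have "\<dots> \<le> B ^ card ?E * (\<Sum>v\<in>?E. d)" using B1 close by (intro mult_left_mono sum_mono) auto
        finally show ?thesis by simp
      qed
      have y: "\<bar>?y \<phi>\<bar> \<le> B ^ card ?E" if f: "\<phi> \<in> ?P n" for \<phi>
        by (rule prod_bound) (rule GB[OF _ gu[OF f]])
      have "A n - tree_sum G k p n = ((\<Sum>\<phi>\<in>?I n. ?x \<phi>) - (\<Sum>\<phi>\<in>?P n. ?y \<phi>)) / real n ^ card ?V"
        unfolding A[OF n] tree_sum_def gsum_def tree_H_def by (simp only: diff_divide_distrib)
      also have "(\<Sum>\<phi>\<in>?P n. ?y \<phi>) = (\<Sum>\<phi>\<in>?I n. ?y \<phi>) + (\<Sum>\<phi>\<in>?P n - ?I n. ?y \<phi>)"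
        by (subst sum.subset_diff[OF IP fP]) (rule add.commute)
      also have "(\<Sum>\<phi>\<in>?I n. ?x \<phi>) - ((\<Sum>\<phi>\<in>?I n. ?y \<phi>) + (\<Sum>\<phi>\<in>?P n - ?I n. ?y \<phi>)) = (\<Sum>\<phi>\<in>?I n. ?x \<phi> - ?y \<phi>) - (\<Sum>\<phi>\<in>?P n - ?I n. ?y \<phi>)"
        by (simp add: sum_subtractf)
      finally have eq: "A n - tree_sum G k p n = ((\<Sum>\<phi>\<in>?I n. ?x \<phi> - ?y \<phi>) - (\<Sum>\<phi>\<in>?P n - ?I n. ?y \<phi>)) / real n ^ card ?V" .
      have "\<bar>\<Sum>\<phi>\<in>?I n. ?x \<phi> - ?y \<phi>\<bar> \<le> (\<Sum>\<phi>\<in>?I n. B ^ card ?E * (real (card ?E) * d))"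
        by (rule order_trans[OF sum_abs sum_mono[OF xy]]) (use IP in blast)
      also have "\<dots> = real (card (?I n)) * (B ^ card ?E * (real (card ?E) * d))" by simp
      also have "\<dots> \<le> real n ^ card ?V * (e / 2)"
      proof (rule mult_mono[OF _ de])
        show "real (card (?I n)) \<le> real n ^ card ?V" using card_injmaps_le[of ?V n] by (simp only: of_nat_power[symmetric] of_nat_le_iff finite_imageI finite_lessThan)
      qed (use B1 d in auto)
      finally have b1: "\<bar>\<Sum>\<phi>\<in>?I n. ?x \<phi> - ?y \<phi>\<bar> \<le> real n ^ card ?V * (e / 2)" .
      have "\<bar>\<Sum>\<phi>\<in>?P n - ?I n. ?y \<phi>\<bar> \<le> (\<Sum>\<phi>\<in>?P n - ?I n. B ^ card ?E)"
        by (rule order_trans[OF sum_abs sum_mono[OF y]]) blast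
      also have "\<dots> = real (card (?P n - ?I n)) * B ^ card ?E" by simp
      also have "\<dots> \<le> ((real (card ?V))\<^sup>2 * real n ^ card ?V / real n) * B ^ card ?E"
        by (rule mult_right_mono[OF card_noninj_maps]) (use n B1 in auto)
      also have "\<dots> = real n ^ card ?V * (c / real n)" by (simp add: c_def)
      finally have b2: "\<bar>\<Sum>\<phi>\<in>?P n - ?I n. ?y \<phi>\<bar> \<le> real n ^ card ?V * (c / real n)" .
      have "\<bar>A n - tree_sum G k p n\<bar> \<le> (real n ^ card ?V * (e / 2) + real n ^ card ?V * (c / real n)) / real n ^ card ?V"
        unfolding eq abs_divide using b1 b2 n by (simp only: power_abs abs_of_nat) (rule divide_right_mono, linarith, simp)
      also have "\<dots> = e / 2 + c / real n" using n by (simp add: add_divide_distrib)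
      also have "\<dots> < e" using elim(2) by linarith
      finally show ?case by simp
    qed
    then show "\<exists>no. \<forall>n\<ge>no. norm (A n - tree_sum G k p n - 0) < e" by (simp add: eventually_sequentially)
  qed
  from tendsto_add[OF this convergent_LIMSEQ_iff[THEN iffD1, OF convergent_tree_sum]]
  show ?thesis unfolding A_def by simp
qed

end

lemma small_uniform:
  assumes a: "a < 1"
  shows "\<exists>C\<ge>1. \<forall>\<^sub>F n in sequentially. \<forall>i j r. 1 \<le> i \<and> i \<le> j \<and> j \<le> n \<and> 1 \<le> r \<and> r \<le> R \<longrightarrow> \<bar>m n (i, j) r\<bar> \<le> C * real n powr (- a)"
proof -
  obtain Cf where Cf: "\<And>r. r \<ge> 1 \<Longrightarrow> \<forall>\<^sub>F n in sequentially. \<forall>i j. 1 \<le> i \<and> i \<le> j \<and> j \<le> n \<longrightarrow> \<bar>m n (i, j) r\<bar> \<le> Cf r * real n powr (- a)"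
  proof -
    have "\<forall>r. \<exists>C. r \<ge> 1 \<longrightarrow> (\<forall>\<^sub>F n in sequentially. \<forall>i j. 1 \<le> i \<and> i \<le> j \<and> j \<le> n \<longrightarrow> \<bar>m n (i, j) r\<bar> \<le> C * real n powr (- a))"
      using small[OF _ a] by blast
    from choice[OF this] that show thesis by blast
  qed
  define C where "C = 1 + (\<Sum>r=1..R. \<bar>Cf r\<bar>)"
  have "\<forall>\<^sub>F n in sequentially. \<forall>r\<in>{1..R}. \<forall>i j. 1 \<le> i \<and> i \<le> j \<and> j \<le> n \<longrightarrow> \<bar>m n (i, j) r\<bar> \<le> Cf r * real n powr (- a)"
    by (subst eventually_ball_finite_distrib) (use Cf in auto)
  then have "\<forall>\<^sub>F n in sequentially. \<forall>i j r. 1 \<le> i \<and> i \<le> j \<and> j \<le> n \<and> 1 \<le> r \<and> r \<le> R \<longrightarrow> \<bar>m n (i, j) r\<bar> \<le> C * real n powr (- a)"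
  proof eventually_elim
    case (elim n)
    show ?case
    proof (intro allI impI)
      fix i j r assume h: "1 \<le> i \<and> i \<le> j \<and> j \<le> n \<and> 1 \<le> r \<and> r \<le> R"
      then have "\<bar>m n (i, j) r\<bar> \<le> Cf r * real n powr (- a)" using elim by auto
      moreover have "\<bar>Cf r\<bar> \<le> (\<Sum>r=1..R. \<bar>Cf r\<bar>)" using h by (intro member_le_sum) auto
      then have "Cf r \<le> C" by (simp add: C_def)
      then have "Cf r * real n powr (- a) \<le> C * real n powr (- a)" by (intro mult_right_mono) auto
      ultimately show "\<bar>m n (i, j) r\<bar> \<le> C * real n powr (- a)" by linarith
    qed
  qed
  moreover have "C \<ge> 1" by (simp add: C_def sum_nonneg)
  ultimately show ?thesis by blast
qed

text \<open>With \<open>E\<close> edges there are at most \<open>E\<close> vertices, so the sum over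
  labellings is at most of order \<open>n powr ((1 - a) * E)\<close>, and the division by
  \<open>n\<close> decides.\<close>

lemma nontree_contribution:
  assumes k: "k > 0" and p: "p \<in> patterns k" "\<not> treelike k p"
  shows "(\<lambda>n. (\<Sum>\<phi>\<in>injmaps (verts k p) {1..n}. wprod (m n) k (\<lambda>s\<in>{..<k}. \<phi> (p s))) / real n) \<longlonglongrightarrow> 0"
proof -
  \<comment> \<open>Chosen so that \<open>(1 - a) * k = 1 / 2\<close>.\<close>
  define a where "a = 1 - 1 / (2 * real k)"
  have a: "0 < a" "a < 1" using k by (auto simp: a_def field_simps)
  obtain C where C: "C \<ge> 1" and ev: "\<forall>\<^sub>F n in sequentially. \<forall>i j r. 1 \<le> i \<and> i \<le> j \<and> j \<le> n \<and> 1 \<le> r \<and> r \<le> k \<longrightarrow> \<bar>m n (i, j) r\<bar> \<le> C * real n powr (- a)"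
    using small_uniform[OF a(2)] by blast
  let ?E = "card (step k p ` {..<k})"
  have Ek: "?E \<le> k" using card_image_le[of "{..<k}" "step k p"] by simp
  have VE: "card (verts k p) \<le> ?E" by (rule card_verts_le[OF p(1) k p(2)])
  have "\<forall>\<^sub>F n in sequentially. norm ((\<Sum>\<phi>\<in>injmaps (verts k p) {1..n}. wprod (m n) k (\<lambda>s\<in>{..<k}. \<phi> (p s))) / real n) \<le> C ^ k * real n powr (- 1 / 2)"
    using ev eventually_ge_at_top[of 1]
  proof eventually_elim
    case (elim n)
    have n: "n \<ge> 1" by fact
    let ?q = "real n powr (- a)"
    have w: "\<bar>wprod (m n) k (\<lambda>s\<in>{..<k}. \<phi> (p s))\<bar> \<le> (C * ?q) ^ ?E" if f: "\<phi> \<in> injmaps (verts k p) {1..n}" for \<phi>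
    proof -
      let ?w = "\<lambda>s\<in>{..<k}. \<phi> (p s)"
      have i: "inj_on \<phi> (verts k p)" using f by (simp add: injmaps_def)
      have "\<bar>wprod (m n) k ?w\<bar> = (\<Prod>e\<in>step k ?w ` {..<k}. \<bar>m n e (mult k ?w e)\<bar>)" unfolding wprod_def by (rule abs_prod)
      also have "\<dots> \<le> (\<Prod>e\<in>step k ?w ` {..<k}. C * ?q)"
      proof (intro prod_mono conjI abs_ge_zero)
        fix e assume "e \<in> step k ?w ` {..<k}"
        then obtain s where s: "s < k" "e = step k ?w s" by auto
        have in1: "\<phi> (p r) \<in> {1..n}" if "r < k" for r using f that by (auto simp: injmaps_def)
        have "Suc s mod k < k" using k by simp
        note in2 = in1[OF s(1)] in1[OF this]
        have "mult k ?w e \<ge> 1" using mult_pos[OF s(1), of ?w] s(2) by simp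
        moreover have "mult k ?w e \<le> k"
          unfolding mult_def using card_mono[of "{..<k}" "{s. s < k \<and> step k ?w s = e}"] by auto
        ultimately show "\<bar>m n e (mult k ?w e)\<bar> \<le> C * ?q"
          using elim(1) in2 unfolding s(2) step_compose[OF s(1)] ed_def by (auto simp: min_def max_def)
      qed
      also have "\<dots> = (C * ?q) ^ ?E" using card_step_compose[OF p(1) i] by simp
      finally show ?thesis .
    qed
    have "norm ((\<Sum>\<phi>\<in>injmaps (verts k p) {1..n}. wprod (m n) k (\<lambda>s\<in>{..<k}. \<phi> (p s))) / real n)
      \<le> (\<Sum>\<phi>\<in>injmaps (verts k p) {1..n}. (C * ?q) ^ ?E) / real n"
      unfolding real_norm_def abs_divide using w by (simp only: abs_of_nat) (intro divide_right_mono order_trans[OF sum_abs sum_mono], auto)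
    also have "\<dots> = real (card (injmaps (verts k p) {1..n})) * (C * ?q) ^ ?E / real n" by simp
    also have "\<dots> \<le> real n ^ ?E * (C * ?q) ^ ?E / real n"
    proof (intro divide_right_mono mult_right_mono)
      have "real (card (injmaps (verts k p) {1..n})) \<le> real n ^ card (verts k p)"
        using card_injmaps_le[of "verts k p" n] by (simp only: of_nat_power[symmetric] of_nat_le_iff finite_imageI finite_lessThan)
      also have "\<dots> \<le> real n ^ ?E" using n VE by (intro power_increasing) auto
      finally show "real (card (injmaps (verts k p) {1..n})) \<le> real n ^ ?E" .
    qed (use C in auto)
    also have "\<dots> = C ^ ?E * (real n powr ((1 - a) * real ?E) * real n powr (- 1))"
    proof -
      have "real n ^ ?E * ?q ^ ?E = real n powr ((1 - a) * real ?E)"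
        using n by (simp add: powr_realpow[symmetric] powr_powr powr_add[symmetric] algebra_simps)
      moreover have "real n powr (- 1) = 1 / real n" using n by (simp add: powr_minus_divide)
      ultimately show ?thesis by (simp add: power_mult_distrib)
    qed
    also have "\<dots> \<le> C ^ k * real n powr (- 1 / 2)"
    proof (rule mult_mono)
      show "C ^ ?E \<le> C ^ k" using C Ek by (intro power_increasing) auto
      have "(1 - a) * real ?E \<le> (1 - a) * real k" using a Ek by (intro mult_left_mono) auto
      also have "\<dots> = 1 / 2" using k by (simp add: a_def)
      finally show "real n powr ((1 - a) * real ?E) * real n powr (- 1) \<le> real n powr (- 1 / 2)"
        unfolding powr_add[symmetric] using n by (intro powr_mono) auto
    qed (use C in auto)
    finally show ?case .
  qed
  moreover have "(\<lambda>n. C ^ k * real n powr (- 1 / 2)) \<longlonglongrightarrow> 0" by real_asymp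
  ultimately show ?thesis by (rule Lim_null_comparison)
qed

theorem mean_trace_limit:
  assumes k: "k > 0"
  shows "(\<lambda>n. (\<Sum>w\<in>PiE {..<k} (\<lambda>_. {1..n}). wprod (m n) k w) / real n) \<longlonglongrightarrow> beta G k"
proof -
  let ?c = "\<lambda>p n. (\<Sum>\<phi>\<in>injmaps (verts k p) {1..n}. wprod (m n) k (\<lambda>s\<in>{..<k}. \<phi> (p s))) / real n"
  have "(\<lambda>n. \<Sum>p\<in>patterns k. ?c p n) \<longlonglongrightarrow> (\<Sum>p\<in>patterns k. if treelike k p then lim (tree_sum G k p) else 0)"
  proof (rule tendsto_sum)
    fix p assume p: "p \<in> patterns k"
    show "?c p \<longlonglongrightarrow> (if treelike k p then lim (tree_sum G k p) else 0)"
      using tree_contribution[OF k, of p] nontree_contribution[OF k p] p by (auto simp: tree_patterns_def)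
  qed
  also have "(\<Sum>p\<in>patterns k. if treelike k p then lim (tree_sum G k p) else 0) = beta G k"
    using k by (simp add: beta_def tree_patterns_def sum.If_cases Int_def)
  also have "(\<lambda>n. \<Sum>p\<in>patterns k. ?c p n) = (\<lambda>n. (\<Sum>w\<in>PiE {..<k} (\<lambda>_. {1..n}). wprod (m n) k w) / real n)"
    by (rule ext) (simp add: sum_walks_by_pattern sum_divide_distrib)
  finally show ?thesis .
qed

lemma tree_sum_LIMSEQ: "k > 0 \<Longrightarrow> p \<in> tree_patterns k \<Longrightarrow> tree_sum G k p \<longlonglongrightarrow> lim (tree_sum G k p)"
  using convergent_tree_sum convergent_LIMSEQ_iff by blast

lemma lim_tree_sum_nonneg: "k > 0 \<Longrightarrow> p \<in> tree_patterns k \<Longrightarrow> lim (tree_sum G k p) \<ge> 0"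
  by (rule LIMSEQ_le_const[OF tree_sum_LIMSEQ]) (use tree_sum_nonneg in auto)

lemma M_seq_upper: "r \<ge> 1 \<Longrightarrow> q \<in> unit_square \<Longrightarrow> \<bar>G r q\<bar> \<le> M_seq G (2 * r)"
  unfolding M_seq_def using G_bounded[of r]
  by (simp del: cbox_Pair_iff) (intro cSUP_upper bounded_imp_bdd_above, auto simp: bounded_iff)

lemma M_seq_nonneg: "r \<ge> 1 \<Longrightarrow> M_seq G r \<ge> 0"
proof (cases "even r")
  case True
  assume "r \<ge> 1"
  then have "r = 2 * (r div 2)" "r div 2 \<ge> 1" using True by auto
  then have "\<bar>G (r div 2) (0, 0)\<bar> \<le> M_seq G r" using M_seq_upper[of "r div 2" "(0, 0)"] by (simp add: cbox_Pair_eq)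
  then show ?thesis by (rule order_trans[OF abs_ge_zero])
qed (simp add: M_seq_def)

text \<open>The sup norms along the edges of a tree multiply to the weight of the partition of its
  steps; partitions that do not come from trees only add nonnegative terms.\<close>

lemma beta_le_alpha: "k > 0 \<Longrightarrow> beta G (2 * k) \<le> alpha G k" "beta G k \<ge> 0"
proof -
  show "beta G k \<ge> 0" unfolding beta_def by (auto intro!: sum_nonneg lim_tree_sum_nonneg)
  assume k: "k > 0"
  let ?K = "2 * k"
  have K: "?K > 0" using k by simp
  have "beta G ?K = (\<Sum>p\<in>tree_patterns ?K. lim (tree_sum G ?K p))" using k by (simp add: beta_def)
  also have "\<dots> \<le> (\<Sum>p\<in>tree_patterns ?K. partition_weight (M_seq G) (step_blocks ?K p))"
  proof (rule sum_mono)
    fix p assume p: "p \<in> tree_patterns ?K"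
    have pp: "p \<in> patterns ?K" "treelike ?K p" using p by (auto simp: tree_patterns_def)
    have "\<bar>tree_sum G ?K p n\<bar> \<le> (\<Prod>v\<in>nonroots ?K p. M_seq G (mult ?K p (disc p v)))" for n
    proof (rule tree_sum_abs_le[OF K p])
      fix v q assume v: "v \<in> nonroots ?K p" and q: "q \<in> unit_square"
      show "\<bar>tree_H G ?K p v q\<bar> \<le> M_seq G (mult ?K p (disc p v))"
        using M_seq_upper[OF tree_patterns_half_mult(2)[OF p K v] q] tree_patterns_half_mult(1)[OF p K v]
        by (simp add: tree_H_def)
    qed
    then have "lim (tree_sum G ?K p) \<le> (\<Prod>v\<in>nonroots ?K p. M_seq G (mult ?K p (disc p v)))"
      by (intro LIMSEQ_le_const2[OF tree_sum_LIMSEQ[OF K p]]) (auto simp: abs_le_iff)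
    also have "\<dots> = (\<Prod>e\<in>step ?K p ` {..<?K}. M_seq G (mult ?K p e))"
    proof -
      have im: "step ?K p ` {..<?K} = disc p ` nonroots ?K p" using treelike_iff[OF pp(1)] pp(2) by blast
      show ?thesis unfolding im by (subst prod.reindex[OF inj_on_disc[OF pp(1)]]) simp
    qed
    finally show "lim (tree_sum G ?K p) \<le> partition_weight (M_seq G) (step_blocks ?K p)"
      by (simp only: partition_weight_step_blocks)
  qed
  also have "\<dots> = (\<Sum>\<sigma>\<in>step_blocks ?K ` tree_patterns ?K. partition_weight (M_seq G) \<sigma>)"
    using inj_on_step_blocks[of ?K] by (subst sum.reindex) (auto simp: tree_patterns_def)
  also have "\<dots> \<le> alpha G k"
    unfolding alpha_def
  proof (rule sum_mono2)
    show "finite {\<sigma>. partition_on {1..2 * k} \<sigma>}"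
      by (rule finitely_many_partition_on) simp
    show "step_blocks ?K ` tree_patterns ?K \<subseteq> {\<sigma>. partition_on {1..2 * k} \<sigma>}" using partition_step_blocks by blast
    fix \<sigma> assume "\<sigma> \<in> {\<sigma>. partition_on {1..2 * k} \<sigma>} - step_blocks ?K ` tree_patterns ?K"
    then have s: "partition_on {1..2 * k} \<sigma>" by simp
    show "0 \<le> partition_weight (M_seq G) \<sigma>" unfolding partition_weight_def
    proof (rule prod_nonneg)
      fix V assume V: "V \<in> \<sigma>"
      then have "V \<noteq> {}" "V \<subseteq> {1..2 * k}" using s by (auto simp: partition_on_def)
      then have "card V \<ge> 1" by (metis One_nat_def Suc_leI card_gt_0_iff finite_atLeastAtMost finite_subset)
      then show "0 \<le> M_seq G (card V)" by (rule M_seq_nonneg)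
    qed
  qed
  finally show "beta G ?K \<le> alpha G k" .
qed


end

section \<open>Almost sure convergence\<close>

definition edges :: "nat \<Rightarrow> (nat \<times> nat) set" where
  "edges n = {(i, j). 1 \<le> i \<and> i \<le> j \<and> j \<le> n}"

lemma step_in_edges:
  assumes "w \<in> PiE {..<k} (\<lambda>_. {1..n})" "s < k" shows "step k w s \<in> edges n"
proof -
  have "Suc s mod k < k" using assms(2) by (intro mod_less_divisor) auto
  then have "w s \<in> {1..n}" "w (Suc s mod k) \<in> {1..n}" using PiE_mem[OF assms(1)] assms(2) by blast+
  then show ?thesis by (auto simp: step_def ed_def edges_def)
qed

locale edge_variables = prob_space M for M :: "'a measure" +
  fixes n :: nat and Y :: "nat \<times> nat \<Rightarrow> 'a \<Rightarrow> real"
  assumes indep: "indep_vars (\<lambda>_. borel) Y (edges n)"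
    and int: "\<And>e r. e \<in> edges n \<Longrightarrow> r \<ge> 1 \<Longrightarrow> integrable M (\<lambda>\<omega>. Y e \<omega> ^ r)"
begin

definition mom :: "nat \<times> nat \<Rightarrow> nat \<Rightarrow> real" where "mom e r = expectation (\<lambda>\<omega>. Y e \<omega> ^ r)"

text \<open>Grouping the factors by edge turns the product into powers of independent
  variables.\<close>

lemma expectation_prod_steps:
  assumes T: "finite T" and e: "\<epsilon> ` T \<subseteq> edges n"
  shows "integrable M (\<lambda>\<omega>. \<Prod>s\<in>T. Y (\<epsilon> s) \<omega>)"
    "expectation (\<lambda>\<omega>. \<Prod>s\<in>T. Y (\<epsilon> s) \<omega>) = (\<Prod>e\<in>\<epsilon> ` T. mom e (card {s \<in> T. \<epsilon> s = e}))"
proof -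
  let ?r = "\<lambda>e. card {s \<in> T. \<epsilon> s = e}"
  have eq: "(\<Prod>s\<in>T. Y (\<epsilon> s) \<omega>) = (\<Prod>e\<in>\<epsilon> ` T. Y e \<omega> ^ ?r e)" for \<omega>
  proof -
    have "(\<Prod>s\<in>T. Y (\<epsilon> s) \<omega>) = (\<Prod>e\<in>\<epsilon> ` T. \<Prod>s | s \<in> T \<and> \<epsilon> s = e. Y (\<epsilon> s) \<omega>)"
      by (rule prod.group[symmetric]) (use T in auto)
    also have "\<dots> = (\<Prod>e\<in>\<epsilon> ` T. Y e \<omega> ^ ?r e)" by (intro prod.cong refl) simp
    finally show ?thesis .
  qed
  have iv: "indep_vars (\<lambda>_. borel) (\<lambda>e \<omega>. Y e \<omega> ^ ?r e) (\<epsilon> ` T)"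
    by (rule indep_vars_compose2[OF indep_vars_subset[OF indep e]]) simp
  have i: "integrable M (\<lambda>\<omega>. Y e \<omega> ^ ?r e)" if "e \<in> \<epsilon> ` T" for e
  proof (rule int)
    show "e \<in> edges n" using that e by blast
    have "{s \<in> T. \<epsilon> s = e} \<noteq> {}" using that by blast
    then have "?r e > 0" using T by (simp add: card_gt_0_iff)
    then show "?r e \<ge> 1" by simp
  qed
  show "integrable M (\<lambda>\<omega>. \<Prod>s\<in>T. Y (\<epsilon> s) \<omega>)"
    unfolding eq using T i by (intro indep_vars_integrable[OF _ iv]) auto
  show "expectation (\<lambda>\<omega>. \<Prod>s\<in>T. Y (\<epsilon> s) \<omega>) = (\<Prod>e\<in>\<epsilon> ` T. mom e (?r e))"
    unfolding eq mom_def using T i by (intro indep_vars_lebesgue_integral[OF _ iv]) auto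
qed

definition circ :: "nat \<Rightarrow> (nat \<Rightarrow> nat) \<Rightarrow> 'a \<Rightarrow> real" where
  "circ k w \<omega> = (\<Prod>s<k. Y (step k w s) \<omega>)"

definition trp :: "nat \<Rightarrow> 'a \<Rightarrow> real" where
  "trp k \<omega> = (\<Sum>w\<in>PiE {..<k} (\<lambda>_. {1..n}). circ k w \<omega>)"

lemma circ_moments:
  assumes "w \<in> PiE {..<k} (\<lambda>_. {1..n})"
  shows "integrable M (circ k w)" "expectation (circ k w) = wprod mom k w"
proof -
  have "step k w ` {..<k} \<subseteq> edges n" using step_in_edges[OF assms] by blast
  note * = expectation_prod_steps[OF _ this]
  have "circ k w = (\<lambda>\<omega>. \<Prod>s<k. Y (step k w s) \<omega>)" by (rule ext) (simp add: circ_def)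
  then show "integrable M (circ k w)" "expectation (circ k w) = wprod mom k w"
    using * by (simp_all add: wprod_def mult_def)
qed

lemma trp_mean:
  shows "integrable M (trp k)" "expectation (trp k) = (\<Sum>w\<in>PiE {..<k} (\<lambda>_. {1..n}). wprod mom k w)"
proof -
  have t: "trp k = (\<lambda>\<omega>. \<Sum>w\<in>PiE {..<k} (\<lambda>_. {1..n}). circ k w \<omega>)" by (rule ext) (simp add: trp_def)
  show "integrable M (trp k)" unfolding t by (intro Bochner_Integration.integrable_sum circ_moments)
  show "expectation (trp k) = (\<Sum>w\<in>PiE {..<k} (\<lambda>_. {1..n}). wprod mom k w)"
    unfolding t by (simp add: Bochner_Integration.integral_sum circ_moments)
qed

lemma circs_moments:
  assumes W: "W \<in> PiE J (\<lambda>_. PiE {..<k} (\<lambda>_. {1..n}))" and A: "A \<subseteq> J" "finite J"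
  shows "integrable M (\<lambda>\<omega>. \<Prod>a\<in>A. circ k (W a) \<omega>)" "expectation (\<lambda>\<omega>. \<Prod>a\<in>A. circ k (W a) \<omega>) = mprod mom k W A"
proof -
  let ?\<epsilon> = "\<lambda>z. step k (W (fst z)) (snd z)"
  have fA: "finite A" using A finite_subset by auto
  have sub: "?\<epsilon> ` (A \<times> {..<k}) \<subseteq> edges n"
  proof
    fix e assume "e \<in> ?\<epsilon> ` (A \<times> {..<k})"
    then obtain a s where "a \<in> A" "s < k" "e = step k (W a) s" by auto
    then show "e \<in> edges n" using step_in_edges[of "W a" k n s] W A by auto
  qed
  have eq: "(\<Prod>a\<in>A. circ k (W a) \<omega>) = (\<Prod>z\<in>A \<times> {..<k}. Y (?\<epsilon> z) \<omega>)" for \<omega>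
    by (simp add: circ_def prod.cartesian_product case_prod_beta)
  have "?\<epsilon> ` (A \<times> {..<k}) = eset k W A" by (force simp: eset_def)
  then show "integrable M (\<lambda>\<omega>. \<Prod>a\<in>A. circ k (W a) \<omega>)" "expectation (\<lambda>\<omega>. \<Prod>a\<in>A. circ k (W a) \<omega>) = mprod mom k W A"
    using expectation_prod_steps[OF _ sub] fA unfolding eq mprod_def by simp_all
qed

text \<open>The fourth power is expanded over quadruples of walks, and each product of four centred
  factors over the set \<open>A\<close> of factors whose random part is taken.\<close>

lemma trp_fourth_moment:
  shows "integrable M (\<lambda>\<omega>. (trp k \<omega> - expectation (trp k)) ^ 4)"
    "expectation (\<lambda>\<omega>. (trp k \<omega> - expectation (trp k)) ^ 4) =
      (\<Sum>W\<in>PiE {..<4} (\<lambda>_. PiE {..<k} (\<lambda>_. {1..n})). cmoment mom k W {..<4})"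
proof -
  let ?P = "PiE {..<k} (\<lambda>_. {1..n})" and ?J = "{..<4::nat}"
  let ?W = "PiE ?J (\<lambda>_. ?P)"
  have fP: "finite ?P" by (intro finite_PiE) auto
  have ex: "(trp k \<omega> - expectation (trp k)) ^ 4 =
      (\<Sum>W\<in>?W. \<Sum>A\<in>Pow ?J. (\<Prod>a\<in>A. circ k (W a) \<omega>) * (\<Prod>a\<in>?J - A. - mprod mom k W {a}))" for \<omega>
  proof -
    have "(trp k \<omega> - expectation (trp k)) ^ 4 = (\<Prod>a\<in>?J. \<Sum>w\<in>?P. circ k w \<omega> + - wprod mom k w)"
      by (simp add: trp_def trp_mean(2) sum_subtractf)
    also have "\<dots> = (\<Sum>W\<in>?W. \<Prod>a\<in>?J. circ k (W a) \<omega> + - wprod mom k (W a))"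
      by (rule prod_sum_PiE) (use fP in auto)
    also have "\<dots> = (\<Sum>W\<in>?W. \<Sum>A\<in>Pow ?J. (\<Prod>a\<in>A. circ k (W a) \<omega>) * (\<Prod>a\<in>?J - A. - wprod mom k (W a)))"
      by (intro sum.cong refl prod_add) simp
    also have "\<dots> = (\<Sum>W\<in>?W. \<Sum>A\<in>Pow ?J. (\<Prod>a\<in>A. circ k (W a) \<omega>) * (\<Prod>a\<in>?J - A. - mprod mom k W {a}))"
    proof (intro sum.cong refl arg_cong2[of _ _ _ _ "(*)"] prod.cong arg_cong[of _ _ uminus])
      fix W A a assume W: "W \<in> ?W" and a: "a \<in> ?J - A"
      have "W a \<in> ?P" using W a by auto
      then have "wprod mom k (W a) = expectation (circ k (W a))" using circ_moments by simp
      also have "\<dots> = mprod mom k W {a}" using circs_moments(2)[OF W, of "{a}"] a by simp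
      finally show "wprod mom k (W a) = mprod mom k W {a}" .
    qed
    finally show ?thesis .
  qed
  have i: "integrable M (\<lambda>\<omega>. (\<Prod>a\<in>A. circ k (W a) \<omega>) * (\<Prod>a\<in>?J - A. - mprod mom k W {a}))" if "W \<in> ?W" "A \<in> Pow ?J" for W A
    using circs_moments(1)[OF that(1), of A] that(2) by simp
  show "integrable M (\<lambda>\<omega>. (trp k \<omega> - expectation (trp k)) ^ 4)"
    unfolding ex by (intro Bochner_Integration.integrable_sum i)
  have "expectation (\<lambda>\<omega>. (trp k \<omega> - expectation (trp k)) ^ 4) =
      (\<Sum>W\<in>?W. \<Sum>A\<in>Pow ?J. expectation (\<lambda>\<omega>. (\<Prod>a\<in>A. circ k (W a) \<omega>) * (\<Prod>a\<in>?J - A. - mprod mom k W {a})))"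
    unfolding ex by (subst Bochner_Integration.integral_sum, intro Bochner_Integration.integrable_sum i, assumption+)
      (intro sum.cong refl Bochner_Integration.integral_sum i)
  also have "\<dots> = (\<Sum>W\<in>?W. \<Sum>A\<in>Pow ?J. mprod mom k W A * (\<Prod>a\<in>?J - A. - mprod mom k W {a}))"
  proof (intro sum.cong refl)
    fix W A assume W: "W \<in> ?W" and A: "A \<in> Pow ?J"
    show "expectation (\<lambda>\<omega>. (\<Prod>a\<in>A. circ k (W a) \<omega>) * (\<Prod>a\<in>?J - A. - mprod mom k W {a})) = mprod mom k W A * (\<Prod>a\<in>?J - A. - mprod mom k W {a})"
      using circs_moments[OF W, of A] A by simp
  qed
  finally show "expectation (\<lambda>\<omega>. (trp k \<omega> - expectation (trp k)) ^ 4) = (\<Sum>W\<in>?W. cmoment mom k W ?J)"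
    by (simp only: cmoment_def)
qed

end

text \<open>The sum of the fourth powers has a finite mean and is therefore finite almost surely.
  The argument allows any joint law of the variables \<open>Z n\<close>.\<close>

lemma (in prob_space) fourth_moments_summable_AE:
  fixes Z :: "nat \<Rightarrow> 'a \<Rightarrow> real"
  assumes i: "\<And>n. integrable M (\<lambda>\<omega>. Z n \<omega> ^ 4)" and s: "summable (\<lambda>n. expectation (\<lambda>\<omega>. Z n \<omega> ^ 4))"
  shows "AE \<omega> in M. (\<lambda>n. Z n \<omega>) \<longlonglongrightarrow> 0"
proof -
  have m: "(\<lambda>\<omega>. ennreal (Z n \<omega> ^ 4)) \<in> borel_measurable M" for n using borel_measurable_integrable[OF i[of n]] by simp
  have nn: "0 \<le> Z n \<omega> ^ 4" for n \<omega> by (rule zero_le_even_power) simp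
  have "(\<integral>\<^sup>+\<omega>. (\<Sum>n. ennreal (Z n \<omega> ^ 4)) \<partial>M) = (\<Sum>n. \<integral>\<^sup>+\<omega>. ennreal (Z n \<omega> ^ 4) \<partial>M)"
    by (rule nn_integral_suminf[OF m])
  also have "\<dots> = (\<Sum>n. ennreal (expectation (\<lambda>\<omega>. Z n \<omega> ^ 4)))"
    using nn by (intro suminf_cong nn_integral_eq_integral i) auto
  also have "\<dots> = ennreal (\<Sum>n. expectation (\<lambda>\<omega>. Z n \<omega> ^ 4))"
    using nn by (intro suminf_ennreal2 s integral_nonneg) auto
  finally have "(\<integral>\<^sup>+\<omega>. (\<Sum>n. ennreal (Z n \<omega> ^ 4)) \<partial>M) \<noteq> \<infinity>" by simp
  then have "AE \<omega> in M. (\<Sum>n. ennreal (Z n \<omega> ^ 4)) \<noteq> \<infinity>"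
    by (rule nn_integral_noteq_infinite[rotated]) (use m in measurable)
  then show ?thesis
  proof eventually_elim
    case (elim \<omega>)
    have "summable (\<lambda>n. Z n \<omega> ^ 4)" using elim unfolding infinity_ennreal_def by (intro summable_suminf_not_top nn)
    then have "(\<lambda>n. Z n \<omega> ^ 4) \<longlonglongrightarrow> 0" by (rule summable_LIMSEQ_zero)
    then have "(\<lambda>n. root 4 (Z n \<omega> ^ 4)) \<longlonglongrightarrow> root 4 0" by (rule tendsto_real_root)
    moreover have "root 4 (x ^ 4) = \<bar>x\<bar>" for x :: real using real_root_power_cancel[of 4 "\<bar>x\<bar>"] by (simp add: power_even_abs)
    ultimately show "(\<lambda>n. Z n \<omega>) \<longlonglongrightarrow> 0" by (simp add: tendsto_rabs_zero_iff)
  qed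
qed

lemma ennreal_inverse_antimono: "a \<le> b \<Longrightarrow> inverse (b::ennreal) \<le> inverse a"
  by (cases a; cases b; cases "a = 0") (auto simp: top_unique inverse_ennreal ennreal_le_iff)

text \<open>Smaller moments make the terms of the series larger.\<close>

lemma (in moment_array) carleman_beta:
  assumes "Carleman (alpha G)" shows "carleman_moments (beta G)"
proof -
  let ?c = "\<lambda>k. 1 / real (2 * Suc k)"
  have "(\<Sum>k. inverse (ennreal (alpha G (Suc k) powr ?c k))) \<le> (\<Sum>k. inverse (ennreal (beta G (2 * Suc k) powr ?c k)))"
  proof (rule suminf_le)
    fix k
    have "beta G (2 * Suc k) powr ?c k \<le> alpha G (Suc k) powr ?c k"
      by (rule powr_mono2) (use beta_le_alpha[of "Suc k"] beta_le_alpha(2)[of "2 * Suc k"] in auto)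
    then show "inverse (ennreal (alpha G (Suc k) powr ?c k)) \<le> inverse (ennreal (beta G (2 * Suc k) powr ?c k))"
      by (intro ennreal_inverse_antimono ennreal_leI)
  qed (rule summableI)+
  then show ?thesis using assms unfolding Carleman_def carleman_moments_def by (simp only: top_unique)
qed

lemma measurable_times_below: "(\<lambda>u. u * below c u) \<in> borel_measurable borel"
  unfolding below_def by measurable

lemma below_cases: "below c u = 0 \<or> below c u = 1" by (simp add: below_def indicator_def)

lemma power_times_below: "r \<ge> 1 \<Longrightarrow> (u * below c u) ^ r = u ^ r * below c u"
  using below_cases[of c u] by auto

locale symmetric_array =
  fixes M :: "'a measure" and x :: "nat \<Rightarrow> nat \<Rightarrow> nat \<Rightarrow> 'a \<Rightarrow> real" and t :: "nat \<Rightarrow> ennreal"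
    and g :: "nat \<Rightarrow> nat \<Rightarrow> real \<times> real \<Rightarrow> real" and G :: "nat \<Rightarrow> real \<times> real \<Rightarrow> real"
  assumes indep_symmetric: "indep_symmetric_matrices M x" and assumption: "assumption_A M x t g G"
begin

sublocale prob_space M using indep_symmetric by (simp add: indep_symmetric_matrices_def)

definition y :: "nat \<Rightarrow> nat \<times> nat \<Rightarrow> 'a \<Rightarrow> real" where
  "y n e \<omega> = x n (fst e) (snd e) \<omega> * below (t n) (x n (fst e) (snd e) \<omega>)"

lemma y_power: "r \<ge> 1 \<Longrightarrow> y n (i, j) \<omega> ^ r = x n i j \<omega> ^ r * below (t n) (x n i j \<omega>)"
  unfolding y_def by (simp add: power_times_below)

lemma edge_variables_y: "n \<ge> 1 \<Longrightarrow> edge_variables M n (y n)"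
proof
  assume n: "n \<ge> 1"
  have "indep_vars (\<lambda>_. borel) (\<lambda>(i, j). x n i j) (edges n)"
    using indep_symmetric n unfolding indep_symmetric_matrices_def edges_def by blast
  from indep_vars_compose2[OF this, of "\<lambda>_ u. u * below (t n) u" "\<lambda>_. borel"]
  show "indep_vars (\<lambda>_. borel) (y n) (edges n)"
    using measurable_times_below by (simp add: y_def[abs_def] case_prod_beta)
  fix e r assume e: "e \<in> edges n" and r: "(r::nat) \<ge> 1"
  obtain i j where ij: "e = (i, j)" "1 \<le> i" "i \<le> j" "j \<le> n" using e by (auto simp: edges_def)
  have "integrable M (\<lambda>\<omega>. x n i j \<omega> ^ r * below (t n) (x n i j \<omega>))"
    using assumption r ij(2-4) unfolding assumption_A_def by blast
  then show "integrable M (\<lambda>\<omega>. y n e \<omega> ^ r)" using r by (simp add: ij(1) y_power)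
qed

definition entry_moment :: "nat \<Rightarrow> nat \<times> nat \<Rightarrow> nat \<Rightarrow> real" where
  "entry_moment n e r = expectation (\<lambda>\<omega>. y n e \<omega> ^ r)"

lemma mom_eq_entry_moment: "n \<ge> 1 \<Longrightarrow> edge_variables.mom M (y n) = entry_moment n"
proof -
  assume "n \<ge> 1"
  then interpret edge_variables M n "y n" by (rule edge_variables_y)
  show ?thesis by (intro ext) (simp add: mom_def entry_moment_def)
qed

lemma g_props:
  assumes "k \<ge> 1" "n \<ge> 1"
  shows "bounded (g k n ` unit_square)" "Riemann_integrable_cbox (g k n) (0, 0) (1, 1)"
    "u \<in> {0..1} \<Longrightarrow> v \<in> {0..1} \<Longrightarrow> g k n (u, v) = g k n (v, u)"
  using assumption[unfolded assumption_A_def, THEN conjunct1, rule_format, OF assms] by auto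

lemma g_lim: "k \<ge> 1 \<Longrightarrow> uniform_limit unit_square (g k) (G k) sequentially"
  using assumption unfolding assumption_A_def by blast

lemma entry_moment_even:
  assumes "r \<ge> 1" "1 \<le> i" "i \<le> j" "j \<le> n"
  shows "real n * entry_moment n (i, j) (2 * r) = g r n (grid n i j)"
proof -
  have "real n * (\<integral>\<omega>. x n i j \<omega> ^ (2 * r) * below (t n) (x n i j \<omega>) \<partial>M) = g r n (real i / real n, real j / real n)"
    using assumption assms unfolding assumption_A_def by blast
  then show ?thesis using assms y_power[of "2 * r" n i j] by (simp add: entry_moment_def grid_def)
qed

text \<open>\<open>n\<close> times the moment is a value of \<open>g k n\<close>, which is
  eventually bounded by a bound for \<open>G k\<close> plus 1.\<close>

lemma entry_moment_small_even:
  assumes k: "k \<ge> 1" and a: "a < 1"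
  shows "\<exists>C. \<forall>\<^sub>F n in sequentially. \<forall>i j. 1 \<le> i \<and> i \<le> j \<and> j \<le> n \<longrightarrow> \<bar>entry_moment n (i, j) (2 * k)\<bar> \<le> C * real n powr (- a)"
proof -
  have "bounded (G k ` unit_square)"
    by (rule osc_uniform_limit(1)[of "g k"]) (use g_props[OF k] g_lim[OF k] Riemann_integrable_osc in auto)
  then obtain B where B: "\<And>p. p \<in> unit_square \<Longrightarrow> \<bar>G k p\<bar> \<le> B" unfolding bounded_iff by fastforce
  have "\<forall>\<^sub>F n in sequentially. \<forall>p\<in>unit_square. dist (g k n p) (G k p) < 1"
    using g_lim[OF k] by (rule uniform_limitD) simp
  then have "\<forall>\<^sub>F n in sequentially. \<forall>i j. 1 \<le> i \<and> i \<le> j \<and> j \<le> n \<longrightarrow> \<bar>entry_moment n (i, j) (2 * k)\<bar> \<le> (B + 1) * real n powr (- a)"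
    using eventually_ge_at_top[of 1]
  proof eventually_elim
    case (elim n)
    show ?case
    proof (intro allI impI)
      fix i j assume ij: "1 \<le> i \<and> i \<le> j \<and> j \<le> n"
      then have u: "grid n i j \<in> unit_square" using elim(2) by (intro grid_in_unit) auto
      have "\<bar>g k n (grid n i j)\<bar> \<le> B + 1"
        using elim(1)[rule_format, OF u] B[OF u] by (simp add: dist_real_def abs_le_iff abs_less_iff)
      moreover have "entry_moment n (i, j) (2 * k) = g k n (grid n i j) * real n powr (- 1)"
        using entry_moment_even[OF k, of i j n] ij elim(2) by (simp add: powr_minus_divide field_simps)
      ultimately have "\<bar>entry_moment n (i, j) (2 * k)\<bar> \<le> (B + 1) * real n powr (- 1)"
        by (simp add: abs_mult divide_right_mono)
      also have "\<dots> \<le> (B + 1) * real n powr (- a)"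
        using a elim(2) order_trans[OF abs_ge_zero B[OF u]] by (intro mult_left_mono powr_mono) auto
      finally show "\<bar>entry_moment n (i, j) (2 * k)\<bar> \<le> (B + 1) * real n powr (- a)" .
    qed
  qed
  then show ?thesis by blast
qed

lemma entry_moment_small_odd:
  assumes k: "k \<ge> 1" and a: "a < 1"
  shows "\<forall>\<^sub>F n in sequentially. \<forall>i j. 1 \<le> i \<and> i \<le> j \<and> j \<le> n \<longrightarrow> \<bar>entry_moment n (i, j) (2 * k - 1)\<bar> \<le> 1 * real n powr (- a)"
proof -
  let ?f = "\<lambda>n i j. \<bar>\<integral>\<omega>. x n i j \<omega> ^ (2 * k - 1) * below (t n) (x n i j \<omega>) \<partial>M\<bar>"
  let ?S = "\<lambda>n. SUP (i, j)\<in>edges n. ?f n i j"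
  have "(\<lambda>n. real n powr a * ?S n) \<longlonglongrightarrow> 0"
    unfolding edges_def using assumption k a unfolding assumption_A_def by blast
  then have "\<forall>\<^sub>F n in sequentially. real n powr a * ?S n < 1" by (rule order_tendstoD) simp
  then show ?thesis using eventually_ge_at_top[of 1]
  proof eventually_elim
    case (elim n)
    have fin: "finite (edges n)" by (rule finite_subset[of _ "{1..n} \<times> {1..n}"]) (auto simp: edges_def)
    show ?case
    proof (intro allI impI)
      fix i j assume ij: "1 \<le> i \<and> i \<le> j \<and> j \<le> n"
      have e: "(i, j) \<in> edges n" using ij by (simp add: edges_def)
      have "entry_moment n (i, j) (2 * k - 1) = (\<integral>\<omega>. x n i j \<omega> ^ (2 * k - 1) * below (t n) (x n i j \<omega>) \<partial>M)"
        using y_power[of "2 * k - 1" n i j] k by (simp add: entry_moment_def)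
      then have "\<bar>entry_moment n (i, j) (2 * k - 1)\<bar> \<le> ?S n"
        using cSUP_upper[OF e, of "\<lambda>(i, j). ?f n i j"] fin by simp
      moreover have "?S n \<le> real n powr (- a)" using elim by (simp add: powr_minus field_simps)
      ultimately show "\<bar>entry_moment n (i, j) (2 * k - 1)\<bar> \<le> 1 * real n powr (- a)" by simp
    qed
  qed
qed

sublocale moment_array entry_moment g G
proof
  fix r :: nat and a :: real assume r: "r \<ge> 1" and a: "a < 1"
  show "\<exists>C. \<forall>\<^sub>F n in sequentially. \<forall>i j. 1 \<le> i \<and> i \<le> j \<and> j \<le> n \<longrightarrow> \<bar>entry_moment n (i, j) r\<bar> \<le> C * real n powr (- a)"
  proof (cases "even r")
    case True
    then have "r = 2 * (r div 2)" "r div 2 \<ge> 1" using r by auto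
    then show ?thesis using entry_moment_small_even[of "r div 2" a] a by simp
  next
    case False
    then have "r = 2 * (r div 2 + 1) - 1" "r div 2 + 1 \<ge> 1" by presburger+
    then show ?thesis using entry_moment_small_odd[of "r div 2 + 1" a] a by metis
  qed
next
  show "entry_moment n (i, j) (2 * r) \<ge> 0" for r n i j unfolding entry_moment_def by (rule Bochner_Integration.integral_nonneg) simp
next
  show "osc (g r n) \<longlonglongrightarrow> 0" if "r \<ge> 1" "n \<ge> 1" for r n using g_props[OF that] by (intro Riemann_integrable_osc)
qed (use entry_moment_even g_lim g_props in blast)+

definition trace :: "nat \<Rightarrow> nat \<Rightarrow> 'a \<Rightarrow> real" where
  "trace k n \<omega> = (\<Sum>w\<in>PiE {..<k} (\<lambda>_. {1..n}). \<Prod>s<k. y n (step k w s) \<omega>)"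

lemma trace_moments:
  assumes n: "n \<ge> 1"
  shows "expectation (trace k n) = (\<Sum>w\<in>PiE {..<k} (\<lambda>_. {1..n}). wprod (entry_moment n) k w)"
    "integrable M (\<lambda>\<omega>. (trace k n \<omega> - expectation (trace k n)) ^ 4)"
    "expectation (\<lambda>\<omega>. (trace k n \<omega> - expectation (trace k n)) ^ 4) =
      (\<Sum>W\<in>PiE {..<4} (\<lambda>_. PiE {..<k} (\<lambda>_. {1..n})). cmoment (entry_moment n) k W {..<4})"
proof -
  interpret e: edge_variables M n "y n" using n by (rule edge_variables_y)
  have t: "e.trp k = trace k n" by (rule ext) (simp add: e.trp_def e.circ_def trace_def)
  show "expectation (trace k n) = (\<Sum>w\<in>PiE {..<k} (\<lambda>_. {1..n}). wprod (entry_moment n) k w)"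
    "integrable M (\<lambda>\<omega>. (trace k n \<omega> - expectation (trace k n)) ^ 4)"
    "expectation (\<lambda>\<omega>. (trace k n \<omega> - expectation (trace k n)) ^ 4) =
      (\<Sum>W\<in>PiE {..<4} (\<lambda>_. PiE {..<k} (\<lambda>_. {1..n})). cmoment (entry_moment n) k W {..<4})"
    using e.trp_mean(2)[of k] e.trp_fourth_moment[of k] unfolding t mom_eq_entry_moment[OF n] by auto
qed

lemma trace_convergence:
  assumes k: "k > 0"
  shows "AE \<omega> in M. (\<lambda>n. trace k n \<omega> / real n) \<longlonglongrightarrow> beta G k"
proof -
  \<comment> \<open>Here \<open>(1 - a) * (4 * k) = 1 / 2\<close>, so the fourth central moment is
    of order \<open>n powr (5 / 2)\<close>; after division by \<open>n ^ 4\<close> the exponent is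
    \<open>- 3 / 2\<close>, which is summable.\<close>
  define a where "a = 1 - 1 / (8 * real k)"
  have a: "0 < a" "a < 1" using k by (auto simp: a_def field_simps)
  obtain C where C: "C \<ge> 1" and ev: "\<forall>\<^sub>F n in sequentially. \<forall>i j r. 1 \<le> i \<and> i \<le> j \<and> j \<le> n \<and> 1 \<le> r \<and> r \<le> 4 * k \<longrightarrow> \<bar>entry_moment n (i, j) r\<bar> \<le> C * real n powr (- a)"
    using small_uniform[OF a(2)] by blast
  define D where "D = (real (4 * k) + 1) * (2 ^ 4 * C ^ (4 * k) * real (4 * k) ^ (4 * k))"
  define Z where "Z n \<omega> = (if n \<ge> 1 then (trace k n \<omega> - expectation (trace k n)) / real n else 0)" for n \<omega>
  have i: "integrable M (\<lambda>\<omega>. Z n \<omega> ^ 4)" for n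
    using trace_moments(2)[of n k] by (cases "n \<ge> 1") (auto simp: Z_def power_divide)
  have "\<forall>\<^sub>F n in sequentially. norm (expectation (\<lambda>\<omega>. Z n \<omega> ^ 4)) \<le> D * real n powr (- 3 / 2)"
    using ev eventually_ge_at_top[of 1]
  proof eventually_elim
    case (elim n)
    have n: "n \<ge> 1" by fact
    have "expectation (\<lambda>\<omega>. (trace k n \<omega> - expectation (trace k n)) ^ 4) \<le> D * real n powr (2 + (1 - a) * real (4 * k))"
      unfolding trace_moments(3)[OF n] D_def
    proof (rule sum_cmoment_bound[OF k n C])
      show "0 < a" "a \<le> 1" using a by auto
      fix e :: "nat \<times> nat" and r :: nat
      assume "fst e \<in> {1..n}" "snd e \<in> {1..n}" "fst e \<le> snd e" "1 \<le> r" "r \<le> 4 * k"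
      then show "\<bar>entry_moment n e r\<bar> \<le> C * real n powr (- a)"
        using elim(1)[rule_format, of "fst e" "snd e" r] by simp
    qed
    also have "2 + (1 - a) * real (4 * k) = 5 / 2" using k by (simp add: a_def)
    finally have *: "expectation (\<lambda>\<omega>. (trace k n \<omega> - expectation (trace k n)) ^ 4) \<le> D * real n powr (5 / 2)" .
    have "expectation (\<lambda>\<omega>. Z n \<omega> ^ 4) = expectation (\<lambda>\<omega>. (trace k n \<omega> - expectation (trace k n)) ^ 4) / real n ^ 4"
      using n by (simp add: Z_def power_divide)
    also have "\<dots> \<le> D * real n powr (5 / 2) / real n powr 4"
      using * n by (simp add: powr_numeral divide_right_mono)
    also have "\<dots> = D * real n powr (- 3 / 2)" using powr_diff[of "real n" "5 / 2" 4] by simp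
    finally show ?case using Bochner_Integration.integral_nonneg[of M "\<lambda>\<omega>. Z n \<omega> ^ 4"] by simp
  qed
  moreover have "summable (\<lambda>n. D * real n powr (- 3 / 2))"
    by (rule summable_mult) (simp add: summable_real_powr_iff)
  ultimately have "summable (\<lambda>n. expectation (\<lambda>\<omega>. Z n \<omega> ^ 4))" by (rule summable_comparison_test_ev)
  from fourth_moments_summable_AE[OF i this] show ?thesis
  proof eventually_elim
    case (elim \<omega>)
    have "(\<lambda>n. (\<Sum>w\<in>PiE {..<k} (\<lambda>_. {1..n}). wprod (entry_moment n) k w) / real n) \<longlonglongrightarrow> beta G k"
      by (rule mean_trace_limit[OF k])
    from tendsto_add[OF elim this]
    have "(\<lambda>n. Z n \<omega> + (\<Sum>w\<in>PiE {..<k} (\<lambda>_. {1..n}). wprod (entry_moment n) k w) / real n) \<longlonglongrightarrow> beta G k" by simp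
    then show ?case
    proof (rule Lim_transform_eventually)
      show "\<forall>\<^sub>F n in sequentially. Z n \<omega> + (\<Sum>w\<in>PiE {..<k} (\<lambda>_. {1..n}). wprod (entry_moment n) k w) / real n = trace k n \<omega> / real n"
        using eventually_ge_at_top[of 1] by eventually_elim (simp add: Z_def trace_moments(1) diff_divide_distrib)
    qed
  qed
qed

end

section \<open>From traces of powers to spectral distributions\<close>

lemma matrix_of_symmetric:
  assumes "\<And>i j. i \<in> {1..n} \<Longrightarrow> j \<in> {1..n} \<Longrightarrow> a i j = a j i"
  shows "matrix_of n a \<in> carrier_mat n n" "(matrix_of n a)\<^sup>T = matrix_of n a"
  unfolding matrix_of_def using assms by (auto intro!: eq_matI)

lemma symmetric_spectral_data:
  fixes A :: "real mat"
  assumes A: "A \<in> carrier_mat n n" "A\<^sup>T = A"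
  obtains U d where "U \<in> carrier_mat n n" "U\<^sup>T * U = 1\<^sub>m n" "U\<^sup>T * A * U = diag_of n d"
    "proots (char_poly A) = mset (map d [0..<n])"
proof -
  obtain U d where U: "U \<in> carrier_mat n n" "U\<^sup>T * U = 1\<^sub>m n" "U\<^sup>T * A * U = diag_of n d"
    using real_spectral_theorem[OF A] by blast
  show thesis by (rule that[OF U proots_char_poly_orthogonal(2)[OF A(1) U]])
qed

lemma esd_moments:
  assumes A: "A \<in> carrier_mat n n" "A\<^sup>T = A" and n: "n > 0"
  shows "integrable (esd A) (\<lambda>u. u ^ k)" "(\<integral>u. u ^ k \<partial>esd A) = tr (A ^\<^sub>m k) / real n"
proof -
  obtain U d where U: "U \<in> carrier_mat n n" "U\<^sup>T * U = 1\<^sub>m n" "U\<^sup>T * A * U = diag_of n d"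
    and p: "proots (char_poly A) = mset (map d [0..<n])" by (rule symmetric_spectral_data[OF A]) blast
  note * = integral_esd[OF A(1) n p, of "\<lambda>u. u ^ k"]
  show "integrable (esd A) (\<lambda>u. u ^ k)" by (rule *(1)) simp
  show "(\<integral>u. u ^ k \<partial>esd A) = tr (A ^\<^sub>m k) / real n"
    unfolding tr_pow_orthogonal[OF A(1) U] using *(2) by simp
qed

lemma iexp_lipschitz: "cmod (iexp (s * u) - iexp (s * v)) \<le> \<bar>s\<bar> * \<bar>u - v\<bar>"
proof -
  have "iexp (s * u) - iexp (s * v) = iexp (s * v) * (iexp (s * (u - v)) - 1)"
    by (simp add: exp_add[symmetric] algebra_simps)
  then have "cmod (iexp (s * u) - iexp (s * v)) = cmod (iexp (s * (u - v)) - 1)"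
    by (simp only: norm_mult norm_exp_i_times mult_1_left)
  also have "\<dots> \<le> \<bar>s * (u - v)\<bar>" using iexp_approx1[of "s * (u - v)" 0] by simp
  finally show ?thesis by (simp only: abs_mult)
qed

text \<open>\<open>iexp (s * u)\<close> is Lipschitz in \<open>u\<close> with constant
  \<open>\<bar>s\<bar>\<close>; dividing the bound of \<open>spectral_lipschitz\<close> by
  \<open>n\<close> turns its factor \<open>sqrt n\<close> into \<open>1 / sqrt n\<close>.\<close>

lemma esd_char_diff:
  assumes A: "A \<in> carrier_mat n n" "A\<^sup>T = A" and B: "B \<in> carrier_mat n n" "B\<^sup>T = B" and n: "n > 0"
  shows "cmod (char (esd A) s - char (esd B) s) \<le> \<bar>s\<bar> * sqrt (frob (A - B) / real n)"
proof -
  obtain U d where U: "U \<in> carrier_mat n n" "U\<^sup>T * U = 1\<^sub>m n" "U\<^sup>T * A * U = diag_of n d"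
    and p: "proots (char_poly A) = mset (map d [0..<n])" by (rule symmetric_spectral_data[OF A]) blast
  obtain V e where V: "V \<in> carrier_mat n n" "V\<^sup>T * V = 1\<^sub>m n" "V\<^sup>T * B * V = diag_of n e"
    and q: "proots (char_poly B) = mset (map e [0..<n])" by (rule symmetric_spectral_data[OF B]) blast
  have c: "char (esd A) s = (1 / real n) *\<^sub>R (\<Sum>i<n. iexp (s * d i))"
    "char (esd B) s = (1 / real n) *\<^sub>R (\<Sum>i<n. iexp (s * e i))"
    unfolding char_def by (rule integral_esd(2)[OF A(1) n p] integral_esd(2)[OF B(1) n q]; simp)+
  have "cmod ((\<Sum>i<n. iexp (s * d i)) - (\<Sum>i<n. iexp (s * e i))) \<le> \<bar>s\<bar> * sqrt (real n * frob (A - B))"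
    by (rule spectral_lipschitz[OF A(1) B(1) U V]) (use iexp_lipschitz in auto)
  then have "cmod (char (esd A) s - char (esd B) s) \<le> (1 / real n) * (\<bar>s\<bar> * sqrt (real n * frob (A - B)))"
    unfolding c scaleR_diff_right[symmetric] norm_scaleR using n by (simp add: divide_right_mono)
  also have "\<dots> = \<bar>s\<bar> * sqrt (frob (A - B) / real n)"
    using n by (simp add: real_sqrt_mult real_sqrt_divide real_div_sqrt field_simps)
  finally show ?thesis .
qed

text \<open>One outcome at which both convergences hold decides: the characteristic functions of the
  two limits agree.\<close>

lemma weak_conv_as_unique:
  assumes M: "prob_space M" and d: "\<And>n \<omega>. real_distribution (F n \<omega>)"
    and mu: "real_distribution \<mu>" "weak_conv_as M F \<mu>" and nu: "real_distribution \<nu>" "weak_conv_as M F \<nu>"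
  shows "\<mu> = \<nu>"
proof -
  interpret prob_space M by fact
  have "AE \<omega> in M. weak_conv_m (\<lambda>n. F n \<omega>) \<mu> \<and> weak_conv_m (\<lambda>n. F n \<omega>) \<nu>"
    using mu(2) nu(2) unfolding weak_conv_as_def by eventually_elim simp
  then obtain \<omega> where w: "weak_conv_m (\<lambda>n. F n \<omega>) \<mu>" "weak_conv_m (\<lambda>n. F n \<omega>) \<nu>"
    using eventually_happens'[OF ae_filter_bot] by blast
  have "char \<mu> s = char \<nu> s" for s
    by (rule LIMSEQ_unique[OF levy_continuity1[OF d mu(1) w(1)] levy_continuity1[OF d nu(1) w(2)]])
  then show ?thesis by (intro Levy_uniqueness mu nu) auto
qed

text \<open>Dominated convergence for the indicators of the events.\<close>

lemma (in prob_space) AE_tendsto_imp_prob: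
  fixes X :: "nat \<Rightarrow> 'a \<Rightarrow> real"
  assumes a: "AE \<omega> in M. (\<lambda>n. X n \<omega>) \<longlonglongrightarrow> c" and e: "e > 0"
  shows "(\<lambda>n. prob {\<omega> \<in> space M. \<bar>X n \<omega> - c\<bar> > e}) \<longlonglongrightarrow> 0"
proof -
  let ?A = "\<lambda>n. {\<omega> \<in> space M. \<bar>X n \<omega> - c\<bar> > e}"
  \<comment> \<open>\<open>X n\<close> need not be measurable; a non-measurable event has measure 0 by convention\<close>
  define A where "A n = (if ?A n \<in> sets M then ?A n else {})" for n
  have m: "A n \<in> sets M" for n by (simp add: A_def)
  have eq: "prob (?A n) = (\<integral>\<omega>. indicator (A n) \<omega> \<partial>M)" for n
  proof -
    have "prob (?A n) = prob (A n)" by (auto simp: A_def measure_notin_sets)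
    then show ?thesis using m sets.sets_into_space[OF m] by (simp add: Int_absorb2)
  qed
  have "(\<lambda>n. \<integral>\<omega>. indicator (A n) \<omega> \<partial>M) \<longlonglongrightarrow> (\<integral>\<omega>. (0::real) \<partial>M)"
  proof (rule integral_dominated_convergence[where w = "\<lambda>_. 1"])
    show "AE \<omega> in M. (\<lambda>n. indicator (A n) \<omega> :: real) \<longlonglongrightarrow> 0"
      using a
    proof eventually_elim
      case (elim \<omega>)
      have "\<forall>\<^sub>F n in sequentially. dist (X n \<omega>) c < e" using elim e by (rule tendstoD)
      then have "\<forall>\<^sub>F n in sequentially. indicator (A n) \<omega> = (0::real)"
        by eventually_elim (auto simp: A_def indicator_def dist_real_def)
      then show ?case by (rule tendsto_eventually)
    qed
  qed (use m in \<open>auto simp: indicator_def\<close>)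
  then show ?thesis unfolding eq by simp
qed

text \<open>The bounded variables \<open>min 1 \<bar>T n\<bar>\<close> tend to 0 in mean, which
  yields an almost surely convergent subsequence; once the values are below 1 the truncation is
  invisible.\<close>

lemma (in prob_space) tendsto_in_prob_subseq_AE:
  fixes T :: "nat \<Rightarrow> 'a \<Rightarrow> real"
  assumes m: "\<And>n. T n \<in> borel_measurable M" and T: "tendsto_in_prob M T 0"
  shows "\<exists>s. strict_mono s \<and> (AE \<omega> in M. (\<lambda>n. T (s n) \<omega>) \<longlonglongrightarrow> 0)"
proof -
  let ?u = "\<lambda>n \<omega>. min 1 \<bar>T n \<omega>\<bar>"
  have [measurable]: "?u n \<in> borel_measurable M" for n using m[of n] by measurable
  have i: "integrable M (?u n)" for n by (rule integrable_const_bound[where B = 1]) auto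
  have "(\<lambda>n. \<integral>\<omega>. norm (?u n \<omega>) \<partial>M) \<longlonglongrightarrow> 0"
  proof (rule LIMSEQ_I)
    fix e :: real assume e: "e > 0"
    let ?B = "\<lambda>n. {\<omega> \<in> space M. \<bar>T n \<omega> - 0\<bar> > e / 2}"
    have B: "?B n \<in> sets M" for n using m[of n] by measurable
    have "(\<lambda>n. prob (?B n)) \<longlonglongrightarrow> 0" using T half_gt_zero[OF e] unfolding tendsto_in_prob_def by blast
    then have "\<forall>\<^sub>F n in sequentially. prob (?B n) < e / 2" by (rule order_tendstoD) (use e in simp)
    then obtain N where N: "\<And>n. n \<ge> N \<Longrightarrow> prob (?B n) < e / 2" by (auto simp: eventually_sequentially)
    have "norm ((\<integral>\<omega>. norm (?u n \<omega>) \<partial>M) - 0) < e" if "n \<ge> N" for n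
    proof -
      have "(\<integral>\<omega>. norm (?u n \<omega>) \<partial>M) \<le> (\<integral>\<omega>. e / 2 + indicator (?B n) \<omega> \<partial>M)"
      proof (rule integral_mono)
        show "integrable M (\<lambda>\<omega>. norm (?u n \<omega>))" by (rule integrable_norm[OF i])
        show "integrable M (\<lambda>\<omega>. e / 2 + indicator (?B n) \<omega>)"
          by (intro Bochner_Integration.integrable_add integrable_const integrable_real_indicator B) (simp add: emeasure_eq_measure)
        show "norm (?u n \<omega>) \<le> e / 2 + indicator (?B n) \<omega>" if "\<omega> \<in> space M" for \<omega>
          using that e by (simp add: indicator_def min_def)
      qed
      also have "\<dots> = e / 2 + prob (?B n)" 
        using B[of n] by (subst Bochner_Integration.integral_add) (auto simp: prob_space Int_absorb2 emeasure_eq_measure)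
      also have "\<dots> < e" using N[OF that] by simp
      finally show ?thesis by simp
    qed
    then show "\<exists>no. \<forall>n\<ge>no. norm ((\<integral>\<omega>. norm (?u n \<omega>) \<partial>M) - 0) < e" by blast
  qed
  from tendsto_L1_AE_subseq[OF i this] obtain s where s: "strict_mono s" "AE \<omega> in M. (\<lambda>n. ?u (s n) \<omega>) \<longlonglongrightarrow> 0" by blast
  have "AE \<omega> in M. (\<lambda>n. T (s n) \<omega>) \<longlonglongrightarrow> 0"
    using s(2)
  proof eventually_elim
    case (elim \<omega>)
    have "\<forall>\<^sub>F n in sequentially. ?u (s n) \<omega> < 1" using elim by (rule order_tendstoD) simp
    then have "\<forall>\<^sub>F n in sequentially. ?u (s n) \<omega> = \<bar>T (s n) \<omega>\<bar>" by eventually_elim simp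
    from Lim_transform_eventually[OF elim this] show ?case by (simp add: tendsto_rabs_zero_iff)
  qed
  then show ?thesis using s(1) by blast
qed

section \<open>Limits of the truncated and of the original matrices\<close>

context symmetric_array begin

lemma x_sym: "n \<ge> 1 \<Longrightarrow> i \<in> {1..n} \<Longrightarrow> j \<in> {1..n} \<Longrightarrow> \<omega> \<in> space M \<Longrightarrow> x n i j \<omega> = x n j i \<omega>"
  using indep_symmetric unfolding indep_symmetric_matrices_def by blast

lemma symmetric_matrices:
  assumes "\<omega> \<in> space M"
  shows "matrix_of n (\<lambda>i j. x n i j \<omega>) \<in> carrier_mat n n" "(matrix_of n (\<lambda>i j. x n i j \<omega>))\<^sup>T = matrix_of n (\<lambda>i j. x n i j \<omega>)"
    "matrix_of n (\<lambda>i j. x n i j \<omega> * below (t n) (x n i j \<omega>)) \<in> carrier_mat n n"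
    "(matrix_of n (\<lambda>i j. x n i j \<omega> * below (t n) (x n i j \<omega>)))\<^sup>T = matrix_of n (\<lambda>i j. x n i j \<omega> * below (t n) (x n i j \<omega>))"
proof -
  have s: "x n i j \<omega> = x n j i \<omega>" if "i \<in> {1..n}" "j \<in> {1..n}" for i j
    by (rule x_sym) (use that assms in auto)
  show "matrix_of n (\<lambda>i j. x n i j \<omega>) \<in> carrier_mat n n" "(matrix_of n (\<lambda>i j. x n i j \<omega>))\<^sup>T = matrix_of n (\<lambda>i j. x n i j \<omega>)"
    by (rule matrix_of_symmetric; use s in blast)+
  have s': "x n i j \<omega> * below (t n) (x n i j \<omega>) = x n j i \<omega> * below (t n) (x n j i \<omega>)" if "i \<in> {1..n}" "j \<in> {1..n}" for i j
    using s[OF that] by simp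
  show "matrix_of n (\<lambda>i j. x n i j \<omega> * below (t n) (x n i j \<omega>)) \<in> carrier_mat n n"
    "(matrix_of n (\<lambda>i j. x n i j \<omega> * below (t n) (x n i j \<omega>)))\<^sup>T = matrix_of n (\<lambda>i j. x n i j \<omega> * below (t n) (x n i j \<omega>))"
    by (rule matrix_of_symmetric; use s' in blast)+
qed

lemma esd_Z_moments:
  assumes w: "\<omega> \<in> space M" and n: "n \<ge> 1"
  shows "integrable (esd_Z x t n \<omega>) (\<lambda>u. u ^ k)"
    "k > 0 \<Longrightarrow> (\<integral>u. u ^ k \<partial>esd_Z x t n \<omega>) = trace k n \<omega> / real n"
proof -
  define A where "A = matrix_of n (\<lambda>i j. x n i j \<omega> * below (t n) (x n i j \<omega>))"
  have A: "A \<in> carrier_mat n n" "A\<^sup>T = A" unfolding A_def by (rule symmetric_matrices[OF w])+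
  have Z: "esd_Z x t n \<omega> = esd A" by (simp add: esd_Z_def A_def)
  note m = esd_moments[OF A, of k]
  show "integrable (esd_Z x t n \<omega>) (\<lambda>u. u ^ k)" unfolding Z using m(1) n by simp
  assume k: "k > 0"
  have e: "A $$ (i, j) = y n (ed (Suc i) (Suc j)) \<omega>" if "i < n" "j < n" for i j
    using that x_sym[OF n, of "Suc i" "Suc j" \<omega>] w by (auto simp: A_def matrix_of_def y_def ed_def min_def max_def)
  have "tr (A ^\<^sub>m k) = (\<Sum>w\<in>PiE {..<k} (\<lambda>_. {..<n}). \<Prod>s<k. A $$ (w s, w (Suc s mod k)))"
    by (rule tr_pow_closed_walks[OF A(1) k])
  also have "\<dots> = trace k n \<omega>" unfolding trace_def
  \<comment> \<open>Matrix indices start at 0, entry indices at 1.\<close>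
  proof (rule sum.reindex_bij_witness[of _ "\<lambda>w. \<lambda>s\<in>{..<k}. w s - 1" "\<lambda>w. \<lambda>s\<in>{..<k}. Suc (w s)"])
    fix w assume w: "w \<in> PiE {..<k} (\<lambda>_. {..<n})"
    show "(\<lambda>s\<in>{..<k}. (\<lambda>s\<in>{..<k}. Suc (w s)) s - 1) = w"
      by (rule ext) (use PiE_arb[OF w] in \<open>auto simp: restrict_def\<close>)
    show "(\<lambda>s\<in>{..<k}. Suc (w s)) \<in> PiE {..<k} (\<lambda>_. {1..n})" using PiE_mem[OF w] by (auto simp: Suc_le_eq)
    show "(\<Prod>s<k. y n (step k (\<lambda>s\<in>{..<k}. Suc (w s)) s) \<omega>) = (\<Prod>s<k. A $$ (w s, w (Suc s mod k)))"
    proof (rule prod.cong[OF refl])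
      fix s assume s: "s \<in> {..<k}"
      have s': "Suc s mod k \<in> {..<k}" using k by simp
      have "A $$ (w s, w (Suc s mod k)) = y n (ed (Suc (w s)) (Suc (w (Suc s mod k)))) \<omega>"
        by (rule e) (use PiE_mem[OF w s] PiE_mem[OF w s'] in auto)
      then show "y n (step k (\<lambda>s\<in>{..<k}. Suc (w s)) s) \<omega> = A $$ (w s, w (Suc s mod k))"
        unfolding step_def using s s' by (simp only: restrict_apply if_True)
    qed
  next
    fix w assume w: "w \<in> PiE {..<k} (\<lambda>_. {1..n})"
    have 1: "Suc (w s - 1) = w s" "w s - 1 < n" if "s < k" for s using PiE_mem[OF w, of s] that by auto
    show "(\<lambda>s\<in>{..<k}. Suc ((\<lambda>s\<in>{..<k}. w s - 1) s)) = w"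
      by (intro ext) (use PiE_arb[OF w] 1 in \<open>auto simp: restrict_def\<close>)
    show "(\<lambda>s\<in>{..<k}. w s - 1) \<in> PiE {..<k} (\<lambda>_. {..<n})" using 1(2) by (intro restrict_PiE_iff[THEN iffD2]) auto
  qed
  finally show "(\<integral>u. u ^ k \<partial>esd_Z x t n \<omega>) = trace k n \<omega> / real n" unfolding Z using m(2) n by simp
qed

text \<open>A limit law is obtained separately at almost every outcome; all these laws have the
  moments \<open>beta G\<close>, which are determinate, so they coincide.\<close>

theorem esd_Z_limit:
  "\<exists>\<mu>. real_distribution \<mu> \<and> (\<forall>k. integrable \<mu> (\<lambda>u. u ^ k) \<and> (\<integral>u. u ^ k \<partial>\<mu>) = beta G k) \<and> weak_conv_as M (esd_Z x t) \<mu>"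
proof -
  let ?P = "\<lambda>\<mu>. real_distribution \<mu> \<and> (\<forall>k. integrable \<mu> (\<lambda>u. u ^ k) \<and> (\<integral>u. u ^ k \<partial>\<mu>) = beta G k)"
  have C: "carleman_moments (beta G)" using assumption by (intro carleman_beta) (simp add: assumption_A_def)
  have "AE \<omega> in M. \<forall>k>0. (\<lambda>n. trace k n \<omega> / real n) \<longlonglongrightarrow> beta G k"
    using trace_convergence by (subst AE_all_countable) auto
  then have conv: "AE \<omega> in M. \<exists>\<mu>. ?P \<mu> \<and> weak_conv_m (\<lambda>n. esd_Z x t n \<omega>) \<mu>"
    using AE_space
  proof eventually_elim
    case (elim \<omega>)
    \<comment> \<open>Size 0 is skipped, because nothing is known about the moments of the
      unspecified measure that belongs to the empty matrix.\<close>
    have "\<exists>\<mu>. ?P \<mu> \<and> weak_conv_m (\<lambda>n. esd_Z x t (Suc n) \<omega>) \<mu>"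
      unfolding conj_assoc
    proof (rule method_of_moments[OF _ _ _ C])
      show d: "real_distribution (esd_Z x t (Suc n) \<omega>)" for n unfolding esd_Z_def by (rule real_distribution_esd)
      show "integrable (esd_Z x t (Suc n) \<omega>) (\<lambda>u. u ^ k)" for n k using elim by (intro esd_Z_moments) auto
      show "(\<lambda>n. \<integral>u. u ^ k \<partial>esd_Z x t (Suc n) \<omega>) \<longlonglongrightarrow> beta G k" for k
      proof (cases "k = 0")
        case True
        have "prob_space (esd_Z x t (Suc n) \<omega>)" for n using d[of n] by (simp add: real_distribution_def)
        then show ?thesis using True by (simp add: beta_def prob_space.prob_space)
      next
        case False
        then have "(\<lambda>n. trace k (Suc n) \<omega> / real (Suc n)) \<longlonglongrightarrow> beta G k"
          using elim(1) by (intro LIMSEQ_Suc[where f = "\<lambda>n. trace k n \<omega> / real n"]) auto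
        moreover have "(\<integral>u. u ^ k \<partial>esd_Z x t (Suc n) \<omega>) = trace k (Suc n) \<omega> / real (Suc n)" for n
          using False elim(2) by (intro esd_Z_moments) auto
        ultimately show ?thesis by (simp only:)
      qed
    qed
    then obtain \<mu> where "?P \<mu>" and *: "weak_conv_m (\<lambda>n. esd_Z x t (Suc n) \<omega>) \<mu>" by blast
    moreover have "weak_conv_m (\<lambda>n. esd_Z x t n \<omega>) \<mu>"
      using * unfolding weak_conv_m_def weak_conv_def by (blast intro: LIMSEQ_imp_Suc)
    ultimately show ?case by blast
  qed
  from eventually_happens'[OF ae_filter_bot this] obtain \<mu> where mu: "?P \<mu>" by blast
  have "AE \<omega> in M. weak_conv_m (\<lambda>n. esd_Z x t n \<omega>) \<mu>"
    using conv
  proof eventually_elim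
    case (elim \<omega>)
    then obtain \<nu> where nu: "?P \<nu>" and w: "weak_conv_m (\<lambda>n. esd_Z x t n \<omega>) \<nu>" by blast
    have "\<nu> = \<mu>" by (rule real_distribution_moments_unique[OF _ _ _ _ _ _ C]) (use mu nu in auto)
    then show ?case using w by simp
  qed
  then show ?thesis using mu unfolding weak_conv_as_def by blast
qed

text \<open>The two matrices differ exactly in the entries beyond the truncation level, so their
  squared Frobenius distance is \<open>n\<close> times \<open>tail_sum\<close>.\<close>

lemma esd_W_char_diff:
  assumes w: "\<omega> \<in> space M" and n: "n \<ge> 1"
  shows "cmod (char (esd_W x n \<omega>) s - char (esd_Z x t n \<omega>) s) \<le> \<bar>s\<bar> * sqrt (tail_sum x t n \<omega>)"
proof -
  let ?A = "matrix_of n (\<lambda>i j. x n i j \<omega>)" and ?B = "matrix_of n (\<lambda>i j. x n i j \<omega> * below (t n) (x n i j \<omega>))"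
  have "frob (?A - ?B) = (\<Sum>i<n. \<Sum>j<n. (x n (Suc i) (Suc j) \<omega>)\<^sup>2 * indicator {v. ennreal \<bar>v\<bar> > t n} (x n (Suc i) (Suc j) \<omega>))"
    unfolding frob_def by (intro sum.cong) (auto simp: matrix_of_def below_def indicator_def not_le)
  also have "\<dots> = (\<Sum>i=1..n. \<Sum>j=1..n. (x n i j \<omega>)\<^sup>2 * indicator {v. ennreal \<bar>v\<bar> > t n} (x n i j \<omega>))"
    by (simp only: One_nat_def sum.atLeast1_atMost_eq)
  finally have "frob (?A - ?B) / real n = tail_sum x t n \<omega>" unfolding tail_sum_def by simp
  then show ?thesis
    using esd_char_diff[OF symmetric_matrices[OF w], of n s] n unfolding esd_W_def esd_Z_def by simp
qed

text \<open>The sizes \<open>r n\<close> run through all numbers for almost sure convergence, and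
  through a subsequence for convergence in probability.\<close>

lemma esd_W_weak_conv:
  assumes w: "\<omega> \<in> space M" and mu: "real_distribution \<mu>" and r: "filterlim r at_top sequentially"
    and Z: "weak_conv_m (\<lambda>n. esd_Z x t n \<omega>) \<mu>" and T: "(\<lambda>n. tail_sum x t (r n) \<omega>) \<longlonglongrightarrow> 0"
  shows "weak_conv_m (\<lambda>n. esd_W x (r n) \<omega>) \<mu>"
proof (rule levy_continuity[OF _ mu])
  show "real_distribution (esd_W x (r n) \<omega>)" for n unfolding esd_W_def by (rule real_distribution_esd)
  fix s
  have "(\<lambda>n. char (esd_Z x t n \<omega>) s) \<longlonglongrightarrow> char \<mu> s"
    by (rule levy_continuity1[OF _ mu Z]) (unfold esd_Z_def, rule real_distribution_esd)
  then have cz: "(\<lambda>n. char (esd_Z x t (r n) \<omega>) s) \<longlonglongrightarrow> char \<mu> s" using r by (rule filterlim_compose)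
  have "(\<lambda>n. char (esd_W x (r n) \<omega>) s - char (esd_Z x t (r n) \<omega>) s) \<longlonglongrightarrow> 0"
  proof (rule Lim_null_comparison)
    have "\<forall>\<^sub>F n in sequentially. r n \<ge> 1" using r by (simp add: filterlim_at_top)
    then show "\<forall>\<^sub>F n in sequentially. cmod (char (esd_W x (r n) \<omega>) s - char (esd_Z x t (r n) \<omega>) s) \<le> \<bar>s\<bar> * sqrt (tail_sum x t (r n) \<omega>)"
      by eventually_elim (rule esd_W_char_diff[OF w])
    have "(\<lambda>n. \<bar>s\<bar> * sqrt (tail_sum x t (r n) \<omega>)) \<longlonglongrightarrow> \<bar>s\<bar> * sqrt 0" using T by (intro tendsto_intros)
    then show "(\<lambda>n. \<bar>s\<bar> * sqrt (tail_sum x t (r n) \<omega>)) \<longlonglongrightarrow> 0" by simp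
  qed
  from tendsto_add[OF this cz] show "(\<lambda>n. char (esd_W x (r n) \<omega>) s) \<longlonglongrightarrow> char \<mu> s" by simp
qed

text \<open>Independence includes measurability on and above the diagonal; below it, symmetry on
  \<open>space M\<close> provides it.\<close>

lemma measurable_tail_sum: "tail_sum x t n \<in> borel_measurable M"
proof (cases "n \<ge> 1")
  case True
  have e: "x n i j \<in> borel_measurable M" if "1 \<le> i" "i \<le> j" "j \<le> n" for i j
  proof -
    have "indep_vars (\<lambda>_. borel) (\<lambda>(i, j). x n i j) (edges n)"
      using indep_symmetric True unfolding indep_symmetric_matrices_def edges_def by blast
    then have "\<forall>e\<in>edges n. (\<lambda>(i, j). x n i j) e \<in> borel_measurable M" unfolding indep_vars_def by blast
    from this[rule_format, of "(i, j)"] show ?thesis using that by (simp add: edges_def)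
  qed
  have [measurable]: "x n i j \<in> borel_measurable M" if "i \<in> {1..n}" "j \<in> {1..n}" for i j
  proof (cases "i \<le> j")
    case False
    have "x n i j \<in> borel_measurable M \<longleftrightarrow> x n j i \<in> borel_measurable M"
      by (rule measurable_cong) (rule x_sym[OF True that])
    then show ?thesis using e[of j i] False that by auto
  qed (use e that in auto)
  have m: "(\<lambda>u. u\<^sup>2 * indicator {v. ennreal \<bar>v\<bar> > t n} u) \<in> borel_measurable borel" (is "?h \<in> _") by measurable
  have "(\<lambda>\<omega>. 1 / real n * (\<Sum>i=1..n. \<Sum>j=1..n. ?h (x n i j \<omega>))) \<in> borel_measurable M"
    by (intro borel_measurable_times borel_measurable_const borel_measurable_sum measurable_compose[OF _ m]) measurable
  then show ?thesis by (simp add: tail_sum_def[abs_def])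
qed (simp add: tail_sum_def[abs_def])

text \<open>By contradiction: a subsequence along which the probabilities stay away from 0 has a
  further subsequence on which the tail sums tend to 0 almost surely, and there the almost sure
  argument applies.\<close>

lemma esd_W_limit_in_prob:
  assumes mu: "real_distribution \<mu>" and Z: "weak_conv_as M (esd_Z x t) \<mu>"
    and T: "tendsto_in_prob M (tail_sum x t) 0"
  shows "weak_conv_in_prob M (esd_W x) \<mu>"
  unfolding weak_conv_in_prob_def tendsto_in_prob_def
proof (intro allI impI)
  fix f :: "real \<Rightarrow> real" and e :: real assume f: "continuous_on UNIV f \<and> bounded (range f)" and e: "e > 0"
  let ?X = "\<lambda>n \<omega>. \<integral>u. f u \<partial>esd_W x n \<omega>" and ?c = "\<integral>u. f u \<partial>\<mu>"
  let ?p = "\<lambda>n. prob {\<omega> \<in> space M. \<bar>?X n \<omega> - ?c\<bar> > e}"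
  show "?p \<longlonglongrightarrow> 0"
  proof (rule ccontr)
    assume "\<not> ?p \<longlonglongrightarrow> 0"
    then obtain \<epsilon> where eps: "\<epsilon> > 0" "\<forall>N. \<exists>n\<ge>N. \<not> norm (?p n - 0) < \<epsilon>"
      unfolding LIMSEQ_iff by blast
    let ?S = "{n. \<not> norm (?p n - 0) < \<epsilon>}"
    have "infinite ?S" unfolding infinite_nat_iff_unbounded_le using eps(2) by blast
    then obtain r :: "nat \<Rightarrow> nat" where r: "strict_mono r" "\<And>n. r n \<in> ?S" using infinite_enumerate[of ?S] by blast
    have "tendsto_in_prob M (\<lambda>n. tail_sum x t (r n)) 0"
      unfolding tendsto_in_prob_def
    proof (intro allI impI)
      fix e :: real assume "e > 0"
      then have "(\<lambda>n. prob {\<omega> \<in> space M. e < \<bar>tail_sum x t n \<omega> - 0\<bar>}) \<longlonglongrightarrow> 0"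
        using T unfolding tendsto_in_prob_def by blast
      from filterlim_compose[OF this filterlim_subseq[OF r(1)]]
      show "(\<lambda>n. prob {\<omega> \<in> space M. e < \<bar>tail_sum x t (r n) \<omega> - 0\<bar>}) \<longlonglongrightarrow> 0" .
    qed
    from tendsto_in_prob_subseq_AE[OF measurable_tail_sum this] obtain s where s: "strict_mono s"
      "AE \<omega> in M. (\<lambda>n. tail_sum x t (r (s n)) \<omega>) \<longlonglongrightarrow> 0" by blast
    have rs: "filterlim (\<lambda>n. r (s n)) at_top sequentially"
      by (rule filterlim_compose[OF filterlim_subseq[OF r(1)] filterlim_subseq[OF s(1)]])
    obtain B where B: "\<And>u. norm (f u) \<le> B" using f unfolding bounded_iff by auto
    have "AE \<omega> in M. (\<lambda>n. ?X (r (s n)) \<omega>) \<longlonglongrightarrow> ?c"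
      using s(2) Z[unfolded weak_conv_as_def] AE_space
    proof eventually_elim
      case (elim \<omega>)
      have "weak_conv_m (\<lambda>n. esd_W x (r (s n)) \<omega>) \<mu>" by (rule esd_W_weak_conv[OF elim(3) mu rs elim(2,1)])
      then show ?case
        by (rule weak_conv_imp_integral_bdd_continuous_conv[rotated 2])
          (use f B in \<open>auto simp: mu esd_W_def real_distribution_esd continuous_on_eq_continuous_at\<close>)
    qed
    from AE_tendsto_imp_prob[OF this e] have "\<forall>\<^sub>F n in sequentially. ?p (r (s n)) < \<epsilon>"
      by (rule order_tendstoD) (rule eps(1))
    then obtain n where "?p (r (s n)) < \<epsilon>" by (auto simp: eventually_sequentially)
    then show False using r(2)[of "s n"] by simp
  qed
qed

lemma esd_W_limit_as:
  assumes mu: "real_distribution \<mu>" and Z: "weak_conv_as M (esd_Z x t) \<mu>"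
    and T: "AE \<omega> in M. (\<lambda>n. tail_sum x t n \<omega>) \<longlonglongrightarrow> 0"
  shows "weak_conv_as M (esd_W x) \<mu>"
  unfolding weak_conv_as_def
  using T Z[unfolded weak_conv_as_def] AE_space
proof eventually_elim
  case (elim \<omega>)
  show ?case by (rule esd_W_weak_conv[OF elim(3) mu filterlim_ident elim(2,1)])
qed

end

section \<open>The semi-circular case\<close>

definition grid_mean :: "(real \<times> real \<Rightarrow> real) \<Rightarrow> nat \<Rightarrow> real" where
  "grid_mean f N = (\<Sum>i=1..N. \<Sum>j=1..N. f (grid N i j)) / (real N)\<^sup>2"

lemma sum_PiE_one_marginal:
  fixes h :: "nat \<Rightarrow> real"
  assumes V: "finite V" "u \<in> V" and A: "finite A"
  shows "(\<Sum>\<phi>\<in>PiE V (\<lambda>_. A). h (\<phi> u)) = real (card A) ^ (card V - 1) * (\<Sum>i\<in>A. h i)"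
proof -
  have "V = insert u (V - {u})" using V by auto
  then have "(\<Sum>\<phi>\<in>PiE V (\<lambda>_. A). h (\<phi> u)) = (\<Sum>\<phi>\<in>PiE (insert u (V - {u})) (\<lambda>_. A). h (\<phi> u))" by simp
  also have "\<dots> = (\<Sum>l\<in>A. \<Sum>w\<in>PiE (V - {u}) (\<lambda>_. A). h l)" by (subst sum_PiE_insert) auto
  also have "\<dots> = real (card A ^ card (V - {u})) * (\<Sum>l\<in>A. h l)" using V by (simp add: card_PiE sum_distrib_left)
  finally show ?thesis using V by simp
qed

text \<open>The largest vertex is a leaf, since parents are smaller. Summing over its label replaces
  its edge by a row mean, which is \<open>c\<close> up to an error that is small in mean; so every
  edge in turn contributes a factor \<open>c\<close>.\<close>

lemma gsum_row_regular:
  fixes H :: "real \<times> real \<Rightarrow> real"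
  assumes E: "finite E" "\<And>v. v \<in> E \<Longrightarrow> q v < v \<and> q v \<in> insert 0 E"
    and bd: "bounded (H ` unit_square)"
    and lim: "(\<lambda>n. (\<Sum>i=1..n. \<bar>row_mean H n i - c\<bar>) / real n) \<longlonglongrightarrow> 0"
  shows "gsum (insert 0 E) E q (\<lambda>v. v) (\<lambda>_. H) \<longlonglongrightarrow> c ^ card E"
  using E
proof (induction "card E" arbitrary: E)
  case 0
  then have E: "E = {}" by simp
  have "\<forall>\<^sub>F n in sequentially. gsum {0} {} q (\<lambda>v. v) (\<lambda>_. H) n = 1"
    using eventually_ge_at_top[of 1] by eventually_elim (simp add: gsum_def card_PiE)
  then show ?case unfolding E by (simp add: tendsto_eventually)
next
  case (Suc d)
  obtain B where B: "\<And>p. p \<in> unit_square \<Longrightarrow> \<bar>H p\<bar> \<le> B" using bd by (force simp: bounded_iff)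
  define m where "m = Max E"
  define E' where "E' = E - {m}"
  let ?V = "insert 0 E'" and ?a = "q m"
  have m: "m \<in> E" using Suc.hyps(2) Suc.prems(1) unfolding m_def by (intro Max_in) auto
  have E'm: "v < m" if "v \<in> E'" for v
    using that Max_ge[OF Suc.prems(1), of v] by (auto simp: E'_def m_def le_less)
  have q': "q v < v \<and> q v \<in> ?V" if "v \<in> E'" for v
    using Suc.prems(2)[of v] that E'm[OF that] by (auto simp: E'_def)
  have a: "?a \<in> ?V" "?a \<noteq> m" using Suc.prems(2)[OF m] by (auto simp: E'_def)
  have fE: "finite E'" and EI: "E = insert m E'" "m \<notin> E'" using Suc.prems(1) m by (auto simp: E'_def)
  have m0: "m \<noteq> 0" using Suc.prems(2)[OF m] by simp
  have cE: "card E = Suc (card E')" using EI fE by simp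
  have IH: "gsum ?V E' q (\<lambda>v. v) (\<lambda>_. H) \<longlonglongrightarrow> c ^ card E'"
    by (rule Suc.hyps(1)) (use Suc.hyps(2) cE fE q' in auto)
  let ?P = "\<lambda>n \<phi>. \<Prod>e\<in>E'. H (grid n (\<phi> (q e)) (\<phi> e))"
  have cV: "card (insert 0 E) = Suc (card ?V)" using EI fE m0 by (subst EI(1), subst insert_commute) simp
  have full: "gsum (insert 0 E) E q (\<lambda>v. v) (\<lambda>_. H) n = (\<Sum>\<phi>\<in>PiE ?V (\<lambda>_. {1..n}). ?P n \<phi> * row_mean H n (\<phi> ?a)) / real n ^ card ?V"
    if n: "n \<ge> 1" for n
  proof -
    have "(\<Sum>\<phi>\<in>PiE (insert 0 E) (\<lambda>_. {1..n}). \<Prod>e\<in>E. H (grid n (\<phi> (q e)) (\<phi> e)))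
      = (\<Sum>\<phi>\<in>PiE (insert m ?V) (\<lambda>_. {1..n}). \<Prod>e\<in>E. H (grid n (\<phi> (q e)) (\<phi> e)))"
      using EI(1) by (simp add: insert_commute)
    also have "\<dots> = (\<Sum>l=1..n. \<Sum>\<phi>\<in>PiE ?V (\<lambda>_. {1..n}). \<Prod>e\<in>E. H (grid n ((\<phi>(m := l)) (q e)) ((\<phi>(m := l)) e)))"
      by (rule sum_PiE_insert) (use EI m0 in auto)
    also have "\<dots> = (\<Sum>l=1..n. \<Sum>\<phi>\<in>PiE ?V (\<lambda>_. {1..n}). H (grid n (\<phi> ?a) l) * ?P n \<phi>)"
    proof (intro sum.cong refl)
      fix l \<phi>
      have "(\<Prod>e\<in>E. H (grid n ((\<phi>(m := l)) (q e)) ((\<phi>(m := l)) e))) =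
        H (grid n ((\<phi>(m := l)) ?a) ((\<phi>(m := l)) m)) * (\<Prod>e\<in>E'. H (grid n ((\<phi>(m := l)) (q e)) ((\<phi>(m := l)) e)))"
        using EI fE by (subst EI(1)) simp
      also have "(\<Prod>e\<in>E'. H (grid n ((\<phi>(m := l)) (q e)) ((\<phi>(m := l)) e))) = ?P n \<phi>"
      proof (rule prod.cong[OF refl])
        fix e assume e: "e \<in> E'"
        have "e \<noteq> m" "q e \<noteq> m" using q'[OF e] E'm[OF e] by linarith+
        then show "H (grid n ((\<phi>(m := l)) (q e)) ((\<phi>(m := l)) e)) = H (grid n (\<phi> (q e)) (\<phi> e))" by simp
      qed
      finally show "(\<Prod>e\<in>E. H (grid n ((\<phi>(m := l)) (q e)) ((\<phi>(m := l)) e))) = H (grid n (\<phi> ?a) l) * ?P n \<phi>" using a by simp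
    qed
    also have "\<dots> = (\<Sum>\<phi>\<in>PiE ?V (\<lambda>_. {1..n}). \<Sum>l=1..n. H (grid n (\<phi> ?a) l) * ?P n \<phi>)" by (rule sum.swap)
    also have "\<dots> = (\<Sum>\<phi>\<in>PiE ?V (\<lambda>_. {1..n}). real n * (?P n \<phi> * row_mean H n (\<phi> ?a)))"
      using n by (intro sum.cong refl) (simp add: row_mean_def sum_distrib_right[symmetric])
    finally show ?thesis using n unfolding gsum_def cV by (simp add: sum_distrib_left[symmetric])
  qed
  have "(\<lambda>n. gsum (insert 0 E) E q (\<lambda>v. v) (\<lambda>_. H) n - c * gsum ?V E' q (\<lambda>v. v) (\<lambda>_. H) n) \<longlonglongrightarrow> 0"
  proof (rule Lim_null_comparison)
    show "\<forall>\<^sub>F n in sequentially. norm (gsum (insert 0 E) E q (\<lambda>v. v) (\<lambda>_. H) n - c * gsum ?V E' q (\<lambda>v. v) (\<lambda>_. H) n)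
      \<le> B ^ card E' * ((\<Sum>i=1..n. \<bar>row_mean H n i - c\<bar>) / real n)"
      using eventually_ge_at_top[of 1]
    proof eventually_elim
      case (elim n)
      let ?S = "PiE ?V (\<lambda>_. {1..n})"
      have "gsum (insert 0 E) E q (\<lambda>v. v) (\<lambda>_. H) n - c * gsum ?V E' q (\<lambda>v. v) (\<lambda>_. H) n
        = (\<Sum>\<phi>\<in>?S. ?P n \<phi> * (row_mean H n (\<phi> ?a) - c)) / real n ^ card ?V"
      proof -
        have "(\<Sum>\<phi>\<in>?S. ?P n \<phi> * (row_mean H n (\<phi> ?a) - c)) = (\<Sum>\<phi>\<in>?S. ?P n \<phi> * row_mean H n (\<phi> ?a)) - c * (\<Sum>\<phi>\<in>?S. ?P n \<phi>)"
          by (simp add: algebra_simps sum_subtractf sum_distrib_left)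
        then show ?thesis unfolding full[OF elim] unfolding gsum_def by (simp add: diff_divide_distrib)
      qed
      also have "norm \<dots> \<le> (\<Sum>\<phi>\<in>?S. B ^ card E' * \<bar>row_mean H n (\<phi> ?a) - c\<bar>) / real n ^ card ?V"
        unfolding real_norm_def abs_divide power_abs abs_of_nat
      proof (intro divide_right_mono order_trans[OF sum_abs sum_mono])
        fix \<phi> assume f: "\<phi> \<in> ?S"
        have "\<bar>?P n \<phi>\<bar> \<le> B ^ card E'"
        proof (rule prod_bound)
          fix e assume e: "e \<in> E'"
          have "\<phi> (q e) \<in> {1..n}" "\<phi> e \<in> {1..n}" using PiE_mem[OF f] q'[OF e] e by blast+
          then show "\<bar>H (grid n (\<phi> (q e)) (\<phi> e))\<bar> \<le> B" using elim by (intro B grid_in_unit) auto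
        qed
        then show "\<bar>?P n \<phi> * (row_mean H n (\<phi> ?a) - c)\<bar> \<le> B ^ card E' * \<bar>row_mean H n (\<phi> ?a) - c\<bar>"
          unfolding abs_mult by (rule mult_right_mono) simp
      qed simp
      also have "(\<Sum>\<phi>\<in>?S. B ^ card E' * \<bar>row_mean H n (\<phi> ?a) - c\<bar>) = B ^ card E' * (real n ^ (card ?V - 1) * (\<Sum>i=1..n. \<bar>row_mean H n i - c\<bar>))"
        using sum_PiE_one_marginal[of ?V ?a "{1..n}" "\<lambda>i. \<bar>row_mean H n i - c\<bar>"] fE a(1) by (simp add: sum_distrib_left[symmetric])
      also have "\<dots> / real n ^ card ?V = B ^ card E' * ((\<Sum>i=1..n. \<bar>row_mean H n i - c\<bar>) / real n)"
      proof -
        have "card ?V > 0" using fE by (subst card_gt_0_iff) auto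
        then have "card ?V = Suc (card ?V - 1)" by (simp only: Suc_diff_1)
        then have "real n ^ card ?V = real n * real n ^ (card ?V - 1)" by (metis power_Suc)
        then show ?thesis using elim by simp
      qed
      finally show ?case .
    qed
    have "(\<lambda>n. B ^ card E' * ((\<Sum>i=1..n. \<bar>row_mean H n i - c\<bar>) / real n)) \<longlonglongrightarrow> B ^ card E' * 0"
      by (intro tendsto_intros lim)
    then show "(\<lambda>n. B ^ card E' * ((\<Sum>i=1..n. \<bar>row_mean H n i - c\<bar>) / real n)) \<longlonglongrightarrow> 0" by simp
  qed
  from tendsto_add[OF this tendsto_mult_left[OF IH, of c]] show ?case using cE by simp
qed

context moment_array begin

text \<open>One edge function with vanishing grid mean is enough: the others are bounded by their
  sup norms, and the remaining vertices are averaged out.\<close>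

lemma lim_tree_sum_zero:
  assumes k: "k > 0" and p: "p \<in> tree_patterns k" and v: "v \<in> nonroots k p"
    and lim: "grid_mean (G (mult k p (disc p v) div 2)) \<longlonglongrightarrow> 0"
  shows "lim (tree_sum G k p) = 0"
proof -
  let ?V = "verts k p" and ?E = "nonroots k p"
  let ?r = "\<lambda>v. mult k p (disc p v) div 2"
  have pp: "p \<in> patterns k" using p by (simp add: tree_patterns_def)
  define C where "C = (\<Prod>w\<in>?E - {v}. M_seq G (2 * ?r w))"
  have V: "parent p v \<in> ?V" "v \<in> ?V" "parent p v \<noteq> v" using patternsD(8,9)[OF pp v] v by auto
  have le: "tree_sum G k p n \<le> C * grid_mean (G (?r v)) n" if n: "n \<ge> 1" for n
  proof -
    let ?S = "PiE ?V (\<lambda>_. {1..n})"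
    have "(\<Sum>\<phi>\<in>?S. \<Prod>w\<in>?E. tree_H G k p w (grid n (\<phi> (parent p w)) (\<phi> w))) \<le> (\<Sum>\<phi>\<in>?S. C * G (?r v) (grid n (\<phi> (parent p v)) (\<phi> v)))"
    proof (rule sum_mono)
      fix \<phi> assume f: "\<phi> \<in> ?S"
      have mem: "\<phi> (parent p w) \<in> {1..n}" "\<phi> w \<in> {1..n}" if "w \<in> ?E" for w
        using PiE_mem[OF f] patternsD(9)[OF pp that] that by blast+
      have nn: "tree_H G k p w (grid n (\<phi> (parent p w)) (\<phi> w)) \<ge> 0" if "w \<in> ?E" for w
        unfolding tree_H_def by (rule G_grid_nonneg[OF tree_patterns_half_mult(2)[OF p k that] mem[OF that]])
      have ub: "tree_H G k p w (grid n (\<phi> (parent p w)) (\<phi> w)) \<le> M_seq G (2 * ?r w)" if "w \<in> ?E" for w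
      proof -
        have "grid n (\<phi> (parent p w)) (\<phi> w) \<in> unit_square" using n by (intro grid_in_unit mem[OF that]) simp
        from M_seq_upper[OF tree_patterns_half_mult(2)[OF p k that] this] show ?thesis unfolding tree_H_def by linarith
      qed
      have "(\<Prod>w\<in>?E. tree_H G k p w (grid n (\<phi> (parent p w)) (\<phi> w))) =
        tree_H G k p v (grid n (\<phi> (parent p v)) (\<phi> v)) * (\<Prod>w\<in>?E - {v}. tree_H G k p w (grid n (\<phi> (parent p w)) (\<phi> w)))"
        by (rule prod.remove) (use v in auto)
      also have "\<dots> \<le> tree_H G k p v (grid n (\<phi> (parent p v)) (\<phi> v)) * C"
        unfolding C_def using nn ub by (intro mult_left_mono prod_mono nn[OF v]) blast
      finally show "(\<Prod>w\<in>?E. tree_H G k p w (grid n (\<phi> (parent p w)) (\<phi> w))) \<le> C * G (?r v) (grid n (\<phi> (parent p v)) (\<phi> v))"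
        by (simp only: tree_H_def mult.commute)
    qed
    also have "\<dots> = C * (real n ^ (card ?V - 2) * (\<Sum>i=1..n. \<Sum>j=1..n. G (?r v) (grid n i j)))"
      using sum_PiE_marginal[of ?V "parent p v" v "{1..n}" "\<lambda>i j. G (?r v) (grid n i j)"] V by (simp add: sum_distrib_left[symmetric])
    finally have "tree_sum G k p n \<le> C * (real n ^ (card ?V - 2) * (\<Sum>i=1..n. \<Sum>j=1..n. G (?r v) (grid n i j))) / real n ^ card ?V"
      unfolding tree_sum_def gsum_def by (intro divide_right_mono) auto
    also have "\<dots> = C * grid_mean (G (?r v)) n"
    proof -
      have "card {parent p v, v} \<le> card ?V" by (rule card_mono) (use V in auto)
      then have "card ?V = card ?V - 2 + 2" using V(3) by simp
      then have "real n ^ card ?V = real n ^ (card ?V - 2) * (real n)\<^sup>2" by (metis power_add)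
      then show ?thesis using n by (simp add: grid_mean_def)
    qed
    finally show ?thesis .
  qed
  have "tree_sum G k p \<longlonglongrightarrow> 0"
  proof (rule tendsto_sandwich[of "\<lambda>_. 0" _ _ "\<lambda>n. C * grid_mean (G (?r v)) n"])
    show "\<forall>\<^sub>F n in sequentially. tree_sum G k p n \<le> C * grid_mean (G (?r v)) n"
      using eventually_ge_at_top[of 1] by eventually_elim (rule le)
    have "(\<lambda>n. C * grid_mean (G (?r v)) n) \<longlonglongrightarrow> C * 0" by (intro tendsto_intros lim)
    then show "(\<lambda>n. C * grid_mean (G (?r v)) n) \<longlonglongrightarrow> 0" by simp
  qed (use tree_sum_nonneg[OF k p] in auto)
  then show ?thesis by (rule limI)
qed

lemma lim_tree_sum_double:
  assumes k: "k > 0" and p: "p \<in> double_trees k"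
    and lim: "(\<lambda>n. (\<Sum>i=1..n. \<bar>row_mean (G 1) n i - c\<bar>) / real n) \<longlonglongrightarrow> 0"
  shows "lim (tree_sum G k p) = c ^ card (nonroots k p)"
proof -
  have pp: "p \<in> patterns k" and m2: "\<And>v. v \<in> nonroots k p \<Longrightarrow> mult k p (disc p v) = 2" using p by (auto simp: double_trees_def)
  have V: "insert 0 (nonroots k p) = verts k p" using zero_in_verts(1)[OF pp k] by blast
  have "gsum (insert 0 (nonroots k p)) (nonroots k p) (parent p) (\<lambda>v. v) (\<lambda>_. G 1) \<longlonglongrightarrow> c ^ card (nonroots k p)"
  proof (rule gsum_row_regular[OF _ _ _ lim])
    show "finite (nonroots k p)" by simp
    show "bounded (G 1 ` unit_square)" by (rule G_bounded) simp
    show "parent p v < v \<and> parent p v \<in> insert 0 (nonroots k p)" if "v \<in> nonroots k p" for v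
      unfolding V using patternsD(8,9)[OF pp that] by blast
  qed
  also have "gsum (insert 0 (nonroots k p)) (nonroots k p) (parent p) (\<lambda>v. v) (\<lambda>_. G 1) = tree_sum G k p"
    unfolding tree_sum_def V gsum_def
  proof (intro ext arg_cong2[of _ _ _ _ "(/)"] sum.cong prod.cong refl)
    fix n \<phi> v assume "v \<in> nonroots k p"
    from m2[OF this] have "mult k p (disc p v) div 2 = 1" by (simp only:)
    then show "G 1 (grid n (\<phi> (parent p v)) (\<phi> v)) = tree_H G k p v (grid n (\<phi> (parent p v)) (\<phi> v))"
      by (simp only: tree_H_def)
  qed
  finally show ?thesis by (rule limI)
qed

text \<open>A tree with an edge crossed more than twice carries some \<open>G r\<close> with
  \<open>r > 1\<close> and drops out. A tree with all edges crossed twice has \<open>k / 2\<close>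
  of them, each contributing \<open>c\<close>; hence \<open>s = sqrt c\<close>.\<close>

lemma beta_semicircle:
  assumes "semicircle_condition G"
  shows "\<exists>s>0. \<forall>k. beta G k = s ^ k * real (dyck_count k 0)"
proof -
  obtain c where c: "c > 0" "AE u in lborel. u \<in> {0..1} \<longrightarrow> ((\<lambda>v. G 1 (u, v)) has_integral c) {0..1}"
    and z: "\<And>r. r > 1 \<Longrightarrow> AE q in lborel. q \<in> unit_square \<longrightarrow> G r q = 0"
    using assms unfolding semicircle_condition_def by blast
  have row: "(\<lambda>n. (\<Sum>i=1..n. \<bar>row_mean (G 1) n i - c\<bar>) / real n) \<longlonglongrightarrow> 0"
    using has_integral_section_iff_row_mean[OF G_bounded[of 1] G_osc[of 1], of c] c(2) by simp
  have gm: "grid_mean (G r) \<longlonglongrightarrow> 0" if r: "r > 1" for r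
  proof -
    have "(\<lambda>N. (\<Sum>i=1..N. \<Sum>j=1..N. \<bar>G r (grid N i j)\<bar>) / (real N)\<^sup>2) \<longlonglongrightarrow> 0"
      using AE_zero_iff_grid_mean[OF G_bounded[of r] G_osc[of r]] z[OF r] r by simp
    also have "(\<lambda>N. (\<Sum>i=1..N. \<Sum>j=1..N. \<bar>G r (grid N i j)\<bar>) / (real N)\<^sup>2) = grid_mean (G r)"
    proof
      fix N
      have "\<bar>G r (grid N i j)\<bar> = G r (grid N i j)" if "i \<in> {1..N}" "j \<in> {1..N}" for i j
        using G_grid_nonneg[OF _ that, of r] r by simp
      then show "(\<Sum>i=1..N. \<Sum>j=1..N. \<bar>G r (grid N i j)\<bar>) / (real N)\<^sup>2 = grid_mean (G r) N"
        unfolding grid_mean_def by simp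
    qed
    finally show ?thesis .
  qed
  have "beta G k = sqrt c ^ k * dyck_count k 0" for k
  proof (cases "k = 0")
    case True
    then show ?thesis by (simp add: beta_def dyck_count_0)
  next
    case False
    then have k: "k > 0" by simp
    have sub: "double_trees k \<subseteq> tree_patterns k" by (auto simp: double_trees_def tree_patterns_def)
    have "beta G k = (\<Sum>p\<in>tree_patterns k. lim (tree_sum G k p))" using k by (simp add: beta_def)
    also have "\<dots> = (\<Sum>p\<in>double_trees k. lim (tree_sum G k p))"
    proof (rule sum.mono_neutral_right[OF _ sub], simp, rule ballI)
      fix p assume p: "p \<in> tree_patterns k - double_trees k"
      then have pt: "p \<in> tree_patterns k" by simp
      obtain v where v: "v \<in> nonroots k p" "mult k p (disc p v) \<noteq> 2"
        using p unfolding double_trees_def tree_patterns_def by blast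
      have "mult k p (disc p v) div 2 > 1" using tree_patterns_half_mult[OF pt k v(1)] v(2) by linarith
      then show "lim (tree_sum G k p) = 0" by (intro lim_tree_sum_zero[OF k pt v(1)] gm)
    qed
    also have "\<dots> = (\<Sum>p\<in>double_trees k. sqrt c ^ k)"
    proof (rule sum.cong[OF refl])
      fix p assume p: "p \<in> double_trees k"
      have "sqrt c ^ k = sqrt c ^ (2 * card (nonroots k p))" using card_nonroots_double_tree[OF p] by simp
      then show "lim (tree_sum G k p) = sqrt c ^ k" using c(1) by (simp only: lim_tree_sum_double[OF k p row] power_mult real_sqrt_pow2 less_imp_le)
    qed
    finally show ?thesis by (simp add: card_double_trees[OF k])
  qed
  then show ?thesis using c(1) by (intro exI[of _ "sqrt c"]) simp
qed

end

lemma scaled_semicircle: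
  assumes s: "s > 0"
  defines "\<mu> \<equiv> distr std_semicircle borel (\<lambda>u. s * u)"
  shows "real_distribution \<mu>" "integrable \<mu> (\<lambda>u. u ^ k)" "(\<integral>u. u ^ k \<partial>\<mu>) = s ^ k * dyck_count k 0"
proof -
  interpret S: real_distribution std_semicircle by (rule real_distribution_std_semicircle)
  have m: "(\<lambda>u. s * u) \<in> measurable std_semicircle borel" by simp
  show "real_distribution \<mu>" unfolding \<mu>_def by (intro S.real_distribution_distr m)
  show "integrable \<mu> (\<lambda>u. u ^ k)" unfolding \<mu>_def using moments_std_semicircle(1)[of k]
    by (subst integrable_distr_eq[OF m]) (auto simp: power_mult_distrib)
  show "(\<integral>u. u ^ k \<partial>\<mu>) = s ^ k * dyck_count k 0" unfolding \<mu>_def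
    by (subst integral_distr[OF m]) (auto simp: power_mult_distrib moments_std_semicircle(2))
qed

section \<open>Tree patterns with two and four steps\<close>

definition pattern_of :: "nat list \<Rightarrow> nat \<Rightarrow> nat" where
  "pattern_of xs = (\<lambda>s\<in>{..<length xs}. xs ! s)"

lemma treelike_2: "treelike 2 w \<longleftrightarrow> (\<exists>v\<in>nonroots 2 w. ed (w 0) (w 1) = disc w v) \<and> (\<exists>v\<in>nonroots 2 w. ed (w 1) (w 0) = disc w v)"
proof -
  have "(\<forall>s<2. P s) \<longleftrightarrow> P 0 \<and> P 1" for P :: "nat \<Rightarrow> bool" by (auto simp: less_2_cases_iff)
  moreover have "Suc 1 mod 2 = 0" "Suc 0 mod 2 = 1" by simp_all
  ultimately show ?thesis unfolding treelike_def step_def by (simp only:)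
qed

lemma less_4_cases: "(s::nat) < 4 \<longleftrightarrow> s = 0 \<or> s = 1 \<or> s = 2 \<or> s = 3" by auto

lemma Suc_mod_4: "Suc 0 mod 4 = 1" "Suc 1 mod 4 = 2" "Suc 2 mod 4 = 3" "Suc 3 mod 4 = 0" by simp_all

lemma treelike_4: "treelike 4 w \<longleftrightarrow>
  (\<exists>v\<in>nonroots 4 w. ed (w 0) (w 1) = disc w v) \<and> (\<exists>v\<in>nonroots 4 w. ed (w 1) (w 2) = disc w v) \<and>
  (\<exists>v\<in>nonroots 4 w. ed (w 2) (w 3) = disc w v) \<and> (\<exists>v\<in>nonroots 4 w. ed (w 3) (w 0) = disc w v)"
proof -
  have "(\<forall>s<4. P s) \<longleftrightarrow> P 0 \<and> P 1 \<and> P 2 \<and> P 3" for P :: "nat \<Rightarrow> bool" by (auto simp: less_4_cases)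
  then show ?thesis unfolding treelike_def step_def by (simp only: Suc_mod_4)
qed

lemma mult_eq_sum: "mult k w e = (\<Sum>s<k. of_bool (step k w s = e))"
proof -
  have "mult k w e = card {s \<in> {..<k}. step k w s = e}" by (simp add: mult_def)
  also have "\<dots> = (\<Sum>s<k. of_bool (step k w s = e))" by (simp add: Int_def)
  finally show ?thesis .
qed

lemma mult_2: "mult 2 w e = of_bool (ed (w 0) (w 1) = e) + of_bool (ed (w 1) (w 0) = e)"
proof -
  have "{..<2} = {0, 1::nat}" by auto
  then show ?thesis unfolding mult_eq_sum step_def by simp
qed

lemma mult_4: "mult 4 w e = of_bool (ed (w 0) (w 1) = e) + of_bool (ed (w 1) (w 2) = e)
  + of_bool (ed (w 2) (w 3) = e) + of_bool (ed (w 3) (w 0) = e)"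
proof -
  have "{..<4} = {0, 1, 2, 3::nat}" by auto
  then have "sum f {..<4} = f 0 + f 1 + f 2 + f 3" for f :: "nat \<Rightarrow> nat" by simp
  then show ?thesis unfolding mult_eq_sum step_def by (simp only: Suc_mod_4)
qed

lemma pt_nth:
  "pattern_of [a,b] 0 = a" "pattern_of [a,b] 1 = b"
  "pattern_of [a,b,c,d] 0 = a" "pattern_of [a,b,c,d] 1 = b" "pattern_of [a,b,c,d] 2 = c" "pattern_of [a,b,c,d] 3 = d"
  by (simp_all add: pattern_of_def)

lemmas pt_eval = pattern_of_def numeral_eq_Suc lessThan_Suc All_less_Suc

lemma disc_pt:
  "disc (pattern_of [0,1]) 1 = (0,1)" "disc (pattern_of [0,1,0,1]) 1 = (0,1)" "disc (pattern_of [0,1,0,3]) 1 = (0,1)"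
  "disc (pattern_of [0,1,0,3]) 3 = (0,3)" "disc (pattern_of [0,1,2,1]) 1 = (0,1)" "disc (pattern_of [0,1,2,1]) 2 = (1,2)"
  by (simp_all add: pattern_of_def ed_def)

lemma verts_pt:
  "verts 2 (pattern_of [0,1]) = {0,1}" "verts 4 (pattern_of [0,1,0,1]) = {0,1}"
  "verts 4 (pattern_of [0,1,0,3]) = {0,1,3}" "verts 4 (pattern_of [0,1,2,1]) = {0,1,2}"
  by (auto simp: pt_eval)

lemma patterns_pt:
  "pattern_of [0,1] \<in> patterns 2" "pattern_of [0,1,0,1] \<in> patterns 4"
  "pattern_of [0,1,0,3] \<in> patterns 4" "pattern_of [0,1,2,1] \<in> patterns 4"
  by (auto simp: patterns_def pt_eval)

lemma treelike_pt:
  "treelike 2 (pattern_of [0,1])" "treelike 4 (pattern_of [0,1,0,1])"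
  "treelike 4 (pattern_of [0,1,0,3])" "treelike 4 (pattern_of [0,1,2,1])"
proof -
  have bex: "(\<exists>v\<in>{0,1} - {0::nat}. P v) \<longleftrightarrow> P 1" "(\<exists>v\<in>{0,1,3} - {0::nat}. P v) \<longleftrightarrow> P 1 \<or> P 3"
    "(\<exists>v\<in>{0,1,2} - {0::nat}. P v) \<longleftrightarrow> P 1 \<or> P 2" for P by auto
  have e: "ed 0 1 = (0,1)" "ed 1 0 = (0,1)" "ed 0 3 = (0,3)" "ed 3 0 = (0,3)" "ed 1 2 = (1,2)" "ed 2 1 = (1,2)"
    by (simp_all add: ed_def)
  show "treelike 2 (pattern_of [0,1])" "treelike 4 (pattern_of [0,1,0,1])" "treelike 4 (pattern_of [0,1,0,3])" "treelike 4 (pattern_of [0,1,2,1])"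
    unfolding treelike_2 treelike_4 verts_pt bex disc_pt pt_nth e by (simp_all only: simp_thms)
qed

lemma tree_patterns_pt:
  "pattern_of [0,1] \<in> tree_patterns 2" "pattern_of [0,1,0,1] \<in> tree_patterns 4"
  "pattern_of [0,1,0,3] \<in> tree_patterns 4" "pattern_of [0,1,2,1] \<in> tree_patterns 4"
  by (simp_all only: tree_patterns_def mem_Collect_eq patterns_pt treelike_pt simp_thms)

lemma tree_patterns_2: "tree_patterns 2 = {pattern_of [0,1]}"
proof
  show "tree_patterns 2 \<subseteq> {pattern_of [0,1]}"
  proof
    fix p assume "p \<in> tree_patterns 2"
    then have p: "p \<in> patterns 2" and t: "treelike 2 p" by (auto simp: tree_patterns_def)
    have p0: "p 0 = 0" using patternsD(1)[OF p, of 0] by simp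
    have p1: "p 1 = 1"
    proof (rule ccontr)
      assume "p 1 \<noteq> 1"
      then have "p 1 = 0" using patternsD(1)[OF p, of 1] by simp
      then have "verts 2 p = {0}" using p0 by (auto simp: numeral_eq_Suc lessThan_Suc)
      moreover have "\<exists>v\<in>nonroots 2 p. step 2 p 0 = disc p v" using t unfolding treelike_def by simp
      ultimately show False by simp
    qed
    have "p s = pattern_of [0,1] s" for s
    proof -
      consider "s = 0" | "s = 1" | "s \<ge> 2" by linarith
      then show ?thesis
      proof cases
        case 3
        then have "p s = undefined" using p by (auto simp: patterns_def PiE_def extensional_def)
        then show ?thesis using 3 by (simp add: pattern_of_def)
      qed (use p0 p1 in \<open>simp_all add: pattern_of_def\<close>)
    qed
    then show "p \<in> {pattern_of [0,1]}" by auto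
  qed
qed (use tree_patterns_pt(1) in simp)

text \<open>In order: one edge crossed twice, one edge crossed four times, two edges at the root,
  and a path of two edges that starts at the root.\<close>

lemma tree_sum_pt:
  "tree_sum G 2 (pattern_of [0,1]) n = (\<Sum>a=1..n. \<Sum>b=1..n. G 1 (grid n a b)) / real n ^ 2"
  "tree_sum G 4 (pattern_of [0,1,0,1]) n = (\<Sum>a=1..n. \<Sum>b=1..n. G 2 (grid n a b)) / real n ^ 2"
  "tree_sum G 4 (pattern_of [0,1,0,3]) n = (\<Sum>a=1..n. \<Sum>b=1..n. \<Sum>c=1..n. G 1 (grid n a b) * G 1 (grid n a c)) / real n ^ 3"
  "tree_sum G 4 (pattern_of [0,1,2,1]) n = (\<Sum>a=1..n. \<Sum>b=1..n. \<Sum>c=1..n. G 1 (grid n a b) * G 1 (grid n b c)) / real n ^ 3"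
proof -
  have par: "pattern_of [0,1] (1 - 1) = 0" "pattern_of [0,1,0,1] (1 - 1) = 0" "pattern_of [0,1,0,3] (1 - 1) = 0" "pattern_of [0,1,0,3] (3 - 1) = 0"
    "pattern_of [0,1,2,1] (1 - 1) = 0" "pattern_of [0,1,2,1] (2 - 1) = 1"
    by (simp_all add: pattern_of_def)
  have m: "mult 2 (pattern_of [0,1]) (ed 0 1) div 2 = 1" "mult 4 (pattern_of [0,1,0,1]) (ed 0 1) div 2 = 2"
    "mult 4 (pattern_of [0,1,0,3]) (ed 0 1) div 2 = 1" "mult 4 (pattern_of [0,1,0,3]) (ed 0 3) div 2 = 1"
    "mult 4 (pattern_of [0,1,2,1]) (ed 0 1) div 2 = 1" "mult 4 (pattern_of [0,1,2,1]) (ed 1 2) div 2 = 1"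
    unfolding mult_2 mult_4 pt_nth by (simp_all add: ed_def)
  have diff: "{0,1} - {0} = {1::nat}" "{0,1,3} - {0} = {1,3::nat}" "{0,1,2} - {0} = {1,2::nat}" by auto
  note ev = tree_sum_def gsum_def verts_pt diff tree_H_def
  have two: "(\<Sum>\<phi>\<in>PiE {0,1::nat} (\<lambda>_. {1..n}). F (\<phi> 0) (\<phi> 1)) = (\<Sum>a=1..n. \<Sum>b=1..n. F a b)" for F :: "nat \<Rightarrow> nat \<Rightarrow> real"
    by (simp add: sum_PiE_insert)
  have three: "(\<Sum>\<phi>\<in>PiE {0,1,v} (\<lambda>_. {1..n}). F (\<phi> 0) (\<phi> 1) (\<phi> v)) = (\<Sum>a=1..n. \<Sum>b=1..n. \<Sum>c=1..n. F a b c)"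
    if "v > 1" for F :: "nat \<Rightarrow> nat \<Rightarrow> nat \<Rightarrow> real" and v :: nat
    using that by (simp add: sum_PiE_insert)
  have card: "card {0,1::nat} = 2" "card {0,1,3::nat} = 3" "card {0,1,2::nat} = 3" by simp_all
  have pr1: "prod f {1::nat} = f 1" and pr2: "prod f {1,3::nat} = f 1 * f 3" and pr3: "prod f {1,2::nat} = f 1 * f 2" for f :: "nat \<Rightarrow> real" by simp_all
  show "tree_sum G 2 (pattern_of [0,1]) n = (\<Sum>a=1..n. \<Sum>b=1..n. G 1 (grid n a b)) / real n ^ 2"
    "tree_sum G 4 (pattern_of [0,1,0,1]) n = (\<Sum>a=1..n. \<Sum>b=1..n. G 2 (grid n a b)) / real n ^ 2"
    unfolding ev card pr1 par m using two[of "\<lambda>a b. G 1 (grid n a b)"] two[of "\<lambda>a b. G 2 (grid n a b)"] by (simp_all only:)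
  show "tree_sum G 4 (pattern_of [0,1,0,3]) n = (\<Sum>a=1..n. \<Sum>b=1..n. \<Sum>c=1..n. G 1 (grid n a b) * G 1 (grid n a c)) / real n ^ 3"
    unfolding ev card pr2 par m using three[of 3 "\<lambda>a b c. G 1 (grid n a b) * G 1 (grid n a c)"] by simp
  show "tree_sum G 4 (pattern_of [0,1,2,1]) n = (\<Sum>a=1..n. \<Sum>b=1..n. \<Sum>c=1..n. G 1 (grid n a b) * G 1 (grid n b c)) / real n ^ 3"
    unfolding ev card pr3 par m using three[of 2 "\<lambda>a b c. G 1 (grid n a b) * G 1 (grid n b c)"] by simp
qed

lemma dyck_count_small: "dyck_count 2 0 = 1" "dyck_count 4 0 = 2"
  by (simp_all add: numeral_eq_Suc dyck_count_Suc dyck_count_0)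

context moment_array begin

text \<open>Both trees with two edges are stars, centred at the root and at its child respectively;
  the symmetry of \<open>G 1\<close> at grid points makes their sums equal.\<close>

lemma tree_sum_pt_row_mean:
  assumes n: "n \<ge> 1"
  shows "tree_sum G 2 (pattern_of [0,1]) n = (\<Sum>i=1..n. row_mean (G 1) n i) / real n"
    "tree_sum G 4 (pattern_of [0,1,0,3]) n = (\<Sum>i=1..n. (row_mean (G 1) n i)\<^sup>2) / real n"
    "tree_sum G 4 (pattern_of [0,1,2,1]) n = (\<Sum>i=1..n. (row_mean (G 1) n i)\<^sup>2) / real n"
proof -
  let ?s = "\<lambda>i. \<Sum>j=1..n. G 1 (grid n i j)"
  have r: "(\<Sum>i=1..n. (row_mean (G 1) n i)\<^sup>2) / real n = (\<Sum>i=1..n. ?s i * ?s i) / real n ^ 3"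
    by (simp add: row_mean_def power_divide sum_divide_distrib[symmetric] power2_eq_square power3_eq_cube)
  show "tree_sum G 2 (pattern_of [0,1]) n = (\<Sum>i=1..n. row_mean (G 1) n i) / real n"
    unfolding tree_sum_pt by (simp add: row_mean_def sum_divide_distrib[symmetric] power2_eq_square)
  show "tree_sum G 4 (pattern_of [0,1,0,3]) n = (\<Sum>i=1..n. (row_mean (G 1) n i)\<^sup>2) / real n"
    unfolding tree_sum_pt r by (simp add: sum_product)
  have "(\<Sum>a=1..n. \<Sum>b=1..n. \<Sum>c=1..n. G 1 (grid n a b) * G 1 (grid n b c)) = (\<Sum>b=1..n. \<Sum>a=1..n. \<Sum>c=1..n. G 1 (grid n b a) * G 1 (grid n b c))"
    by (subst sum.swap) (intro sum.cong refl arg_cong2[of _ _ _ _ "(*)"] G_grid_sym order.refl, auto)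
  also have "\<dots> = (\<Sum>i=1..n. ?s i * ?s i)" by (simp add: sum_product)
  finally show "tree_sum G 4 (pattern_of [0,1,2,1]) n = (\<Sum>i=1..n. (row_mean (G 1) n i)\<^sup>2) / real n"
    unfolding tree_sum_pt r by simp
qed

text \<open>The moment inequality passes to the limit at each grid point and gives
  \<open>2 * G r \<le> L * G 2 + B / L\<close>; here \<open>L\<close> is taken large first, and then
  \<open>n\<close>.\<close>

lemma grid_mean_dominated:
  assumes amgm: "\<And>n i j L. i \<in> {1..n} \<Longrightarrow> j \<in> {1..n} \<Longrightarrow> L > 0 \<Longrightarrow>
      2 * m n (ed i j) (2 * r) \<le> L * m n (ed i j) (2 * 2) + m n (ed i j) (2 * (2 * r - 2)) / L"
    and lim: "grid_mean (G 2) \<longlonglongrightarrow> 0" and r: "r \<ge> 2"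
  shows "grid_mean (G r) \<longlonglongrightarrow> 0"
proof (rule LIMSEQ_I)
  fix e :: real assume e: "e > 0"
  let ?q = "2 * r - 2"
  have q: "?q \<ge> 1" "r \<ge> 1" using r by auto
  define B where "B = M_seq G (2 * ?q)"
  have B: "B \<ge> 0" unfolding B_def by (rule M_seq_nonneg) (use q in simp)
  \<comment> \<open>Large enough for \<open>B / L \<le> e / 2\<close>.\<close>
  define L where "L = 2 * B / e + 1"
  have L: "L > 0" using B e by (simp add: L_def add_nonneg_pos)
  have BL: "B / L \<le> e / 2" using B e L unfolding L_def by (simp add: field_simps)
  have pw: "2 * G r (grid n i j) \<le> L * G 2 (grid n i j) + B / L" if ij: "i \<in> {1..n}" "j \<in> {1..n}" for n i j
  proof -
    let ?N = "\<lambda>l. n * Suc l" and ?e = "\<lambda>l. ed (i * Suc l) (j * Suc l)"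
    have "2 * G r (grid n i j) \<le> L * G 2 (grid n i j) + G ?q (grid n i j) / L"
    proof (rule LIMSEQ_le)
      show "(\<lambda>l. 2 * (real (?N l) * m (?N l) (?e l) (2 * r))) \<longlonglongrightarrow> 2 * G r (grid n i j)"
        by (intro tendsto_intros G_grid_LIMSEQ q ij)
      show "(\<lambda>l. L * (real (?N l) * m (?N l) (?e l) (2 * 2)) + (real (?N l) * m (?N l) (?e l) (2 * ?q)) / L) \<longlonglongrightarrow> L * G 2 (grid n i j) + G ?q (grid n i j) / L"
        using L by (intro tendsto_intros G_grid_LIMSEQ q ij) auto
      have "2 * (real (?N l) * m (?N l) (?e l) (2 * r)) \<le> L * (real (?N l) * m (?N l) (?e l) (2 * 2)) + (real (?N l) * m (?N l) (?e l) (2 * ?q)) / L" for l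
      proof -
        have "real (?N l) * (2 * m (?N l) (?e l) (2 * r)) \<le> real (?N l) * (L * m (?N l) (?e l) (2 * 2) + m (?N l) (?e l) (2 * ?q) / L)"
          by (rule mult_left_mono[OF amgm[OF scaled_grid[OF ij(1)] scaled_grid[OF ij(2)] L]]) (rule of_nat_0_le_iff)
        then show ?thesis by (simp only: distrib_left mult.left_commute times_divide_eq_right)
      qed
      then show "\<exists>N. \<forall>l\<ge>N. 2 * (real (?N l) * m (?N l) (?e l) (2 * r)) \<le> L * (real (?N l) * m (?N l) (?e l) (2 * 2)) + (real (?N l) * m (?N l) (?e l) (2 * ?q)) / L"
        by blast
    qed
    moreover have "grid n i j \<in> unit_square" using ij by (intro grid_in_unit) auto
    then have "G ?q (grid n i j) \<le> B" using M_seq_upper[OF q(1)] unfolding B_def by (meson abs_le_D1)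
    then have "G ?q (grid n i j) / L \<le> B / L" using L by (intro divide_right_mono) auto
    ultimately show ?thesis by linarith
  qed
  have le: "2 * grid_mean (G r) n \<le> L * grid_mean (G 2) n + B / L" if n: "n \<ge> 1" for n
  proof -
    have "(\<Sum>i=1..n. \<Sum>j=1..n. 2 * G r (grid n i j)) \<le> (\<Sum>i=1..n. \<Sum>j=1..n. L * G 2 (grid n i j) + B / L)"
      by (intro sum_mono pw)
    also have "\<dots> = L * (\<Sum>i=1..n. \<Sum>j=1..n. G 2 (grid n i j)) + (real n)\<^sup>2 * (B / L)"
      by (simp add: sum.distrib sum_distrib_left power2_eq_square mult.assoc)
    finally have "2 * (\<Sum>i=1..n. \<Sum>j=1..n. G r (grid n i j)) \<le> L * (\<Sum>i=1..n. \<Sum>j=1..n. G 2 (grid n i j)) + (real n)\<^sup>2 * (B / L)"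
      by (simp only: sum_distrib_left)
    then have "2 * (\<Sum>i=1..n. \<Sum>j=1..n. G r (grid n i j)) / (real n)\<^sup>2 \<le> (L * (\<Sum>i=1..n. \<Sum>j=1..n. G 2 (grid n i j)) + (real n)\<^sup>2 * (B / L)) / (real n)\<^sup>2"
      by (rule divide_right_mono) simp
    also have "\<dots> = L * grid_mean (G 2) n + B / L" using n by (simp add: grid_mean_def add_divide_distrib)
    finally show ?thesis by (simp add: grid_mean_def)
  qed
  have "(\<lambda>n. L * grid_mean (G 2) n) \<longlonglongrightarrow> L * 0" by (intro tendsto_intros lim)
  then have "\<forall>\<^sub>F n in sequentially. L * grid_mean (G 2) n < e" by (rule order_tendstoD) (use e in simp)
  then have "\<forall>\<^sub>F n in sequentially. norm (grid_mean (G r) n - 0) < e"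
    using eventually_ge_at_top[of 1]
  proof eventually_elim
    case (elim n)
    have "grid_mean (G r) n \<ge> 0" unfolding grid_mean_def by (intro divide_nonneg_nonneg sum_nonneg G_grid_nonneg[OF q(2)]) auto
    moreover have "2 * grid_mean (G r) n < 2 * e" using le[OF elim(2)] BL elim(1) e by linarith
    ultimately show ?case by simp
  qed
  then show "\<exists>no. \<forall>n\<ge>no. norm (grid_mean (G r) n - 0) < e" by (simp add: eventually_sequentially)
qed

text \<open>In the limit the two stars with four steps both contribute the mean square of the row
  means of \<open>G 1\<close>, whose mean is \<open>s\<^sup>2\<close>. The value of
  \<open>beta G 4\<close> then leaves room neither for a variance of the row means nor for the mean
  of \<open>G 2\<close>, the contribution of the single edge.\<close>

lemma semicircle_conditionI:
  assumes amgm: "\<And>n i j r L. i \<in> {1..n} \<Longrightarrow> j \<in> {1..n} \<Longrightarrow> r \<ge> 2 \<Longrightarrow> L > 0 \<Longrightarrow>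
      2 * m n (ed i j) (2 * r) \<le> L * m n (ed i j) (2 * 2) + m n (ed i j) (2 * (2 * r - 2)) / L"
    and s: "s > 0" and b2: "beta G 2 = s\<^sup>2" and b4: "beta G 4 = 2 * (s\<^sup>2)\<^sup>2"
  shows "semicircle_condition G"
proof -
  let ?R = "row_mean (G 1)" and ?T = "tree_sum G 4"
  let ?a = "pattern_of [0,1,0,1]" and ?b = "pattern_of [0,1,0,3]" and ?c = "pattern_of [0,1,2,1]"
  note lims = tree_sum_LIMSEQ[of 4, OF _ tree_patterns_pt(2)] tree_sum_LIMSEQ[of 4, OF _ tree_patterns_pt(3)] tree_sum_LIMSEQ[of 4, OF _ tree_patterns_pt(4)]
  have "lim (tree_sum G 2 (pattern_of [0,1])) = s\<^sup>2" using b2 by (simp add: beta_def tree_patterns_2)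
  then have l1: "tree_sum G 2 (pattern_of [0,1]) \<longlonglongrightarrow> s\<^sup>2" using tree_sum_LIMSEQ[OF _ tree_patterns_pt(1)] by simp
  have distinct: "?a \<noteq> ?b" "?a \<noteq> ?c" "?b \<noteq> ?c"
  proof -
    have "?a 3 = 1" "?b 3 = 3" "?c 3 = 1" "?a 2 = 0" "?c 2 = 2" by (simp_all add: pattern_of_def)
    then show "?a \<noteq> ?b" "?a \<noteq> ?c" "?b \<noteq> ?c" by auto
  qed
  have bc: "lim (?T ?b) = lim (?T ?c)"
  proof -
    have "\<forall>\<^sub>F n in sequentially. ?T ?b n = ?T ?c n"
      using eventually_ge_at_top[of 1] by eventually_elim (simp only: tree_sum_pt_row_mean)
    from Lim_transform_eventually[OF lims(2) this] have "?T ?c \<longlonglongrightarrow> lim (?T ?b)" by simp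
    from LIMSEQ_unique[OF this lims(3)] show ?thesis by simp
  qed
  have "lim (?T ?a) + (lim (?T ?b) + lim (?T ?c)) = (\<Sum>p\<in>{?a, ?b, ?c}. lim (?T p))" using distinct by simp
  \<comment> \<open>Any further tree pattern contributes a nonnegative term.\<close>
  also have "\<dots> \<le> (\<Sum>p\<in>tree_patterns 4. lim (?T p))"
    by (rule sum_mono2) (use tree_patterns_pt(2-4) lim_tree_sum_nonneg[of 4] in auto)
  also have "\<dots> = 2 * (s\<^sup>2)\<^sup>2" using b4 by (simp add: beta_def)
  finally have sum: "lim (?T ?a) + 2 * lim (?T ?b) \<le> 2 * (s\<^sup>2)\<^sup>2" using bc by simp
  \<comment> \<open>The mean square deviation of the row means from
    \<open>s\<^sup>2\<close>.\<close>
  let ?V = "\<lambda>n. (\<Sum>i=1..n. (?R n i - s\<^sup>2)\<^sup>2) / real n"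
  have "(\<lambda>n. ?T ?b n - 2 * s\<^sup>2 * tree_sum G 2 (pattern_of [0,1]) n + (s\<^sup>2)\<^sup>2) \<longlonglongrightarrow> lim (?T ?b) - 2 * s\<^sup>2 * s\<^sup>2 + (s\<^sup>2)\<^sup>2"
    by (intro tendsto_intros l1 lims) simp
  moreover have "\<forall>\<^sub>F n in sequentially. ?T ?b n - 2 * s\<^sup>2 * tree_sum G 2 (pattern_of [0,1]) n + (s\<^sup>2)\<^sup>2 = ?V n"
    using eventually_ge_at_top[of 1]
  proof eventually_elim
    case (elim n)
    have "(\<Sum>i=1..n. (?R n i - s\<^sup>2)\<^sup>2) = (\<Sum>i=1..n. (?R n i)\<^sup>2) - 2 * s\<^sup>2 * (\<Sum>i=1..n. ?R n i) + real n * (s\<^sup>2)\<^sup>2"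
      by (simp add: power2_diff sum.distrib sum_subtractf sum_distrib_left algebra_simps)
    then show ?case unfolding tree_sum_pt_row_mean[OF elim] using elim by (simp add: add_divide_distrib diff_divide_distrib)
  qed
  ultimately have V: "?V \<longlonglongrightarrow> lim (?T ?b) - 2 * s\<^sup>2 * s\<^sup>2 + (s\<^sup>2)\<^sup>2" by (rule Lim_transform_eventually)
  have "lim (?T ?b) - 2 * s\<^sup>2 * s\<^sup>2 + (s\<^sup>2)\<^sup>2 \<ge> 0"
    by (rule LIMSEQ_le_const[OF V]) (auto intro!: divide_nonneg_nonneg sum_nonneg)
  then have Q: "lim (?T ?b) \<ge> (s\<^sup>2)\<^sup>2" by (simp add: power2_eq_square)
  have a0: "lim (?T ?a) \<ge> 0" by (rule lim_tree_sum_nonneg) (use tree_patterns_pt in auto)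
  have eqs: "lim (?T ?a) = 0" "lim (?T ?b) = (s\<^sup>2)\<^sup>2" using sum Q a0 by linarith+
  have V0: "?V \<longlonglongrightarrow> 0" using V unfolding eqs by (simp add: power2_eq_square)
  have "grid_mean (G 2) = ?T ?a" unfolding grid_mean_def by (rule ext) (simp only: tree_sum_pt)
  then have gm2: "grid_mean (G 2) \<longlonglongrightarrow> 0" using lims(1) eqs(1) by simp
  have "AE p in lborel. p \<in> unit_square \<longrightarrow> G k p = 0" if k: "k > 1" for k
  proof -
    have "grid_mean (G k) \<longlonglongrightarrow> 0" by (rule grid_mean_dominated[OF _ gm2]) (use amgm[of _ _ _ k] k in auto)
    also have "grid_mean (G k) = (\<lambda>N. (\<Sum>i=1..N. \<Sum>j=1..N. \<bar>G k (grid N i j)\<bar>) / (real N)\<^sup>2)"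
    proof
      fix N
      have "\<bar>G k (grid N i j)\<bar> = G k (grid N i j)" if "i \<in> {1..N}" "j \<in> {1..N}" for i j
        using G_grid_nonneg[OF _ that, of k] k by simp
      then show "grid_mean (G k) N = (\<Sum>i=1..N. \<Sum>j=1..N. \<bar>G k (grid N i j)\<bar>) / (real N)\<^sup>2"
        unfolding grid_mean_def by simp
    qed
    finally show ?thesis using AE_zero_iff_grid_mean[OF G_bounded[of k] G_osc[of k]] k by simp
  qed
  moreover have "AE u in lborel. u \<in> {0..1} \<longrightarrow> ((\<lambda>v. G 1 (u, v)) has_integral s\<^sup>2) {0..1}"
  proof -
    \<comment> \<open>By Cauchy--Schwarz the mean absolute deviation is at most the root of the mean
      square deviation.\<close>
    have "(\<lambda>n. (\<Sum>i=1..n. \<bar>?R n i - s\<^sup>2\<bar>) / real n) \<longlonglongrightarrow> 0"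
    proof (rule Lim_null_comparison)
      show "\<forall>\<^sub>F n in sequentially. norm ((\<Sum>i=1..n. \<bar>?R n i - s\<^sup>2\<bar>) / real n) \<le> sqrt (?V n)"
        using eventually_ge_at_top[of 1]
      proof eventually_elim
        case (elim n)
        let ?A = "\<Sum>i=1..n. \<bar>?R n i - s\<^sup>2\<bar>"
        have "?A\<^sup>2 \<le> real n * (\<Sum>i=1..n. (?R n i - s\<^sup>2)\<^sup>2)"
          using sum_squared_le_sum_of_squares[of "\<lambda>i. \<bar>?R n i - s\<^sup>2\<bar>" "{1..n}"] by (simp add: mult.commute)
        then have "(?A / real n)\<^sup>2 \<le> ?V n" using elim by (simp add: power_divide power2_eq_square field_simps)
        moreover have "?A / real n \<ge> 0" by (intro divide_nonneg_nonneg sum_nonneg) auto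
        ultimately show ?case by (simp add: real_le_rsqrt)
      qed
      show "(\<lambda>n. sqrt (?V n)) \<longlonglongrightarrow> 0" using tendsto_real_sqrt[OF V0] by simp
    qed
    then show ?thesis using has_integral_section_iff_row_mean[OF G_bounded[of 1] G_osc[of 1], of "s\<^sup>2"] by simp
  qed
  ultimately show ?thesis unfolding semicircle_condition_def using s by (intro conjI allI impI exI[of _ "s\<^sup>2"]) auto
qed

end

context symmetric_array begin

text \<open>The expectation of \<open>(L * y\<^sup>2 - y ^ (2 * r - 2))\<^sup>2 / L\<close>, for the
  entry \<open>y\<close>, is nonnegative. This puts the higher moments under the control of the
  fourth.\<close>

lemma entry_moment_AM_GM:
  assumes ij: "i \<in> {1..n}" "j \<in> {1..n}" and r: "r \<ge> 2" and L: "L > 0"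
  shows "2 * entry_moment n (ed i j) (2 * r) \<le> L * entry_moment n (ed i j) (2 * 2) + entry_moment n (ed i j) (2 * (2 * r - 2)) / L"
proof -
  let ?y = "y n (ed i j)"
  have "n \<ge> 1" using ij by auto
  then interpret e: edge_variables M n "y n" by (rule edge_variables_y)
  have e: "ed i j \<in> edges n" using ij by (auto simp: edges_def ed_def)
  have i: "integrable M (\<lambda>\<omega>. ?y \<omega> ^ q)" if "q \<ge> 1" for q using e.int[OF e that] .
  have pw: "2 * u ^ (2 * r) \<le> L * u ^ (2 * 2) + u ^ (2 * (2 * r - 2)) / L" for u :: real
  proof -
    let ?a = "u ^ 2" and ?b = "u ^ (2 * r - 2)"
    have "2 * r = 2 + (2 * r - 2)" using r by simp
    then have ab: "u ^ (2 * r) = ?a * ?b" by (metis power_add)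
    have "0 \<le> (L * ?a - ?b)\<^sup>2 / L" using L by simp
    also have "\<dots> = L * ?a\<^sup>2 + ?b\<^sup>2 / L - 2 * (?a * ?b)" using L by (simp add: power2_eq_square field_simps)
    finally show ?thesis unfolding ab by (simp add: power_mult[symmetric] mult.commute)
  qed
  have "2 * entry_moment n (ed i j) (2 * r) = expectation (\<lambda>\<omega>. 2 * ?y \<omega> ^ (2 * r))" by (simp add: entry_moment_def)
  also have "\<dots> \<le> expectation (\<lambda>\<omega>. L * ?y \<omega> ^ (2 * 2) + ?y \<omega> ^ (2 * (2 * r - 2)) / L)"
    by (rule integral_mono[OF _ _ pw]) (use r in \<open>auto intro!: i Bochner_Integration.integrable_add\<close>)
  also have "\<dots> = L * entry_moment n (ed i j) (2 * 2) + entry_moment n (ed i j) (2 * (2 * r - 2)) / L"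
    unfolding entry_moment_def using r by (subst Bochner_Integration.integral_add) (auto intro!: i)
  finally show ?thesis .
qed

text \<open>One direction uses only the second and the fourth moment, with the Catalan numbers 1 and
  2; the other matches all moments and concludes by determinacy.\<close>

lemma semicircular_iff_condition:
  assumes mu: "real_distribution \<mu>" "\<And>k. integrable \<mu> (\<lambda>u. u ^ k)" "\<And>k. (\<integral>u. u ^ k \<partial>\<mu>) = beta G k"
  shows "semicircular \<mu> \<longleftrightarrow> semicircle_condition G"
proof
  assume "semicircular \<mu>"
  then obtain s where s: "s > 0" "\<mu> = distr std_semicircle borel (\<lambda>u. s * u)" by (auto simp: semicircular_def)
  have b: "beta G k = s ^ k * real (dyck_count k 0)" for k
    using scaled_semicircle(3)[OF s(1), of k] mu(3)[of k] s(2) by simp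
  show "semicircle_condition G"
    by (rule semicircle_conditionI[OF entry_moment_AM_GM s(1)]) (simp_all add: b dyck_count_small)
next
  assume "semicircle_condition G"
  then obtain s where s: "s > 0" "\<And>k. beta G k = s ^ k * real (dyck_count k 0)" using beta_semicircle by blast
  have C: "carleman_moments (beta G)" using assumption by (intro carleman_beta) (simp add: assumption_A_def)
  have "\<mu> = distr std_semicircle borel (\<lambda>u. s * u)"
    by (rule real_distribution_moments_unique[OF mu(1) scaled_semicircle(1)[OF s(1)] mu(2) scaled_semicircle(2)[OF s(1)] mu(3) _ C])
      (simp add: scaled_semicircle(3)[OF s(1)] s(2))
  then show "semicircular \<mu>" using s(1) by (auto simp: semicircular_def)
qed

end

text \<open>Concerns an arbitrary almost sure limit \<open>\<nu>\<close>, and stands outside the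
  locale so that it also applies to a second array on another probability space.\<close>

lemma esd_Z_limit_moments:
  assumes "indep_symmetric_matrices M x" "assumption_A M x t g G"
    and nu: "real_distribution \<nu>" "weak_conv_as M (esd_Z x t) \<nu>"
  shows "integrable \<nu> (\<lambda>u. u ^ k)" "(\<integral>u. u ^ k \<partial>\<nu>) = beta G k"
proof -
  interpret symmetric_array M x t g G by (intro symmetric_array.intro assms)
  obtain \<mu> where mu: "real_distribution \<mu>" "\<And>k. integrable \<mu> (\<lambda>u. u ^ k)" "\<And>k. (\<integral>u. u ^ k \<partial>\<mu>) = beta G k"
    "weak_conv_as M (esd_Z x t) \<mu>" using esd_Z_limit by blast
  have "\<nu> = \<mu>"
    by (rule weak_conv_as_unique[OF prob_space_axioms _ nu mu(1,4)]) (unfold esd_Z_def, rule real_distribution_esd)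
  then show "integrable \<nu> (\<lambda>u. u ^ k)" "(\<integral>u. u ^ k \<partial>\<nu>) = beta G k" using mu by simp_all
qed

theorem theorem2p1:
  fixes M :: "'a measure"
    and x :: "nat \<Rightarrow> nat \<Rightarrow> nat \<Rightarrow> 'a \<Rightarrow> real"
    and t :: "nat \<Rightarrow> ennreal"
    and g :: "nat \<Rightarrow> nat \<Rightarrow> real \<times> real \<Rightarrow> real"
    and G :: "nat \<Rightarrow> real \<times> real \<Rightarrow> real"
  assumes "indep_symmetric_matrices M x"
    and "assumption_A M x t g G"
  shows "\<exists>\<mu>. real_distribution \<mu> \<and>
    \<comment> \<open>(a): convergence, and the moments of the limit depend on the functions \<open>G k\<close> alone\<close>
    weak_conv_as M (esd_Z x t) \<mu> \<and>
    (\<forall>k. integrable \<mu> (\<lambda>u. u ^ k)) \<and>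
    (\<forall>(N :: 'b measure) x' t' g' G' \<nu>.
       indep_symmetric_matrices N x' \<and> assumption_A N x' t' g' G' \<and>
       (\<forall>k\<ge>1. \<forall>p\<in>unit_square. G' k p = G k p) \<and>
       real_distribution \<nu> \<and> weak_conv_as N (esd_Z x' t') \<nu> \<longrightarrow>
       (\<forall>k. integrable \<nu> (\<lambda>u. u ^ k) \<and> (\<integral>u. u ^ k \<partial>\<nu>) = (\<integral>u. u ^ k \<partial>\<mu>))) \<and>
    \<comment> \<open>(b)\<close>
    ((AE \<omega> in M. (\<lambda>n. tail_sum x t n \<omega>) \<longlonglongrightarrow> 0) \<longrightarrow> weak_conv_as M (esd_W x) \<mu>) \<and>
    (tendsto_in_prob M (tail_sum x t) 0 \<longrightarrow> weak_conv_in_prob M (esd_W x) \<mu>) \<and>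
    \<comment> \<open>the semi-circular case\<close>
    (semicircular \<mu> \<longleftrightarrow> semicircle_condition G)"
proof -
  interpret symmetric_array M x t g G by (intro symmetric_array.intro assms)
  obtain \<mu> where mu: "real_distribution \<mu>" "\<And>k. integrable \<mu> (\<lambda>u. u ^ k)" "\<And>k. (\<integral>u. u ^ k \<partial>\<mu>) = beta G k"
    "weak_conv_as M (esd_Z x t) \<mu>" using esd_Z_limit by blast
  show ?thesis
  proof (intro exI[of _ \<mu>] conjI allI impI mu)
    fix N :: "'b measure" and x' t' g' G' \<nu> k
    assume h: "indep_symmetric_matrices N x' \<and> assumption_A N x' t' g' G' \<and>
       (\<forall>k\<ge>1. \<forall>p\<in>unit_square. G' k p = G k p) \<and>
       real_distribution \<nu> \<and> weak_conv_as N (esd_Z x' t') \<nu>"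
    then have N: "indep_symmetric_matrices N x'" "assumption_A N x' t' g' G'"
      "real_distribution \<nu>" "weak_conv_as N (esd_Z x' t') \<nu>" and eq: "\<And>k p. k \<ge> 1 \<Longrightarrow> p \<in> unit_square \<Longrightarrow> G' k p = G k p" by blast+
    note nu = esd_Z_limit_moments[OF N, of k]
    show "integrable \<nu> (\<lambda>u. u ^ k)" by (rule nu)
    show "(\<integral>u. u ^ k \<partial>\<nu>) = (\<integral>u. u ^ k \<partial>\<mu>)" unfolding nu(2) mu(3) by (rule beta_cong) (rule eq)
  next
    assume "AE \<omega> in M. (\<lambda>n. tail_sum x t n \<omega>) \<longlonglongrightarrow> 0"
    then show "weak_conv_as M (esd_W x) \<mu>" by (rule esd_W_limit_as[OF mu(1,4)])
  next
    assume "tendsto_in_prob M (tail_sum x t) 0"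
    then show "weak_conv_in_prob M (esd_W x) \<mu>" by (rule esd_W_limit_in_prob[OF mu(1,4)])
  next
    show "semicircular \<mu> \<longleftrightarrow> semicircle_condition G" by (rule semicircular_iff_condition[OF mu(1-3)])
  qed
qed

end
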